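(* Let $K$ be a field and let $n$ be an integer with $2n \ge 4$; if $K = \mathrm{GF}(2)$, assume moreover that $2n \ge 6$. Then there exists a cyclic, strictly hyperbolic conjugacy class $\Omega$ of $\mathrm{Sp}(2n,K)$ such that $\mathrm{Sp}(2n, K) = \Omega^2 \cup \{-\mathrm{I}_{2n}\}$, where $\Omega^2 = \{M_1M_2 : M_1,M_2\in\Omega\}$.
   Context: $\mathrm{Sp}(2n,K)$ is the group of all $P\in \mathrm{GL}(2n,K)$ with $PGP' = G$, where $P'$ is the transpose of $P$ and $G = \begin{pmatrix} 0 & \mathrm{I}_n\\ -\mathrm{I}_n & 0\end{pmatrix}$. A matrix is cyclic if its minimal polynomial equals its characteristic polynomial; a conjugacy class is cyclic if its elements are. A conjugacy class of $\mathrm{Sp}(2n,K)$ is called strictly hyperbolic if the minimal polynomial of its elements is of the form $q(x)q^*(x)$, where $q\in K[x]$ is a monic polynomial with $q(0)\neq 0$ that is prime to its reciprocal $q^*(x) = q(0)^{-1}x^{\deg q}q(x^{-1})$. *)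

theory Defs
  imports
    "HOL-Algebra.Group_Action"
    "HOL-Computational_Algebra.Polynomial"
    "Jordan_Normal_Form.Char_Poly"
begin

definition symplectic_form :: "nat \<Rightarrow> 'a :: field mat" where
  "symplectic_form n = four_block_mat (0\<^sub>m n n) (1\<^sub>m n) (- 1\<^sub>m n) (0\<^sub>m n n)"

text \<open>The argument is half the matrix size: \<^term>\<open>Sp n\<close> is the group written $Sp(2n,K)$.\<close>

definition Sp :: "nat \<Rightarrow> 'a :: field mat monoid" where
  "Sp n =
    \<lparr>carrier = {P \<in> carrier_mat (2 * n) (2 * n).
        invertible_mat P \<and> P * symplectic_form n * transpose_mat P = symplectic_form n},
     monoid.mult = (*),
     one = 1\<^sub>m (2 * n)\<rparr>"

definition conjugacy_classes :: "('g, 'm) monoid_scheme \<Rightarrow> 'g set set" where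
  "conjugacy_classes G =
    orbits G (carrier G) (\<lambda>g. \<lambda>h \<in> carrier G. g \<otimes>\<^bsub>G\<^esub> h \<otimes>\<^bsub>G\<^esub> inv\<^bsub>G\<^esub> g)"

text \<open>The value $p(A) = \sum_k p_k A^k$ for a square matrix $A$, written entrywise.\<close>

definition poly_mat :: "'a :: comm_ring_1 poly \<Rightarrow> 'a mat \<Rightarrow> 'a mat" where
  "poly_mat p A =
    mat (dim_row A) (dim_row A) (\<lambda>ij. \<Sum>k\<le>degree p. coeff p k * (A ^\<^sub>m k) $$ ij)"

definition is_min_poly :: "'a :: field mat \<Rightarrow> 'a poly \<Rightarrow> bool" where
  "is_min_poly A p \<longleftrightarrow>
    monic p \<and> poly_mat p A = 0\<^sub>m (dim_row A) (dim_row A) \<and>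
    (\<forall>r. r \<noteq> 0 \<and> poly_mat r A = 0\<^sub>m (dim_row A) (dim_row A) \<longrightarrow> degree p \<le> degree r)"

definition cyclic_mat :: "'a :: field mat \<Rightarrow> bool" where
  "cyclic_mat A \<longleftrightarrow> is_min_poly A (char_poly A)"

definition cyclic_class :: "'a :: field mat set \<Rightarrow> bool" where
  "cyclic_class \<Omega> \<longleftrightarrow> (\<forall>A \<in> \<Omega>. cyclic_mat A)"

text \<open>For $q(0) \neq 0$, \<^term>\<open>reflect_poly q\<close> is $x^{\deg q} q(x^{-1})$.\<close>

definition reciprocal_poly :: "'a :: field poly \<Rightarrow> 'a poly" where
  "reciprocal_poly q = Polynomial.smult (inverse (poly q 0)) (reflect_poly q)"

definition strictly_hyperbolic_class :: "'a :: field mat set \<Rightarrow> bool" where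
  "strictly_hyperbolic_class \<Omega> \<longleftrightarrow>
    (\<exists>q. monic q \<and> poly q 0 \<noteq> 0 \<and> coprime q (reciprocal_poly q) \<and>
      (\<forall>A \<in> \<Omega>. is_min_poly A (q * reciprocal_poly q)))"

lemma poly_mat_index:
  "i < dim_row A \<Longrightarrow> j < dim_row A \<Longrightarrow> degree p \<le> N \<Longrightarrow>
    poly_mat p A $$ (i, j) = (\<Sum>k\<le>N. coeff p k * (A ^\<^sub>m k) $$ (i, j))"
  unfolding poly_mat_def
  by (simp, rule sum.mono_neutral_left) (auto simp: coeff_eq_0)

lemma is_min_poly_unique:
  assumes "is_min_poly A p" "is_min_poly A q"
  shows "p = q"
proof (rule ccontr)
  assume "p \<noteq> q"
  have deg: "degree p = degree q"
    using assms unfolding is_min_poly_def by (metis antisym leading_coeff_0_iff zero_neq_one)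
  have "poly_mat (p - q) A = 0\<^sub>m (dim_row A) (dim_row A)" (is "_ = ?Z")
  proof (rule eq_matI)
    fix i j assume "i < dim_row ?Z" "j < dim_col ?Z"
    then have i: "i < dim_row A" and j: "j < dim_row A" by auto
    have d: "degree (p - q) \<le> degree p" using deg degree_diff_le by (metis order_refl)
    have "poly_mat (p - q) A $$ (i, j) = poly_mat p A $$ (i, j) - poly_mat q A $$ (i, j)"
      using poly_mat_index[OF i j d] poly_mat_index[OF i j, of p "degree p"]
        poly_mat_index[OF i j, of q "degree p"] deg
      by (simp add: sum_subtractf algebra_simps)
    also have "\<dots> = ?Z $$ (i, j)" using assms i j unfolding is_min_poly_def by simp
    finally show "poly_mat (p - q) A $$ (i, j) = ?Z $$ (i, j)" .
  qed (auto simp: poly_mat_def)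
  then have le: "degree p \<le> degree (p - q)"
    using assms \<open>p \<noteq> q\<close> unfolding is_min_poly_def by auto
  moreover have "degree (p - q) \<le> degree p" using deg degree_diff_le by (metis order_refl)
  ultimately have "degree (p - q) = degree p" by simp
  then have "lead_coeff (p - q) = 0" using assms deg unfolding is_min_poly_def by simp
  then show False using \<open>p \<noteq> q\<close> by (metis eq_iff_diff_eq_0 leading_coeff_0_iff)
qed

lemma group_Sp: "group (Sp n :: 'a :: field mat monoid)"
proof -
  define G :: "'a mat" where "G = symplectic_form n"
  have G [simp]: "G \<in> carrier_mat (2 * n) (2 * n)"
    unfolding G_def symplectic_form_def carrier_mat_def by (auto simp: mult_2)
  have sp: "P \<in> carrier (Sp n) \<longleftrightarrow> P \<in> carrier_mat (2 * n) (2 * n) \<and>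
      invertible_mat P \<and> P * G * transpose_mat P = G" for P
    unfolding Sp_def G_def by simp
  note assoc = assoc_mult_mat[where ?n\<^sub>1 = "2*n" and ?n\<^sub>2 = "2*n" and ?n\<^sub>3 = "2*n" and ?n\<^sub>4 = "2*n"]
    mult_carrier_mat[of _ "2*n" "2*n" _ "2*n"]
  have inverse: "\<exists>Q \<in> carrier_mat (2 * n) (2 * n). P * Q = 1\<^sub>m (2 * n) \<and> Q * P = 1\<^sub>m (2 * n)"
    if "P \<in> carrier_mat (2 * n) (2 * n)" "invertible_mat P" for P :: "'a mat"
  proof -
    from that(2) obtain Q where Q: "P * Q = 1\<^sub>m (dim_row P)" "Q * P = 1\<^sub>m (dim_row Q)"
      unfolding invertible_mat_def inverts_mat_def by blast
    have "Q \<in> carrier_mat (2 * n) (2 * n)"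
      using Q that(1) by (metis carrier_matD carrier_matI index_mult_mat(2,3) index_one_mat(2,3))
    then show ?thesis using Q that(1) by auto
  qed
  show ?thesis
  proof (rule groupI)
    fix P Q :: "'a mat" assume "P \<in> carrier (Sp n)" "Q \<in> carrier (Sp n)"
    then have P: "P \<in> carrier_mat (2 * n) (2 * n)" "invertible_mat P" "P * G * transpose_mat P = G"
      and Q: "Q \<in> carrier_mat (2 * n) (2 * n)" "invertible_mat Q" "Q * G * transpose_mat Q = G"
      by (auto simp: sp)
    have "P * Q * G * transpose_mat (P * Q) = P * (Q * G * transpose_mat Q) * transpose_mat P"
      using P(1) Q(1) G
      by (simp add: transpose_mult[OF P(1) Q(1)] assoc)
    moreover have "invertible_mat (P * Q)"
    proof -
      obtain P' Q' where P': "P' \<in> carrier_mat (2 * n) (2 * n)"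
          "P * P' = 1\<^sub>m (2 * n)" "P' * P = 1\<^sub>m (2 * n)"
        and Q': "Q' \<in> carrier_mat (2 * n) (2 * n)"
          "Q * Q' = 1\<^sub>m (2 * n)" "Q' * Q = 1\<^sub>m (2 * n)"
        using inverse[OF P(1,2)] inverse[OF Q(1,2)] by blast
      have "P * Q * (Q' * P') = P * (Q * Q') * P'" "Q' * P' * (P * Q) = Q' * (P' * P) * Q"
        using P(1) Q(1) P'(1) Q'(1) by (simp_all add: assoc)
      then show ?thesis
        using P(1) Q(1) P' Q' unfolding invertible_mat_def inverts_mat_def
        by (auto intro!: exI[of _ "Q' * P'"])
    qed
    ultimately show "P \<otimes>\<^bsub>Sp n\<^esub> Q \<in> carrier (Sp n)"
      using P Q unfolding sp by (simp add: Sp_def)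
  next
    show "\<one>\<^bsub>Sp n\<^esub> \<in> carrier (Sp n :: 'a mat monoid)"
    proof -
      have "1\<^sub>m (2 * n) * G * transpose_mat (1\<^sub>m (2 * n)) = G"
        by (simp add: left_mult_one_mat[OF G] right_mult_one_mat[OF G])
      then show ?thesis
        unfolding sp by (auto simp: Sp_def invertible_mat_def inverts_mat_def
            intro!: exI[of _ "1\<^sub>m (2 * n)"])
    qed
  next
    fix P Q R :: "'a mat" assume "P \<in> carrier (Sp n)" "Q \<in> carrier (Sp n)" "R \<in> carrier (Sp n)"
    then show "P \<otimes>\<^bsub>Sp n\<^esub> Q \<otimes>\<^bsub>Sp n\<^esub> R = P \<otimes>\<^bsub>Sp n\<^esub> (Q \<otimes>\<^bsub>Sp n\<^esub> R)"
      unfolding sp by (simp add: Sp_def assoc)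
  next
    fix P :: "'a mat" assume "P \<in> carrier (Sp n)"
    then show "\<one>\<^bsub>Sp n\<^esub> \<otimes>\<^bsub>Sp n\<^esub> P = P"
      unfolding sp by (auto simp: Sp_def intro: left_mult_one_mat)
  next
    fix P :: "'a mat" assume "P \<in> carrier (Sp n)"
    then have P: "P \<in> carrier_mat (2 * n) (2 * n)" "invertible_mat P" "P * G * transpose_mat P = G"
      by (auto simp: sp)
    from inverse[OF P(1,2)] obtain Q where Q: "Q \<in> carrier_mat (2 * n) (2 * n)"
      and PQ: "P * Q = 1\<^sub>m (2 * n)" and QP: "Q * P = 1\<^sub>m (2 * n)" by blast
    have QPt: "transpose_mat P * transpose_mat Q = 1\<^sub>m (2 * n)"
      using transpose_mult[OF Q P(1)] QP by simp
    have "Q * G * transpose_mat Q = Q * (P * G * transpose_mat P) * transpose_mat Q"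
      using P(3) by simp
    also have "\<dots> = (Q * P) * G * (transpose_mat P * transpose_mat Q)"
      using P(1) Q by (simp add: assoc)
    also have "\<dots> = G" using QP QPt by (simp add: left_mult_one_mat[OF G] right_mult_one_mat[OF G])
    finally have "Q \<in> carrier (Sp n)"
      unfolding sp using Q P(1) PQ QP by (auto simp: invertible_mat_def inverts_mat_def)
    then show "\<exists>Q\<in>carrier (Sp n). Q \<otimes>\<^bsub>Sp n\<^esub> P = \<one>\<^bsub>Sp n\<^esub>"
      using QP by (auto simp: Sp_def)
  qed
qed

end

theory Submission
  imports Defs "HOL-Library.Function_Algebras"
begin

text \<open>
  Let \<open>C\<close> be the companion matrix of a monic polynomial \<open>q\<close> of degree \<open>n\<close> that is coprime to its
  reciprocal, and let \<open>\<Omega>\<close> be the class of \<open>diag(C, C\<^sup>-\<^sup>T)\<close>. Solving Sylvester equations, every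
  symplectic \<open>P\<close> whose upper left block \<open>A\<close> (in some symplectic basis) can be written as \<open>A = X Y\<^sup>-\<^sup>1\<close>
  with \<open>X\<close> and \<open>Y\<close> both similar to \<open>C\<close> is a product of two elements of \<open>\<Omega>\<close>. Such a factorisation of
  \<open>A\<close> is found when \<open>A\<close> is triangular below a nonscalar 2 by 2 corner, by solving for the rows of an
  intertwining matrix as polynomials modulo \<open>q\<close>. A suitable symplectic basis is built by peeling off
  hyperbolic planes spanned by \<open>x\<close> and \<open>P x\<close>, where the quadratic form \<open>\<omega>(P x, x)\<close> does not vanish;
  where it vanishes identically, \<open>P\<close> is an involution and is split directly.
\<close>

text \<open>The determinant shapes the proof: a quotient of two matrices similar to \<open>C\<close>
  has determinant 1, so \<open>A\<close> must be brought to determinant 1 by the choice of the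
  symplectic basis. Adding to the f's combinations of the e's with a symmetric coefficient matrix
  \<open>S\<close> replaces \<open>A\<close> by \<open>A + S F\<close>, where \<open>F\<close> has
  the entries \<omega>(P e_j, e_i); vectors with \<omega>(P x, x) nonzero make \<open>F\<close>
  large enough to adjust determinant and trace of the corner. The central matrix -I has the block -I
  in every basis, of determinant -1 if n is odd and the characteristic is not 2; no basis helps
  there. Diagonal blocks with entries 1 and -1 cost one condition for each nonzero coefficient of
  \<open>q\<close>, hence the sparse \<open>q\<close>: x^n + \<delta> if some \<delta> is different
  from 0, 1 and -1, and x^n - x^k - 1 over GF(2) and GF(3). For n = 2 nothing is left below the
  corner, and its trace is treated by hand. The excluded group Sp(4,2) is the symmetric group S_6,
  in which a product of two conjugate elements is always even.\<close>

lemma mult_mat_index: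
  "A \<in> carrier_mat n m \<Longrightarrow> B \<in> carrier_mat m k \<Longrightarrow> i < n \<Longrightarrow> j < k \<Longrightarrow>
    (A * B) $$ (i, j) = (\<Sum>l<m. A $$ (i, l) * B $$ (l, j))"
  by (auto simp: scalar_prod_def atLeast0LessThan)

section \<open>Values of polynomials at square matrices\<close>

lemma pow_mat_comm:
  "A \<in> carrier_mat n n \<Longrightarrow> A * (A ^\<^sub>m k) = (A ^\<^sub>m k) * A"
proof (induction k)
  case (Suc k)
  have "A * (A ^\<^sub>m Suc k) = (A * (A ^\<^sub>m k)) * A"
    using Suc.prems by (simp add: assoc_mult_mat[of _ n n _ n _ n])
  then show ?case using Suc by simp
qed auto

lemma dim_poly_mat [simp]: "dim_row (poly_mat p A) = dim_row A" "dim_col (poly_mat p A) = dim_row A"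
  by (simp_all add: poly_mat_def)

lemma poly_mat_carrier [simp]: "A \<in> carrier_mat n n \<Longrightarrow> poly_mat p A \<in> carrier_mat n n"
  by (auto simp: poly_mat_def)

lemma poly_mat_0 [simp]: "A \<in> carrier_mat n n \<Longrightarrow> poly_mat 0 A = 0\<^sub>m n n"
  by (auto simp: poly_mat_def)

lemma poly_mat_add:
  assumes A: "A \<in> carrier_mat n n"
  shows "poly_mat (p + q) A = poly_mat p A + poly_mat q A"
proof (rule eq_matI)
  let ?N = "max (degree p) (degree q)"
  have d: "degree (p + q) \<le> ?N" by (rule degree_add_le_max)
  fix i j assume "i < dim_row (poly_mat p A + poly_mat q A)" "j < dim_col (poly_mat p A + poly_mat q A)"
  then have i: "i < dim_row A" and j: "j < dim_row A" by (auto simp: poly_mat_def)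
  show "poly_mat (p + q) A $$ (i, j) = (poly_mat p A + poly_mat q A) $$ (i, j)"
    using poly_mat_index[OF i j d] poly_mat_index[OF i j, of p ?N] poly_mat_index[OF i j, of q ?N] i j A
    by (simp add: sum.distrib algebra_simps)
qed (use A in \<open>auto simp: poly_mat_def\<close>)

lemma poly_mat_smult:
  assumes A: "A \<in> carrier_mat n n"
  shows "poly_mat (Polynomial.smult c p) A = c \<cdot>\<^sub>m poly_mat p A"
proof (rule eq_matI)
  fix i j assume "i < dim_row (c \<cdot>\<^sub>m poly_mat p A)" "j < dim_col (c \<cdot>\<^sub>m poly_mat p A)"
  then have i: "i < dim_row A" and j: "j < dim_row A" by (auto simp: poly_mat_def)
  show "poly_mat (Polynomial.smult c p) A $$ (i, j) = (c \<cdot>\<^sub>m poly_mat p A) $$ (i, j)"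
    using poly_mat_index[OF i j degree_smult_le[of c p]] poly_mat_index[OF i j order.refl, of p] i j A
    by (simp add: sum_distrib_left mult.assoc)
qed (use A in \<open>auto simp: poly_mat_def\<close>)

lemma poly_mat_pCons:
  assumes A: "A \<in> carrier_mat n n"
  shows "poly_mat (pCons a p) A = a \<cdot>\<^sub>m 1\<^sub>m n + A * poly_mat p A"
proof (rule eq_matI)
  fix i j assume "i < dim_row (a \<cdot>\<^sub>m 1\<^sub>m n + A * poly_mat p A)" "j < dim_col (a \<cdot>\<^sub>m 1\<^sub>m n + A * poly_mat p A)"
  then have i: "i < n" and j: "j < n" using A by (auto simp: poly_mat_def)
  have pw: "(A ^\<^sub>m Suc k) $$ (i, j) = (\<Sum>l<n. A $$ (i, l) * (A ^\<^sub>m k) $$ (l, j))" for k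
  proof -
    have "A ^\<^sub>m Suc k = A * (A ^\<^sub>m k)" using pow_mat_comm[OF A] by simp
    also have "\<dots> $$ (i, j) = (\<Sum>l<n. A $$ (i, l) * (A ^\<^sub>m k) $$ (l, j))"
      using A i j by (simp add: scalar_prod_def atLeast0LessThan)
    finally show ?thesis .
  qed
  have "poly_mat (pCons a p) A $$ (i, j)
      = (\<Sum>k\<le>Suc (degree p). coeff (pCons a p) k * (A ^\<^sub>m k) $$ (i, j))"
    by (rule poly_mat_index) (use A i j degree_pCons_le in auto)
  also have "\<dots> = a * (1\<^sub>m n) $$ (i, j) + (\<Sum>k\<le>degree p. coeff p k * (A ^\<^sub>m Suc k) $$ (i, j))"
    by (subst sum.atMost_Suc_shift) (use A in simp)
  also have "(\<Sum>k\<le>degree p. coeff p k * (A ^\<^sub>m Suc k) $$ (i, j))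
      = (\<Sum>k\<le>degree p. \<Sum>l<n. A $$ (i, l) * (coeff p k * (A ^\<^sub>m k) $$ (l, j)))"
    by (simp only: pw sum_distrib_left) (simp add: mult_ac)
  also have "\<dots> = (\<Sum>l<n. \<Sum>k\<le>degree p. A $$ (i, l) * (coeff p k * (A ^\<^sub>m k) $$ (l, j)))"
    by (rule sum.swap)
  also have "\<dots> = (\<Sum>l<n. A $$ (i, l) * poly_mat p A $$ (l, j))"
    using A j by (auto simp: sum_distrib_left poly_mat_def intro!: sum.cong)
  also have "\<dots> = (A * poly_mat p A) $$ (i, j)"
    using A i j by (simp add: scalar_prod_def atLeast0LessThan)
  finally show "poly_mat (pCons a p) A $$ (i, j) = (a \<cdot>\<^sub>m 1\<^sub>m n + A * poly_mat p A) $$ (i, j)"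
    using A i j by (simp add: poly_mat_def)
qed (use A in \<open>auto simp: poly_mat_def\<close>)

text \<open>The common source of three later arguments: a matrix commutes with its polynomials,
  similar matrices are killed by the same polynomials, and an intertwiner of two matrices vanishes
  if some polynomial is 0 on one of them and 1 on the other.\<close>

lemma poly_mat_intertwine:
  assumes A: "A \<in> carrier_mat n n" and B: "B \<in> carrier_mat m m" and X: "X \<in> carrier_mat n m"
    and eq: "A * X = X * B"
  shows "poly_mat p A * X = X * poly_mat p B"
proof (induction p)
  case 0
  then show ?case using A B X by simp
next
  case (pCons a p)
  have "poly_mat (pCons a p) A * X = a \<cdot>\<^sub>m X + A * (poly_mat p A * X)"
    using A X by (simp add: poly_mat_pCons[OF A] add_mult_distrib_mat[of _ n n _ _ m]
        assoc_mult_mat[of _ n n _ n _ m] mult_smult_assoc_mat[of _ n n _ m])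
  also have "A * (poly_mat p A * X) = (A * X) * poly_mat p B"
    using A B X pCons by (simp add: assoc_mult_mat[of _ n n _ m _ m])
  also have "\<dots> = X * (B * poly_mat p B)"
    using B X by (simp add: eq assoc_mult_mat[of _ n m _ m _ m])
  also have "a \<cdot>\<^sub>m X + X * (B * poly_mat p B) = X * poly_mat (pCons a p) B"
    using B X by (simp add: poly_mat_pCons[OF B] mult_add_distrib_mat[of _ n m _ m]
        mult_smult_distrib[of _ n m _ m])
  finally show ?case .
qed

lemma poly_mat_comm:
  assumes A: "A \<in> carrier_mat n n"
  shows "poly_mat p A * A = A * poly_mat p A"
  by (rule poly_mat_intertwine[OF A A A refl])

lemma poly_mat_mult:
  assumes A: "A \<in> carrier_mat n n"
  shows "poly_mat (p * q) A = poly_mat p A * poly_mat q A"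
proof (induction p)
  case 0
  then show ?case using A poly_mat_carrier[OF A, of q] by simp
next
  case (pCons a p)
  have q: "poly_mat q A \<in> carrier_mat n n" "poly_mat p A \<in> carrier_mat n n" using A by auto
  have "poly_mat (pCons a p * q) A = a \<cdot>\<^sub>m poly_mat q A + (0 \<cdot>\<^sub>m 1\<^sub>m n + A * poly_mat (p * q) A)"
    using A by (simp add: poly_mat_add[OF A] poly_mat_smult[OF A] poly_mat_pCons[OF A])
  also have "0 \<cdot>\<^sub>m 1\<^sub>m n + A * poly_mat (p * q) A = A * poly_mat (p * q) A"
    using A by (intro eq_matI) auto
  finally show ?case using A q pCons left_mult_one_mat[OF q(1)]
    by (simp add: poly_mat_pCons[OF A] add_mult_distrib_mat[of _ n n _ _ n]
        assoc_mult_mat[of _ n n _ n _ n] mult_smult_assoc_mat[of _ n n _ n])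
qed

lemma poly_mat_1: "A \<in> carrier_mat n n \<Longrightarrow> poly_mat 1 A = 1\<^sub>m n"
  unfolding one_pCons by (subst poly_mat_pCons) auto

lemma poly_mat_transpose:
  assumes A: "A \<in> carrier_mat n n"
  shows "poly_mat p (transpose_mat A) = transpose_mat (poly_mat p A)"
proof (induction p)
  case 0
  then show ?case using A by simp
next
  case (pCons a p)
  have "transpose_mat (poly_mat (pCons a p) A)
      = a \<cdot>\<^sub>m 1\<^sub>m n + transpose_mat (A * poly_mat p A)"
    unfolding poly_mat_pCons[OF A]
    by (subst transpose_add[of _ n n]) (use A in \<open>auto intro!: arg_cong2[of _ _ _ _ "(+)"] eq_matI\<close>)
  also have "transpose_mat (A * poly_mat p A) = transpose_mat (poly_mat p A * A)"
    using poly_mat_comm[OF A] by simp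
  also have "\<dots> = transpose_mat A * transpose_mat (poly_mat p A)"
    by (rule transpose_mult[of _ n n]) (use A in auto)
  finally show ?case using A pCons poly_mat_pCons[of "transpose_mat A" n a p] by simp
qed

lemma poly_mat_similar:
  assumes "similar_mat A B" and A: "A \<in> carrier_mat n n" and z: "poly_mat p B = 0\<^sub>m n n"
  shows "poly_mat p A = 0\<^sub>m n n"
proof -
  obtain P Q where PQ: "P \<in> carrier_mat n n" "Q \<in> carrier_mat n n" "B \<in> carrier_mat n n"
    "P * Q = 1\<^sub>m n" "Q * P = 1\<^sub>m n" "A = P * B * Q"
    using similar_matD[OF assms(1)] A by (metis carrier_matD(1) insert_subset)
  have "A * P = P * B"
    using PQ by (simp add: assoc_mult_mat[of _ n n _ n _ n])
  then have "poly_mat p A * P = P * poly_mat p B"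
    using poly_mat_intertwine A PQ by blast
  then have "poly_mat p A * P * Q = 0\<^sub>m n n" using z PQ by simp
  moreover have "poly_mat p A * P * Q = poly_mat p A * (P * Q)"
    using A PQ by (intro assoc_mult_mat[of _ n n _ n _ n]) auto
  ultimately show ?thesis using PQ(4) right_mult_one_mat[OF poly_mat_carrier[OF A]] by simp
qed

text \<open>Only the existence of the lower left block \<open>Z\<close> is recorded. For the
  polynomial used in \<open>sylvester_aux\<close> this unnamed block is itself the solution of the
  Sylvester equation.\<close>

lemma poly_mat_block_lower:
  assumes X: "X \<in> carrier_mat n n" and Y: "Y \<in> carrier_mat m n" and W: "W \<in> carrier_mat m m"
  shows "\<exists>Z \<in> carrier_mat m n. poly_mat p (four_block_mat X (0\<^sub>m n m) Y W)
    = four_block_mat (poly_mat p X) (0\<^sub>m n m) Z (poly_mat p W)"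
proof (induction p)
  case 0
  have "four_block_mat X (0\<^sub>m n m) Y W \<in> carrier_mat (n + m) (n + m)" using X W by auto
  then show ?case using X W by (intro bexI[of _ "0\<^sub>m m n"]) (auto intro!: eq_matI)
next
  case (pCons a p)
  let ?M = "four_block_mat X (0\<^sub>m n m) Y W"
  have M: "?M \<in> carrier_mat (n + m) (n + m)" using X W by auto
  obtain Z where Z: "Z \<in> carrier_mat m n"
    "poly_mat p ?M = four_block_mat (poly_mat p X) (0\<^sub>m n m) Z (poly_mat p W)"
    using pCons by blast
  let ?Z = "Y * poly_mat p X + W * Z"
  have e1: "?M * poly_mat p ?M = four_block_mat (X * poly_mat p X) (0\<^sub>m n m) ?Z (W * poly_mat p W)"
    unfolding Z(2) using X Y W Z(1)
    by (subst mult_four_block_mat[of _ n n _ m _ m _ _ n _ m])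
      (auto intro!: cong_four_block_mat simp: left_mult_zero_mat[of _ m m] right_mult_zero_mat[of _ n n])
  have e2: "a \<cdot>\<^sub>m 1\<^sub>m (n + m) = four_block_mat (a \<cdot>\<^sub>m 1\<^sub>m n) (0\<^sub>m n m) (0\<^sub>m m n) (a \<cdot>\<^sub>m 1\<^sub>m m)"
    by (rule eq_matI) auto
  have "poly_mat (pCons a p) ?M
    = four_block_mat (poly_mat (pCons a p) X) (0\<^sub>m n m) ?Z (poly_mat (pCons a p) W)"
    unfolding poly_mat_pCons[OF M] poly_mat_pCons[OF X] poly_mat_pCons[OF W] e1 e2
    using X Y W Z(1) by (subst add_four_block_mat[of _ n n _ m _ m]) auto
  then show ?case using X Y W Z(1) by (intro bexI[of _ ?Z]) auto
qed

section \<open>Companion matrices\<close>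

text \<open>Rows and columns run through descending powers: right multiplication takes the row of
  coefficients of a polynomial of degree below n, highest power first, to that of x times the
  polynomial modulo \<open>q\<close>. In this order polynomials of degree n-1-i in row i form an
  upper triangular matrix.\<close>

definition companion :: "'a :: field poly \<Rightarrow> 'a mat" where
  "companion q = mat (degree q) (degree q)
    (\<lambda>(i, j). if i = 0 then - coeff q (degree q - 1 - j) else if i = Suc j then 1 else 0)"

lemma companion_carrier [simp]: "companion q \<in> carrier_mat (degree q) (degree q)"
  by (simp add: companion_def)

lemma companion_dim [simp]: "dim_row (companion q) = degree q" "dim_col (companion q) = degree q"
  by (simp_all add: companion_def)

lemma companion_shift:
  assumes z: "degree z < degree q" and l: "l < degree q"
  shows "(\<Sum>k<degree q. coeff z (degree q - 1 - k) * companion q $$ (k, l))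
    = coeff (pCons 0 z) (degree q - 1 - l) - coeff z (degree q - 1) * coeff q (degree q - 1 - l)"
proof -
  obtain m where m: "degree q = Suc m" using l by (cases "degree q") auto
  have "(\<Sum>k<degree q. coeff z (degree q - 1 - k) * companion q $$ (k, l))
    = coeff z m * - coeff q (m - l) + (\<Sum>k<m. coeff z (m - Suc k) * (if k = l then 1 else 0))"
    unfolding m sum.lessThan_Suc_shift using l m by (auto simp: companion_def intro!: sum.cong)
  also have "(\<Sum>k<m. coeff z (m - Suc k) * (if k = l then 1 else 0)) = coeff (pCons 0 z) (m - l)"
  proof (cases "l < m")
    case True
    then obtain d where d: "m = Suc (l + d)" using less_iff_Suc_add by auto
    show ?thesis using True by (simp add: d if_distrib[of "\<lambda>x. _ * x"] cong: if_cong)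
  next
    case False
    then have "m - l = 0" using l m by simp
    then show ?thesis using False by (auto intro!: sum.neutral)
  qed
  finally show ?thesis using m by simp
qed

text \<open>Row i of \<open>Z\<close> encodes the polynomial \<zeta>_i, so the matrix equation says
  row by row that a combination of the x \<zeta>_i and the \<zeta>_i vanishes modulo q. These
  combinations have degree at most n, so divisibility by q means being a scalar multiple of q, and
  the equation can be checked by identities between polynomials.\<close>

lemma pencil_companion:
  assumes q: "monic q" and n: "degree q = n"
    and A: "A \<in> carrier_mat n n" and X: "X \<in> carrier_mat n n"
    and deg: "\<And>i. i < n \<Longrightarrow> degree (\<zeta> i) < n"
    and rel: "\<And>j. j < n \<Longrightarrow> \<exists>r. (\<Sum>i<n. Polynomial.smult (A $$ (j, i)) (pCons 0 (\<zeta> i))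
        - Polynomial.smult (X $$ (j, i)) (\<zeta> i)) = Polynomial.smult r q"
  defines "Z \<equiv> mat n n (\<lambda>(i, k). coeff (\<zeta> i) (n - 1 - k))"
  shows "A * (Z * companion q) = X * Z"
proof (rule eq_matI)
  have C: "companion q \<in> carrier_mat n n" using companion_carrier[of q] n by simp
  have Z: "Z \<in> carrier_mat n n" by (simp add: Z_def)
  fix j l assume "j < dim_row (X * Z)" "l < dim_col (X * Z)"
  then have j: "j < n" and l: "l < n" using X Z by auto
  obtain r where r: "(\<Sum>i<n. Polynomial.smult (A $$ (j, i)) (pCons 0 (\<zeta> i))
        - Polynomial.smult (X $$ (j, i)) (\<zeta> i)) = Polynomial.smult r q"
    using rel[OF j] by blast
  \<comment> \<open>The scalar r is read off at x^n: q is monic there, and only the shifted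
    polynomials x \<zeta>_i reach that degree.\<close>
  have "r = coeff (Polynomial.smult r q) n" using q n by simp
  also have "\<dots> = (\<Sum>i<n. A $$ (j, i) * coeff (\<zeta> i) (n - 1))"
  proof -
    have "coeff (pCons 0 (\<zeta> i)) n = coeff (\<zeta> i) (n - 1)" for i
      using j by (cases n) auto
    moreover have "coeff (\<zeta> i) n = 0" if "i < n" for i
      using deg[OF that] by (rule coeff_eq_0)
    ultimately show ?thesis unfolding r[symmetric] by (simp add: coeff_sum del: smult_pCons)
  qed
  finally have r': "r = (\<Sum>i<n. A $$ (j, i) * coeff (\<zeta> i) (n - 1))" .
  have ZC: "(Z * companion q) $$ (i, l)
      = coeff (pCons 0 (\<zeta> i)) (n - 1 - l) - coeff (\<zeta> i) (n - 1) * coeff q (n - 1 - l)"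
    if "i < n" for i
    using companion_shift[of "\<zeta> i" q l] deg[OF that] n l that Z C
    by (simp add: scalar_prod_def atLeast0LessThan Z_def)
  have "(A * (Z * companion q)) $$ (j, l) = (\<Sum>i<n. A $$ (j, i) *
      (coeff (pCons 0 (\<zeta> i)) (n - 1 - l) - coeff (\<zeta> i) (n - 1) * coeff q (n - 1 - l)))"
    using ZC by (subst mult_mat_index[OF A mult_carrier_mat[OF Z C] j l]) simp
  also have "\<dots> = (\<Sum>i<n. A $$ (j, i) * coeff (pCons 0 (\<zeta> i)) (n - 1 - l)) - r * coeff q (n - 1 - l)"
    unfolding r' sum_distrib_right sum_subtractf[symmetric]
    by (rule sum.cong) (simp_all add: algebra_simps)
  also have "r * coeff q (n - 1 - l) = coeff (Polynomial.smult r q) (n - 1 - l)" by simp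
  also have "(\<Sum>i<n. A $$ (j, i) * coeff (pCons 0 (\<zeta> i)) (n - 1 - l)) - coeff (Polynomial.smult r q) (n - 1 - l)
      = (\<Sum>i<n. X $$ (j, i) * coeff (\<zeta> i) (n - 1 - l))"
    unfolding r[symmetric] by (simp add: coeff_sum sum_subtractf del: smult_pCons)
  also have "\<dots> = (X * Z) $$ (j, l)"
    using X Z j l by (simp add: scalar_prod_def atLeast0LessThan Z_def)
  finally show "(A * (Z * companion q)) $$ (j, l) = (X * Z) $$ (j, l)" .
qed (use A X n in \<open>auto simp: Z_def\<close>)

lemma det_coeff_mat:
  assumes "\<And>i. i < n \<Longrightarrow> degree (\<zeta> i) = n - 1 - i" "\<And>i. i < n \<Longrightarrow> \<zeta> i \<noteq> 0"
  shows "det (mat n n (\<lambda>(i, k). coeff (\<zeta> i) (n - 1 - k)) :: 'a :: field mat) \<noteq> 0"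
proof -
  let ?Z = "mat n n (\<lambda>(i, k). coeff (\<zeta> i) (n - 1 - k)) :: 'a mat"
  have "upper_triangular ?Z"
    using assms(1) by (auto simp: upper_triangular_def intro!: coeff_eq_0)
  then have "det ?Z = prod_list (diag_mat ?Z)"
    by (rule det_upper_triangular[of _ n]) simp
  moreover have "?Z $$ (i, i) \<noteq> 0" if "i < n" for i
    using leading_coeff_neq_0[OF assms(2)[OF that]] assms(1)[OF that] that by simp
  ultimately show ?thesis
    by (auto simp: diag_mat_def prod_list_zero_iff)
qed

lemma det_nonzero_inverse:
  fixes Z :: "'a :: field mat"
  assumes "Z \<in> carrier_mat n n" "det Z \<noteq> 0"
  obtains Z' where "Z' \<in> carrier_mat n n" "Z * Z' = 1\<^sub>m n" "Z' * Z = 1\<^sub>m n"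
  using det_non_zero_imp_unit[OF assms] unfolding Units_def ring_mat_def by auto

text \<open>This is the pencil with \<open>A = 1\<close>: the \<zeta>_i form a basis of K[x] modulo
  q, and multiplication by x has the matrix \<open>X\<close> in it.\<close>

lemma similar_companionI:
  fixes X :: "'a :: field mat"
  assumes q: "monic q" and n: "degree q = n" and X: "X \<in> carrier_mat n n"
    and deg: "\<And>i. i < n \<Longrightarrow> degree (\<zeta> i) = n - 1 - i" "\<And>i. i < n \<Longrightarrow> \<zeta> i \<noteq> 0"
    and rel: "\<And>j. j < n \<Longrightarrow> \<exists>r. pCons 0 (\<zeta> j)
        - (\<Sum>i<n. Polynomial.smult (X $$ (j, i)) (\<zeta> i)) = Polynomial.smult r q"
  shows "similar_mat X (companion q)"
proof -
  let ?Z = "mat n n (\<lambda>(i, k). coeff (\<zeta> i) (n - 1 - k)) :: 'a mat"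
  have C: "companion q \<in> carrier_mat n n" using companion_carrier[of q] n by simp
  have "1\<^sub>m n * (?Z * companion q) = X * ?Z"
  proof (rule pencil_companion[OF q n _ X])
    fix j assume j: "j < n"
    have "(\<Sum>i<n. Polynomial.smult (1\<^sub>m n $$ (j, i)) (pCons 0 (\<zeta> i))) = pCons 0 (\<zeta> j)"
      using j by (subst sum.cong[OF refl, of _ _ "\<lambda>i. if i = j then pCons 0 (\<zeta> j) else 0"]) auto
    then show "\<exists>r. (\<Sum>i<n. Polynomial.smult (1\<^sub>m n $$ (j, i)) (pCons 0 (\<zeta> i))
        - Polynomial.smult (X $$ (j, i)) (\<zeta> i)) = Polynomial.smult r q"
      using rel[OF j] by (simp add: sum_subtractf)
  qed (use deg in auto)
  moreover have "1\<^sub>m n * (?Z * companion q) = ?Z * companion q"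
    by (rule left_mult_one_mat) (use C in auto)
  ultimately have ZC: "?Z * companion q = X * ?Z" by simp
  obtain Z' where Z': "Z' \<in> carrier_mat n n" "?Z * Z' = 1\<^sub>m n" "Z' * ?Z = 1\<^sub>m n"
    using det_nonzero_inverse[OF _ det_coeff_mat[OF deg]] by (metis mat_carrier)
  have "?Z * companion q * Z' = X * (?Z * Z')"
    unfolding ZC using X Z' by (intro assoc_mult_mat[of _ n n _ n _ n]) auto
  then have "X = ?Z * companion q * Z'" using X Z' by simp
  then show ?thesis
    unfolding similar_mat_def using Z' X C by (intro exI[of _ ?Z] exI[of _ Z'] similar_mat_witI) auto
qed

lemma similar_mat_intro:
  fixes A :: "'a :: field mat"
  assumes "A \<in> carrier_mat n n" "B \<in> carrier_mat n n" "P \<in> carrier_mat n n" "Q \<in> carrier_mat n n"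
    "P * Q = 1\<^sub>m n" "A = P * B * Q"
  shows "similar_mat A B"
  unfolding similar_mat_def
  using similar_mat_witI[of P Q n A B] mat_mult_left_right_inverse[of P n Q] assms by blast

lemma similar_mat_obtain:
  assumes "similar_mat A B" "A \<in> carrier_mat n n"
  obtains P Q where "B \<in> carrier_mat n n" "P \<in> carrier_mat n n" "Q \<in> carrier_mat n n"
    "P * Q = 1\<^sub>m n" "Q * P = 1\<^sub>m n" "A = P * B * Q"
  using similar_matD[OF assms(1)] assms(2) by (metis carrier_matD(1) insert_subset)

lemma similar_mat_reindex:
  fixes A :: "'a :: field mat"
  assumes A: "A \<in> carrier_mat n n" and inj: "inj_on \<pi> {..<n}" and into: "\<And>i. i < n \<Longrightarrow> \<pi> i < n"
  shows "similar_mat (mat n n (\<lambda>(i, j). A $$ (\<pi> i, \<pi> j))) A"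
proof -
  let ?P = "mat n n (\<lambda>(i, j). if j = \<pi> i then 1 else 0) :: 'a mat"
  let ?Q = "mat n n (\<lambda>(i, j). if i = \<pi> j then 1 else 0) :: 'a mat"
  have "?P * ?Q = 1\<^sub>m n"
  proof (rule eq_matI)
    fix i j assume "i < dim_row (1\<^sub>m n :: 'a mat)" "j < dim_col (1\<^sub>m n :: 'a mat)"
    then have ij: "i < n" "j < n" by auto
    have "(?P * ?Q) $$ (i, j) = (\<Sum>k<n. (if k = \<pi> i then 1 else 0) * (if k = \<pi> j then 1 else 0))"
      using ij by (subst mult_mat_index[of _ n n _ n]) auto
    also have "\<dots> = (if \<pi> i = \<pi> j then 1 else 0)"
      using into[OF ij(1)] by (simp add: if_distrib[of "\<lambda>x. x * _"] cong: if_cong)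
    also have "\<dots> = 1\<^sub>m n $$ (i, j)" using inj ij by (auto simp: inj_on_def)
    finally show "(?P * ?Q) $$ (i, j) = 1\<^sub>m n $$ (i, j)" .
  qed auto
  moreover have "mat n n (\<lambda>(i, j). A $$ (\<pi> i, \<pi> j)) = ?P * A * ?Q"
  proof (rule eq_matI)
    fix i j assume "i < dim_row (?P * A * ?Q)" "j < dim_col (?P * A * ?Q)"
    then have ij: "i < n" "j < n" by auto
    have PA: "(?P * A) $$ (i, k) = A $$ (\<pi> i, k)" if "k < n" for k
      using ij that into[OF ij(1)]
      by (subst mult_mat_index[OF _ A]) (auto simp: if_distrib[of "\<lambda>x. x * _"] cong: if_cong)
    have "(?P * A * ?Q) $$ (i, j) = (\<Sum>k<n. A $$ (\<pi> i, k) * (if k = \<pi> j then 1 else 0))"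
      using ij PA A by (subst mult_mat_index[of _ n n _ n]) auto
    also have "\<dots> = A $$ (\<pi> i, \<pi> j)"
      using into[OF ij(2)] by (simp add: if_distrib[of "\<lambda>x. _ * x"] cong: if_cong)
    finally show "mat n n (\<lambda>(i, j). A $$ (\<pi> i, \<pi> j)) $$ (i, j) = (?P * A * ?Q) $$ (i, j)"
      using ij by simp
  qed auto
  ultimately show ?thesis
    using A by (intro similar_mat_intro[of _ n _ ?P ?Q]) auto
qed

text \<open>In reversed order the transpose is the matrix of multiplication by x in the Horner basis
  h_i = \<open>poly_shift (Suc i) q\<close>, the quotients of q by x^(i+1): x h_i is h_(i-1) minus
  the constant q_i, and the shift by 0 is q itself, which vanishes modulo q.\<close>

lemma similar_companion_transpose:
  fixes q :: "'a :: field poly"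
  assumes q: "monic q"
  shows "similar_mat (transpose_mat (companion q)) (companion q)"
proof -
  let ?n = "degree q"
  let ?X = "mat ?n ?n (\<lambda>(i, j). transpose_mat (companion q) $$ (?n - 1 - i, ?n - 1 - j))"
  have "similar_mat ?X (transpose_mat (companion q))"
    by (rule similar_mat_reindex) (auto simp: inj_on_def)
  moreover have "similar_mat ?X (companion q)"
  proof (rule similar_companionI[OF q refl])
    let ?z = "\<lambda>i. poly_shift (Suc i) q"
    fix i assume i: "i < ?n"
    have c: "coeff (?z i) (?n - 1 - i) = 1" using q i by (simp add: coeff_poly_shift)
    then show nz: "?z i \<noteq> 0" by auto
    have "degree (?z i) \<le> ?n - 1 - i"
      by (rule degree_le) (auto simp: coeff_poly_shift intro!: coeff_eq_0)
    with c show "degree (?z i) = ?n - 1 - i" by (metis le_degree le_antisym one_neq_zero)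
    have ent: "?X $$ (i, l) = (if l = ?n - 1 then - coeff q i else if i = Suc l then 1 else 0)"
      if "l < ?n" for l
      using i that by (auto simp: companion_def)
    have last: "?z (?n - 1) = 1"
      using i q by (intro poly_eqI) (auto simp: coeff_poly_shift coeff_1 intro!: coeff_eq_0)
    have "(\<Sum>l<?n. Polynomial.smult (?X $$ (i, l)) (?z l))
      = (\<Sum>l<?n. (if l = ?n - 1 then [:- coeff q i:] else 0) + (if Suc l = i then ?z l else 0))"
      using ent i last by (intro sum.cong) auto
    also have "\<dots> = [:- coeff q i:] + (\<Sum>l<?n. if Suc l = i then ?z l else 0)"
      using i by (subst sum.distrib) simp
    also have "(\<Sum>l<?n. if Suc l = i then ?z l else 0) = (if i = 0 then 0 else poly_shift i q)"
      using i by (cases i) auto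
    finally have s: "(\<Sum>l<?n. Polynomial.smult (?X $$ (i, l)) (?z l))
      = [:- coeff q i:] + (if i = 0 then 0 else poly_shift i q)" .
    have "pCons 0 (?z i) = poly_shift i q + [:- coeff q i:]"
      by (intro poly_eqI) (auto simp: coeff_poly_shift coeff_pCons split: nat.splits)
    then have "pCons 0 (?z i) - (\<Sum>l<?n. Polynomial.smult (?X $$ (i, l)) (?z l))
      = (if i = 0 then Polynomial.smult 1 q else Polynomial.smult 0 q)"
      unfolding s by (auto simp: poly_shift_0)
    then show "\<exists>r. pCons 0 (?z i) - (\<Sum>l<?n. Polynomial.smult (?X $$ (i, l)) (?z l)) = Polynomial.smult r q"
      by metis
  qed simp
  ultimately show ?thesis using similar_mat_sym similar_mat_trans by blast
qed

lemma similar_mat_transpose: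
  fixes A :: "'a :: field mat"
  assumes "similar_mat A B" "A \<in> carrier_mat n n"
  shows "similar_mat (transpose_mat A) (transpose_mat B)"
proof -
  obtain P Q where PQ: "B \<in> carrier_mat n n" "P \<in> carrier_mat n n" "Q \<in> carrier_mat n n"
    "P * Q = 1\<^sub>m n" "Q * P = 1\<^sub>m n" "A = P * B * Q" by (rule similar_mat_obtain[OF assms])
  have "transpose_mat Q * transpose_mat P = 1\<^sub>m n"
    using transpose_mult[OF PQ(2,3)] PQ(4) by simp
  moreover have "transpose_mat A = transpose_mat Q * transpose_mat B * transpose_mat P"
    using PQ transpose_mult[of "P * B" n n Q n] transpose_mult[OF PQ(2,1)]
    by (simp add: assoc_mult_mat[of _ n n _ n _ n])
  ultimately show ?thesis
    using PQ assms by (intro similar_mat_intro[of _ n _ "transpose_mat Q" "transpose_mat P"]) auto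
qed

lemma similar_companion_transposeI:
  fixes X :: "'a :: field mat"
  assumes q: "monic q" and "similar_mat X (companion q)" "X \<in> carrier_mat n n"
  shows "similar_mat (transpose_mat X) (companion q)"
  using similar_mat_transpose[OF assms(2,3)] similar_companion_transpose[OF q] similar_mat_trans by blast

lemma mult_smult_one_add:
  fixes R :: "'a :: field mat"
  assumes "R \<in> carrier_mat m n" "B \<in> carrier_mat n n" "C \<in> carrier_mat n n"
  shows "R * (a \<cdot>\<^sub>m 1\<^sub>m n + B * C) = a \<cdot>\<^sub>m (R * 1\<^sub>m n) + R * B * C"
  using assms by (simp add: mult_add_distrib_mat[of _ m n _ n] mult_smult_distrib[of _ m n _ n]
      assoc_mult_mat[of _ m n _ n _ n])

lemma coeff_row_companion:
  fixes q :: "'a :: field poly"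
  assumes q: "monic q" and n: "degree q = n" and p: "degree p < n"
  defines "R \<equiv> \<lambda>p. mat 1 n (\<lambda>(i, k). coeff p (n - 1 - k)) :: 'a mat"
  shows "R p * companion q = R (pCons 0 p - Polynomial.smult (coeff p (n - 1)) q)"
proof (rule eq_matI)
  have C: "companion q \<in> carrier_mat n n" using companion_carrier[of q] n by simp
  let ?S = "R (pCons 0 p - Polynomial.smult (coeff p (n - 1)) q)"
  fix i l assume "i < dim_row ?S" "l < dim_col ?S"
  then have i: "i = 0" and l: "l < n" by (auto simp: R_def)
  have "(R p * companion q) $$ (i, l) = (\<Sum>k<n. coeff p (n - 1 - k) * companion q $$ (k, l))"
    using i l C by (subst mult_mat_index[of _ 1 n _ n]) (auto simp: R_def)
  then show "(R p * companion q) $$ (i, l) = ?S $$ (i, l)"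
    using companion_shift[of p q l] p l n i by (simp add: R_def)
qed (use n in \<open>auto simp: R_def\<close>)

text \<open>The row \<open>R 1\<close> stands for the polynomial 1 and is a cyclic vector: applying
  p(C) multiplies it by p. As long as deg p < n no reduction modulo q takes place, so the
  coefficients of p can be read off.\<close>

lemma poly_mat_companion_row:
  fixes q :: "'a :: field poly"
  assumes q: "monic q" and n: "degree q = n" and p: "degree p < n"
  defines "R \<equiv> \<lambda>p. mat 1 n (\<lambda>(i, k). coeff p (n - 1 - k)) :: 'a mat"
  shows "R 1 * poly_mat p (companion q) = R p"
  using p
proof (induction p)
  case 0
  have "companion q \<in> carrier_mat n n" using companion_carrier[of q] n by simp
  then show ?case by (auto simp: R_def)
next
  case (pCons a p)
  have C: "companion q \<in> carrier_mat n n" using companion_carrier[of q] n by simp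
  have R: "R p \<in> carrier_mat 1 n" for p by (simp add: R_def)
  show ?case
  proof (cases "p = 0")
    case True
    have "poly_mat (pCons a 0) (companion q) = a \<cdot>\<^sub>m 1\<^sub>m n + companion q * 0\<^sub>m n n"
      using poly_mat_pCons[OF C, of a 0] C by simp
    also have "\<dots> = a \<cdot>\<^sub>m 1\<^sub>m n" using right_mult_zero_mat[OF C, of n] by simp
    finally have "R 1 * poly_mat (pCons a 0) (companion q) = a \<cdot>\<^sub>m (R 1 * 1\<^sub>m n)"
      using R[of 1] by (simp add: mult_smult_distrib[of _ 1 n _ n])
    also have "\<dots> = R (pCons a 0)"
      using R[of 1] by (intro eq_matI) (auto simp: R_def coeff_pCons coeff_1 split: nat.splits)
    finally show ?thesis using True by simp
  next
    case False
    then have d: "degree p < n - 1" "degree p < n" using pCons.prems by auto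
    have "R 1 * poly_mat (pCons a p) (companion q)
        = R 1 * (a \<cdot>\<^sub>m 1\<^sub>m n + poly_mat p (companion q) * companion q)"
      using poly_mat_pCons[OF C] poly_mat_comm[OF C] by simp
    also have "\<dots> = a \<cdot>\<^sub>m (R 1 * 1\<^sub>m n) + R 1 * poly_mat p (companion q) * companion q"
      by (rule mult_smult_one_add[OF R]) (use C in auto)
    also have "R 1 * poly_mat p (companion q) = R p" using pCons d by simp
    also have "R p * companion q = R (pCons 0 p - Polynomial.smult (coeff p (n - 1)) q)"
      unfolding R_def by (rule coeff_row_companion[OF q n d(2)])
    also have "coeff p (n - 1) = 0" using d by (intro coeff_eq_0)
    also have "a \<cdot>\<^sub>m (R 1 * 1\<^sub>m n) + R (pCons 0 p - Polynomial.smult 0 q) = R (pCons a p)"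
      using R[of 1] by (intro eq_matI) (auto simp: R_def coeff_pCons coeff_1 split: nat.splits)
    finally show ?thesis .
  qed
qed

text \<open>Pushing the row of 1 through q(C) gives q modulo q, which is 0. Every unit row is the
  row of a monomial, hence the image of \<open>R 1\<close> under a power of C; since polynomials in
  C commute, q(C) kills it too.\<close>

lemma poly_mat_companion_self:
  fixes q :: "'a :: field poly"
  assumes q: "monic q" and n: "degree q = n"
  shows "poly_mat q (companion q) = 0\<^sub>m n n"
proof (cases "n = 0")
  case True
  then show ?thesis using n by (intro eq_matI) auto
next
  case False
  define R where "R = (\<lambda>p. mat 1 n (\<lambda>(i, k). coeff p (n - 1 - k)) :: 'a mat)"
  have C: "companion q \<in> carrier_mat n n" using companion_carrier[of q] n by simp
  have R: "R p \<in> carrier_mat 1 n" for p by (simp add: R_def)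
  obtain a p where qp: "q = pCons a p" by (cases q)
  have p: "degree p = n - 1" "monic p" "p \<noteq> 0" using qp q n False by (auto split: if_splits)
  have "R 1 * poly_mat q (companion q)
      = R 1 * (a \<cdot>\<^sub>m 1\<^sub>m n + poly_mat p (companion q) * companion q)"
    unfolding qp using poly_mat_pCons[OF C] poly_mat_comm[OF C] qp by simp
  also have "\<dots> = a \<cdot>\<^sub>m (R 1 * 1\<^sub>m n) + R 1 * poly_mat p (companion q) * companion q"
    by (rule mult_smult_one_add[OF R]) (use C in auto)
  also have "R 1 * poly_mat p (companion q) = R p"
    unfolding R_def by (rule poly_mat_companion_row[OF q n]) (use p False in simp)
  also have "R p * companion q = R (pCons 0 p - Polynomial.smult (coeff p (n - 1)) q)"
    unfolding R_def by (rule coeff_row_companion[OF q n]) (use p False in simp)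
  also have "pCons 0 p - Polynomial.smult (coeff p (n - 1)) q = [:- a:]"
    using p qp by (simp add: qp)
  also have "a \<cdot>\<^sub>m (R 1 * 1\<^sub>m n) + R [:- a:] = 0\<^sub>m 1 n"
    using R[of 1] by (intro eq_matI) (auto simp: R_def coeff_pCons coeff_1 split: nat.splits)
  finally have z: "R 1 * poly_mat q (companion q) = 0\<^sub>m 1 n" .
  show ?thesis
  proof (rule eq_matI)
    fix i j assume "i < dim_row (0\<^sub>m n n :: 'a mat)" "j < dim_col (0\<^sub>m n n :: 'a mat)"
    then have i: "i < n" and j: "j < n" by auto
    let ?m = "monom 1 (n - 1 - i) :: 'a poly"
    have "R ?m * poly_mat q (companion q) = R 1 * poly_mat ?m (companion q) * poly_mat q (companion q)"
      unfolding R_def by (subst poly_mat_companion_row[OF q n]) (use i in \<open>auto simp: degree_monom_eq\<close>)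
    also have "\<dots> = R 1 * (poly_mat q (companion q) * poly_mat ?m (companion q))"
      using R[of 1] C by (simp add: assoc_mult_mat[of _ 1 n _ n _ n] mult.commute
          flip: poly_mat_mult[OF C])
    also have "\<dots> = 0\<^sub>m 1 n * poly_mat ?m (companion q)"
      using R[of 1] C z assoc_mult_mat[of "R 1" 1 n "poly_mat q (companion q)" n "poly_mat ?m (companion q)" n] by simp
    finally have "(R ?m * poly_mat q (companion q)) $$ (0, j) = 0"
    using left_mult_zero_mat[OF poly_mat_carrier[OF C], of 1 ?m] j by simp
    moreover have "(R ?m * poly_mat q (companion q)) $$ (0, j)
        = (\<Sum>k<n. coeff ?m (n - 1 - k) * poly_mat q (companion q) $$ (k, j))"
      using j C R by (subst mult_mat_index[of _ 1 n _ n]) (auto simp: R_def)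
    moreover have "\<dots> = (\<Sum>k<n. (if k = i then poly_mat q (companion q) $$ (i, j) else 0))"
      using i by (intro sum.cong) auto
    ultimately show "poly_mat q (companion q) $$ (i, j) = 0\<^sub>m n n $$ (i, j)" using i j by simp
  qed (use n in auto)
qed

text \<open>After division by q a remainder of degree below n is left, and the row
  \<open>R 1\<close> turns the vanishing of its value at C into the vanishing of its
  coefficients.\<close>

lemma poly_mat_companion_zero_dvd:
  fixes q :: "'a :: field poly"
  assumes q: "monic q" and n: "degree q = n"
    and z: "poly_mat r (companion q) = 0\<^sub>m n n"
  shows "q dvd r"
proof (cases "n = 0")
  case True
  then have "q = 1" using q n by (metis monic_degree_0)
  then show ?thesis by simp
next
  case False
  define R where "R = (\<lambda>p. mat 1 n (\<lambda>(i, k). coeff p (n - 1 - k)) :: 'a mat)"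
  have C: "companion q \<in> carrier_mat n n" using companion_carrier[of q] n by simp
  let ?s = "r mod q"
  have q0: "q \<noteq> 0" using q by auto
  have d: "degree ?s < n" using degree_mod_less[OF q0, of r] False n by auto
  have "poly_mat r (companion q) = poly_mat (r div q * q) (companion q) + poly_mat ?s (companion q)"
    using poly_mat_add[OF C, of "r div q * q" ?s] by simp
  also have "poly_mat (r div q * q) (companion q) = 0\<^sub>m n n"
    by (simp add: poly_mat_mult[OF C] poly_mat_companion_self[OF q n])
      (rule right_mult_zero_mat, use C in auto)
  finally have "poly_mat ?s (companion q) = 0\<^sub>m n n" using z C by simp
  then have "R 1 * 0\<^sub>m n n = R ?s"
    using poly_mat_companion_row[OF q n d] by (simp add: R_def)
  then have R0: "R ?s = 0\<^sub>m 1 n" by (simp add: R_def)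
  have "coeff ?s k = 0" for k
  proof (cases "k < n")
    case True
    have "R ?s $$ (0, n - 1 - k) = coeff ?s k" using True by (simp add: R_def)
    then show ?thesis using R0 True by simp
  next
    case False
    then show ?thesis using d by (intro coeff_eq_0) simp
  qed
  then have "?s = 0" by (intro poly_eqI) simp
  then show ?thesis by (simp add: mod_eq_0_iff_dvd)
qed

text \<open>Inverting the variable maps K[x] modulo the reciprocal q' onto K[x] modulo q, so
  multiplication by x^-1 on the first is multiplication by x on the second, with the powers of x in
  opposite order up to a common factor. The pencil is applied with monomials, for which
  \<open>Z\<close> is the identity matrix.\<close>

lemma companion_reverse_mult:
  fixes q :: "'a :: field poly"
  assumes q: "monic q" and q0: "poly q 0 \<noteq> 0" and n: "degree q = n"
  defines "q' \<equiv> reciprocal_poly q"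
  shows "monic q'" "degree q' = n" "poly q' 0 \<noteq> 0"
    and "mat n n (\<lambda>(i, j). companion q $$ (n - 1 - i, n - 1 - j)) * companion q' = 1\<^sub>m n"
proof -
  have c0: "coeff q 0 \<noteq> 0" using q0 by (simp add: poly_0_coeff_0)
  have r: "reflect_poly q = Polynomial.smult (poly q 0) q'" using q0 by (simp add: q'_def reciprocal_poly_def)
  show m: "monic q'" using q0 c0 by (simp add: q'_def reciprocal_poly_def poly_0_coeff_0 coeff_reflect_poly)
  show d: "degree q' = n" using q0 c0 n by (simp add: q'_def reciprocal_poly_def)
  show "poly q' 0 \<noteq> 0" using q0 q by (auto simp: q'_def reciprocal_poly_def poly_0_coeff_0)
  let ?A = "mat n n (\<lambda>(i, j). companion q $$ (n - 1 - i, n - 1 - j))"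
  let ?z = "\<lambda>i. monom 1 (n - 1 - i) :: 'a poly"
  have "?A * (mat n n (\<lambda>(i, k). coeff (?z i) (n - 1 - k)) * companion q')
      = 1\<^sub>m n * mat n n (\<lambda>(i, k). coeff (?z i) (n - 1 - k))"
  proof (rule pencil_companion[OF m d])
    fix j assume j: "j < n"
    have x: "pCons 0 (?z i) = monom 1 (n - i)" if "i < n" for i
    proof -
      have "n - i = Suc (n - 1 - i)" using that by simp
      then show ?thesis by (simp add: monom_Suc)
    qed
    have one: "(\<Sum>i<n. Polynomial.smult (1\<^sub>m n $$ (j, i)) (?z i)) = ?z j"
      using j by (subst sum.cong[OF refl, of _ _ "\<lambda>i. if i = j then ?z j else 0"]) auto
    have A: "(\<Sum>i<n. Polynomial.smult (?A $$ (j, i)) (pCons 0 (?z i)))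
      = (if j = n - 1 then - (\<Sum>i<n. monom (coeff q i) (n - i)) else ?z j)"
    proof (cases "j = n - 1")
      case True
      have "(\<Sum>i<n. Polynomial.smult (?A $$ (j, i)) (pCons 0 (?z i)))
        = (\<Sum>i<n. - monom (coeff q i) (n - i))"
        using True j n x by (intro sum.cong) (auto simp: companion_def smult_monom minus_monom)
      then show ?thesis using True by (simp add: sum_negf)
    next
      case False
      have "(\<Sum>i<n. Polynomial.smult (?A $$ (j, i)) (pCons 0 (?z i)))
        = (\<Sum>i<n. if i = Suc j then pCons 0 (?z i) else 0)"
        using False j n by (intro sum.cong) (auto simp: companion_def)
      then show ?thesis using False j x[of "Suc j"] by simp
    qed
    \<comment> \<open>The constant term of x^n q(1/x) is 1 because q is monic; what remains is the
      sum met in the last row of the pencil, the only row that is not a mere shift.\<close>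
    have "(\<Sum>i<n. monom (coeff q i) (n - i)) + 1 = reflect_poly q"
    proof (rule poly_eqI)
      fix k
      have "coeff (\<Sum>i<n. monom (coeff q i) (n - i)) k = (\<Sum>i<n. if k = n - i then coeff q i else 0)"
        by (simp add: coeff_sum) (rule sum.cong, auto)
      also have "\<dots> = (\<Sum>i<n. if i = n - k then (if 0 < k \<and> k \<le> n then coeff q i else 0) else 0)"
        by (rule sum.cong) auto
      also have "\<dots> = (if 0 < k \<and> k \<le> n then coeff q (n - k) else 0)" by simp
      finally show "coeff ((\<Sum>i<n. monom (coeff q i) (n - i)) + 1) k = coeff (reflect_poly q) k"
        using n q by (auto simp: coeff_reflect_poly coeff_1)
    qed
    then have "- ((\<Sum>i<n. monom (coeff q i) (n - i)) + 1) = Polynomial.smult (- poly q 0) q'"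
      using r by simp
    then have s: "- (\<Sum>i<n. monom (coeff q i) (n - i)) - 1 = Polynomial.smult (- poly q 0) q'"
      by simp
    show "\<exists>r. (\<Sum>i<n. Polynomial.smult (?A $$ (j, i)) (pCons 0 (?z i))
        - Polynomial.smult (1\<^sub>m n $$ (j, i)) (?z i)) = Polynomial.smult r q'"
    proof (cases "j = n - 1")
      case True
      then show ?thesis unfolding sum_subtractf A one using s by (intro exI[of _ "- poly q 0"]) (simp only: True simp_thms if_True diff_self_eq_0 monom_eq_1)
    next
      case False
      then show ?thesis unfolding sum_subtractf A one by (intro exI[of _ 0]) simp
    qed
  qed (auto simp: degree_monom_eq)
  moreover have "mat n n (\<lambda>(i, k). coeff (?z i) (n - 1 - k)) = 1\<^sub>m n" by (rule eq_matI) auto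
  moreover have "1\<^sub>m n * companion q' = companion q'" using companion_carrier[of q'] d by simp
  ultimately show "?A * companion q' = 1\<^sub>m n" by simp
qed

lemma similar_inverse:
  fixes X :: "'a :: field mat"
  assumes s: "similar_mat X A" and X: "X \<in> carrier_mat n n" and W: "W \<in> carrier_mat n n"
    and XW: "X * W = 1\<^sub>m n" and B: "B \<in> carrier_mat n n" and AB: "A * B = 1\<^sub>m n"
  shows "similar_mat W B"
proof -
  obtain P Q where PQ: "A \<in> carrier_mat n n" "P \<in> carrier_mat n n" "Q \<in> carrier_mat n n"
    "P * Q = 1\<^sub>m n" "Q * P = 1\<^sub>m n" "X = P * A * Q" by (rule similar_mat_obtain[OF s X])
  note c = mult_carrier_mat[of _ n n _ n]
  note a = assoc_mult_mat[of _ n n _ n _ n]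
  have qp: "Q * (P * Y) = Y" if "Y \<in> carrier_mat n n" for Y
    using a[OF PQ(3,2) that] PQ(5) that by simp
  have ab: "A * (B * Y) = Y" if "Y \<in> carrier_mat n n" for Y
    using a[OF PQ(1) B that] AB that by simp
  have 1: "X * (P * B * Q) = 1\<^sub>m n"
    using PQ B by (simp add: a c qp ab)
  have "W * X = 1\<^sub>m n" by (rule mat_mult_left_right_inverse[OF X W XW])
  then have "P * B * Q = W * X * (P * B * Q)" using PQ B left_mult_one_mat[of "P * B * Q" n n] by (simp add: c)
  also have "\<dots> = W * (X * (P * B * Q))" using W X PQ B by (simp add: a c)
  also have "\<dots> = W" using 1 W by simp
  finally have "W = P * B * Q" by simp
  then show ?thesis using W B PQ by (intro similar_mat_intro[of W n B P Q])
qed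

lemma similar_companion_inverse:
  fixes X :: "'a :: field mat"
  assumes q: "monic q" and q0: "poly q 0 \<noteq> 0" and n: "degree q = n"
    and s: "similar_mat X (companion q)" and X: "X \<in> carrier_mat n n" and W: "W \<in> carrier_mat n n"
    and XW: "X * W = 1\<^sub>m n"
  shows "similar_mat W (companion (reciprocal_poly q))"
proof -
  let ?A = "mat n n (\<lambda>(i, j). companion q $$ (n - 1 - i, n - 1 - j))"
  have C: "companion q \<in> carrier_mat n n" using companion_carrier[of q] n by simp
  have "similar_mat ?A (companion q)" by (rule similar_mat_reindex[OF C]) (auto simp: inj_on_def)
  then have "similar_mat X ?A" using s similar_mat_sym similar_mat_trans by blast
  then show ?thesis
    using companion_reverse_mult[OF q q0 n] companion_carrier[of "reciprocal_poly q"]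
    by (intro similar_inverse[OF _ X W XW]) auto
qed

lemma char_poly_companion:
  fixes q :: "'a :: field poly"
  assumes q: "monic q"
  shows "char_poly (companion q) = q"
proof (cases "degree q")
  case 0
  then have "q = 1" using q by (metis monic_degree_0)
  then show ?thesis by (simp add: char_poly_def char_poly_matrix_def companion_def)
next
  case (Suc m)
  let ?n = "degree q"
  define M where "M = char_poly_matrix (companion q)"
  have M: "M \<in> carrier_mat ?n ?n" by (simp add: M_def)
  have Mi: "M $$ (i, j) = (if i = 0 then [:coeff q (?n - 1 - j):] else if i = Suc j then [:-1:] else 0)
      + (if i = j then [:0, 1:] else 0)" if "i < ?n" "j < ?n" for i j
    using that by (auto simp: M_def char_poly_matrix_def companion_def)
  \<comment> \<open>Multiplying by this matrix of determinant 1 adds to the last column of the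
    characteristic matrix the earlier columns times powers of x; by Horner's scheme the last column
    becomes q, 0, ..., 0.\<close>
  define T where "T = mat ?n ?n (\<lambda>(i, j). if j = m then monom 1 (m - i) else if i = j then 1 else 0 :: 'a poly)"
  have T: "T \<in> carrier_mat ?n ?n" by (simp add: T_def)
  have "upper_triangular T" using Suc by (auto simp: T_def upper_triangular_def)
  then have "det T = prod_list (diag_mat T)" by (rule det_upper_triangular[OF _ T])
  also have "diag_mat T = map (\<lambda>_. 1) [0..<?n]" using Suc by (auto simp: diag_mat_def T_def)
  also have "prod_list \<dots> = 1" by (simp add: map_replicate_const)
  finally have dT: "det T = 1" .
  define N where "N = mat ?n ?n (\<lambda>(i, j). if j = m then (if i = 0 then q else 0) else M $$ (i, j))"
  have N: "N \<in> carrier_mat ?n ?n" by (simp add: N_def)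
  have MT: "M * T = N"
  proof (rule eq_matI)
    fix i j assume "i < dim_row N" "j < dim_col N"
    then have i: "i < ?n" and j: "j < ?n" by (auto simp: N_def)
    have e: "(M * T) $$ (i, j) = (\<Sum>k<?n. M $$ (i, k) * T $$ (k, j))"
      by (rule mult_mat_index[OF M T i j])
    show "(M * T) $$ (i, j) = N $$ (i, j)"
    proof (cases "j = m")
      case False
      have "(\<Sum>k<?n. M $$ (i, k) * T $$ (k, j)) = (\<Sum>k<?n. if k = j then M $$ (i, j) else 0)"
        using False j by (intro sum.cong) (auto simp: T_def)
      then show ?thesis using e False i j by (simp add: N_def)
    next
      case True
      have "(\<Sum>k<?n. M $$ (i, k) * T $$ (k, j)) = (\<Sum>k<?n. M $$ (i, k) * monom 1 (m - k))"
        using True j by (intro sum.cong) (auto simp: T_def)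
      also have "\<dots> = (\<Sum>k<?n. (if i = 0 then monom (coeff q (m - k)) (m - k) else if i = Suc k then - monom 1 (m - k) else 0)
          + (if i = k then monom 1 (Suc (m - k)) else 0))"
      proof (rule sum.cong[OF refl])
        fix k assume "k \<in> {..<?n}"
        then have k: "k < ?n" by simp
        show "M $$ (i, k) * monom 1 (m - k) = (if i = 0 then monom (coeff q (m - k)) (m - k)
            else if i = Suc k then - monom 1 (m - k) else 0) + (if i = k then monom 1 (Suc (m - k)) else 0)"
          unfolding Mi[OF i k] using Suc by (simp add: smult_monom monom_Suc minus_monom distrib_right)
      qed
      also have "\<dots> = (\<Sum>k<?n. (if i = 0 then monom (coeff q (m - k)) (m - k) else if i = Suc k then - monom 1 (m - k) else 0))
          + monom 1 (Suc (m - i))"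
        using i by (subst sum.distrib) simp
      also have "(\<Sum>k<?n. (if i = 0 then monom (coeff q (m - k)) (m - k) else if i = Suc k then - monom 1 (m - k) else 0))
          = (if i = 0 then q - monom 1 (Suc m) else - monom 1 (Suc (m - i)))"
      proof (cases i)
        case 0
        have "(\<Sum>k<?n. monom (coeff q (m - k)) (m - k)) = (\<Sum>k<Suc m. monom (coeff q k) k)"
          unfolding Suc using sum.nat_diff_reindex[of "\<lambda>k. monom (coeff q k) k" "Suc m"] by simp
        also have "\<dots> = (\<Sum>k\<le>?n. monom (coeff q k) k) - monom 1 (Suc m)"
          using q Suc by (simp add: lessThan_Suc_atMost)
        finally show ?thesis using 0 poly_as_sum_of_monoms[of q] by simp
      next
        case (Suc i')
        have "m - i' = Suc (m - i)" using Suc i \<open>degree q = Suc m\<close> by simp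
        moreover have "(\<Sum>k<?n. if i = 0 then monom (coeff q (m - k)) (m - k) else if i = Suc k then - monom 1 (m - k) else 0)
          = (\<Sum>k<?n. if k = i' then - monom 1 (m - i') else 0)"
          using Suc by (intro sum.cong) auto
        ultimately show ?thesis using Suc i by simp
      qed
      finally show ?thesis using e True i j by (simp add: N_def)
    qed
  qed (use M T N in auto)
  have "det N = (\<Sum>i<?n. N $$ (i, m) * cofactor N i m)"
    by (rule laplace_expansion_column[OF N]) (use Suc in simp)
  also have "\<dots> = (\<Sum>i<?n. if i = 0 then q * cofactor N 0 m else 0)"
    using Suc by (intro sum.cong) (auto simp: N_def)
  also have "\<dots> = q * cofactor N 0 m" using Suc by simp
  \<comment> \<open>What remains after the deletion is upper triangular with -1 on the diagonal; its
    determinant (-1)^m cancels the sign of the cofactor.\<close>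
  also have "cofactor N 0 m = 1"
  proof -
    let ?D = "mat_delete N 0 m"
    have D: "?D \<in> carrier_mat m m" using N Suc by (auto simp: mat_delete_def)
    have Di: "?D $$ (i, j) = M $$ (Suc i, j)" if "i < m" "j < m" for i j
      using that N Suc by (auto simp: mat_delete_def N_def)
    have "upper_triangular ?D"
      using D Suc by (auto simp: upper_triangular_def Di Mi)
    then have "det ?D = prod_list (diag_mat ?D)" by (rule det_upper_triangular[OF _ D])
    also have "diag_mat ?D = map (\<lambda>_. [:-1:]) [0..<m]"
      using D Suc by (auto simp: diag_mat_def Di Mi)
    also have "prod_list \<dots> = (-1) ^ m" by (simp add: map_replicate_const one_pCons)
    finally show ?thesis by (simp add: cofactor_def flip: power_mult_distrib)
  qed
  finally have "det N = q" by simp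
  then show ?thesis using det_mult[OF M T] MT dT by (simp add: char_poly_def M_def)
qed

section \<open>Symplectic block matrices\<close>

lemma minus_zero_mat [simp]: "- 0\<^sub>m n m = (0\<^sub>m n m :: 'a :: field mat)"
  by (intro eq_matI) auto

lemma symplectic_form_carrier [simp]: "symplectic_form n \<in> carrier_mat (2 * n) (2 * n)"
  unfolding symplectic_form_def mult_2 by auto

lemma four_block_carrier [simp]:
  assumes "A \<in> carrier_mat n n" "D \<in> carrier_mat n n"
  shows "four_block_mat A B C D \<in> carrier_mat (2 * n) (2 * n)"
  using assms by (auto simp: mult_2)

lemma mult_four_block:
  assumes "A \<in> carrier_mat n n" "B \<in> carrier_mat n n" "C \<in> carrier_mat n n" "D \<in> carrier_mat n n"
    "A' \<in> carrier_mat n n" "B' \<in> carrier_mat n n" "C' \<in> carrier_mat n n" "D' \<in> carrier_mat n n"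
  shows "four_block_mat A B C D * four_block_mat A' B' C' D'
    = four_block_mat (A * A' + B * C') (A * B' + B * D') (C * A' + D * C') (C * B' + D * (D' :: 'a :: field mat))"
  by (rule mult_four_block_mat[of _ n n _ n _ n _ _ n _ n]) (use assms in auto)

lemma one_four_block: "1\<^sub>m (2 * n) = four_block_mat (1\<^sub>m n) (0\<^sub>m n n) (0\<^sub>m n n) (1\<^sub>m n :: 'a :: field mat)"
  by (simp add: mult_2)

lemma four_block_eq_iff:
  assumes "A \<in> carrier_mat n n" "B \<in> carrier_mat n n" "C \<in> carrier_mat n n" "D \<in> carrier_mat n n"
    "A' \<in> carrier_mat n n" "B' \<in> carrier_mat n n" "C' \<in> carrier_mat n n" "D' \<in> carrier_mat n n"
  shows "four_block_mat A B C D = four_block_mat A' B' C' D' \<longleftrightarrow> A = A' \<and> B = B' \<and> C = C' \<and> D = D'"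
    (is "?L = ?R \<longleftrightarrow> _")
proof
  assume e: "?L = ?R"
  have i: "?L $$ (i, j) = ?R $$ (i, j)" for i j using e by simp
  show "A = A' \<and> B = B' \<and> C = C' \<and> D = D'"
  proof (intro conjI eq_matI)
    fix j k assume "j < dim_row A'" "k < dim_col A'" then show "A $$ (j, k) = A' $$ (j, k)" using i[of j k] assms by auto
  next
    fix j k assume "j < dim_row B'" "k < dim_col B'" then show "B $$ (j, k) = B' $$ (j, k)" using i[of j "n + k"] assms by auto
  next
    fix j k assume "j < dim_row C'" "k < dim_col C'" then show "C $$ (j, k) = C' $$ (j, k)" using i[of "n + j" k] assms by auto
  next
    fix j k assume "j < dim_row D'" "k < dim_col D'" then show "D $$ (j, k) = D' $$ (j, k)" using i[of "n + j" "n + k"] assms by auto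
  qed (use assms in auto)
qed simp

lemma symplectic_form_sq:
  "symplectic_form n * (- symplectic_form n) = (1\<^sub>m (2 * n) :: 'a :: field mat)"
proof -
  have "- symplectic_form n = four_block_mat (0\<^sub>m n n) (- 1\<^sub>m n) (1\<^sub>m n) (0\<^sub>m n n :: 'a mat)"
    unfolding symplectic_form_def by (intro eq_matI) auto
  moreover have "four_block_mat (0\<^sub>m n n) (1\<^sub>m n) (- 1\<^sub>m n) (0\<^sub>m n n)
      * four_block_mat (0\<^sub>m n n) (- 1\<^sub>m n) (1\<^sub>m n) (0\<^sub>m n n :: 'a mat) = 1\<^sub>m (2 * n)"
    by (subst mult_four_block[of _ n]) (auto simp: one_four_block intro!: cong_four_block_mat)
  ultimately show ?thesis by (simp add: symplectic_form_def)
qed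

text \<open>With \<open>G\<close> the matrix \<open>symplectic_form n\<close>, one has
  \<open>G (-G) = 1\<close>, so the equation makes \<open>G P^T (-G)\<close> a right inverse of
  \<open>P\<close>.\<close>

lemma Sp_iff:
  fixes P :: "'a :: field mat"
  shows "P \<in> carrier (Sp n) \<longleftrightarrow>
    P \<in> carrier_mat (2 * n) (2 * n) \<and> P * symplectic_form n * transpose_mat P = symplectic_form n"
proof -
  let ?G = "symplectic_form n :: 'a mat"
  have "invertible_mat P" if P: "P \<in> carrier_mat (2 * n) (2 * n)" and e: "P * ?G * transpose_mat P = ?G"
  proof -
    have G: "?G \<in> carrier_mat (2 * n) (2 * n)" by simp
    let ?Q = "?G * transpose_mat P * (- ?G)"
    have Q: "?Q \<in> carrier_mat (2 * n) (2 * n)" using P by (metis mult_carrier_mat symplectic_form_carrier transpose_carrier_mat uminus_carrier_mat)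
    have "P * ?Q = P * ?G * transpose_mat P * (- ?G)"
      using P G uminus_carrier_mat[OF G] by (simp add: assoc_mult_mat[of _ "2*n" "2*n" _ "2*n" _ "2*n"] mult_carrier_mat[of _ "2*n" "2*n" _ "2*n"])
    also have "\<dots> = 1\<^sub>m (2 * n)" using e symplectic_form_sq by simp
    finally have "P * ?Q = 1\<^sub>m (2 * n)" .
    moreover from this have "?Q * P = 1\<^sub>m (2 * n)" using mat_mult_left_right_inverse P Q by blast
    ultimately show ?thesis using P Q unfolding invertible_mat_def inverts_mat_def by (intro conjI exI[of _ ?Q]) auto
  qed
  then show ?thesis unfolding Sp_def by auto
qed

lemma Sp_carrier_mat: "P \<in> carrier (Sp n) \<Longrightarrow> P \<in> carrier_mat (2 * n) (2 * n)"
  by (simp add: Sp_iff)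

lemma Sp_mult: "P \<in> carrier (Sp n) \<Longrightarrow> Q \<in> carrier (Sp n) \<Longrightarrow> P * Q \<in> carrier (Sp n)"
  using group.subgroup_self[OF group_Sp, THEN subgroup.m_closed, of P n Q] by (simp add: Sp_def)

lemma Sp_inverse:
  fixes P :: "'a :: field mat"
  assumes P: "P \<in> carrier (Sp n)"
  obtains Q where "Q \<in> carrier (Sp n)" "P * Q = 1\<^sub>m (2 * n)" "Q * P = 1\<^sub>m (2 * n)" "inv\<^bsub>Sp n\<^esub> P = Q"
proof -
  interpret group "Sp n :: 'a mat monoid" by (rule group_Sp)
  show ?thesis using that[of "inv\<^bsub>Sp n\<^esub> P"] r_inv[OF P] l_inv[OF P] inv_closed[OF P] by (simp add: Sp_def)
qed

lemma uminus_add_eq: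
  fixes U :: "'a :: field mat"
  shows "U \<in> carrier_mat n n \<Longrightarrow> V \<in> carrier_mat n n \<Longrightarrow> - U + V = V - U"
  by (intro eq_matI) auto

lemma uminus_add_eq_zero:
  fixes U :: "'a :: field mat"
  assumes "U \<in> carrier_mat n n" "V \<in> carrier_mat n n"
  shows "- U + V = 0\<^sub>m n n \<longleftrightarrow> V = U"
proof
  assume e: "- U + V = 0\<^sub>m n n"
  show "V = U"
  proof (rule eq_matI)
    fix i j assume ij: "i < dim_row U" "j < dim_col U"
    have "(- U + V) $$ (i, j) = 0" using e ij assms by simp
    then show "V $$ (i, j) = U $$ (i, j)" using ij assms by simp
  qed (use assms in auto)
qed (use assms in \<open>auto intro!: eq_matI\<close>)

lemma Sp_four_block_iff:
  fixes A :: "'a :: field mat"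
  assumes c: "A \<in> carrier_mat n n" "B \<in> carrier_mat n n" "C \<in> carrier_mat n n" "D \<in> carrier_mat n n"
  shows "four_block_mat A B C D \<in> carrier (Sp n) \<longleftrightarrow>
    A * transpose_mat B = B * transpose_mat A \<and> A * transpose_mat D - B * transpose_mat C = 1\<^sub>m n \<and>
    C * transpose_mat D = D * transpose_mat C"
proof -
  let ?M = "four_block_mat A B C D"
  let ?t = transpose_mat
  have ct: "?t A \<in> carrier_mat n n" "?t B \<in> carrier_mat n n" "?t C \<in> carrier_mat n n" "?t D \<in> carrier_mat n n" using c by auto
  have p: "X * ?t Y \<in> carrier_mat n n" if "X \<in> carrier_mat n n" "Y \<in> carrier_mat n n" for X Y :: "'a mat" using that by auto
  have t: "?t ?M = four_block_mat (?t A) (?t C) (?t B) (?t D)"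
    by (rule transpose_four_block_mat) (use c in auto)
  have z: "X * 0\<^sub>m n n = 0\<^sub>m n n" "X * (- 1\<^sub>m n) = - X" "0\<^sub>m n n + - X = - X" "- X + 0\<^sub>m n n = - X" "X + 0\<^sub>m n n = X" "0\<^sub>m n n + X = X" "X * 1\<^sub>m n = X"
    if "X \<in> carrier_mat n n" for X :: "'a mat" using that by (auto intro!: eq_matI)
  have "?M * symplectic_form n = four_block_mat (- B) A (- D) C"
    unfolding symplectic_form_def using c by (subst mult_four_block[of _ n]) (auto simp: z)
  then have "?M * symplectic_form n * ?t ?M = four_block_mat (- B * ?t A + A * ?t B) (- B * ?t C + A * ?t D)
      (- D * ?t A + C * ?t B) (- D * ?t C + C * ?t D)"
    unfolding t using c ct by (simp add: mult_four_block[of _ n])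
  then have "?M \<in> carrier (Sp n) \<longleftrightarrow> - B * ?t A + A * ?t B = 0\<^sub>m n n \<and> - B * ?t C + A * ?t D = 1\<^sub>m n \<and>
      - D * ?t A + C * ?t B = - 1\<^sub>m n \<and> - D * ?t C + C * ?t D = 0\<^sub>m n n"
    unfolding Sp_iff unfolding symplectic_form_def using c ct by (subst four_block_eq_iff[symmetric, of _ n]) (auto simp del: four_block_eq_iff)
  moreover have "- B * ?t A + A * ?t B = 0\<^sub>m n n \<longleftrightarrow> A * ?t B = B * ?t A"
    "- D * ?t C + C * ?t D = 0\<^sub>m n n \<longleftrightarrow> C * ?t D = D * ?t C" 
    "- B * ?t C + A * ?t D = A * ?t D - B * ?t C" using c
    using uminus_add_eq_zero[OF p[OF c(2) c(1)] p[OF c(1) c(2)]]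
      uminus_add_eq_zero[OF p[OF c(4) c(3)] p[OF c(3) c(4)]]
      uminus_add_eq[OF p[OF c(2) c(3)] p[OF c(1) c(4)]] by simp_all
  \<comment> \<open>The lower left block of the equation is minus the transpose of the upper right
    one, so both express the same condition.\<close>
  moreover have "- D * ?t A + C * ?t B = - ?t (A * ?t D - B * ?t C)"
  proof -
    have "?t (A * ?t D - B * ?t C) = ?t (A * ?t D) - ?t (B * ?t C)"
      by (rule transpose_minus[of _ n n]) (use c in auto)
    also have "?t (A * ?t D) = D * ?t A" using transpose_mult[OF c(1) ct(4)] by simp
    also have "?t (B * ?t C) = C * ?t B" using transpose_mult[OF c(2) ct(3)] by simp
    finally show ?thesis using c by (intro eq_matI) auto
  qed
  ultimately show ?thesis by auto
qed

text \<open>Conjugacy under a symplectic matrix, written without the inverse so that it can be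
  verified by multiplying out blocks.\<close>

definition sp_conj :: "nat \<Rightarrow> 'a :: field mat \<Rightarrow> 'a mat \<Rightarrow> bool" where
  "sp_conj n M N \<longleftrightarrow> (\<exists>g \<in> carrier (Sp n). M * g = g * N)"

lemma sp_conj_trans:
  fixes M :: "'a :: field mat"
  assumes "sp_conj n M N" "sp_conj n N K"
    and c: "M \<in> carrier_mat (2 * n) (2 * n)" "N \<in> carrier_mat (2 * n) (2 * n)" "K \<in> carrier_mat (2 * n) (2 * n)"
  shows "sp_conj n M K"
proof -
  obtain g h where g: "g \<in> carrier (Sp n)" "M * g = g * N" and h: "h \<in> carrier (Sp n)" "N * h = h * K"
    using assms(1,2) unfolding sp_conj_def by blast
  note gc = Sp_carrier_mat[OF g(1)] and hc = Sp_carrier_mat[OF h(1)]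
  note a = assoc_mult_mat[of _ "2 * n" "2 * n" _ "2 * n" _ "2 * n"]
  have "M * (g * h) = (M * g) * h" using gc hc c by (simp add: a)
  also have "\<dots> = g * (N * h)" using g gc hc c by (simp add: a)
  also have "\<dots> = (g * h) * K" using h gc hc c by (simp add: a)
  finally show ?thesis using Sp_mult[OF g(1) h(1)] unfolding sp_conj_def by blast
qed

lemma sp_conj_Sp:
  fixes M :: "'a :: field mat"
  assumes "sp_conj n M N" "M \<in> carrier (Sp n)" and c: "N \<in> carrier_mat (2 * n) (2 * n)"
  shows "N \<in> carrier (Sp n)"
proof -
  obtain g where g: "g \<in> carrier (Sp n)" "M * g = g * N"
    using assms(1) unfolding sp_conj_def by blast
  obtain h where h: "h \<in> carrier (Sp n)" "g * h = 1\<^sub>m (2 * n)" "h * g = 1\<^sub>m (2 * n)" by (rule Sp_inverse[OF g(1)])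
  note gc = Sp_carrier_mat[OF g(1)] and hc = Sp_carrier_mat[OF h(1)] and Mc = Sp_carrier_mat[OF assms(2)]
  note a = assoc_mult_mat[of _ "2 * n" "2 * n" _ "2 * n" _ "2 * n"]
  have "N = (h * g) * N" using h c by simp
  also have "\<dots> = h * (M * g)" using g gc hc c by (simp add: a)
  finally have "N = h * (M * g)" .
  then show ?thesis using Sp_mult[OF h(1) Sp_mult[OF assms(2) g(1)]] by simp
qed

section \<open>Bezout identities and the Sylvester equation for symplectic block triangular
  matrices\<close>

lemma poly_bezout:
  fixes p q :: "'a :: field poly"
  shows "\<exists>u v. u * p + v * q dvd p \<and> u * p + v * q dvd q"
\<comment> \<open>The measure puts 0 below the nonzero constants, so that a vanishing remainder also
  counts as a descent.\<close>
proof (induction "if q = 0 then 0 else Suc (degree q)" arbitrary: p q rule: less_induct)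
  case less
  show ?case
  proof (cases "q = 0")
    case True
    then show ?thesis by (intro exI[of _ 1]) simp
  next
    case False
    have "(if p mod q = 0 then 0 else Suc (degree (p mod q))) < (if q = 0 then 0 else Suc (degree q))"
      using degree_mod_less[OF False, of p] False by auto
    from less[OF this] obtain u v where
      d: "u * q + v * (p mod q) dvd q" "u * q + v * (p mod q) dvd p mod q" by blast
    have e: "u * q + v * (p mod q) = v * p + (u - v * (p div q)) * q"
      by (simp add: minus_div_mult_eq_mod[symmetric] algebra_simps)
    have "u * q + v * (p mod q) dvd p"
      using d by (metis dvd_add dvd_mult div_mult_mod_eq)
    with d(1) show ?thesis unfolding e by blast
  qed
qed

lemma coprime_bezout:
  fixes p q :: "'a :: field poly"
  assumes "coprime p q"
  shows "\<exists>u v. u * p + v * q = 1"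
proof -
  obtain u v where "u * p + v * q dvd p" "u * p + v * q dvd q" using poly_bezout by blast
  then have "u * p + v * q dvd 1" using assms coprime_common_divisor by blast
  then obtain w where "1 = (u * p + v * q) * w" by (elim dvdE)
  then have "w * u * p + w * v * q = 1" by (simp add: algebra_simps)
  then show ?thesis by blast
qed

text \<open>Being symplectic forces W = X^-T, which is similar to the companion matrix of the
  reciprocal q'. From u q + v q' = 1 the polynomial f = v q' satisfies f(W) = 0 and f(X) = 1, so f
  of the whole matrix is a projection with some lower left block R, and its commuting with the
  matrix is the Sylvester equation for R.\<close>

lemma sylvester_aux:
  fixes X :: "'a :: field mat"
  assumes q: "monic q" and q0: "poly q 0 \<noteq> 0" and n: "degree q = n"
    and cop: "coprime q (reciprocal_poly q)"
    and c: "X \<in> carrier_mat n n" "Y \<in> carrier_mat n n" "W \<in> carrier_mat n n"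
    and s: "similar_mat X (companion q)"
    and sp: "four_block_mat X (0\<^sub>m n n) Y W \<in> carrier (Sp n)"
  shows "\<exists>R \<in> carrier_mat n n. Y + W * R = R * X \<and> transpose_mat R = R"
proof -
  let ?t = transpose_mat and ?q' = "reciprocal_poly q"
  let ?M = "four_block_mat X (0\<^sub>m n n) Y W"
  note a = assoc_mult_mat[of _ n n _ n _ n]
  note m = mult_carrier_mat[of _ n n _ n]
  have M: "?M \<in> carrier_mat (n + n) (n + n)" using c by simp
  have tc: "?t X \<in> carrier_mat n n" "?t Y \<in> carrier_mat n n" "?t W \<in> carrier_mat n n" using c by auto
  have "X * ?t W - 0\<^sub>m n n * ?t Y = 1\<^sub>m n" and YW: "Y * ?t W = W * ?t Y"
    using sp c by (auto simp: Sp_four_block_iff)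
  moreover have "X * ?t W - 0\<^sub>m n n * ?t Y = X * ?t W" using c by (intro eq_matI) auto
  ultimately have XW: "X * ?t W = 1\<^sub>m n" by simp
  then have WX': "?t W * X = 1\<^sub>m n" using mat_mult_left_right_inverse c by (metis transpose_carrier_mat)
  have WX: "W * ?t X = 1\<^sub>m n"
    using transpose_mult[of X n n "?t W" n] XW c by simp
  have "similar_mat (?t W) (companion ?q')"
    using similar_companion_inverse[OF q q0 n s c(1) _ XW] c by simp
  then have q'W: "poly_mat ?q' (?t W) = 0\<^sub>m n n"
    using poly_mat_similar[of "?t W"] poly_mat_companion_self companion_reverse_mult[OF q q0 n] c
    by (metis transpose_carrier_mat)
  have q'W: "poly_mat ?q' W = 0\<^sub>m n n"
    using poly_mat_transpose[of "?t W" n ?q'] q'W c by simp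
  have qX: "poly_mat q X = 0\<^sub>m n n"
    using poly_mat_similar[OF s c(1)] poly_mat_companion_self[OF q n] by simp
  obtain u v where uv: "u * q + v * ?q' = 1"
    using coprime_bezout[OF cop] by blast
  let ?f = "v * ?q'"
  have fW: "poly_mat ?f W = 0\<^sub>m n n"
    unfolding poly_mat_mult[OF c(3)] q'W by (rule right_mult_zero_mat) (use c in auto)
  have "poly_mat (u * q) X = 0\<^sub>m n n"
    unfolding poly_mat_mult[OF c(1)] qX by (rule right_mult_zero_mat) (use c in auto)
  then have fX: "poly_mat ?f X = 1\<^sub>m n"
    using poly_mat_add[OF c(1), of "u * q" ?f] uv poly_mat_1[OF c(1)] poly_mat_carrier[OF c(1), of ?f] by simp
  obtain R where R: "R \<in> carrier_mat n n"
    and fM: "poly_mat ?f ?M = four_block_mat (1\<^sub>m n) (0\<^sub>m n n) R (0\<^sub>m n n)"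
    using poly_mat_block_lower[OF c(1,2,3), of ?f] fX fW by auto
  have z: "U * 0\<^sub>m n n = 0\<^sub>m n n" "0\<^sub>m n n * U = 0\<^sub>m n n" "0\<^sub>m n n + U = U" "U + 0\<^sub>m n n = U" "U * 1\<^sub>m n = U" "1\<^sub>m n * U = U"
    if "U \<in> carrier_mat n n" for U :: "'a mat" using that by auto
  have "poly_mat ?f ?M * ?M = ?M * poly_mat ?f ?M" by (rule poly_mat_comm[OF M])
  then have "four_block_mat X (0\<^sub>m n n) (R * X) (0\<^sub>m n n) = four_block_mat X (0\<^sub>m n n) (Y + W * R) (0\<^sub>m n n)"
    unfolding fM using c R by (simp add: mult_four_block[of _ n] z m)
  then have e: "Y + W * R = R * X"
    using c R by (subst (asm) four_block_eq_iff[of _ n]) (auto simp: m)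
  have e1: "Y * ?t W + W * R * ?t W = R"
  proof -
    have "(Y + W * R) * ?t W = R * (X * ?t W)" unfolding e using c R by (simp add: a)
    then show ?thesis using c R XW by (simp add: add_mult_distrib_mat[of _ n n _ _ n] m z)
  qed
  have e2: "W * ?t Y + W * ?t R * ?t W = ?t R"
  proof -
    have "?t (Y * ?t W + W * R * ?t W) = ?t (Y * ?t W) + ?t (W * R * ?t W)"
      by (rule transpose_add[of _ n n]) (use c R in auto)
    also have "?t (Y * ?t W) = W * ?t Y" using transpose_mult[of Y n n "?t W" n] c by simp
    also have "?t (W * R * ?t W) = W * ?t R * ?t W"
      using transpose_mult[of "W * R" n n "?t W" n] transpose_mult[of W n n R n] c R by (simp add: a m)
    finally show ?thesis using e1 by simp
  qed
  \<comment> \<open>By the symplectic relation Y W^T = W Y^T, both R and its transpose solve the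
    same equation, so their difference D satisfies W D W^T = D, that is W D = D X. Then f(W) = 0 and
    f(X) = 1 force D = 0.\<close>
  let ?D = "R - ?t R"
  have D: "?D \<in> carrier_mat n n" using R by auto
  have "W * ?D * ?t W = W * R * ?t W - W * ?t R * ?t W"
    using c R by (simp add: mult_minus_distrib_mat[of _ n n _ n] minus_mult_distrib_mat[of _ n n _ _ n] m)
  also have "\<dots> = (Y * ?t W + W * R * ?t W) - (W * ?t Y + W * ?t R * ?t W)"
    unfolding YW using c R by (intro eq_matI) auto
  also have "\<dots> = ?D" unfolding e1 e2 by simp
  finally have De: "W * ?D * ?t W = ?D" .
  have "W * ?D = W * ?D * (?t W * X)" using WX' c D by (simp add: z m)
  also have "\<dots> = (W * ?D * ?t W) * X" using c D by (simp add: a m)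
  finally have "W * ?D = ?D * X" unfolding De .
  then have "poly_mat ?f W * ?D = ?D * poly_mat ?f X"
    by (rule poly_mat_intertwine[OF c(3,1) D])
  then have "?D = 0\<^sub>m n n" unfolding fX fW using D by (simp add: z)
  then have D0: "?D = 0\<^sub>m n n" .
  have "?t R = R"
  proof (rule eq_matI)
    fix i j assume ij: "i < dim_row R" "j < dim_col R"
    have "?D $$ (i, j) = 0" unfolding D0 using ij R by simp
    then show "?t R $$ (i, j) = R $$ (i, j)" using ij R by simp
  qed (use R in auto)
  with e R show ?thesis by blast
qed

lemma companion_inverse:
  fixes q :: "'a :: field poly"
  assumes q: "monic q" and q0: "poly q 0 \<noteq> 0" and n: "degree q = n"
  obtains K where "K \<in> carrier_mat n n" "companion q * K = 1\<^sub>m n"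
proof -
  have C: "companion q \<in> carrier_mat n n" using companion_carrier[of q] n by simp
  define A where "A = mat n n (\<lambda>(i, j). companion q $$ (n - 1 - i, n - 1 - j))"
  have A: "A \<in> carrier_mat n n" by (simp add: A_def)
  have B: "companion (reciprocal_poly q) \<in> carrier_mat n n"
    using companion_carrier[of "reciprocal_poly q"] companion_reverse_mult(2)[OF q q0 n] by simp
  have AB: "A * companion (reciprocal_poly q) = 1\<^sub>m n" unfolding A_def by (rule companion_reverse_mult(4)[OF q q0 n])
  have "similar_mat A (companion q)" unfolding A_def by (rule similar_mat_reindex[OF C]) (auto simp: inj_on_def)
  then have "similar_mat (companion q) A" by (rule similar_mat_sym)
  then obtain P Q where PQ: "P \<in> carrier_mat n n" "Q \<in> carrier_mat n n"
    "P * Q = 1\<^sub>m n" "Q * P = 1\<^sub>m n" "companion q = P * A * Q" using similar_mat_obtain[OF _ C] by metis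
  let ?B = "companion (reciprocal_poly q)"
  note a = assoc_mult_mat[of _ n n _ n _ n]
  have qp: "Q * (P * Y) = Y" if "Y \<in> carrier_mat n n" for Y
    using a[OF PQ(2,1) that] PQ(4) that by simp
  have ab: "A * (?B * Y) = Y" if "Y \<in> carrier_mat n n" for Y
    using a[OF A B that] AB that by simp
  have "companion q * (P * ?B * Q) = 1\<^sub>m n"
    unfolding PQ(5) using PQ(1-4) A B by (simp add: a mult_carrier_mat[of _ n n _ n] qp ab)
  then show ?thesis using that[of "P * ?B * Q"] PQ(1,2) B by (metis mult_carrier_mat)
qed

text \<open>A unipotent lower block matrix with corner R is symplectic exactly if R is symmetric;
  this is why the Sylvester equation had to be solved symmetrically. It clears Y, and the block
  diagonal matrix of P and P^-T then takes X to the companion matrix; W = X^-T follows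
  along.\<close>

lemma sp_conj_lower:
  fixes X :: "'a :: field mat"
  assumes q: "monic q" and q0: "poly q 0 \<noteq> 0" and n: "degree q = n"
    and cop: "coprime q (reciprocal_poly q)"
    and c: "X \<in> carrier_mat n n" "Y \<in> carrier_mat n n" "W \<in> carrier_mat n n"
    and s: "similar_mat X (companion q)"
    and sp: "four_block_mat X (0\<^sub>m n n) Y W \<in> carrier (Sp n)"
    and K: "K \<in> carrier_mat n n" "companion q * K = 1\<^sub>m n"
  shows "sp_conj n (four_block_mat X (0\<^sub>m n n) Y W)
    (four_block_mat (companion q) (0\<^sub>m n n) (0\<^sub>m n n) (transpose_mat K))"
proof -
  let ?t = transpose_mat and ?C = "companion q"
  note a = assoc_mult_mat[of _ n n _ n _ n]
  note m = mult_carrier_mat[of _ n n _ n]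
  have C: "?C \<in> carrier_mat n n" using companion_carrier[of q] n by simp
  have z: "U * 0\<^sub>m n n = 0\<^sub>m n n" "0\<^sub>m n n * U = 0\<^sub>m n n" "0\<^sub>m n n + U = U" "U + 0\<^sub>m n n = U" "U * 1\<^sub>m n = U" "1\<^sub>m n * U = U" "U - 0\<^sub>m n n = U"
    if "U \<in> carrier_mat n n" for U :: "'a mat" using that by (auto intro!: eq_matI)
  obtain R where R: "R \<in> carrier_mat n n" "Y + W * R = R * X" "?t R = R"
    using sylvester_aux[OF q q0 n cop c s sp] by blast
  let ?U = "four_block_mat (1\<^sub>m n) (0\<^sub>m n n) R (1\<^sub>m n)"
  let ?M = "four_block_mat X (0\<^sub>m n n) Y W" and ?N = "four_block_mat X (0\<^sub>m n n) (0\<^sub>m n n) W"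
  have "?U \<in> carrier (Sp n)" using R by (simp add: Sp_four_block_iff z transpose_one)
  moreover have "?M * ?U = ?U * ?N" using c R by (simp add: mult_four_block[of _ n] z m)
  ultimately have 1: "sp_conj n ?M ?N" unfolding sp_conj_def by blast
  have "?N \<in> carrier (Sp n)" by (rule sp_conj_Sp[OF 1 sp]) (use c in simp)
  then have "X * ?t W - 0\<^sub>m n n * 0\<^sub>m n n = 1\<^sub>m n" using c by (simp add: Sp_four_block_iff)
  then have XW: "X * ?t W = 1\<^sub>m n" using z(7)[of "X * ?t W"] z(1)[of "0\<^sub>m n n"] c by (simp add: m)
  then have WX: "?t W * X = 1\<^sub>m n" using mat_mult_left_right_inverse c by (metis transpose_carrier_mat)
  obtain P Q where PQ: "P \<in> carrier_mat n n" "Q \<in> carrier_mat n n"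
    "P * Q = 1\<^sub>m n" "Q * P = 1\<^sub>m n" "X = P * ?C * Q" using similar_mat_obtain[OF s c(1)] by metis
  have qp: "Q * (P * Y) = Y" if "Y \<in> carrier_mat n n" for Y
    using a[OF PQ(2,1) that] PQ(4) that by simp
  have ck: "?C * (K * Y) = Y" if "Y \<in> carrier_mat n n" for Y
    using a[OF C K(1) that] K(2) that by simp
  have "X * (P * K * Q) = 1\<^sub>m n"
    unfolding PQ(5) using PQ(1-4) C K(1) by (simp add: a m qp ck)
  then have "?t W * X * (P * K * Q) = ?t W" using c PQ K(1) by (simp add: a m z)
  then have W: "?t W = P * K * Q" using WX PQ K(1) by (simp add: z m)
  let ?g = "four_block_mat P (0\<^sub>m n n) (0\<^sub>m n n) (?t Q)"
  let ?D = "four_block_mat ?C (0\<^sub>m n n) (0\<^sub>m n n) (?t K)"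
  have "?g \<in> carrier (Sp n)" using PQ by (simp add: Sp_four_block_iff z)
  moreover have "?N * ?g = ?g * ?D"
  proof -
    have "X * P = P * ?C" using PQ C by (simp add: a z m)
    moreover have "W * ?t Q = ?t Q * ?t K"
    proof -
      have "Q * ?t W = K * Q" unfolding W using PQ K(1) by (simp add: a m qp)
      then have "?t (Q * ?t W) = ?t (K * Q)" by simp
      then show ?thesis using transpose_mult[of Q n n "?t W" n] transpose_mult[of K n n Q n] PQ K(1) c by simp
    qed
    ultimately show ?thesis using c PQ K(1) C by (simp add: mult_four_block[of _ n] z m)
  qed
  ultimately have "sp_conj n ?N ?D" unfolding sp_conj_def by blast
  then show ?thesis using 1 sp_conj_trans[of n ?M ?N ?D] c C K(1) by simp
qed

text \<open>Conjugation by the Gram matrix interchanges the diagonal blocks and turns an upper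
  triangular factor into a lower triangular one, the form that \<open>sp_conj_lower\<close>
  handles.\<close>

lemma sp_conj_swap:
  fixes Z :: "'a :: field mat"
  assumes c: "Z \<in> carrier_mat n n" "B \<in> carrier_mat n n" "W \<in> carrier_mat n n"
  shows "sp_conj n (four_block_mat Z B (0\<^sub>m n n) W) (four_block_mat W (0\<^sub>m n n) (- B) Z)"
proof -
  have z: "U * 0\<^sub>m n n = 0\<^sub>m n n" "0\<^sub>m n n * U = 0\<^sub>m n n" "0\<^sub>m n n + U = U" "U + 0\<^sub>m n n = U" "U * 1\<^sub>m n = U" "1\<^sub>m n * U = U"
    "U * (- 1\<^sub>m n) = - U" "(- 1\<^sub>m n) * U = - U"
    if "U \<in> carrier_mat n n" for U :: "'a mat" using that by (auto intro!: eq_matI)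
  have "symplectic_form n \<in> carrier (Sp n :: 'a mat monoid)"
    unfolding symplectic_form_def by (simp add: Sp_four_block_iff z) (auto simp: z intro!: eq_matI)
  moreover have "four_block_mat Z B (0\<^sub>m n n) W * symplectic_form n
      = symplectic_form n * four_block_mat W (0\<^sub>m n n) (- B) Z"
    unfolding symplectic_form_def using c by (simp add: mult_four_block[of _ n] z)
  ultimately show ?thesis unfolding sp_conj_def by blast
qed

text \<open>\<open>A\<close> is a quotient X Y^-1 of two conjugates of the companion matrix, written
  without inverses: the witness is \<open>Y\<close>, and X is \<open>A * Y\<close>.\<close>

definition good :: "'a :: field poly \<Rightarrow> 'a mat \<Rightarrow> bool" where
  "good q A \<longleftrightarrow> (\<exists>Y. similar_mat Y (companion q) \<and> similar_mat (A * Y) (companion q))"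

lemma similar_companion_carrier:
  "similar_mat Y (companion q) \<Longrightarrow> Y \<in> carrier_mat (degree q) (degree q)"
  using similar_matD[of Y "companion q"] by (metis carrier_matD(1) companion_dim(1) insert_subset)

lemma good_similar:
  fixes A :: "'a :: field mat"
  assumes g: "good q B" and s: "similar_mat A B" and A: "A \<in> carrier_mat (degree q) (degree q)"
  shows "good q A"
proof -
  let ?n = "degree q"
  obtain Y where Y: "similar_mat Y (companion q)" "similar_mat (B * Y) (companion q)"
    using g unfolding good_def by blast
  have Yc: "Y \<in> carrier_mat ?n ?n" by (rule similar_companion_carrier[OF Y(1)])
  obtain P Q where PQ: "B \<in> carrier_mat ?n ?n" "P \<in> carrier_mat ?n ?n" "Q \<in> carrier_mat ?n ?n"
    "P * Q = 1\<^sub>m ?n" "Q * P = 1\<^sub>m ?n" "A = P * B * Q" by (rule similar_mat_obtain[OF s A])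
  note a = assoc_mult_mat[of _ ?n ?n _ ?n _ ?n]
  note m = mult_carrier_mat[of _ ?n ?n _ ?n]
  have qp: "Q * (P * Z) = Z" if "Z \<in> carrier_mat ?n ?n" for Z
    using a[OF PQ(3,2) that] PQ(5) that by simp
  have "similar_mat (P * Y * Q) Y"
    by (rule similar_mat_intro[of _ ?n _ P Q]) (use PQ Yc in auto)
  moreover have "A * (P * Y * Q) = P * (B * Y) * Q" using PQ Yc by (simp add: a m qp)
  then have "similar_mat (A * (P * Y * Q)) (B * Y)"
    by (intro similar_mat_intro[of _ ?n _ P Q]) (use PQ Yc in auto)
  ultimately show ?thesis using Y similar_mat_trans unfolding good_def by blast
qed

text \<open>With X = A Y the matrix factors as a lower block triangular one with corner X times an
  upper block triangular one with diagonal blocks Y^-1 and Y^T. The swap makes the second factor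
  lower triangular with corner Y^T, and a companion matrix is similar to its transpose, so both
  factors are of the kind treated by \<open>sp_conj_lower\<close>, with the same q.\<close>

lemma sp_conj_mult_good:
  fixes A :: "'a :: field mat"
  assumes q: "monic q" and q0: "poly q 0 \<noteq> 0" and n: "degree q = n"
    and cop: "coprime q (reciprocal_poly q)"
    and K: "K \<in> carrier_mat n n" "companion q * K = 1\<^sub>m n"
    and c: "A \<in> carrier_mat n n" "B \<in> carrier_mat n n" "C \<in> carrier_mat n n" "D \<in> carrier_mat n n"
    and P: "four_block_mat A B C D \<in> carrier (Sp n)" and g: "good q A"
  defines "N \<equiv> four_block_mat (companion q) (0\<^sub>m n n) (0\<^sub>m n n) (transpose_mat K)"
  shows "\<exists>M1 \<in> carrier (Sp n). \<exists>M2 \<in> carrier (Sp n). four_block_mat A B C D = M1 * M2 \<and>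
    sp_conj n M1 N \<and> sp_conj n M2 N"
proof -
  let ?t = transpose_mat and ?C = "companion q"
  note a = assoc_mult_mat[of _ n n _ n _ n]
  note m = mult_carrier_mat[of _ n n _ n]
  have Cc: "?C \<in> carrier_mat n n" using companion_carrier[of q] n by simp
  have Nc: "N \<in> carrier_mat (2 * n) (2 * n)" using Cc K by (simp add: N_def)
  have z: "U * 0\<^sub>m n n = 0\<^sub>m n n" "0\<^sub>m n n * U = 0\<^sub>m n n" "0\<^sub>m n n + U = U" "U + 0\<^sub>m n n = U" "U * 1\<^sub>m n = U" "1\<^sub>m n * U = U" "U - 0\<^sub>m n n = U"
    if "U \<in> carrier_mat n n" for U :: "'a mat" using that by (auto intro!: eq_matI)
  obtain Y where Y: "similar_mat Y ?C" "similar_mat (A * Y) ?C" using g unfolding good_def by blast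
  define X where "X = A * Y"
  have Yc: "Y \<in> carrier_mat n n" using similar_companion_carrier[OF Y(1)] n by simp
  have Xc: "X \<in> carrier_mat n n" using Yc c by (simp add: X_def)
  have inverse: "\<exists>V \<in> carrier_mat n n. U * V = 1\<^sub>m n \<and> V * U = 1\<^sub>m n" if U: "similar_mat U ?C" "U \<in> carrier_mat n n" for U
  proof -
    obtain R S where RS: "R \<in> carrier_mat n n" "S \<in> carrier_mat n n"
      "R * S = 1\<^sub>m n" "S * R = 1\<^sub>m n" "U = R * ?C * S" using similar_mat_obtain[OF U] by metis
    have sr: "S * (R * Z) = Z" if "Z \<in> carrier_mat n n" for Z
      using a[OF RS(2,1) that] RS(4) that by simp
    have ck: "?C * (K * Z) = Z" if "Z \<in> carrier_mat n n" for Z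
      using a[OF Cc K(1) that] K(2) that by simp
    have "U * (R * K * S) = 1\<^sub>m n" unfolding RS(5) using RS(1-4) Cc K(1) by (simp add: a m sr ck)
    moreover have "R * K * S \<in> carrier_mat n n" using RS K by simp
    ultimately show ?thesis using mat_mult_left_right_inverse U(2) by blast
  qed
  obtain Yi where Yi: "Yi \<in> carrier_mat n n" "Y * Yi = 1\<^sub>m n" "Yi * Y = 1\<^sub>m n" using inverse[OF Y(1) Yc] by blast
  obtain Xi where Xi: "Xi \<in> carrier_mat n n" "X * Xi = 1\<^sub>m n" "Xi * X = 1\<^sub>m n"
    using inverse[OF Y(2)[folded X_def] Xc] by blast
  have y: "Y * (Yi * Z) = Z" "Yi * (Y * Z) = Z" "X * (Xi * Z) = Z" "Xi * (X * Z) = Z" if "Z \<in> carrier_mat n n" for Z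
    using a[OF Yc Yi(1) that] a[OF Yi(1) Yc that] a[OF Xc Xi(1) that] a[OF Xi(1) Xc that] Yi Xi that by simp_all
  have AX: "A = X * Yi" unfolding X_def using c Yc Yi by (simp add: a z)
  have tt: "?t Y \<in> carrier_mat n n" "?t Yi \<in> carrier_mat n n" "?t Xi \<in> carrier_mat n n" "?t B \<in> carrier_mat n n" "?t X \<in> carrier_mat n n"
    using Yc Yi Xi c Xc by auto
  have "A * ?t B = B * ?t A" using P c by (simp add: Sp_four_block_iff)
  then have "X * Yi * ?t B = B * (?t Yi * ?t X)"
    using transpose_mult[OF Xc Yi(1)] AX by simp
  then have "Xi * (X * Yi * ?t B) * ?t Xi = Xi * (B * (?t Yi * ?t X)) * ?t Xi" by simp
  moreover have "Xi * (X * Yi * ?t B) * ?t Xi = Yi * ?t B * ?t Xi"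
    using Xi(1) Xc Yi(1) tt by (simp add: a m y)
  moreover have "?t X * ?t Xi = 1\<^sub>m n" using transpose_mult[OF Xi(1) Xc] Xi(3) by simp
  then have "Xi * (B * (?t Yi * ?t X)) * ?t Xi = Xi * B * ?t Yi"
    using Xi(1) c tt by (simp add: a m z)
  \<comment> \<open>This is A B^T = B A^T rewritten for A = X Y^-1; it is the relation that makes
    the upper triangular factor symplectic.\<close>
  ultimately have sym: "Yi * ?t B * ?t Xi = Xi * B * ?t Yi" by simp
  let ?P = "four_block_mat A B C D"
  let ?M2 = "four_block_mat Yi (Xi * B) (0\<^sub>m n n) (?t Y)"
  let ?V = "- (Y * Xi * B * ?t Yi)"
  let ?N2 = "four_block_mat Y ?V (0\<^sub>m n n) (?t Yi)"
  have M2: "?M2 \<in> carrier (Sp n)"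
    using Yi Xi c Yc tt transpose_mult[OF Xi(1) c(2)] sym by (simp add: Sp_four_block_iff a m z y)
  have mm: "U * (- V) = - (U * V)" if "U \<in> carrier_mat n n" "V \<in> carrier_mat n n" for U V :: "'a mat" using that by simp
  have YiYt: "?t Y * ?t Yi = 1\<^sub>m n" using transpose_mult[OF Yi(1) Yc] Yi(3) by simp
  have pm: "- U + U = 0\<^sub>m n n" if "U \<in> carrier_mat n n" for U :: "'a mat" using that by (intro eq_matI) auto
  have M2N2: "?M2 * ?N2 = 1\<^sub>m (2 * n)"
    unfolding one_four_block using Yi Xi c Yc tt YiYt by (simp add: mult_four_block[of _ n] a m z y mm pm)
  \<comment> \<open>That \<open>?N2\<close> is symplectic follows from the uniqueness of the inverse
    of \<open>?M2\<close>, without checking its blocks.\<close>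
  obtain N' where N': "N' \<in> carrier (Sp n)" "?M2 * N' = 1\<^sub>m (2 * n)" "N' * ?M2 = 1\<^sub>m (2 * n)" by (rule Sp_inverse[OF M2])
  have N2c: "?N2 \<in> carrier_mat (2 * n) (2 * n)" using Yc tt by simp
  have "N' = N' * (?M2 * ?N2)" using M2N2 Sp_carrier_mat[OF N'(1)] by simp
  also have "\<dots> = N' * ?M2 * ?N2"
    using Sp_carrier_mat[OF N'(1)] Sp_carrier_mat[OF M2] N2c by (simp add: assoc_mult_mat[of _ "2*n" "2*n" _ "2*n" _ "2*n"])
  also have "\<dots> = ?N2" unfolding N'(3) by (rule left_mult_one_mat[OF N2c])
  finally have N2: "?N2 \<in> carrier (Sp n)" "?N2 * ?M2 = 1\<^sub>m (2 * n)" using N' by auto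
  define E where "E = C * ?V + D * ?t Yi"
  have Ec: "E \<in> carrier_mat n n" using c Yc Xi tt by (simp add: E_def m)
  have "?P * ?N2 = four_block_mat X (0\<^sub>m n n) (C * Y) E"
  proof -
    have "A * ?V + B * ?t Yi = 0\<^sub>m n n"
    proof -
      have "A * ?V = - (B * ?t Yi)" unfolding AX using Xc Yi(1) Yc Xi(1) c tt by (simp add: a m z y mm)
      then show ?thesis using pm[of "B * ?t Yi"] c tt by simp
    qed
    then show ?thesis using c Yc tt Xi by (simp add: mult_four_block[of _ n] a m z E_def flip: X_def)
  qed
  moreover have "?P * ?N2 \<in> carrier (Sp n)" by (rule Sp_mult[OF P N2(1)])
  ultimately have M1: "four_block_mat X (0\<^sub>m n n) (C * Y) E \<in> carrier (Sp n)"
    and M1e: "four_block_mat X (0\<^sub>m n n) (C * Y) E = ?P * ?N2" by simp_all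
  have "four_block_mat X (0\<^sub>m n n) (C * Y) E * ?M2 = ?P * (?N2 * ?M2)"
    unfolding M1e using Sp_carrier_mat[OF P] Sp_carrier_mat[OF M2] N2c
    by (simp add: assoc_mult_mat[of _ "2*n" "2*n" _ "2*n" _ "2*n"])
  then have prod: "?P = four_block_mat X (0\<^sub>m n n) (C * Y) E * ?M2"
    unfolding N2(2) using right_mult_one_mat[OF Sp_carrier_mat[OF P]] by simp
  have c1: "sp_conj n (four_block_mat X (0\<^sub>m n n) (C * Y) E) N"
    unfolding N_def
    by (rule sp_conj_lower[OF q q0 n cop Xc _ Ec Y(2)[folded X_def] M1 K]) (use c Yc in auto)
  let ?L = "four_block_mat (?t Y) (0\<^sub>m n n) (- (Xi * B)) Yi"
  have XB: "Xi * B \<in> carrier_mat n n" using Xi c by simp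
  have s1: "sp_conj n ?M2 ?L" by (rule sp_conj_swap[OF Yi(1) XB tt(1)])
  have L: "?L \<in> carrier (Sp n)" by (rule sp_conj_Sp[OF s1 M2]) (use tt Yi in simp)
  have "sp_conj n ?L N" unfolding N_def
    by (rule sp_conj_lower[OF q q0 n cop tt(1) _ Yi(1) similar_companion_transposeI[OF q Y(1) Yc] L K]) (use XB in auto)
  then have "sp_conj n ?M2 N" using sp_conj_trans[OF s1 _ _ _ Nc] Sp_carrier_mat[OF M2] Sp_carrier_mat[OF L] by blast
  with c1 prod M1 M2 show ?thesis by blast
qed

lemma poly_mat_block_diag:
  assumes X: "X \<in> carrier_mat n n" and W: "W \<in> carrier_mat m m"
  shows "poly_mat p (four_block_mat X (0\<^sub>m n m) (0\<^sub>m m n) W)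
    = four_block_mat (poly_mat p X) (0\<^sub>m n m) (0\<^sub>m m n) (poly_mat p W)"
proof (induction p)
  case 0
  have "four_block_mat X (0\<^sub>m n m) (0\<^sub>m m n) W \<in> carrier_mat (n + m) (n + m)" using X W by auto
  then show ?case using X W by (auto intro!: eq_matI)
next
  case (pCons a p)
  let ?M = "four_block_mat X (0\<^sub>m n m) (0\<^sub>m m n) W"
  have M: "?M \<in> carrier_mat (n + m) (n + m)" using X W by auto
  have e1: "?M * poly_mat p ?M = four_block_mat (X * poly_mat p X) (0\<^sub>m n m) (0\<^sub>m m n) (W * poly_mat p W)"
    unfolding pCons(2) using X W
    by (subst mult_four_block_mat[of _ n n _ m _ m _ _ n _ m])
      (auto intro!: cong_four_block_mat simp: left_mult_zero_mat[of _ m m] right_mult_zero_mat[of _ n n]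
        left_mult_zero_mat[of _ n n] right_mult_zero_mat[of _ m m])
  have e2: "a \<cdot>\<^sub>m 1\<^sub>m (n + m) = four_block_mat (a \<cdot>\<^sub>m 1\<^sub>m n) (0\<^sub>m n m) (0\<^sub>m m n) (a \<cdot>\<^sub>m 1\<^sub>m m)"
    by (rule eq_matI) auto
  show ?case
    unfolding poly_mat_pCons[OF M] poly_mat_pCons[OF X] poly_mat_pCons[OF W] e1 e2
    using X W by (subst add_four_block_mat[of _ n n _ m _ m]) auto
qed

lemma sp_conj_similar:
  fixes M :: "'a :: field mat"
  assumes "sp_conj n M N" and c: "M \<in> carrier_mat (2 * n) (2 * n)" "N \<in> carrier_mat (2 * n) (2 * n)"
  shows "similar_mat M N"
proof -
  obtain g where g: "g \<in> carrier (Sp n)" "M * g = g * N"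
    using assms(1) unfolding sp_conj_def by blast
  obtain h where h: "h \<in> carrier (Sp n)" "g * h = 1\<^sub>m (2 * n)" "h * g = 1\<^sub>m (2 * n)" by (rule Sp_inverse[OF g(1)])
  note gc = Sp_carrier_mat[OF g(1)] and hc = Sp_carrier_mat[OF h(1)]
  note a = assoc_mult_mat[of _ "2 * n" "2 * n" _ "2 * n" _ "2 * n"]
  have "M = M * (g * h)" using h c by simp
  also have "\<dots> = g * N * h" using g gc hc c by (simp flip: g(2) add: a)
  finally show ?thesis using gc hc h c by (intro similar_mat_intro[of _ "2*n" _ g h])
qed

lemma char_poly_block_diag:
  fixes X :: "'a :: field mat"
  assumes X: "X \<in> carrier_mat n n" and W: "W \<in> carrier_mat m m"
  shows "char_poly (four_block_mat X (0\<^sub>m n m) (0\<^sub>m m n) W) = char_poly X * char_poly W"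
proof -
  have "char_poly_matrix (four_block_mat X (0\<^sub>m n m) (0\<^sub>m m n) W)
    = four_block_mat (char_poly_matrix X) (0\<^sub>m n m) (0\<^sub>m m n) (char_poly_matrix W)"
    using X W by (intro eq_matI) (auto simp: char_poly_matrix_def)
  then show ?thesis unfolding char_poly_def
    by (simp, subst det_four_block_mat_lower_left_zero[of _ n _ m]) (use X W in auto)
qed

text \<open>Each diagonal block is similar to a companion matrix, one of q and one of its
  reciprocal. So a polynomial kills \<open>M\<close> exactly if it is divisible by both, which by
  coprimality means by their product. The characteristic polynomial is the same product, block by
  block; this yields both the cyclic and the strictly hyperbolic property of the class.\<close>

lemma min_poly_diag_companion:
  fixes q :: "'a :: field poly"
  assumes q: "monic q" and q0: "poly q 0 \<noteq> 0" and n: "degree q = n"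
    and cop: "coprime q (reciprocal_poly q)"
    and K: "K \<in> carrier_mat n n" "companion q * K = 1\<^sub>m n"
    and M: "similar_mat M (four_block_mat (companion q) (0\<^sub>m n n) (0\<^sub>m n n) (transpose_mat K))"
    and Mc: "M \<in> carrier_mat (2 * n) (2 * n)"
  shows "is_min_poly M (q * reciprocal_poly q)" "char_poly M = q * reciprocal_poly q"
proof -
  let ?t = transpose_mat and ?C = "companion q" and ?q' = "reciprocal_poly q"
  let ?N = "four_block_mat ?C (0\<^sub>m n n) (0\<^sub>m n n) (?t K)"
  note q' = companion_reverse_mult(1-3)[OF q q0 n]
  have C: "?C \<in> carrier_mat n n" using companion_carrier[of q] n by simp
  have C': "companion ?q' \<in> carrier_mat n n" using companion_carrier[of ?q'] q' by simp
  have tK: "?t K \<in> carrier_mat n n" using K by simp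
  have N: "?N \<in> carrier_mat (2 * n) (2 * n)" using C tK by simp
  have "similar_mat K (companion ?q')"
    using similar_companion_inverse[OF q q0 n similar_mat_refl[OF C] C K] .
  then have sK: "similar_mat (?t K) (companion ?q')"
    by (rule similar_companion_transposeI[OF q'(1) _ K(1)])
  have zero_iff: "poly_mat p M = 0\<^sub>m (2 * n) (2 * n) \<longleftrightarrow> q dvd p \<and> ?q' dvd p" for p
  proof -
    have "poly_mat p M = 0\<^sub>m (2 * n) (2 * n) \<longleftrightarrow> poly_mat p ?N = 0\<^sub>m (2 * n) (2 * n)"
      using poly_mat_similar[OF M Mc] poly_mat_similar[OF similar_mat_sym[OF M] N] by blast
    also have "\<dots> \<longleftrightarrow> poly_mat p ?C = 0\<^sub>m n n \<and> poly_mat p (?t K) = 0\<^sub>m n n"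
    proof -
      have zz: "0\<^sub>m (2 * n) (2 * n) = four_block_mat (0\<^sub>m n n) (0\<^sub>m n n) (0\<^sub>m n n) (0\<^sub>m n n :: 'a mat)" by (simp add: mult_2)
      show ?thesis unfolding poly_mat_block_diag[OF C tK] zz
        using C tK by (subst four_block_eq_iff[of _ n]) auto
    qed
    also have "poly_mat p ?C = 0\<^sub>m n n \<longleftrightarrow> q dvd p"
    proof
      assume "q dvd p"
      then obtain r where "p = r * q" by (metis dvdE mult.commute)
      then show "poly_mat p ?C = 0\<^sub>m n n"
        using poly_mat_companion_self[OF q n] C by (simp add: poly_mat_mult[OF C]) (rule right_mult_zero_mat, auto)
    qed (rule poly_mat_companion_zero_dvd[OF q n])
    also have "poly_mat p (?t K) = 0\<^sub>m n n \<longleftrightarrow> poly_mat p (companion ?q') = 0\<^sub>m n n"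
      using poly_mat_similar[OF sK tK] poly_mat_similar[OF similar_mat_sym[OF sK] C'] by blast
    also have "\<dots> \<longleftrightarrow> ?q' dvd p"
    proof
      assume "?q' dvd p"
      then obtain r where "p = r * ?q'" by (metis dvdE mult.commute)
      then show "poly_mat p (companion ?q') = 0\<^sub>m n n"
        using poly_mat_companion_self[OF q'(1,2)] C' by (simp add: poly_mat_mult[OF C']) (rule right_mult_zero_mat, auto)
    qed (rule poly_mat_companion_zero_dvd[OF q'(1,2)])
    finally show ?thesis .
  qed
  obtain u v where uv: "u * q + v * ?q' = 1" using coprime_bezout[OF cop] by blast
  have qq: "q * ?q' dvd p" if "q dvd p" "?q' dvd p" for p
  proof -
    have "p = u * (q * p) + v * (?q' * p)"
    proof -
      have "p = (u * q + v * ?q') * p" using uv by simp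
      then show ?thesis by (simp add: algebra_simps)
    qed
    moreover have "q * ?q' dvd q * p" "q * ?q' dvd ?q' * p" using that by (auto intro: mult_dvd_mono simp: mult.commute[of q])
    ultimately show ?thesis by (metis dvd_add dvd_mult)
  qed
  have nz: "q \<noteq> 0" "?q' \<noteq> 0" using q q' by auto
  show "is_min_poly M (q * ?q')"
    unfolding is_min_poly_def
  proof (intro conjI allI impI)
    show "monic (q * ?q')" using q q' by (simp add: lead_coeff_mult)
    show "poly_mat (q * ?q') M = 0\<^sub>m (dim_row M) (dim_row M)" using zero_iff[of "q * ?q'"] Mc by simp
    fix r assume r: "r \<noteq> 0 \<and> poly_mat r M = 0\<^sub>m (dim_row M) (dim_row M)"
    then have "q * ?q' dvd r" using zero_iff[of r] Mc qq by auto
    then show "degree (q * ?q') \<le> degree r" using r dvd_imp_degree_le by blast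
  qed
  have "char_poly M = char_poly ?N" by (rule char_poly_similar[OF M])
  also have "\<dots> = char_poly ?C * char_poly (?t K)" by (rule char_poly_block_diag[OF C tK])
  also have "char_poly (?t K) = char_poly (companion ?q')" by (rule char_poly_similar[OF sK])
  finally show "char_poly M = q * ?q'" by (simp add: char_poly_companion[OF q] char_poly_companion[OF q'(1)])
qed

text \<open>One conjugate of P with a good corner is enough: both factors are conjugated back by the
  same g, which keeps them in the class.\<close>

theorem class_square_covers:
  fixes q :: "'a :: field poly"
  assumes q: "monic q" and q0: "poly q 0 \<noteq> 0" and n: "degree q = n"
    and cop: "coprime q (reciprocal_poly q)"
    and main: "\<And>P :: 'a mat. P \<in> carrier (Sp n) \<Longrightarrow> P \<noteq> - 1\<^sub>m (2 * n) \<Longrightarrow>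
      \<exists>A B C D. A \<in> carrier_mat n n \<and> B \<in> carrier_mat n n \<and> C \<in> carrier_mat n n \<and> D \<in> carrier_mat n n \<and>
        sp_conj n P (four_block_mat A B C D) \<and> good q A"
  shows "\<exists>\<Omega> \<in> conjugacy_classes (Sp n :: 'a mat monoid).
    cyclic_class \<Omega> \<and> strictly_hyperbolic_class \<Omega> \<and>
    carrier (Sp n) = (\<Omega> <#>\<^bsub>Sp n\<^esub> \<Omega>) \<union> {- 1\<^sub>m (2 * n)}"
proof -
  interpret G: group "Sp n :: 'a mat monoid" by (rule group_Sp)
  obtain K where K: "K \<in> carrier_mat n n" "companion q * K = 1\<^sub>m n" by (rule companion_inverse[OF q q0 n])
  let ?C = "companion q"
  let ?N = "four_block_mat ?C (0\<^sub>m n n) (0\<^sub>m n n) (transpose_mat K)"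
  have C: "?C \<in> carrier_mat n n" using companion_carrier[of q] n by simp
  have Nc: "?N \<in> carrier_mat (2 * n) (2 * n)" using C K by simp
  have N: "?N \<in> carrier (Sp n)"
    using C K by (simp add: Sp_four_block_iff) (auto intro!: eq_matI)
  define \<Omega> where "\<Omega> = {M \<in> carrier (Sp n). sp_conj n M ?N}"
  have mult: "M \<otimes>\<^bsub>Sp n\<^esub> M' = M * M'" for M M' :: "'a mat" by (simp add: Sp_def)
  have orb: "\<Omega> = orbit (Sp n) (\<lambda>g. \<lambda>h \<in> carrier (Sp n). g \<otimes>\<^bsub>Sp n\<^esub> h \<otimes>\<^bsub>Sp n\<^esub> inv\<^bsub>Sp n\<^esub> g) ?N"
  proof (intro equalityI subsetI)
    fix M assume "M \<in> \<Omega>"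
    then obtain g where M: "M \<in> carrier (Sp n)" and g: "g \<in> carrier (Sp n)" "M * g = g * ?N"
      unfolding \<Omega>_def sp_conj_def by blast
    have "M = M \<otimes>\<^bsub>Sp n\<^esub> g \<otimes>\<^bsub>Sp n\<^esub> inv\<^bsub>Sp n\<^esub> g" using M g by (simp add: G.m_assoc)
    then have "M = g \<otimes>\<^bsub>Sp n\<^esub> ?N \<otimes>\<^bsub>Sp n\<^esub> inv\<^bsub>Sp n\<^esub> g" using g(2) by (simp add: mult)
    then show "M \<in> orbit (Sp n) (\<lambda>g. \<lambda>h \<in> carrier (Sp n). g \<otimes>\<^bsub>Sp n\<^esub> h \<otimes>\<^bsub>Sp n\<^esub> inv\<^bsub>Sp n\<^esub> g) ?N"
      unfolding orbit_def using g(1) N by auto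
  next
    fix M assume "M \<in> orbit (Sp n) (\<lambda>g. \<lambda>h \<in> carrier (Sp n). g \<otimes>\<^bsub>Sp n\<^esub> h \<otimes>\<^bsub>Sp n\<^esub> inv\<^bsub>Sp n\<^esub> g) ?N"
    then obtain g where g: "g \<in> carrier (Sp n)" "M = g \<otimes>\<^bsub>Sp n\<^esub> ?N \<otimes>\<^bsub>Sp n\<^esub> inv\<^bsub>Sp n\<^esub> g"
      unfolding orbit_def using N by auto
    then have M: "M \<in> carrier (Sp n)" using N by simp
    have "M \<otimes>\<^bsub>Sp n\<^esub> g = g \<otimes>\<^bsub>Sp n\<^esub> ?N" using g N by (simp add: G.m_assoc)
    then show "M \<in> \<Omega>" using M g(1) unfolding \<Omega>_def sp_conj_def by (auto simp: mult)
  qed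
  have cls: "\<Omega> \<in> conjugacy_classes (Sp n)"
    unfolding conjugacy_classes_def orbits_def orb using N by blast
  have mp: "is_min_poly M (q * reciprocal_poly q)" "char_poly M = q * reciprocal_poly q" if "M \<in> \<Omega>" for M
    using that min_poly_diag_companion[OF q q0 n cop K sp_conj_similar] Sp_carrier_mat Nc unfolding \<Omega>_def by blast+
  have "cyclic_class \<Omega>" unfolding cyclic_class_def cyclic_mat_def using mp by simp
  moreover have "strictly_hyperbolic_class \<Omega>"
    unfolding strictly_hyperbolic_class_def using q q0 cop mp by blast
  moreover have "carrier (Sp n) = (\<Omega> <#>\<^bsub>Sp n\<^esub> \<Omega>) \<union> {- 1\<^sub>m (2 * n)}"
  proof (intro equalityI subsetI)
    fix P assume P: "P \<in> carrier (Sp n :: 'a mat monoid)"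
    show "P \<in> (\<Omega> <#>\<^bsub>Sp n\<^esub> \<Omega>) \<union> {- 1\<^sub>m (2 * n)}"
    proof (cases "P = - 1\<^sub>m (2 * n)")
      case False
      obtain A B C' D where c: "A \<in> carrier_mat n n" "B \<in> carrier_mat n n" "C' \<in> carrier_mat n n" "D \<in> carrier_mat n n"
        and s: "sp_conj n P (four_block_mat A B C' D)" and g: "good q A" using main[OF P False] by blast
      let ?P = "four_block_mat A B C' D"
      have Pc: "?P \<in> carrier_mat (2 * n) (2 * n)" using c by simp
      have P': "?P \<in> carrier (Sp n)" by (rule sp_conj_Sp[OF s P Pc])
      obtain M1 M2 where M: "M1 \<in> carrier (Sp n)" "M2 \<in> carrier (Sp n)" "?P = M1 * M2"
        "sp_conj n M1 ?N" "sp_conj n M2 ?N" using sp_conj_mult_good[OF q q0 n cop K c P' g] by blast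
      obtain g where g: "g \<in> carrier (Sp n)" "P * g = g * ?P" using s unfolding sp_conj_def by blast
      have conj: "g \<otimes>\<^bsub>Sp n\<^esub> M \<otimes>\<^bsub>Sp n\<^esub> inv\<^bsub>Sp n\<^esub> g \<in> \<Omega>" if M: "M \<in> carrier (Sp n)" "sp_conj n M ?N" for M
      proof -
        let ?M = "g \<otimes>\<^bsub>Sp n\<^esub> M \<otimes>\<^bsub>Sp n\<^esub> inv\<^bsub>Sp n\<^esub> g"
        have M': "?M \<in> carrier (Sp n)" using g(1) M by simp
        have "?M \<otimes>\<^bsub>Sp n\<^esub> g = g \<otimes>\<^bsub>Sp n\<^esub> M" using g(1) M by (simp add: G.m_assoc)
        then have "sp_conj n ?M M" unfolding sp_conj_def using g(1) by (auto simp: mult)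
        then have "sp_conj n ?M ?N" using sp_conj_trans M Sp_carrier_mat[OF M'] Sp_carrier_mat[OF M(1)] Nc by blast
        then show ?thesis using M' by (simp add: \<Omega>_def)
      qed
      have "P = P \<otimes>\<^bsub>Sp n\<^esub> g \<otimes>\<^bsub>Sp n\<^esub> inv\<^bsub>Sp n\<^esub> g" using P g by (simp add: G.m_assoc)
      also have "P \<otimes>\<^bsub>Sp n\<^esub> g = g \<otimes>\<^bsub>Sp n\<^esub> (M1 \<otimes>\<^bsub>Sp n\<^esub> M2)" using g(2) M(3) by (simp add: mult)
      also have "g \<otimes>\<^bsub>Sp n\<^esub> (M1 \<otimes>\<^bsub>Sp n\<^esub> M2) \<otimes>\<^bsub>Sp n\<^esub> inv\<^bsub>Sp n\<^esub> g
        = (g \<otimes>\<^bsub>Sp n\<^esub> M1 \<otimes>\<^bsub>Sp n\<^esub> inv\<^bsub>Sp n\<^esub> g) \<otimes>\<^bsub>Sp n\<^esub> (g \<otimes>\<^bsub>Sp n\<^esub> M2 \<otimes>\<^bsub>Sp n\<^esub> inv\<^bsub>Sp n\<^esub> g)"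
        using g(1) M(1,2) by (simp add: G.m_assoc G.inv_solve_left)
      finally show ?thesis using conj[OF M(1,4)] conj[OF M(2,5)] unfolding set_mult_def by blast
    qed simp
  next
    fix P assume "P \<in> (\<Omega> <#>\<^bsub>Sp n\<^esub> \<Omega>) \<union> {- 1\<^sub>m (2 * n)}"
    moreover have "- 1\<^sub>m (2 * n) \<in> carrier (Sp n :: 'a mat monoid)"
    proof -
      let ?G = "symplectic_form n :: 'a mat"
      have G: "?G \<in> carrier_mat (2 * n) (2 * n)" by simp
      have t: "transpose_mat (- 1\<^sub>m (2 * n)) = (- 1\<^sub>m (2 * n) :: 'a mat)" by (intro eq_matI) auto
      have "- 1\<^sub>m (2 * n) * ?G = - ?G"
        using left_mult_one_mat[OF G] uminus_mult_left_mat[of "1\<^sub>m (2 * n)" ?G] carrier_matD[OF G] by simp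
      moreover have "- ?G * - 1\<^sub>m (2 * n) = - (- ?G)"
        using right_mult_one_mat[OF uminus_carrier_mat[OF G]]
          uminus_mult_right_mat[of "- ?G" "1\<^sub>m (2 * n)"] carrier_matD[OF G] by simp
      ultimately show ?thesis unfolding Sp_iff t by (auto intro!: eq_matI)
    qed
    ultimately show "P \<in> carrier (Sp n)" unfolding set_mult_def \<Omega>_def by auto
  qed
  ultimately show ?thesis using cls by blast
qed

section \<open>Quotients of two conjugates of a companion matrix\<close>

text \<open>For Y = Z C Z^-1 the pencil equation reads A Y = X. The search for a factorisation of A
  thus becomes the search for polynomials of prescribed degrees, together with a matrix X known to
  be similar to C.\<close>

lemma good_pencil:
  fixes A :: "'a :: field mat"
  assumes q: "monic q" and n: "degree q = n"
    and A: "A \<in> carrier_mat n n" and X: "X \<in> carrier_mat n n" "similar_mat X (companion q)"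
    and deg: "\<And>i. i < n \<Longrightarrow> degree (\<zeta> i) = n - 1 - i" "\<And>i. i < n \<Longrightarrow> \<zeta> i \<noteq> 0"
    and rel: "\<And>j. j < n \<Longrightarrow> \<exists>r. (\<Sum>i<n. Polynomial.smult (A $$ (j, i)) (pCons 0 (\<zeta> i))
        - Polynomial.smult (X $$ (j, i)) (\<zeta> i)) = Polynomial.smult r q"
  shows "good q A"
proof -
  let ?Z = "mat n n (\<lambda>(i, k). coeff (\<zeta> i) (n - 1 - k)) :: 'a mat"
  have C: "companion q \<in> carrier_mat n n" using companion_carrier[of q] n by simp
  have Z: "?Z \<in> carrier_mat n n" by simp
  have e: "A * (?Z * companion q) = X * ?Z"
    by (rule pencil_companion[OF q n A X(1) _ rel]) (use deg in auto)
  obtain Z' where Z': "Z' \<in> carrier_mat n n" "?Z * Z' = 1\<^sub>m n" "Z' * ?Z = 1\<^sub>m n"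
    using det_nonzero_inverse[OF _ det_coeff_mat[OF deg]] by (metis mat_carrier)
  note a = assoc_mult_mat[of _ n n _ n _ n]
  have "A * (?Z * companion q * Z') = A * (?Z * companion q) * Z'" using A Z' C Z by (simp add: a mult_carrier_mat[of _ n n _ n])
  also have "\<dots> = X * (?Z * Z')" unfolding e using X Z' Z by (simp add: a)
  also have "\<dots> = X" using X Z' by simp
  finally have "similar_mat (A * (?Z * companion q * Z')) (companion q)" using X by simp
  moreover have "similar_mat (?Z * companion q * Z') (companion q)"
    by (rule similar_mat_intro[of _ n _ ?Z Z']) (use Z Z' C in auto)
  ultimately show ?thesis unfolding good_def by blast
qed

text \<open>Z_k is meant for index n-1-k. Below the corner A is upper triangular and X essentially
  lowers the index by one, so row j of the pencil, with r = 0, says that x times row j of A applied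
  to the polynomials is Z_(n-j). This recursion yields them all, starting from the last one, which
  is 1.\<close>

fun zpoly :: "'a :: field mat \<Rightarrow> nat \<Rightarrow> nat \<Rightarrow> 'a poly" where
  "zpoly A n 0 = 1"
| "zpoly A n (Suc k) = pCons 0 (\<Sum>l\<in>{..k}. Polynomial.smult (A $$ (n - 1 - k, n - 1 - l)) (zpoly A n l))"

lemma zpoly_props:
  assumes "\<And>k. k < N \<Longrightarrow> A $$ (n - 1 - k, n - 1 - k) \<noteq> 0" "k \<le> N"
  shows "degree (zpoly A n k) = k \<and> coeff (zpoly A n k) k = (\<Prod>j<k. A $$ (n - 1 - j, n - 1 - j))"
  using assms(2)
proof (induction k rule: less_induct)
  case (less k)
  show ?case
  proof (cases k)
    case (Suc m)
    let ?s = "\<Sum>l\<in>{..m}. Polynomial.smult (A $$ (n - 1 - m, n - 1 - l)) (zpoly A n l)"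
    have d: "degree (zpoly A n l) = l" if "l \<le> m" for l using less that Suc by simp
    have c: "coeff ?s m = A $$ (n - 1 - m, n - 1 - m) * coeff (zpoly A n m) m"
    proof -
      have "coeff ?s m = (\<Sum>l\<in>{..m}. A $$ (n - 1 - m, n - 1 - l) * coeff (zpoly A n l) m)" by (simp add: coeff_sum)
      also have "\<dots> = (\<Sum>l\<in>{..m}. if l = m then A $$ (n - 1 - m, n - 1 - m) * coeff (zpoly A n m) m else 0)"
        by (intro sum.cong) (auto simp: d intro!: coeff_eq_0)
      finally show ?thesis by simp
    qed
    also have "coeff (zpoly A n m) m = (\<Prod>j<m. A $$ (n - 1 - j, n - 1 - j))" using less Suc by simp
    finally have c': "coeff ?s m = (\<Prod>j<k. A $$ (n - 1 - j, n - 1 - j))" by (simp add: Suc mult.commute)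
    have "(\<Prod>j<k. A $$ (n - 1 - j, n - 1 - j)) \<noteq> 0" using assms(1) less.prems by auto
    then have nz: "coeff ?s m \<noteq> 0" using c' by simp
    have "degree ?s \<le> m"
      by (rule degree_sum_le) (auto simp: d intro: order.trans[OF degree_smult_le])
    then have "degree ?s = m" using nz le_degree by (metis le_antisym)
    then show ?thesis using c' nz Suc by auto
  qed simp
qed

text \<open>The linear map taking x^k to Z_k, on degrees up to N. The unknown entries of a row of X
  are stored as the coefficients of a polynomial, and the row applied to the Z_k is the value of
  this map.\<close>

definition zcomb :: "(nat \<Rightarrow> 'a :: field poly) \<Rightarrow> nat \<Rightarrow> 'a poly \<Rightarrow> 'a poly" where
  "zcomb Z N F = (\<Sum>k\<le>N. Polynomial.smult (coeff F k) (Z k))"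

lemma zcomb_add: "zcomb Z N (F + G) = zcomb Z N F + zcomb Z N G"
  by (simp add: zcomb_def smult_add_left sum.distrib)

lemma zcomb_diff: "zcomb Z N (F - G) = zcomb Z N F - zcomb Z N G"
  by (simp add: zcomb_def smult_diff_left sum_subtractf)

lemma zcomb_monom: "k \<le> N \<Longrightarrow> zcomb Z N (monom c k) = Polynomial.smult c (Z k)"
proof -
  assume k: "k \<le> N"
  have "zcomb Z N (monom c k) = (\<Sum>j\<le>N. if j = k then Polynomial.smult c (Z k) else 0)"
    unfolding zcomb_def by (intro sum.cong) auto
  then show ?thesis using k by simp
qed

lemma zcomb_degree:
  assumes "\<And>k. k \<le> N \<Longrightarrow> degree (Z k) = k" "degree F \<le> d"
  shows "degree (zcomb Z N F) \<le> d"
  unfolding zcomb_def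
proof (rule degree_sum_le)
  fix k assume "k \<in> {..N}"
  then show "degree (Polynomial.smult (coeff F k) (Z k)) \<le> d"
    using assms by (cases "k \<le> degree F") (auto simp: coeff_eq_0 intro: order.trans[OF degree_smult_le])
qed simp

lemma zcomb_coeff_0:
  assumes "Z 0 = 1" "\<And>k. 1 \<le> k \<Longrightarrow> k \<le> N \<Longrightarrow> coeff (Z k) 0 = 0"
  shows "coeff (zcomb Z N F) 0 = coeff F 0"
proof -
  have "coeff (zcomb Z N F) 0 = (\<Sum>k\<le>N. if k = 0 then coeff F 0 else 0)"
    unfolding zcomb_def coeff_sum by (intro sum.cong) (use assms in auto)
  then show ?thesis by simp
qed

lemma zcomb_id:
  assumes "degree F \<le> N"
  shows "zcomb (monom 1) N F = F"
proof -
  have "zcomb (monom 1) N F = (\<Sum>k\<le>N. monom (coeff F k) k)"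
    by (simp add: zcomb_def smult_monom)
  then show ?thesis using poly_as_sum_of_monoms'[OF assms] by simp
qed

text \<open>\<open>L\<close> is the linear operator through which the unknowns \<Phi> and w enter
  \<open>good_upper_triangular_tail\<close>. A term of degree k in \<Phi> reaches x^(k+2) only
  through the factor - g x; as g is nonzero, the equation is triangular from the top down. At the
  bottom a 2 by 2 system for w and the constant of \<Phi> remains, whose determinant is the quantity
  in \<chi>.\<close>

lemma zcomb_system_solvable:
  fixes Z :: "nat \<Rightarrow> 'a :: field poly"
  assumes N: "1 \<le> N" and deg: "\<And>k. k \<le> N \<Longrightarrow> degree (Z k) = k" and Z0: "Z 0 = 1" and Z1: "Z 1 = [:0, \<rho>:]"
    and c0: "\<And>k. 1 \<le> k \<Longrightarrow> k \<le> N \<Longrightarrow> coeff (Z k) 0 = 0"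
    and g: "g \<noteq> 0" and \<chi>: "e * (\<rho>\<^sup>2 - (e + h) * \<rho> + (e * h - f * g)) \<noteq> 0"
  defines "L \<equiv> \<lambda>\<Phi> w. - Polynomial.smult w [:0, f, e * h - f * g - e * \<rho>:] - [:0, e:] * zcomb Z N \<Phi>
      + [:1, - g:] * zcomb Z N (pCons 0 \<Phi>)"
  assumes "Suc d \<le> N" "degree R \<le> d + 2" "coeff R 0 = 0"
  shows "\<exists>\<Phi> w. degree \<Phi> \<le> d \<and> L \<Phi> w = R"
  using assms(9-)
proof (induction d arbitrary: R)
  case 0
  define r1 r2 where "r1 = coeff R 1" and "r2 = coeff R 2"
  have R: "R = [:0, r1, r2:]"
  proof (rule poly_eqI)
    fix k
    show "coeff R k = coeff [:0, r1, r2:] k"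
      using 0 by (cases k; cases "k - 1"; cases "k - 2") (auto simp: r1_def r2_def numeral_2_eq_2 coeff_pCons intro!: coeff_eq_0 split: nat.splits)
  qed
  \<comment> \<open>Determinant of the two equations for p and w: e times the characteristic
    polynomial of the corner at \<rho>. The values of p and w come from Cramer's rule.\<close>
  define dd where "dd = e * (\<rho>\<^sup>2 - (e + h) * \<rho> + (e * h - f * g))"
  have dd: "dd \<noteq> 0" using \<chi> by (simp add: dd_def)
  let ?D = "e * h - f * g - e * \<rho>"
  define p where "p = (f * r2 - ?D * r1) / dd"
  define w where "w = ((\<rho> - e) * r2 + g * \<rho> * r1) / dd"
  have T0: "zcomb Z N [:p:] = [:p:]" using zcomb_monom[of 0 N Z p] Z0 by (simp add: monom_0)
  have T1: "zcomb Z N (pCons 0 [:p:]) = [:0, p * \<rho>:]"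
    using zcomb_monom[of 1 N Z p] Z1 N by (simp add: monom_Suc monom_0)
  have ddx: "dd = (\<rho> - e) * (e * \<rho> - (e * h - f * g)) - f * g * \<rho>"
    by (simp add: dd_def algebra_simps power2_eq_square)
  have "dd * (p * (\<rho> - e) - w * f) = dd * r1"
  proof -
    have "dd * (p * (\<rho> - e) - w * f) = (dd * p) * (\<rho> - e) - (dd * w) * f" by (simp add: algebra_simps)
    also have "\<dots> = (f * r2 - ?D * r1) * (\<rho> - e) - ((\<rho> - e) * r2 + g * \<rho> * r1) * f" using dd by (simp add: p_def w_def)
    also have "\<dots> = dd * r1" unfolding ddx by (simp add: algebra_simps)
    finally show ?thesis .
  qed
  then have e1: "p * (\<rho> - e) - w * f = r1" using dd by simp
  have "dd * (- w * ?D - g * p * \<rho>) = dd * r2"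
  proof -
    have "dd * (- w * ?D - g * p * \<rho>) = - (dd * w) * ?D - g * (dd * p) * \<rho>" by (simp add: algebra_simps)
    also have "\<dots> = - ((\<rho> - e) * r2 + g * \<rho> * r1) * ?D - g * (f * r2 - ?D * r1) * \<rho>" using dd by (simp add: p_def w_def)
    also have "\<dots> = dd * r2" unfolding ddx by (simp add: algebra_simps)
    finally show ?thesis .
  qed
  then have e2: "- w * ?D - g * p * \<rho> = r2" using dd by simp
  have "L [:p:] w = [:0, p * (\<rho> - e) - w * f, - w * ?D - g * p * \<rho>:]"
  proof (rule poly_eqI)
    fix k
    have k: "k = 0 \<or> k = 1 \<or> k = 2 \<or> (\<exists>j. k = Suc (Suc (Suc j)))" by presburger
    have t: "[:1, - g:] * [:0, p * \<rho>:] = [:0, p * \<rho>, - g * (p * \<rho>):]" by simp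
    show "coeff (L [:p:] w) k = coeff [:0, p * (\<rho> - e) - w * f, - w * ?D - g * p * \<rho>:] k"
      unfolding L_def T0 T1 t using k by (auto simp: numeral_2_eq_2 right_diff_distrib)
  qed
  then have "L [:p:] w = R" unfolding e1 e2 R .
  then show ?case by (intro exI[of _ "[:p:]"] exI[of _ w]) simp
next
  case (Suc d)
  let ?l = "coeff (Z (d + 2)) (d + 2)"
  have dz: "degree (Z (d + 2)) = d + 2" "degree (Z (d + 1)) = d + 1" using deg Suc.prems by auto
  then have l: "?l \<noteq> 0" by (metis leading_coeff_0_iff degree_0 add_is_0 zero_neq_numeral)
  \<comment> \<open>Chosen to cancel the coefficient of x^(d+3), the top degree allowed for
    \<open>R\<close>; the rest falls under the induction hypothesis.\<close>
  define \<kappa> where "\<kappa> = - coeff R (d + 3) / (g * ?l)"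
  let ?M = "monom \<kappa> (Suc d)"
  have TM: "zcomb Z N ?M = Polynomial.smult \<kappa> (Z (d + 1))" using Suc.prems by (simp add: zcomb_monom)
  have TM': "zcomb Z N (pCons 0 ?M) = Polynomial.smult \<kappa> (Z (d + 2))"
    using Suc.prems zcomb_monom[of "Suc (Suc d)" N Z \<kappa>] by (simp add: monom_Suc)
  let ?S = "L ?M 0"
  have S: "?S = - (pCons 0 (Polynomial.smult (e * \<kappa>) (Z (d + 1)))) + Polynomial.smult \<kappa> (Z (d + 2))
      - pCons 0 (Polynomial.smult (g * \<kappa>) (Z (d + 2)))"
    unfolding L_def TM TM'
    by (rule poly_eqI) (simp add: coeff_pCons algebra_simps split: nat.split)
  let ?R = "R - ?S"
  have "coeff ?S (d + 3) = - g * \<kappa> * ?l"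
  proof -
    have z: "coeff (Z (d + 1)) (d + 2) = 0" "coeff (Z (d + 2)) (Suc (d + 2)) = 0" using dz by (auto intro!: coeff_eq_0)
    have d3: "d + 3 = Suc (d + 2)" by simp
    show ?thesis unfolding S d3 by (simp only: coeff_diff coeff_add coeff_minus coeff_pCons_Suc coeff_smult z) simp
  qed
  then have top: "coeff ?R (d + 3) = 0" using g l by (simp add: \<kappa>_def)
  have "degree ?S \<le> d + 3"
    unfolding S using dz by (intro degree_diff_le degree_add_le) (auto intro: order.trans[OF degree_pCons_le] order.trans[OF degree_smult_le])
  then have "degree ?R \<le> d + 3" using Suc.prems by (intro degree_diff_le) auto
  then have dR: "degree ?R \<le> d + 2"
    using top by (metis add_Suc_right degree_0 eval_nat_numeral(3) le_SucE leading_coeff_0_iff zero_le)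
  have "coeff ?S 0 = 0" unfolding S using c0[of "d + 2"] Suc.prems by simp
  then have "coeff ?R 0 = 0" using Suc.prems by simp
  then obtain \<Phi> w where \<Phi>: "degree \<Phi> \<le> d" "L \<Phi> w = ?R" using Suc.IH[OF _ dR] Suc.prems by auto
  have "L (\<Phi> + ?M) w = L \<Phi> w + ?S"
  proof -
    have "pCons 0 (\<Phi> + ?M) = pCons 0 \<Phi> + pCons 0 ?M" by simp
    then show ?thesis unfolding L_def by (simp only: zcomb_add) (simp add: algebra_simps)
  qed
  moreover have "degree (\<Phi> + ?M) \<le> Suc d"
    using \<Phi> by (intro degree_add_le) (auto intro: degree_monom_le)
  ultimately show ?case using \<Phi> by (intro exI[of _ "\<Phi> + ?M"] exI[of _ w]) simp
qed

text \<open>An ansatz for X. Rows 0 and 1 hold the coefficients of unknown polynomials c and a, the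
  later rows lower the index by one. The parameter w stems from taking \<zeta>_1 = Z_(n-2) - w: the
  extra terms in the last column, where \<zeta>_(n-1) = 1, turn combinations of the Z_k into
  combinations of the \<zeta>_i.\<close>

definition pencil_mat :: "nat \<Rightarrow> 'a :: field \<Rightarrow> 'a poly \<Rightarrow> 'a poly \<Rightarrow> 'a mat" where
  "pencil_mat n w a c = mat n n (\<lambda>(j, i).
    if j = 0 then (if i = 0 then 0 else coeff c (n - 1 - i) + (if i = n - 1 then w * coeff c (n - 2) else 0))
    else if j = 1 then (if i = 0 then 1 else coeff a (n - 1 - i) + (if i = n - 1 then w * coeff a (n - 2) else 0))
    else if j = 2 then (if i = 1 then 1 else if i = n - 1 then w else 0)
    else if i = j - 1 then 1 else 0)"

lemma sum_split_two: "2 \<le> n \<Longrightarrow> (\<Sum>i<n. f i) = f 0 + f (1::nat) + (\<Sum>i=2..<n. f i :: 'b :: comm_monoid_add)"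
proof -
  assume "2 \<le> n"
  then have "{..<n} = insert 0 (insert 1 {2..<n})" by auto
  then show ?thesis by (simp add: add.assoc)
qed

lemma pencil_mat_row_sum:
  fixes F :: "'a :: field poly"
  assumes n: "3 \<le> n" and Z0: "Z 0 = 1" and \<zeta>: "\<And>i. 2 \<le> i \<Longrightarrow> i < n \<Longrightarrow> \<zeta> i = Z (n - 1 - i)"
    and \<zeta>1: "\<zeta> 1 = Z (n - 2) - [:w:]"
  shows "(\<Sum>i=1..<n. Polynomial.smult (coeff F (n - 1 - i) + (if i = n - 1 then w * coeff F (n - 2) else 0)) (\<zeta> i))
    = zcomb Z (n - 2) F"
proof -
  let ?g = "\<lambda>i. Polynomial.smult (coeff F (n - 1 - i)) (Z (n - 1 - i))"
  have "(\<Sum>i=1..<n. Polynomial.smult (coeff F (n - 1 - i) + (if i = n - 1 then w * coeff F (n - 2) else 0)) (\<zeta> i))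
    = (\<Sum>i=1..<n. ?g i + (if i = 1 then - [:coeff F (n - 2) * w:] else 0) + (if i = n - 1 then [:w * coeff F (n - 2):] else 0))"
  proof (rule sum.cong[OF refl])
    fix i assume i: "i \<in> {1..<n}"
    consider "i = 1" | "i = n - 1" "i \<noteq> 1" "2 \<le> i" | "i \<noteq> 1" "i \<noteq> n - 1" "2 \<le> i" using i n by fastforce
    then show "Polynomial.smult (coeff F (n - 1 - i) + (if i = n - 1 then w * coeff F (n - 2) else 0)) (\<zeta> i)
      = ?g i + (if i = 1 then - [:coeff F (n - 2) * w:] else 0) + (if i = n - 1 then [:w * coeff F (n - 2):] else 0)"
    proof cases
      case 1
      have "n - 1 - 1 = n - 2" "n - 1 \<noteq> 1" using n by auto
      then show ?thesis using 1 \<zeta>1 by (simp add: smult_diff_right)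
    next
      case 2
      then have "n - 1 - i = 0" "\<zeta> i = Z (n - 1 - i)" using i \<zeta> by auto
      then show ?thesis using 2 Z0 by (simp add: smult_add_left)
    next
      case 3
      then show ?thesis using i \<zeta> by simp
    qed
  qed
  also have "\<dots> = (\<Sum>i=1..<n. ?g i)"
    using n by (simp add: sum.distrib mult.commute)
  also have "\<dots> = zcomb Z (n - 2) F"
    unfolding zcomb_def by (rule sum.reindex_bij_witness[of _ "\<lambda>k. n - 1 - k" "\<lambda>i. n - 1 - i"]) (use n in auto)
  finally show ?thesis .
qed

lemma pencil_mat_rows:
  fixes a c :: "'a :: field poly"
  assumes n: "3 \<le> n" and Z0: "Z 0 = 1" and \<zeta>: "\<And>i. 2 \<le> i \<Longrightarrow> i < n \<Longrightarrow> \<zeta> i = Z (n - 1 - i)"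
    and \<zeta>1: "\<zeta> 1 = Z (n - 2) - [:w:]"
  shows "(\<Sum>i<n. Polynomial.smult (pencil_mat n w a c $$ (0, i)) (\<zeta> i)) = zcomb Z (n - 2) c"
    "(\<Sum>i<n. Polynomial.smult (pencil_mat n w a c $$ (1, i)) (\<zeta> i)) = \<zeta> 0 + zcomb Z (n - 2) a"
    "(\<Sum>i<n. Polynomial.smult (pencil_mat n w a c $$ (2, i)) (\<zeta> i)) = Z (n - 2)"
    "3 \<le> j \<Longrightarrow> j < n \<Longrightarrow> (\<Sum>i<n. Polynomial.smult (pencil_mat n w a c $$ (j, i)) (\<zeta> i)) = Z (n - j)"
proof -
  have s: "(\<Sum>i<n. f i) = f 0 + (\<Sum>i=1..<n. f i)" for f :: "nat \<Rightarrow> 'a poly"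
  proof -
    have "{..<n} = insert 0 {1..<n}" using n by auto
    then show ?thesis by simp
  qed
  have r: "(\<Sum>i=1..<n. Polynomial.smult (coeff F (n - 1 - i) + (if i = n - 1 then w * coeff F (n - 2) else 0)) (\<zeta> i))
    = zcomb Z (n - 2) F" for F
    by (rule pencil_mat_row_sum) (use assms in auto)
  show "(\<Sum>i<n. Polynomial.smult (pencil_mat n w a c $$ (0, i)) (\<zeta> i)) = zcomb Z (n - 2) c"
  proof -
    have "(\<Sum>i<n. Polynomial.smult (pencil_mat n w a c $$ (0, i)) (\<zeta> i))
      = (\<Sum>i=1..<n. Polynomial.smult (coeff c (n - 1 - i) + (if i = n - 1 then w * coeff c (n - 2) else 0)) (\<zeta> i))"
      unfolding s using n by (simp add: pencil_mat_def)
    then show ?thesis by (simp only: r)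
  qed
  show "(\<Sum>i<n. Polynomial.smult (pencil_mat n w a c $$ (1, i)) (\<zeta> i)) = \<zeta> 0 + zcomb Z (n - 2) a"
  proof -
    have "(\<Sum>i<n. Polynomial.smult (pencil_mat n w a c $$ (1, i)) (\<zeta> i))
      = \<zeta> 0 + (\<Sum>i=1..<n. Polynomial.smult (coeff a (n - 1 - i) + (if i = n - 1 then w * coeff a (n - 2) else 0)) (\<zeta> i))"
      unfolding s using n by (simp add: pencil_mat_def)
    then show ?thesis by (simp only: r)
  qed
  have "(\<Sum>i<n. Polynomial.smult (pencil_mat n w a c $$ (2, i)) (\<zeta> i))
    = (\<Sum>i<n. (if i = 1 then \<zeta> 1 else 0) + (if i = n - 1 then Polynomial.smult w (\<zeta> (n - 1)) else 0))"
    using n by (intro sum.cong) (auto simp: pencil_mat_def)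
  also have "\<dots> = \<zeta> 1 + Polynomial.smult w (\<zeta> (n - 1))" using n by (simp add: sum.distrib)
  also have "\<zeta> (n - 1) = 1" using \<zeta>[of "n - 1"] n Z0 by simp
  finally show "(\<Sum>i<n. Polynomial.smult (pencil_mat n w a c $$ (2, i)) (\<zeta> i)) = Z (n - 2)"
    using \<zeta>1 by (simp add: one_pCons)
  assume j: "3 \<le> j" "j < n"
  have "(\<Sum>i<n. Polynomial.smult (pencil_mat n w a c $$ (j, i)) (\<zeta> i)) = (\<Sum>i<n. if i = j - 1 then \<zeta> (j - 1) else 0)"
    using j by (intro sum.cong) (auto simp: pencil_mat_def)
  also have "\<dots> = \<zeta> (j - 1)" using j by simp
  also have "\<dots> = Z (n - j)" using \<zeta>[of "j - 1"] j by simp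
  finally show "(\<Sum>i<n. Polynomial.smult (pencil_mat n w a c $$ (j, i)) (\<zeta> i)) = Z (n - j)" .
qed

lemma degree_diff_eq_left: "degree q < degree p \<Longrightarrow> degree (p - q) = degree (p :: 'a :: field poly)"
  using degree_add_eq_left[of "- q" p] by simp

text \<open>The row formulas hold for every sequence with Z_0 = 1. For Z_k = x^k they show the
  matrix to be multiplication by x modulo x^n - w x^2 - x a - c, so prescribing q is a linear
  condition on w, a and c.\<close>

lemma pencil_mat_similar_companion:
  fixes q :: "'a :: field poly"
  assumes q: "monic q" and deg: "degree q = n" and n: "3 \<le> n"
    and a: "degree a \<le> n - 2" and c: "degree c \<le> n - 2"
    and e: "q = monom 1 n - Polynomial.smult w (monom 1 2) - pCons 0 a - c"
  shows "similar_mat (pencil_mat n w a c) (companion q)"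
proof -
  let ?X = "pencil_mat n w a c"
  define \<zeta> where "\<zeta> i = (if i = 0 then pCons 0 (monom 1 (n - 2) - [:w:]) - a else if i = 1 then monom 1 (n - 2) - [:w:] else monom 1 (n - 1 - i))" for i
  note rows = pencil_mat_rows[where Z = "monom 1" and \<zeta> = \<zeta> and w = w and a = a and c = c, OF n]
  have m0: "monom 1 0 = (1 :: 'a poly)" by simp
  have rows: "(\<Sum>i<n. Polynomial.smult (?X $$ (0, i)) (\<zeta> i)) = c"
    "(\<Sum>i<n. Polynomial.smult (?X $$ (1, i)) (\<zeta> i)) = \<zeta> 0 + a"
    "(\<Sum>i<n. Polynomial.smult (?X $$ (2, i)) (\<zeta> i)) = monom 1 (n - 2)"
    "\<And>j. 3 \<le> j \<Longrightarrow> j < n \<Longrightarrow> (\<Sum>i<n. Polynomial.smult (?X $$ (j, i)) (\<zeta> i)) = monom 1 (n - j)"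
    by (subst rows; (simp add: \<zeta>_def m0 zcomb_id[OF c] zcomb_id[OF a])?)+
  have d1: "degree (monom 1 (n - 2) - [:w:]) = n - 2"
    using n by (subst degree_diff_eq_left) (auto simp: degree_monom_eq)
  have d2: "degree (pCons 0 (monom 1 (n - 2) - [:w:])) = n - 1"
    using n d1 by (subst degree_pCons_eq) auto
  have d0: "degree (\<zeta> 0) = n - 1"
    unfolding \<zeta>_def using n a d2 by (simp add: degree_diff_eq_left)
  have degs: "degree (\<zeta> i) = n - 1 - i" if "i < n" for i
    using d0 d1 that n by (auto simp: \<zeta>_def degree_monom_eq numeral_2_eq_2)
  show ?thesis
  proof (rule similar_companionI[OF q deg, where \<zeta> = \<zeta>])
    show "?X \<in> carrier_mat n n" by (simp add: pencil_mat_def)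
    show "degree (\<zeta> i) = n - 1 - i" if "i < n" for i using degs[OF that] .
    show "\<zeta> i \<noteq> 0" if "i < n" for i
    proof (cases "i = n - 1")
      case True
      then show ?thesis using n by (simp add: \<zeta>_def)
    next
      case False
      then show ?thesis using degs[OF that] that by auto
    qed
    fix j assume j: "j < n"
    consider "j = 0" | "j = 1" | "j = 2" | "3 \<le> j" by linarith
    then show "\<exists>r. pCons 0 (\<zeta> j) - (\<Sum>i<n. Polynomial.smult (?X $$ (j, i)) (\<zeta> i)) = Polynomial.smult r q"
    proof cases
      case 1
      have "pCons 0 (pCons 0 (monom 1 (n - 2))) = (monom 1 n :: 'a poly)"
      proof -
        have "n = Suc (Suc (n - 2))" using n by simp
        then show ?thesis by (metis monom_Suc)
      qed
      moreover have "Polynomial.smult w (monom 1 2) = [:0, 0, w:]" by (simp add: monom_Suc numeral_2_eq_2 monom_0)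
      moreover have "pCons 0 (\<zeta> 0) = pCons 0 (pCons 0 (monom 1 (n - 2))) - [:0, 0, w:] - pCons 0 a"
        by (simp add: \<zeta>_def)
      ultimately have "pCons 0 (\<zeta> 0) - c = q" unfolding e by simp
      then show ?thesis using 1 rows(1) by (intro exI[of _ 1]) simp
    next
      case 2
      then show ?thesis using rows(2) by (intro exI[of _ 0]) (simp add: \<zeta>_def)
    next
      case 3
      have "pCons 0 (monom 1 (n - 1 - 2)) = (monom 1 (n - 2) :: 'a poly)"
      proof -
        have "n - 2 = Suc (n - 1 - 2)" using n by simp
        then show ?thesis by (metis monom_Suc)
      qed
      then show ?thesis using 3 rows(3) by (intro exI[of _ 0]) (simp add: \<zeta>_def)
    next
      case 4
      have "pCons 0 (monom 1 (n - 1 - j)) = (monom 1 (n - j) :: 'a poly)"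
      proof -
        have "n - j = Suc (n - 1 - j)" using j by simp
        then show ?thesis by (metis monom_Suc)
      qed
      then show ?thesis using 4 rows(4)[OF 4 j] by (intro exI[of _ 0]) (simp add: \<zeta>_def)
    qed
  qed
qed

text \<open>Rows 0 and 1 of the pencil, with the multipliers 1 and g/e of q, are two equations for
  \<zeta>_0. Eliminating it leaves the single condition e x r2 + (1 - g x) r1 = q, linear in the
  remaining unknowns. The determinant condition makes its top coefficient right, and
  \<open>zcomb_system_solvable\<close> settles the rest.\<close>

lemma good_upper_triangular_tail:
  fixes A :: "'a :: field mat"
  assumes q: "monic q" and deg: "degree q = n" and n: "3 \<le> n" and A: "A \<in> carrier_mat n n"
    and tri: "\<And>i j. 2 \<le> i \<Longrightarrow> i < n \<Longrightarrow> j < i \<Longrightarrow> A $$ (i, j) = 0"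
    and diag: "\<And>i. 2 \<le> i \<Longrightarrow> i < n \<Longrightarrow> A $$ (i, i) \<noteq> 0"
    and e: "A $$ (0, 0) = e" "e \<noteq> 0" and g: "A $$ (1, 0) = g" "g \<noteq> 0"
    and f: "A $$ (0, 1) = f" and h: "A $$ (1, 1) = h"
    and det: "(e * h - f * g) * (\<Prod>i=2..<n. A $$ (i, i)) = 1"
    and \<rho>: "A $$ (n - 1, n - 1) = \<rho>" and \<chi>: "\<rho>\<^sup>2 - (e + h) * \<rho> + (e * h - f * g) \<noteq> 0"
  shows "good q A"
proof -
  \<comment> \<open>Ring identities in variables: the splitting of the condition into a known defect
    and a part linear in the unknowns, then the two computations that recover rows 0 and 1 from the
    eliminated form.\<close>
  have ids: "e * x * (x * (h * (u - w) + \<eta>1) - (ta + tp - w * (\<rho> * x)))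
      + (1 - g * x) * (x * (f * (u - w) + \<eta>0) - (tc - tx)) - q
    = e * (x * (x * (h * u + \<eta>1) - ta)) + (x * (f * u + \<eta>0) - tc) - g * (x * (x * (f * u + \<eta>0) - tc)) - q
      + (- (w * (f * x + (e * h - f * g - e * \<rho>) * x * x)) - e * x * tp + (1 - g * x) * tx)"
    "e * z = e * r2 - g * r1 \<Longrightarrow> e * x * r2 + (1 - g * x) * r1 = q \<Longrightarrow> x * (e * z) + r1 = q"
    "g = k * e \<Longrightarrow> z = r2 - k * r1 \<Longrightarrow> x * (g * z) + r2 - z = k * (x * (e * z) + r1)"
    for e f g h x u w \<rho> \<eta>0 \<eta>1 ta tp tc tx q z r1 r2 k :: "'a poly"
  proof goal_cases
    case 2
    have "x * (e * z) + r1 = x * (e * r2 - g * r1) + r1" using 2(1) by simp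
    also have "\<dots> = q" unfolding 2(2)[symmetric] by (simp add: algebra_simps)
    finally show ?case .
  qed (simp_all add: algebra_simps)
  define N where "N = n - 2"
  define Z where "Z = zpoly A n"
  have nN: "n = N + 2" "1 \<le> N" using n by (auto simp: N_def)
  have nz: "A $$ (n - 1 - k, n - 1 - k) \<noteq> 0" if "k < N" for k using that nN by (intro diag) auto
  have dZ: "degree (Z k) = k" if "k \<le> N" for k using zpoly_props[of N A n k] nz that by (simp add: Z_def)
  have Z0: "Z 0 = 1" by (simp add: Z_def)
  have Z1: "Z 1 = [:0, \<rho>:]" using \<rho> by (simp add: Z_def)
  have Zc: "coeff (Z k) 0 = 0" if "1 \<le> k" for k using that by (cases k) (auto simp: Z_def)
  define u where "u = Z N"
  have lu: "coeff u N = (\<Prod>i=2..<n. A $$ (i, i))"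
  proof -
    have "coeff u N = (\<Prod>j<N. A $$ (n - 1 - j, n - 1 - j))"
      using zpoly_props[of N A n N] nz by (simp add: u_def Z_def)
    also have "\<dots> = (\<Prod>i=2..<n. A $$ (i, i))"
      by (rule prod.reindex_bij_witness[of _ "\<lambda>i. n - 1 - i" "\<lambda>i. n - 1 - i"]) (use nN in auto)
    finally show ?thesis .
  qed
  define \<eta> where "\<eta> r = (\<Sum>i=2..<n. Polynomial.smult (A $$ (r, i)) (Z (n - 1 - i)))" for r
  have d\<eta>: "degree (\<eta> r) \<le> N - 1" for r
    unfolding \<eta>_def using nN by (intro degree_sum_le) (auto intro!: order.trans[OF degree_smult_le] simp: dZ)
  \<comment> \<open>A first solution of x^n - x a - c = q with degrees at most n-2:
    \<open>a0\<close> absorbs the coefficient of x^(n-1), everything lower goes into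
    \<open>c0\<close>.\<close>
  define a0 where "a0 = monom (- coeff q (n - 1)) N"
  define c0 where "c0 = monom 1 n - pCons 0 a0 - q"
  have qn: "coeff q n = 1" using q deg by simp
  have da0: "degree a0 \<le> N" by (simp add: a0_def degree_monom_le)
  have dc0: "degree c0 \<le> N"
  proof (rule degree_le, intro allI impI)
    fix k assume "N < k"
    then consider "k = n - 1" | "k = n" | "n < k" using nN by linarith
    then show "coeff c0 k = 0"
      using qn deg nN by cases (auto simp: c0_def a0_def coeff_eq_0 simp flip: monom_Suc)
  qed
  have c00: "coeff c0 0 = - coeff q 0" using nN by (simp add: c0_def)
  define x where "x = [:0, 1 :: 'a:]"
  have xp: "pCons 0 p = x * p" for p by (simp add: x_def)
  let ?c = "\<lambda>c. [:c :: 'a:]"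
  define \<Theta> where "\<Theta> = zcomb Z N"
  \<comment> \<open>The defect of the eliminated condition for w = 0, a = a0 and c = c0.\<close>
  define R where "R = ?c e * (x * (x * (?c h * u + \<eta> 1) - \<Theta> a0))
    + (x * (?c f * u + \<eta> 0) - \<Theta> c0) - ?c g * (x * (x * (?c f * u + \<eta> 0) - \<Theta> c0)) - q"
  have du: "degree u = N" by (simp add: u_def dZ)
  have d\<Theta>: "degree (\<Theta> F) \<le> N" if "degree F \<le> N" for F unfolding \<Theta>_def by (rule zcomb_degree[OF dZ that])
  have cz: "coeff p k = 0" if "degree p \<le> N - 1" "N \<le> k" for p :: "'a poly" and k
    using that nN by (intro coeff_eq_0) linarith
  have cz': "coeff p k = 0" if "degree p \<le> N" "N < k" for p :: "'a poly" and k
    using that nN by (intro coeff_eq_0) linarith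
  have dR: "degree R \<le> (N - 1) + 2"
  proof (rule degree_le, intro allI impI)
    fix k assume k: "N - 1 + 2 < k"
    then obtain j where j: "k = Suc (Suc j)" "N \<le> j" using nN by (metis One_nat_def Suc_le_D Suc_le_lessD add_2_eq_Suc' diff_Suc_1 le_add_diff_inverse2 less_Suc_eq_le less_imp_Suc_add not_less_eq_eq add_leD2 diff_add_inverse2 le_trans less_imp_le_nat one_add_one plus_1_eq_Suc)
    \<comment> \<open>Above x^(n-1) only the terms with u and q survive. At x^n, where j = N, they
      cancel: the leading coefficient of u is the product of the diagonal entries below the corner,
      and the determinant of A is 1.\<close>
    have "coeff R k = e * (h * coeff u j) - g * (f * coeff u j) - coeff q k"
      unfolding R_def j using j nN
      by (simp add: x_def cz[OF d\<eta>] cz'[OF d\<Theta>[OF da0]] cz'[OF d\<Theta>[OF dc0]] cz'[of u] du)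
    also have "\<dots> = 0"
    proof (cases "j = N")
      case True
      then show ?thesis using qn j nN det lu by (simp add: algebra_simps)
    next
      case False
      then show ?thesis using j nN deg cz'[of u j] du by (simp add: coeff_eq_0)
    qed
    finally show "coeff R k = 0" .
  qed
  have \<Theta>0: "coeff (\<Theta> F) 0 = coeff F 0" for F unfolding \<Theta>_def by (rule zcomb_coeff_0) (use Z0 Zc in auto)
  have R0: "coeff R 0 = 0" by (simp add: R_def x_def \<Theta>0 c00)
  have "e * (\<rho>\<^sup>2 - (e + h) * \<rho> + (e * h - f * g)) \<noteq> 0" using \<chi> e by simp
  from zcomb_system_solvable[OF nN(2) dZ Z0 Z1 Zc g(2) this, of "N - 1" "- R"] dR R0 nN
  obtain \<Phi> w where \<Phi>: "degree \<Phi> \<le> N - 1" and L: "- Polynomial.smult w [:0, f, e * h - f * g - e * \<rho>:] - [:0, e:] * zcomb Z N \<Phi>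
      + [:1, - g:] * zcomb Z N (pCons 0 \<Phi>) = - R" by (auto simp: degree_minus)
  \<comment> \<open>Moving x \<Phi> between x a and c, and w x^2 between x a and the w term, leaves
    x^n - w x^2 - x a - c equal to q.\<close>
  define a c where "a = a0 + \<Phi> - [:0, w:]" and "c = c0 - pCons 0 \<Phi>"
  have da: "degree a \<le> N" unfolding a_def using da0 \<Phi> nN by (intro degree_diff_le degree_add_le) auto
  have dc: "degree c \<le> N" unfolding c_def using dc0 \<Phi> nN by (intro degree_diff_le) (auto intro: order.trans[OF degree_pCons_le])
  have \<Theta>a: "\<Theta> a = \<Theta> a0 + \<Theta> \<Phi> - ?c w * (?c \<rho> * x)"
  proof -
    have "[:0, w:] = monom w 1" by (simp add: monom_Suc monom_0)
    then have "\<Theta> [:0, w:] = Polynomial.smult w [:0, \<rho>:]" using zcomb_monom[OF nN(2), of Z w] Z1 by (simp add: \<Theta>_def)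
    also have "\<dots> = ?c w * (?c \<rho> * x)" by (simp add: x_def)
    finally show ?thesis unfolding a_def \<Theta>_def by (simp only: zcomb_add zcomb_diff)
  qed
  have \<Theta>c: "\<Theta> c = \<Theta> c0 - \<Theta> (pCons 0 \<Phi>)" unfolding c_def \<Theta>_def by (simp only: zcomb_diff)
  define r1 r2 where "r1 = x * (?c f * (u - ?c w) + \<eta> 0) - \<Theta> c" and "r2 = x * (?c h * (u - ?c w) + \<eta> 1) - \<Theta> a"
  have key: "?c e * x * r2 + (1 - ?c g * x) * r1 = q"
  proof -
    have L': "- (?c w * (?c f * x + (?c e * ?c h - ?c f * ?c g - ?c e * ?c \<rho>) * x * x)) - ?c e * x * \<Theta> \<Phi>
      + (1 - ?c g * x) * \<Theta> (pCons 0 \<Phi>) = - R"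
    proof -
      have "?c w * (?c f * x + (?c e * ?c h - ?c f * ?c g - ?c e * ?c \<rho>) * x * x) = Polynomial.smult w [:0, f, e * h - f * g - e * \<rho>:]"
        by (simp add: x_def)
      moreover have "?c e * x = [:0, e:]" "1 - ?c g * x = [:1, - g:]" by (simp_all add: x_def one_pCons)
      ultimately show ?thesis using L unfolding \<Theta>_def by simp
    qed
    have "?c e * x * r2 + (1 - ?c g * x) * r1 - q = R + (- (?c w * (?c f * x + (?c e * ?c h - ?c f * ?c g - ?c e * ?c \<rho>) * x * x)) - ?c e * x * \<Theta> \<Phi>
      + (1 - ?c g * x) * \<Theta> (pCons 0 \<Phi>))"
      unfolding r1_def r2_def \<Theta>a \<Theta>c R_def by (rule ids(1))
    then show ?thesis unfolding L' by simp
  qed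
  \<comment> \<open>The value at 0 is the difference of row 1 and g/e times row 0, in which q and x
    \<zeta>_0 cancel.\<close>
  define \<zeta> where "\<zeta> i = (if i = 0 then r2 - ?c (g / e) * r1 else if i = 1 then u - ?c w else Z (n - 1 - i))" for i
  have key2: "x * (?c e * \<zeta> 0) + r1 = q"
  proof -
    have "?c e * ?c (g / e) = ?c g" using e by simp
    then have "?c e * \<zeta> 0 = ?c e * r2 - ?c g * r1" unfolding \<zeta>_def by (simp add: right_diff_distrib mult.assoc[symmetric] del: mult_pCons_left mult_pCons_right)
    then show ?thesis using key by (rule ids(2))
  qed
  have dr1: "degree r1 \<le> n - 1"
  proof -
    have "degree (x * (?c f * (u - ?c w) + \<eta> 0)) \<le> Suc N"
      unfolding xp[symmetric] using du d\<eta>[of 0] nN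
      by (intro order.trans[OF degree_pCons_le]) (auto intro!: degree_add_le degree_diff_le order.trans[OF degree_smult_le])
    then show ?thesis unfolding r1_def using d\<Theta>[OF dc] nN by (intro degree_diff_le) auto
  qed
  \<comment> \<open>From e x \<zeta>_0 = q - r1 with deg r1 < n the degree is exactly n-1, as the
    triangular shape of the coefficient matrix requires.\<close>
  have d0: "degree (\<zeta> 0) = n - 1"
  proof -
    have "x * (?c e * \<zeta> 0) = q - r1" using key2 by (simp add: algebra_simps)
    moreover have "degree (q - r1) = n" using degree_diff_eq_left[of r1 q] deg dr1 n by simp
    ultimately have s: "degree (pCons 0 (Polynomial.smult e (\<zeta> 0))) = n" by (simp add: xp)
    then have "\<zeta> 0 \<noteq> 0" using n by auto
    then show ?thesis using s e by simp
  qed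
  have degs: "degree (\<zeta> i) = n - 1 - i" if "i < n" for i
  proof -
    consider "i = 0" | "i = 1" | "2 \<le> i" by linarith
    then show ?thesis
    proof cases
      case 2
      then show ?thesis using du nN by (simp add: \<zeta>_def degree_diff_eq_left)
    qed (use d0 that nN in \<open>auto simp: \<zeta>_def dZ\<close>)
  qed
  have e': "q = monom 1 n - Polynomial.smult w (monom 1 2) - pCons 0 a - c"
    unfolding a_def c_def c0_def by (simp add: numeral_2_eq_2 monom_Suc monom_0)
  note rows = pencil_mat_rows[where Z = Z and \<zeta> = \<zeta> and w = w and a = a and c = c, OF n Z0]
  have N2: "n - 2 = N" using nN by simp
  have rows: "(\<Sum>i<n. Polynomial.smult (pencil_mat n w a c $$ (0, i)) (\<zeta> i)) = \<Theta> c"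
    "(\<Sum>i<n. Polynomial.smult (pencil_mat n w a c $$ (1, i)) (\<zeta> i)) = \<zeta> 0 + \<Theta> a"
    "(\<Sum>i<n. Polynomial.smult (pencil_mat n w a c $$ (2, i)) (\<zeta> i)) = u"
    "\<And>j. 3 \<le> j \<Longrightarrow> j < n \<Longrightarrow> (\<Sum>i<n. Polynomial.smult (pencil_mat n w a c $$ (j, i)) (\<zeta> i)) = Z (n - j)"
    by (subst rows; (simp add: \<zeta>_def \<Theta>_def u_def N2)?)+
  have lhs: "(\<Sum>i<n. Polynomial.smult (A $$ (j, i)) (pCons 0 (\<zeta> i)))
      = x * (?c (A $$ (j, 0)) * \<zeta> 0 + ?c (A $$ (j, 1)) * (u - ?c w) + \<eta> j)" for j
  proof -
    have "(\<Sum>i<n. Polynomial.smult (A $$ (j, i)) (pCons 0 (\<zeta> i))) = x * (\<Sum>i<n. Polynomial.smult (A $$ (j, i)) (\<zeta> i))"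
      by (simp add: sum_distrib_left x_def)
    also have "(\<Sum>i<n. Polynomial.smult (A $$ (j, i)) (\<zeta> i))
      = Polynomial.smult (A $$ (j, 0)) (\<zeta> 0) + Polynomial.smult (A $$ (j, 1)) (\<zeta> 1) + (\<Sum>i=2..<n. Polynomial.smult (A $$ (j, i)) (\<zeta> i))"
      using n by (intro sum_split_two) simp
    also have "(\<Sum>i=2..<n. Polynomial.smult (A $$ (j, i)) (\<zeta> i)) = \<eta> j"
      unfolding \<eta>_def by (intro sum.cong) (auto simp: \<zeta>_def)
    also have "\<zeta> 1 = u - ?c w" by (simp add: \<zeta>_def)
    finally show ?thesis by simp
  qed
  show ?thesis
  proof (rule good_pencil[OF q deg A, where X = "pencil_mat n w a c" and \<zeta> = \<zeta>])
    show "pencil_mat n w a c \<in> carrier_mat n n" by (simp add: pencil_mat_def)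
    show "similar_mat (pencil_mat n w a c) (companion q)"
      by (rule pencil_mat_similar_companion[OF q deg n _ _ e']) (use da dc N2 in auto)
    show "degree (\<zeta> i) = n - 1 - i" if "i < n" for i by (rule degs[OF that])
    show "\<zeta> i \<noteq> 0" if "i < n" for i
    proof (cases "i = n - 1")
      case True
      then show ?thesis using nN Z0 by (simp add: \<zeta>_def)
    next
      case False
      then show ?thesis using degs[OF that] that by auto
    qed
    fix j assume j: "j < n"
    consider "j = 0" | "j = 1" | "2 \<le> j" by linarith
    then show "\<exists>r. (\<Sum>i<n. Polynomial.smult (A $$ (j, i)) (pCons 0 (\<zeta> i))
        - Polynomial.smult (pencil_mat n w a c $$ (j, i)) (\<zeta> i)) = Polynomial.smult r q"
    proof cases
      case 1
      have "x * (?c e * \<zeta> 0 + ?c f * (u - ?c w) + \<eta> 0) - \<Theta> c = q"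
        using key2 unfolding r1_def by (simp add: distrib_left add_diff_eq add.assoc del: mult_pCons_left mult_pCons_right)
      then show ?thesis unfolding sum_subtractf lhs using 1 rows(1) e f by (intro exI[of _ 1]) simp
    next
      case 2
      have "x * (?c g * \<zeta> 0 + ?c h * (u - ?c w) + \<eta> 1) - (\<zeta> 0 + \<Theta> a) = x * (?c g * \<zeta> 0) + r2 - \<zeta> 0"
        unfolding r2_def by (simp add: distrib_left del: mult_pCons_left mult_pCons_right)
      also have "\<dots> = ?c (g / e) * (x * (?c e * \<zeta> 0) + r1)"
      proof -
        have "?c g = ?c (g / e) * ?c e" using e by simp
        moreover have "\<zeta> 0 = r2 - ?c (g / e) * r1" by (simp add: \<zeta>_def)
        ultimately show ?thesis by (rule ids(3))
      qed
      also have "\<dots> = Polynomial.smult (g / e) q" unfolding key2 by simp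
      finally show ?thesis unfolding sum_subtractf lhs using 2 rows(2) g h by (intro exI[of _ "g / e"]) simp
    next
      case 3
      have "x * \<eta> j = Z (n - j)"
      proof -
        have nj: "n - j = Suc (n - 1 - j)" using j by simp
        have "\<eta> j = (\<Sum>i=j..<n. Polynomial.smult (A $$ (j, i)) (Z (n - 1 - i)))"
          unfolding \<eta>_def using 3 by (intro sum.mono_neutral_right) (auto simp: tri[OF 3 j])
        also have "\<dots> = (\<Sum>l\<in>{..n - 1 - j}. Polynomial.smult (A $$ (j, n - 1 - l)) (Z l))"
          by (rule sum.reindex_bij_witness[of _ "\<lambda>i. n - 1 - i" "\<lambda>i. n - 1 - i"]) (use j in auto)
        finally show ?thesis unfolding nj Z_def using j by (simp add: xp)
      qed
      then have l: "(\<Sum>i<n. Polynomial.smult (A $$ (j, i)) (pCons 0 (\<zeta> i))) = Z (n - j)"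
        unfolding lhs using 3 tri[OF 3 j] by simp
      have "(\<Sum>i<n. Polynomial.smult (pencil_mat n w a c $$ (j, i)) (\<zeta> i)) = Z (n - j)"
        using rows(3) rows(4)[OF _ j] 3 by (cases "j = 2") (auto simp: u_def N2)
      then show ?thesis unfolding sum_subtractf l by (intro exI[of _ 0]) simp
    qed
  qed
qed

text \<open>A change of basis inside the corner makes its first column nonzero in both places. A
  nonscalar 2 by 2 matrix M has a vector u that is not an eigenvector; in the basis u, v = M u - u
  its first column is (1, 1), and by Cayley-Hamilton trace t and determinant d give the second one.
  The rows below the corner are unaffected.\<close>

lemma good_nonscalar_block:
  fixes A :: "'a :: field mat"
  assumes q: "monic q" and deg: "degree q = n" and n: "3 \<le> n" and A: "A \<in> carrier_mat n n"
    and tri: "\<And>i j. 2 \<le> i \<Longrightarrow> i < n \<Longrightarrow> j < i \<Longrightarrow> A $$ (i, j) = 0"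
    and det: "(A $$ (0, 0) * A $$ (1, 1) - A $$ (0, 1) * A $$ (1, 0)) * (\<Prod>i=2..<n. A $$ (i, i)) = 1"
    and ns: "A $$ (0, 1) \<noteq> 0 \<or> A $$ (1, 0) \<noteq> 0 \<or> A $$ (0, 0) \<noteq> A $$ (1, 1)"
    and \<rho>: "A $$ (n - 1, n - 1) = \<rho>" and \<chi>: "\<rho>\<^sup>2 - (A $$ (0, 0) + A $$ (1, 1)) * \<rho>
      + (A $$ (0, 0) * A $$ (1, 1) - A $$ (0, 1) * A $$ (1, 0)) \<noteq> 0"
  shows "good q A"
proof -
  define e f g h where "e = A $$ (0, 0)" "f = A $$ (0, 1)" "g = A $$ (1, 0)" "h = A $$ (1, 1)"
  note efgh = this
  \<comment> \<open>One of (1,0), (0,1) and (1,1) is not an eigenvector; the expression is the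
    determinant of u and M u.\<close>
  obtain u0 u1 where u: "u0 * (g * u0 + h * u1) - u1 * (e * u0 + f * u1) \<noteq> 0"
  proof (cases "g = 0")
    case False
    then show ?thesis by (intro that[of 1 0]) auto
  next
    case g: True
    show ?thesis
    proof (cases "f = 0")
      case False
      then show ?thesis by (intro that[of 0 1]) auto
    next
      case True
      then show ?thesis using g ns by (intro that[of 1 1]) (auto simp: efgh)
    qed
  qed
  define v0 v1 where "v0 = e * u0 + f * u1 - u0" and "v1 = g * u0 + h * u1 - u1"
  define D where "D = u0 * v1 - u1 * v0"
  have D: "D \<noteq> 0" using u by (simp add: D_def v0_def v1_def algebra_simps)
  define t d where "t = e + h" and "d = e * h - f * g"
  define B where "B = mat n n (\<lambda>(i, j). if i < 2 \<and> j < 2 then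
      (if i = 0 then if j = 0 then u0 else v0 else if j = 0 then u1 else v1) else if i = j then 1 else 0)"
  define B' where "B' = mat n n (\<lambda>(i, j). if i < 2 \<and> j < 2 then
      (if i = 0 then if j = 0 then v1 / D else - v0 / D else if j = 0 then - u1 / D else u0 / D) else if i = j then 1 else 0)"
  define A' where "A' = mat n n (\<lambda>(i, j). if i < 2 then
      if j < 2 then (if j = 0 then 1 else if i = 0 then t - 1 - d else t - 1)
      else if i = 0 then (v1 * A $$ (0, j) - v0 * A $$ (1, j)) / D else (u0 * A $$ (1, j) - u1 * A $$ (0, j)) / D
      else A $$ (i, j))"
  have c: "B \<in> carrier_mat n n" "B' \<in> carrier_mat n n" "A' \<in> carrier_mat n n" by (auto simp: B_def B'_def A'_def)
  have cases2: "i = 0 \<or> i = 1 \<or> 2 \<le> i" for i :: nat by linarith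
  have n': "0 < n" "1 < n" "Suc 0 < n" using n by auto
  have delta: "(\<Sum>k=2..<n. F k * (if k = j then 1 else 0)) = (if 2 \<le> j \<and> j < n then F j else 0)"
    "(\<Sum>k=2..<n. (if j = k then 1 else 0) * F k) = (if 2 \<le> j \<and> j < n then F j else 0)" for F :: "nat \<Rightarrow> 'a" and j
  proof -
    have "(\<Sum>k=2..<n. F k * (if k = j then 1 else 0)) = (\<Sum>k=2..<n. if k = j then F j else 0)" by (intro sum.cong) auto
    then show "(\<Sum>k=2..<n. F k * (if k = j then 1 else 0)) = (if 2 \<le> j \<and> j < n then F j else 0)" by simp
    have "(\<Sum>k=2..<n. (if j = k then 1 else 0) * F k) = (\<Sum>k=2..<n. if j = k then F j else 0)" by (intro sum.cong) auto
    then show "(\<Sum>k=2..<n. (if j = k then 1 else 0) * F k) = (if 2 \<le> j \<and> j < n then F j else 0)" by simp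
  qed
  have left: "(\<Sum>k<n. M $$ (i, k) * B $$ (k, j)) = (if j = 0 then M $$ (i, 0) * u0 + M $$ (i, 1) * u1
      else if j = 1 then M $$ (i, 0) * v0 + M $$ (i, 1) * v1 else M $$ (i, j))" if "j < n" for M i j
  proof -
    have "(\<Sum>k=2..<n. M $$ (i, k) * B $$ (k, j)) = (\<Sum>k=2..<n. M $$ (i, k) * (if k = j then 1 else 0))"
      using that by (intro sum.cong) (auto simp: B_def)
    also have "\<dots> = (if 2 \<le> j \<and> j < n then M $$ (i, j) else 0)" by (rule delta)
    finally show ?thesis using cases2[of j] that n' by (subst sum_split_two) (auto simp: B_def)
  qed
  have right: "(\<Sum>k<n. B $$ (i, k) * M $$ (k, j)) = (if i = 0 then u0 * M $$ (0, j) + v0 * M $$ (1, j)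
      else if i = 1 then u1 * M $$ (0, j) + v1 * M $$ (1, j) else M $$ (i, j))" if "i < n" for M i j
  proof -
    have "(\<Sum>k=2..<n. B $$ (i, k) * M $$ (k, j)) = (\<Sum>k=2..<n. (if i = k then 1 else 0) * M $$ (k, j))"
      using that by (intro sum.cong) (auto simp: B_def)
    also have "\<dots> = (if 2 \<le> i \<and> i < n then M $$ (i, j) else 0)" by (rule delta)
    finally show ?thesis using cases2[of i] that n' by (subst sum_split_two) (auto simp: B_def)
  qed
  have dd: "u0 * v1 / D - u1 * v0 / D = 1" using D by (simp add: D_def flip: diff_divide_distrib)
  have BB': "B * B' = 1\<^sub>m n"
  proof (rule eq_matI)
    fix i j assume "i < dim_row (1\<^sub>m n :: 'a mat)" "j < dim_col (1\<^sub>m n :: 'a mat)"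
    then have ij: "i < n" "j < n" by auto
    have "(B * B') $$ (i, j) = (\<Sum>k<n. B $$ (i, k) * B' $$ (k, j))" using ij c by (intro mult_mat_index)
    also have "\<dots> = 1\<^sub>m n $$ (i, j)" unfolding right[OF ij(1)]
      using cases2[of i] cases2[of j] ij n' dd
      by (elim disjE) (simp_all add: B'_def algebra_simps)
    finally show "(B * B') $$ (i, j) = 1\<^sub>m n $$ (i, j)" .
  qed (use c in auto)
  have AB: "A * B = B * A'"
  proof (rule eq_matI)
    fix i j assume "i < dim_row (B * A')" "j < dim_col (B * A')"
    then have ij: "i < n" "j < n" using c by auto
    have "(A * B) $$ (i, j) = (\<Sum>k<n. A $$ (i, k) * B $$ (k, j))" using ij c A by (intro mult_mat_index)
    also have "\<dots> = (\<Sum>k<n. B $$ (i, k) * A' $$ (k, j))" unfolding right[OF ij(1)] left[OF ij(2)]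
    proof -
      consider "i < 2" "j = 0" | "i < 2" "j = 1" | "i < 2" "2 \<le> j" | "2 \<le> i" "j < 2" | "2 \<le> i" "2 \<le> j" by linarith
      then show "(if j = 0 then A $$ (i, 0) * u0 + A $$ (i, 1) * u1
          else if j = 1 then A $$ (i, 0) * v0 + A $$ (i, 1) * v1 else A $$ (i, j))
        = (if i = 0 then u0 * A' $$ (0, j) + v0 * A' $$ (1, j)
          else if i = 1 then u1 * A' $$ (0, j) + v1 * A' $$ (1, j) else A' $$ (i, j))"
      proof cases
        case 1
        then have "i = 0 \<or> i = 1" by linarith
        then show ?thesis using 1 n' by (elim disjE) (simp_all add: A'_def v0_def v1_def efgh algebra_simps)
      next
        case 2
        then have "i = 0 \<or> i = 1" by linarith
        then show ?thesis using 2 n' by (elim disjE) (simp_all add: A'_def v0_def v1_def t_def d_def efgh algebra_simps)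
      next
        case 3
        have "u0 * ((v1 * a - v0 * b) / D) + v0 * ((u0 * b - u1 * a) / D) = a"
          "u1 * ((v1 * a - v0 * b) / D) + v1 * ((u0 * b - u1 * a) / D) = b" for a b
        proof -
          have "u0 * ((v1 * a - v0 * b) / D) + v0 * ((u0 * b - u1 * a) / D) = a * D / D"
            by (simp add: D_def add_divide_distrib[symmetric] algebra_simps)
          then show "u0 * ((v1 * a - v0 * b) / D) + v0 * ((u0 * b - u1 * a) / D) = a" using D by simp
          have "u1 * ((v1 * a - v0 * b) / D) + v1 * ((u0 * b - u1 * a) / D) = b * D / D"
            by (simp add: D_def add_divide_distrib[symmetric] algebra_simps)
          then show "u1 * ((v1 * a - v0 * b) / D) + v1 * ((u0 * b - u1 * a) / D) = b" using D by simp
        qed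
        moreover have "i = 0 \<or> i = 1" using 3 by linarith
        ultimately show ?thesis using 3 n' ij by (auto simp: A'_def)
      next
        case 4
        then show ?thesis using n' ij by (auto simp: A'_def tri)
      next
        case 5
        then show ?thesis using n' ij by (auto simp: A'_def)
      qed
    qed
    also have "\<dots> = (B * A') $$ (i, j)" using ij c by (intro mult_mat_index[symmetric])
    finally show "(A * B) $$ (i, j) = (B * A') $$ (i, j)" .
  qed (use A c in auto)
  have B'B: "B' * B = 1\<^sub>m n" using mat_mult_left_right_inverse[OF c(1,2) BB'] .
  note as = assoc_mult_mat[of _ n n _ n _ n]
  have "A = A * (B * B')" using BB' A by simp
  also have "\<dots> = B * A' * B'" using A c by (simp add: AB[symmetric] as)
  finally have "similar_mat A A'" using A c BB' B'B by (intro similar_mat_intro[of _ n _ B B']) auto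
  moreover have "good q A'"
  proof (rule good_upper_triangular_tail[OF q deg n c(3) _ _ refl _ refl _ refl refl _ refl])
    have pr: "(\<Prod>i=2..<n. A' $$ (i, i)) = (\<Prod>i=2..<n. A $$ (i, i))" by (intro prod.cong) (auto simp: A'_def)
    have dd: "A' $$ (0, 0) * A' $$ (1, 1) - A' $$ (0, 1) * A' $$ (1, 0) = d" using n' by (simp add: A'_def)
    have tt: "A' $$ (0, 0) + A' $$ (1, 1) = t" using n' by (simp add: A'_def)
    show "(A' $$ (0, 0) * A' $$ (1, 1) - A' $$ (0, 1) * A' $$ (1, 0)) * (\<Prod>i=2..<n. A' $$ (i, i)) = 1"
      unfolding pr dd using det by (simp add: d_def efgh)
    have "A' $$ (n - 1, n - 1) = \<rho>" using n \<rho> by (simp add: A'_def)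
    then show "(A' $$ (n - 1, n - 1))\<^sup>2 - (A' $$ (0, 0) + A' $$ (1, 1)) * A' $$ (n - 1, n - 1)
      + (A' $$ (0, 0) * A' $$ (1, 1) - A' $$ (0, 1) * A' $$ (1, 0)) \<noteq> 0"
      unfolding dd tt using \<chi> by (simp add: d_def t_def efgh)
    show "A' $$ (i, j) = 0" if "2 \<le> i" "i < n" "j < i" for i j using that tri by (simp add: A'_def)
    show "A' $$ (i, i) \<noteq> 0" if "2 \<le> i" "i < n" for i
    proof -
      have "(\<Prod>i=2..<n. A $$ (i, i)) \<noteq> 0" using det by (metis mult_zero_right zero_neq_one)
      then have "A $$ (i, i) \<noteq> 0" using that prod_zero_iff[of "{2..<n}" "\<lambda>i. A $$ (i, i)"] by auto
      then show ?thesis using that by (simp add: A'_def)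
    qed
  qed (use n' in \<open>auto simp: A'_def\<close>)
  ultimately show ?thesis using good_similar[of q A' A] A deg by simp
qed

section \<open>Symplectic bases adapted to an isometry\<close>

locale symplectic_space = vector_space scale
  for scale :: "'a :: field \<Rightarrow> 'v :: ab_group_add \<Rightarrow> 'v" (infixr "*s" 75) +
  fixes \<omega> :: "'v \<Rightarrow> 'v \<Rightarrow> 'a"
  assumes add_left: "\<omega> (x + y) z = \<omega> x z + \<omega> y z"
    and scale_left: "\<omega> (c *s x) z = c * \<omega> x z"
    and alternating [simp]: "\<omega> x x = 0"
    and skew: "\<omega> x y = - \<omega> y x"
begin

lemma add_right: "\<omega> x (y + z) = \<omega> x y + \<omega> x z"
  using skew[of x "y + z"] skew[of x y] skew[of x z] add_left[of y z x] by simp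

lemma scale_right: "\<omega> x (c *s y) = c * \<omega> x y"
  using skew[of x "c *s y"] skew[of x y] scale_left[of c y x] by simp

lemma zero_left [simp]: "\<omega> 0 y = 0" using scale_left[of 0 0 y] by simp

lemma zero_right [simp]: "\<omega> y 0 = 0" using skew[of y 0] by simp

lemma minus_left: "\<omega> (- x) y = - \<omega> x y" using add_left[of x "- x" y] by (simp add: eq_neg_iff_add_eq_0 add.commute)

lemma minus_right: "\<omega> x (- y) = - \<omega> x y" using add_right[of x y "- y"] by (simp add: eq_neg_iff_add_eq_0 add.commute)

lemma diff_left: "\<omega> (x - y) z = \<omega> x z - \<omega> y z" using add_left[of x "- y" z] by (simp add: minus_left)

lemma diff_right: "\<omega> x (y - z) = \<omega> x y - \<omega> x z" using add_right[of x y "- z"] by (simp add: minus_right)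

lemmas bilinear = add_left add_right scale_left scale_right minus_left minus_right diff_left diff_right

text \<open>A symplectic basis with m hyperbolic pairs. Spanning is expressed in its dual form, that
  only 0 is orthogonal to all members, so that bases and dimensions do not have to be
  discussed.\<close>

definition frame :: "'v set \<Rightarrow> nat \<Rightarrow> (nat \<Rightarrow> 'v) \<Rightarrow> (nat \<Rightarrow> 'v) \<Rightarrow> bool" where
  "frame U m e f \<longleftrightarrow> subspace U \<and> (\<forall>i<m. e i \<in> U \<and> f i \<in> U) \<and>
    (\<forall>i<m. \<forall>j<m. \<omega> (e i) (e j) = 0 \<and> \<omega> (f i) (f j) = 0 \<and> \<omega> (e i) (f j) = (if i = j then 1 else 0)) \<and>
    (\<forall>x \<in> U. (\<forall>i<m. \<omega> x (e i) = 0 \<and> \<omega> x (f i) = 0) \<longrightarrow> x = 0)"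

definition perp :: "'v set \<Rightarrow> 'v \<Rightarrow> 'v \<Rightarrow> 'v set" where
  "perp U a b = {x \<in> U. \<omega> x a = 0 \<and> \<omega> x b = 0}"

lemma frameD:
  assumes "frame U m e f"
  shows "subspace U" "i < m \<Longrightarrow> e i \<in> U" "i < m \<Longrightarrow> f i \<in> U"
    "i < m \<Longrightarrow> j < m \<Longrightarrow> \<omega> (e i) (e j) = 0" "i < m \<Longrightarrow> j < m \<Longrightarrow> \<omega> (f i) (f j) = 0"
    "i < m \<Longrightarrow> j < m \<Longrightarrow> \<omega> (e i) (f j) = (if i = j then 1 else 0)"
    "i < m \<Longrightarrow> j < m \<Longrightarrow> \<omega> (f i) (e j) = (if i = j then - 1 else 0)"
proof -
  show "\<omega> (f i) (e j) = (if i = j then - 1 else 0)" if "i < m" "j < m"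
  proof -
    have "\<omega> (e j) (f i) = (if j = i then 1 else 0)" using assms that unfolding frame_def by blast
    then show ?thesis using skew[of "f i" "e j"] by simp
  qed
qed (use assms in \<open>unfold frame_def, blast+\<close>)

lemma frame_complete:
  assumes "frame U m e f" "x \<in> U" "\<And>i. i < m \<Longrightarrow> \<omega> x (e i) = 0" "\<And>i. i < m \<Longrightarrow> \<omega> x (f i) = 0"
  shows "x = 0"
  using assms unfolding frame_def by blast

lemma frameI:
  assumes "subspace U" "\<And>i. i < m \<Longrightarrow> e i \<in> U" "\<And>i. i < m \<Longrightarrow> f i \<in> U"
    "\<And>i j. i < m \<Longrightarrow> j < m \<Longrightarrow> \<omega> (e i) (e j) = 0" "\<And>i j. i < m \<Longrightarrow> j < m \<Longrightarrow> \<omega> (f i) (f j) = 0"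
    "\<And>i j. i < m \<Longrightarrow> j < m \<Longrightarrow> \<omega> (e i) (f j) = (if i = j then 1 else 0)"
    "\<And>x. x \<in> U \<Longrightarrow> (\<And>i. i < m \<Longrightarrow> \<omega> x (e i) = 0) \<Longrightarrow> (\<And>i. i < m \<Longrightarrow> \<omega> x (f i) = 0) \<Longrightarrow> x = 0"
  shows "frame U m e f"
  unfolding frame_def using assms by blast

lemma frame_zero: "frame U 0 e f \<Longrightarrow> U = {0}"
  using subspace_0[of U] unfolding frame_def by blast

lemma frame_nondegenerate:
  assumes "frame U m e f" "x \<in> U" "x \<noteq> 0"
  obtains y where "y \<in> U" "\<omega> x y = 1"
proof -
  obtain z where z: "z \<in> U" "\<omega> x z \<noteq> 0" using assms unfolding frame_def by blast
  show ?thesis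
    using z subspace_scale[OF frameD(1)[OF assms(1)], of z "inverse (\<omega> x z)"]
    by (intro that[of "inverse (\<omega> x z) *s z"]) (auto simp: scale_right)
qed

lemma subspace_perp: "subspace U \<Longrightarrow> subspace (perp U a b)"
  unfolding subspace_def perp_def by (auto simp: bilinear)

text \<open>Transvections preserve the form. Completeness carries over because moving a transvection
  to the other argument gives its inverse, with -c in place of c.\<close>

lemma frame_transvection:
  assumes "frame U m e f" "w \<in> U"
  shows "frame U m (\<lambda>i. e i + (c * \<omega> (e i) w) *s w) (\<lambda>i. f i + (c * \<omega> (f i) w) *s w)"
proof -
  let ?T = "\<lambda>x. x + (c * \<omega> x w) *s w"
  note F = frameD[OF assms(1)]
  have T: "\<omega> (?T x) (?T y) = \<omega> x y" for x y
    using skew[of w y] by (simp add: bilinear algebra_simps)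
  have TU: "?T x \<in> U" if "x \<in> U" for x using that assms F(1) by (intro subspace_add subspace_scale) auto
  show ?thesis
  proof (rule frameI)
    fix x
    assume x: "x \<in> U" and o: "\<And>i. i < m \<Longrightarrow> \<omega> x (?T (e i)) = 0" "\<And>i. i < m \<Longrightarrow> \<omega> x (?T (f i)) = 0"
    let ?y = "x - (c * \<omega> x w) *s w"
    have a: "\<omega> ?y z = \<omega> x (?T z)" for z using skew[of w z] by (simp add: bilinear algebra_simps)
    have "?y \<in> U" using x assms F(1) by (intro subspace_diff subspace_scale) auto
    then have y: "?y = 0" using frame_complete[OF assms(1), of ?y] o unfolding a by blast
    then have "\<omega> ?y w = 0" by simp
    then have "\<omega> x w = 0" by (simp add: bilinear)
    then show "x = 0" using y by simp
  qed (use F(1-6) TU in \<open>auto simp: T\<close>)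
qed

lemma transvection_maps:
  assumes "\<omega> x y \<noteq> 0"
  shows "x + (inverse (\<omega> x y) * \<omega> x (y - x)) *s (y - x) = y"
  using assms by (simp add: bilinear)

text \<open>A transvection takes e_0 to any y with \<omega>(e_0, y) nonzero. For an a orthogonal to
  e_0 two of them are composed, through a vector z that is orthogonal to neither.\<close>

lemma frame_first:
  assumes F: "frame U (Suc m) e f" and a: "a \<in> U" "a \<noteq> 0"
  shows "\<exists>e f. frame U (Suc m) e f \<and> e 0 = a"
proof -
  have step: "\<exists>e f. frame U (Suc m) e f \<and> e 0 = y"
    if "frame U (Suc m) e f" "y \<in> U" "\<omega> (e 0) y \<noteq> 0" for e f y
  proof -
    have "y - e 0 \<in> U" using that frameD(2)[OF that(1), of 0] by (intro subspace_diff[OF frameD(1)[OF that(1)]]) auto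
    from frame_transvection[OF that(1) this, of "inverse (\<omega> (e 0) y)"] show ?thesis
      using transvection_maps[OF that(3)] by blast
  qed
  show ?thesis
  proof (cases "\<omega> (e 0) a = 0")
    case False
    then show ?thesis using step[OF F a(1)] by blast
  next
    case True
    have f0: "f 0 \<in> U" "\<omega> (e 0) (f 0) = 1" using frameD(3,6)[OF F] by auto
    obtain b where b: "b \<in> U" "\<omega> a b = 1" by (rule frame_nondegenerate[OF F a])
    obtain z where z: "z \<in> U" "\<omega> (e 0) z \<noteq> 0" "\<omega> a z \<noteq> 0"
    proof (cases "\<omega> a (f 0) = 0 \<and> \<omega> (e 0) b = 0")
      case True
      then show ?thesis using f0 b frameD(1)[OF F] by (intro that[of "f 0 + b"]) (auto simp: bilinear subspace_add)
    next
      case False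
      then show ?thesis using f0 b that[of "f 0"] that[of b] by auto
    qed
    obtain e' f' where F': "frame U (Suc m) e' f'" "e' 0 = z" using step[OF F z(1,2)] by blast
    have "\<omega> (e' 0) a \<noteq> 0" using z(3) skew[of z a] F'(2) by simp
    then show ?thesis using step[OF F'(1) a(1)] by blast
  qed
qed

text \<open>Once e_0 = a, the second member is moved by transvections along y - f_0, which fix a
  because a pairs to 1 with both y and f_0. If f_0 and b are orthogonal, the detour goes through f_0
  + a.\<close>

lemma frame_hyperbolic_pair:
  assumes F: "frame U (Suc m) e f" and ab: "a \<in> U" "b \<in> U" "\<omega> a b = 1"
  shows "\<exists>e f. frame U (Suc m) e f \<and> e 0 = a \<and> f 0 = b"
proof -
  have "a \<noteq> 0" using ab(3) by auto
  then obtain e f where F: "frame U (Suc m) e f" and e0: "e 0 = a" using frame_first[OF F ab(1)] by blast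
  have step: "\<exists>e f. frame U (Suc m) e f \<and> e 0 = a \<and> f 0 = y"
    if "frame U (Suc m) e f" "e 0 = a" "y \<in> U" "\<omega> a y = 1" "\<omega> (f 0) y \<noteq> 0" for e f y
  proof -
    have "y - f 0 \<in> U" using that frameD(3)[OF that(1), of 0] by (intro subspace_diff[OF frameD(1)[OF that(1)]]) auto
    from frame_transvection[OF that(1) this, of "inverse (\<omega> (f 0) y)"]
    have F': "frame U (Suc m) (\<lambda>i. e i + (inverse (\<omega> (f 0) y) * \<omega> (e i) (y - f 0)) *s (y - f 0))
      (\<lambda>i. f i + (inverse (\<omega> (f 0) y) * \<omega> (f i) (y - f 0)) *s (y - f 0))" .
    have "\<omega> (e 0) (y - f 0) = 0" using that frameD(6)[OF that(1), of 0 0] by (simp add: bilinear)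
    then have "e 0 + (inverse (\<omega> (f 0) y) * \<omega> (e 0) (y - f 0)) *s (y - f 0) = a" using that(2) by simp
    then show ?thesis using F' transvection_maps[OF that(5)] by blast
  qed
  have f0: "f 0 \<in> U" "\<omega> a (f 0) = 1" using frameD(3)[OF F] frameD(6)[OF F, of 0 0] e0 by auto
  show ?thesis
  proof (cases "\<omega> (f 0) b = 0")
    case False
    then show ?thesis using step[OF F e0 ab(2,3)] by blast
  next
    case True
    let ?z = "f 0 + a"
    have "?z \<in> U" using f0 ab frameD(1)[OF F] subspace_add by blast
    moreover have "\<omega> a ?z = 1" "\<omega> (f 0) ?z \<noteq> 0" using f0 skew[of "f 0" a] by (simp_all add: bilinear)
    ultimately obtain e' f' where F': "frame U (Suc m) e' f'" "e' 0 = a" "f' 0 = ?z" using step[OF F e0] by blast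
    have "\<omega> (f' 0) b \<noteq> 0" using F' True ab by (simp add: bilinear)
    then show ?thesis using step[OF F'(1,2) ab(2,3)] by blast
  qed
qed

lemma frame_tail:
  assumes F: "frame U (Suc m) e f"
  shows "frame (perp U (e 0) (f 0)) m (\<lambda>i. e (Suc i)) (\<lambda>i. f (Suc i))"
proof -
  note D = frameD[OF F]
  have "e (Suc i) \<in> perp U (e 0) (f 0)" "f (Suc i) \<in> perp U (e 0) (f 0)" if "i < m" for i
    using D(2-7) that by (auto simp: perp_def)
  then show ?thesis
  proof (intro frameI)
    fix x assume x: "x \<in> perp U (e 0) (f 0)" and o: "\<And>i. i < m \<Longrightarrow> \<omega> x (e (Suc i)) = 0" "\<And>i. i < m \<Longrightarrow> \<omega> x (f (Suc i)) = 0"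
    show "x = 0"
    proof (rule frame_complete[OF F])
      fix i assume "i < Suc m"
      then show "\<omega> x (e i) = 0" "\<omega> x (f i) = 0" using x o by (cases i; simp add: perp_def)+
    qed (use x in \<open>simp add: perp_def\<close>)
  qed (use D(4-6) subspace_perp[OF D(1)] in auto)
qed

lemma frame_cons:
  assumes U: "subspace U" and ab: "a \<in> U" "b \<in> U" "\<omega> a b = 1" and Fr: "frame (perp U a b) m e f"
  shows "frame U (Suc m) (case_nat a e) (case_nat b f)"
proof -
  note F = frameD[OF Fr]
  have p: "e i \<in> U" "f i \<in> U" "\<omega> (e i) a = 0" "\<omega> (e i) b = 0" "\<omega> (f i) a = 0" "\<omega> (f i) b = 0"
    "\<omega> a (e i) = 0" "\<omega> b (e i) = 0" "\<omega> a (f i) = 0" "\<omega> b (f i) = 0" if "i < m" for i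
    using F(2,3)[OF that] skew[of a "e i"] skew[of b "e i"] skew[of a "f i"] skew[of b "f i"] unfolding perp_def by auto
  show ?thesis
  proof (rule frameI)
    fix x assume x: "x \<in> U" "\<And>i. i < Suc m \<Longrightarrow> \<omega> x (case_nat a e i) = 0" "\<And>i. i < Suc m \<Longrightarrow> \<omega> x (case_nat b f i) = 0"
    show "x = 0"
    proof (rule frame_complete[OF Fr])
      show "x \<in> perp U a b" using x(1) x(2,3)[of 0] by (simp add: perp_def)
      fix i assume "i < m"
      then show "\<omega> x (e i) = 0" "\<omega> x (f i) = 0" using x(2,3)[of "Suc i"] by simp_all
    qed
  qed (use U ab p F(4-6) in \<open>auto split: nat.split\<close>)
qed

text \<open>Stands in for a dimension count: cutting off a hyperbolic pair, whichever it is, leaves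
  a space with exactly one pair fewer.\<close>

lemma perp_frame:
  assumes "frame U (Suc m) e f" "a \<in> U" "b \<in> U" "\<omega> a b = 1"
  shows "\<exists>e f. frame (perp U a b) m e f"
  using frame_hyperbolic_pair[OF assms] frame_tail by blast

lemma frame_permute:
  assumes F: "frame U m e f" and \<pi>: "bij_betw \<pi> {..<m} {..<m}"
  shows "frame U m (\<lambda>i. e (\<pi> i)) (\<lambda>i. f (\<pi> i))"
proof -
  have into: "\<pi> i < m" if "i < m" for i using bij_betwE[OF \<pi>] that by auto
  have inj: "\<pi> i = \<pi> j \<longleftrightarrow> i = j" if "i < m" "j < m" for i j
    using bij_betw_imp_inj_on[OF \<pi>] that unfolding inj_on_def by auto
  have onto: "\<exists>i<m. j = \<pi> i" if "j < m" for j
    using bij_betw_imp_surj_on[OF \<pi>] that by (metis imageE lessThan_iff)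
  show ?thesis
  proof (rule frameI)
    fix x assume x: "x \<in> U" "\<And>i. i < m \<Longrightarrow> \<omega> x (e (\<pi> i)) = 0" "\<And>i. i < m \<Longrightarrow> \<omega> x (f (\<pi> i)) = 0"
    show "x = 0"
    proof (rule frame_complete[OF F x(1)])
      fix i assume "i < m"
      then obtain k where "k < m" "i = \<pi> k" using onto by blast
      then show "\<omega> x (e i) = 0" "\<omega> x (f i) = 0" using x(2,3) by auto
    qed
  qed (use frameD(1-6)[OF F] into inj in auto)
qed

text \<open>The coefficients p, r, r, u form a symmetric matrix, which keeps the new second members
  mutually orthogonal. This is the freedom that changes the upper left block of an isometry while
  the e_i stay.\<close>

lemma frame_shear:
  assumes F: "frame U m e f" and m: "2 \<le> m"
  shows "frame U m e (\<lambda>i. f i + (if i = 0 then p *s e 0 + r *s e 1 else if i = 1 then r *s e 0 + u *s e 1 else 0))"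
    (is "frame U m e ?f")
proof -
  note D = frameD[OF F]
  have m': "0 < m" "1 < m" "Suc 0 < m" using m by auto
  have "?f i \<in> U" if "i < m" for i
    using that m' D(1-3) by (auto intro!: subspace_add subspace_scale)
  moreover have "\<omega> (e i) (?f j) = (if i = j then 1 else 0)" if "i < m" "j < m" for i j
    using that m' D(4,6) by (auto simp: bilinear)
  moreover have "\<omega> (?f i) (?f j) = 0" if "i < m" "j < m" for i j
    using that m' D(4-7) by (auto simp: bilinear)
  ultimately show ?thesis
  proof (intro frameI)
    fix x assume x: "x \<in> U" "\<And>i. i < m \<Longrightarrow> \<omega> x (e i) = 0" "\<And>i. i < m \<Longrightarrow> \<omega> x (?f i) = 0"
    show "x = 0"
    proof (rule frame_complete[OF F x(1,2)])
      fix i assume i: "i < m"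
      show "\<omega> x (f i) = 0" using x(3)[OF i] x(2) m' by (auto simp: bilinear split: if_splits)
    qed
  qed (use D(1,2,4) in auto)
qed

section \<open>Isometries, their compressions and the frames adapted to them\<close>

definition isometry :: "'v set \<Rightarrow> ('v \<Rightarrow> 'v) \<Rightarrow> bool" where
  "isometry U P \<longleftrightarrow> (\<forall>x y. P (x + y) = P x + P y) \<and> (\<forall>c x. P (c *s x) = c *s P x) \<and>
    (\<forall>x \<in> U. P x \<in> U) \<and> (\<forall>x \<in> U. \<forall>y \<in> U. \<omega> (P x) (P y) = \<omega> x y)"

lemma isometryD:
  assumes "isometry U P"
  shows "P (x + y) = P x + P y" "P (c *s x) = c *s P x" "x \<in> U \<Longrightarrow> P x \<in> U"
    "x \<in> U \<Longrightarrow> y \<in> U \<Longrightarrow> \<omega> (P x) (P y) = \<omega> x y" "P (- x) = - P x" "P (x - y) = P x - P y"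
proof -
  show m: "P (- x) = - P x" for x using assms unfolding isometry_def by (metis scale_minus_left[of 1] scale_one)
  show "P (x - y) = P x - P y"
  proof -
    have "P (x + - y) = P x + P (- y)" using assms unfolding isometry_def by blast
    then show ?thesis by (simp add: m)
  qed
qed (use assms in \<open>auto simp: isometry_def\<close>)

definition proj :: "'v \<Rightarrow> 'v \<Rightarrow> 'v \<Rightarrow> 'v" where
  "proj a b x = x - \<omega> x b *s a + \<omega> x a *s b"

lemma proj_right: "\<omega> a y = 0 \<Longrightarrow> \<omega> b y = 0 \<Longrightarrow> \<omega> (proj a b x) y = \<omega> x y"
  by (simp add: proj_def bilinear)

text \<open>For x orthogonal to a and b, P x is orthogonal to P a, which lies in the plane of a and
  b. Hence the plane component of P x is a multiple of P a, two such components are orthogonal to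
  each other, and dropping them preserves the form.\<close>

lemma isometry_compress:
  assumes P: "isometry U P" and U: "subspace U" and ab: "a \<in> U" "b \<in> U" "\<omega> a b = 1"
    and Pa: "P a = l *s a + c *s b" and c: "c \<noteq> 0"
  shows "isometry (perp U a b) (\<lambda>x. proj a b (P x))"
  unfolding isometry_def
proof (intro conjI allI ballI)
  note D = isometryD[OF P]
  fix x y
  show "proj a b (P (x + y)) = proj a b (P x) + proj a b (P y)"
    by (simp add: D proj_def bilinear scale_left_distrib)
  show "proj a b (P (k *s x)) = k *s proj a b (P x)" for k
    by (simp add: D proj_def bilinear scale_right_distrib scale_right_diff_distrib)
  assume x: "x \<in> perp U a b"
  have ba: "\<omega> b a = - 1" using skew[of b a] ab by simp
  have PU: "P x \<in> U" using x D(3) by (simp add: perp_def)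
  then show "proj a b (P x) \<in> perp U a b"
    using ab ba U by (auto simp: perp_def proj_def bilinear intro!: subspace_add subspace_diff subspace_scale)
  assume y: "y \<in> perp U a b"
  have rel: "c * \<omega> (P z) b = - l * \<omega> (P z) a" if "z \<in> perp U a b" for z
  proof -
    have "\<omega> (P z) (P a) = 0" using D(4)[of z a] that ab by (simp add: perp_def)
    then have "l * \<omega> (P z) a + c * \<omega> (P z) b = 0" unfolding Pa by (simp add: bilinear)
    then show ?thesis by (simp add: eq_neg_iff_add_eq_0 add.commute)
  qed
  have "c * (\<omega> (P x) b * \<omega> (P y) a) = c * (\<omega> (P x) a * \<omega> (P y) b)"
  proof -
    have "c * (\<omega> (P x) b * \<omega> (P y) a) = (c * \<omega> (P x) b) * \<omega> (P y) a" by simp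
    also have "\<dots> = \<omega> (P x) a * (c * \<omega> (P y) b)" unfolding rel[OF x] rel[OF y] by simp
    finally show ?thesis by simp
  qed
  then have z: "\<omega> (P x) b * \<omega> (P y) a = \<omega> (P x) a * \<omega> (P y) b" using c by simp
  have "\<omega> (proj a b (P x)) (proj a b (P y)) = \<omega> (P x) (P y) + \<omega> (P x) b * \<omega> (P y) a - \<omega> (P x) a * \<omega> (P y) b"
    using skew[of a "P y"] skew[of b "P y"] ab ba by (simp add: proj_def bilinear algebra_simps)
  also have "\<dots> = \<omega> x y" using z D(4)[of x y] x y by (simp add: perp_def)
  finally show "\<omega> (proj a b (P x)) (proj a b (P y)) = \<omega> x y" .
qed

lemma perpD:
  assumes "y \<in> perp U a b"
  shows "y \<in> U" "\<omega> y a = 0" "\<omega> y b = 0" "\<omega> a y = 0" "\<omega> b y = 0"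
  using assms skew[of a y] skew[of b y] by (auto simp: perp_def)

lemma perpI: "y \<in> U \<Longrightarrow> \<omega> y a = 0 \<Longrightarrow> \<omega> y b = 0 \<Longrightarrow> y \<in> perp U a b"
  by (simp add: perp_def)

text \<open>Polarisation of the vanishing quadratic form \<omega>(P x, x), combined with skew
  symmetry.\<close>

lemma isometry_self_adjoint:
  assumes P: "isometry U P" and U: "subspace U" and Q: "\<forall>x\<in>U. \<omega> (P x) x = 0" and xy: "x \<in> U" "y \<in> U"
  shows "\<omega> (P x) y = \<omega> x (P y)"
proof -
  have "\<omega> (P (x + y)) (x + y) = 0" using Q subspace_add[OF U] xy by blast
  then have "\<omega> (P x) y + \<omega> (P y) x = 0" using bspec[OF Q, OF xy(1)] bspec[OF Q, OF xy(2)] by (simp add: isometryD(1)[OF P] bilinear add.commute)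
  then show ?thesis using skew[of x "P y"] eq_neg_iff_add_eq_0[of "\<omega> (P x) y" "\<omega> (P y) x"] by simp
qed

text \<open>A self-adjoint isometry satisfies \<omega>(P P x, y) = \<omega>(P x, P y) = \<omega>(x,
  y), and the form is nondegenerate on U.\<close>

lemma isometry_involution:
  assumes P: "isometry U P" and F: "frame U m e f" and Q: "\<forall>x\<in>U. \<omega> (P x) x = 0" and x: "x \<in> U"
  shows "P (P x) = x"
proof -
  note U = frameD(1)[OF F]
  have z: "P (P x) - x \<in> U" using U x isometryD(3)[OF P] by (intro subspace_diff) auto
  have o: "\<omega> (P (P x) - x) y = 0" if "y \<in> U" for y
  proof -
    have "\<omega> (P (P x)) y = \<omega> (P x) (P y)" using isometry_self_adjoint[OF P U Q] x that isometryD(3)[OF P] by simp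
    then show ?thesis using isometryD(4)[OF P x that] by (simp add: bilinear)
  qed
  have "P (P x) - x = 0" by (rule frame_complete[OF F z]) (use o frameD(2,3)[OF F] in auto)
  then show ?thesis by simp
qed

lemma isometry_perp:
  assumes P: "isometry U P" and "\<And>x. x \<in> perp U a b \<Longrightarrow> \<omega> (P x) a = 0 \<and> \<omega> (P x) b = 0"
  shows "isometry (perp U a b) P"
  using assms unfolding isometry_def perp_def by auto

text \<open>P is a self-adjoint involution. Outside characteristic 2 it is diagonalisable with
  mutually orthogonal eigenspaces, and hyperbolic pairs can be taken inside them. In characteristic
  2 a vector moved by P leads to an invariant nondegenerate space of dimension 4 on which the upper
  left block is still the identity, although P is not.\<close>

lemma involution_frame:
  assumes "isometry U P" "frame U m e f" "\<forall>x\<in>U. \<omega> (P x) x = 0"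
  shows "\<exists>e f \<epsilon>. frame U m e f \<and> (\<forall>i<m. \<epsilon> i = 1 \<or> \<epsilon> i = - 1) \<and>
    (\<forall>i<m. \<forall>j<m. \<omega> (P (e j)) (f i) = (if i = j then \<epsilon> i else 0)) \<and>
    ((2 :: 'a) \<noteq> 0 \<longrightarrow> (\<forall>i<m. P (e i) = \<epsilon> i *s e i \<and> P (f i) = \<epsilon> i *s f i))"
  using assms
proof (induction m arbitrary: U e f rule: less_induct)
  case (less m)
  note P = less.prems(1) and F = less.prems(2) and Q = less.prems(3)
  note D = isometryD[OF P]
  note U = frameD(1)[OF F]
  note adj = isometry_self_adjoint[OF P U Q] and inv = isometry_involution[OF P F Q]
  show ?case
  proof (cases m)
    case 0
    then show ?thesis using F by (intro exI[of _ e] exI[of _ f] exI[of _ "\<lambda>_. 1"]) simp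
  next
    case (Suc k)
    show ?thesis
    proof (cases "(2 :: 'a) = 0")
      case False
      have v: "e 0 \<in> U" "e 0 \<noteq> 0" using frameD(2)[OF F] frameD(6)[OF F, of 0 0] Suc by auto
      obtain a s where a: "a \<in> U" "a \<noteq> 0" "P a = s *s a" and s: "s = 1 \<or> s = - 1"
      proof (cases "P (e 0) + e 0 = 0")
        case True
        then have "P (e 0) = - 1 *s e 0" by (simp add: eq_neg_iff_add_eq_0)
        then show ?thesis using v by (intro that[of "e 0" "- 1"]) auto
      next
        case False
        have "P (P (e 0) + e 0) = 1 *s (P (e 0) + e 0)" using inv[OF v(1)] by (simp add: D add.commute)
        then show ?thesis using v D(3) U False by (intro that[of "P (e 0) + e 0" 1]) (auto intro: subspace_add)
      qed
      obtain b0 where b0: "b0 \<in> U" "\<omega> a b0 = 1" by (rule frame_nondegenerate[OF F a(1,2)])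
      \<comment> \<open>The projection of b0 onto the s-eigenspace. It still pairs to 1 with a,
        because a lies in the same eigenspace and P is self-adjoint.\<close>
      define b where "b = inverse 2 *s (b0 + s *s P b0)"
      have ss: "s * s = 1" using s by auto
      have b: "b \<in> U" unfolding b_def using b0 U D(3) by (intro subspace_scale subspace_add) auto
      have "\<omega> a (P b0) = s" using adj[OF a(1) b0(1)] a(3) b0(2) by (simp add: bilinear)
      then have ab: "\<omega> a b = 1" using b0 ss False by (simp add: b_def bilinear)
      have Pb: "P b = s *s b" 
      proof -
        have "P b = inverse 2 *s (P b0 + s *s b0)" using inv[OF b0(1)] by (simp add: b_def D)
        also have "P b0 + s *s b0 = s *s (b0 + s *s P b0)" using ss by (simp add: scale_right_distrib add.commute)
        finally show ?thesis unfolding b_def by (simp only: scale_left_commute)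
      qed
      have W: "isometry (perp U a b) P"
      proof (rule isometry_perp[OF P])
        fix x assume x: "x \<in> perp U a b"
        then show "\<omega> (P x) a = 0 \<and> \<omega> (P x) b = 0"
          using adj[OF perpD(1)[OF x] a(1)] adj[OF perpD(1)[OF x] b] a(3) Pb perpD[OF x] by (simp add: bilinear)
      qed
      obtain e0 f0 where F0: "frame (perp U a b) k e0 f0" using perp_frame[OF F[unfolded Suc] a(1) b ab] by blast
      obtain e' f' \<epsilon> where F': "frame (perp U a b) k e' f'" and \<epsilon>: "\<And>i. i < k \<Longrightarrow> \<epsilon> i = 1 \<or> \<epsilon> i = - 1"
        and A: "\<And>i j. i < k \<Longrightarrow> j < k \<Longrightarrow> \<omega> (P (e' j)) (f' i) = (if i = j then \<epsilon> i else 0)"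
        and E: "\<And>i. i < k \<Longrightarrow> P (e' i) = \<epsilon> i *s e' i \<and> P (f' i) = \<epsilon> i *s f' i"
      proof -
        have "\<forall>x\<in>perp U a b. \<omega> (P x) x = 0" using Q perpD(1) by blast
        from less.IH[OF _ W F0 this] Suc False that show ?thesis by blast
      qed
      have pe: "\<omega> a (f' i) = 0" "\<omega> (e' i) b = 0" if "i < k" for i
        using perpD[OF frameD(2)[OF F' that]] perpD[OF frameD(3)[OF F' that]] by auto
      show ?thesis
      proof (intro exI conjI)
        show "frame U m (case_nat a e') (case_nat b f')" unfolding Suc by (rule frame_cons[OF U a(1) b ab F'])
        show "\<forall>i<m. case_nat s \<epsilon> i = 1 \<or> case_nat s \<epsilon> i = - 1" using s \<epsilon> Suc by (auto split: nat.split)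
        show "\<forall>i<m. \<forall>j<m. \<omega> (P (case_nat a e' j)) (case_nat b f' i) = (if i = j then case_nat s \<epsilon> i else 0)"
          using A E a(3) ab pe Suc by (auto simp: bilinear split: nat.split)
        show "2 \<noteq> (0 :: 'a) \<longrightarrow> (\<forall>i<m. P (case_nat a e' i) = case_nat s \<epsilon> i *s case_nat a e' i \<and> P (case_nat b f' i) = case_nat s \<epsilon> i *s case_nat b f' i)"
          using E a(3) Pb Suc by (auto split: nat.split)
      qed
    next
      case two: True
      have m1: "(- 1 :: 'a) = 1" using two by (metis add_eq_0_iff one_add_one)
      have dbl: "c + c = 0" for c :: 'a using two by (metis mult_2 mult_zero_left)
      have dblv: "x + x = 0" for x :: 'v
        using scale_left_distrib[of 1 1 x] two by simp
      have sym: "\<omega> x y = \<omega> y x" for x y using skew[of x y] minus_unique[OF dbl[of "\<omega> y x"]] by simp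
      show ?thesis
      proof (cases "\<forall>x \<in> U. P x = x")
        case True
        then show ?thesis using F frameD(2,6)[OF F] two
          by (intro exI[of _ e] exI[of _ f] exI[of _ "\<lambda>_. 1"]) auto
      next
        case False
        then obtain v where v: "v \<in> U" "P v \<noteq> v" by blast
        \<comment> \<open>In characteristic 2 this sum is the difference P v - v and is fixed by P.
          It leads to two pairs, e0 with f0 and w with g, where P adds g to e0 and f0 to w. Both
          added vectors are orthogonal to f0 and g, so they do not show in the block.\<close>
        define f0 where "f0 = P v + v"
        have f0: "f0 \<in> U" "f0 \<noteq> 0"
        proof -
          show "f0 \<in> U" unfolding f0_def using v D(3) U by (intro subspace_add) auto
          show "f0 \<noteq> 0" using v(2) dblv[of v] unfolding f0_def by (metis add_right_cancel)
        qed
        obtain e0 where e0: "e0 \<in> U" "\<omega> f0 e0 = 1" by (rule frame_nondegenerate[OF F f0])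
        define g where "g = P e0 + e0"
        \<comment> \<open>The correction by \<kappa> f0 makes w orthogonal to e0: the product
          becomes \<kappa> + \<kappa>, which is 0 in characteristic 2.\<close>
        define \<kappa> where "\<kappa> = \<omega> v e0"
        define w where "w = v + \<kappa> *s f0"
        have g: "g \<in> U" unfolding g_def using e0 D(3) U by (intro subspace_add) auto
        have w: "w \<in> U" unfolding w_def using v f0 U by (intro subspace_add subspace_scale) auto
        have Pf0: "P f0 = f0" using inv[OF v(1)] by (simp add: f0_def D add.commute)
        have Pe0: "P e0 = e0 + g" using dblv[of e0] by (simp add: g_def add.left_commute)
        have Pg: "P g = g" using inv[OF e0(1)] by (simp add: g_def D add.commute)
        have Pv: "P v = v + f0" using dblv[of v] by (simp add: f0_def add.left_commute)
        have Pw: "P w = w + f0" by (simp add: w_def D Pv Pf0 algebra_simps)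
        have ef: "\<omega> e0 f0 = 1" using e0 sym[of e0 f0] by simp
        have vf: "\<omega> v f0 = 0" using bspec[OF Q, OF v(1)] sym[of v "P v"] by (simp add: f0_def bilinear)
        have fg: "\<omega> f0 g = 0" using adj[OF f0(1) e0(1)] dbl Pf0 by (simp add: g_def bilinear)
        have eg: "\<omega> e0 g = 0" using bspec[OF Q, OF e0(1)] sym[of e0 "P e0"] by (simp add: g_def bilinear)
        have vg: "\<omega> v g = 1"
        proof -
          have "\<omega> v g = \<omega> (P v) e0 + \<omega> v e0" using adj[OF v(1) e0(1)] by (simp add: g_def bilinear)
          also have "\<dots> = \<omega> f0 e0" by (simp add: f0_def bilinear)
          finally show ?thesis using e0 by simp
        qed
        have wf: "\<omega> w f0 = 0" using vf by (simp add: w_def bilinear)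
        have we: "\<omega> w e0 = 0" using e0 dbl by (simp add: w_def \<kappa>_def bilinear)
        have wg: "\<omega> w g = 1" using vg fg by (simp add: w_def bilinear)
        let ?U1 = "perp U e0 f0"
        have wU: "w \<in> ?U1" using w we wf by (rule perpI)
        have gU: "g \<in> ?U1" by (rule perpI) (use g eg fg sym[of g e0] sym[of g f0] in auto)
        obtain e1 f1 where F1: "frame ?U1 k e1 f1" using perp_frame[OF F[unfolded Suc] e0(1) f0(1) ef] by blast
        have "k \<noteq> 0"
        proof
          assume "k = 0"
          then have "w = 0" using frame_zero[of ?U1 e1 f1] F1 wU by auto
          then show False using wg by simp
        qed
        then obtain l where k: "k = Suc l" by (cases k) auto
        let ?U2 = "perp ?U1 w g"
        obtain e2 f2 where F2: "frame ?U2 l e2 f2" using perp_frame[OF F1[unfolded k] wU gU wg] by blast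
        have x2: "x \<in> U" "\<omega> x e0 = 0" "\<omega> x f0 = 0" "\<omega> x w = 0" "\<omega> x g = 0"
          "\<omega> e0 x = 0" "\<omega> f0 x = 0" "\<omega> w x = 0" "\<omega> g x = 0" if "x \<in> ?U2" for x
          using perpD[OF that] perpD[of x U e0 f0] by auto
        have PU2: "\<omega> (P x) e0 = 0" "\<omega> (P x) f0 = 0" "\<omega> (P x) w = 0" "\<omega> (P x) g = 0" if "x \<in> ?U2" for x
          using adj[OF x2(1)[OF that] e0(1)] adj[OF x2(1)[OF that] f0(1)] adj[OF x2(1)[OF that] w] adj[OF x2(1)[OF that] g]
            x2[OF that] Pe0 Pf0 Pw Pg by (simp_all add: bilinear)
        have I2: "isometry ?U2 P"
          unfolding isometry_def
        proof (intro conjI allI ballI)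
          fix x assume x: "x \<in> ?U2"
          show "P x \<in> ?U2" using PU2[OF x] D(3) x2[OF x] by (intro perpI) auto
          fix y assume "y \<in> ?U2"
          then show "\<omega> (P x) (P y) = \<omega> x y" using D(4) x2(1) x by blast
        qed (use D in auto)
        obtain e' f' \<epsilon> where F': "frame ?U2 l e' f'" and \<epsilon>: "\<And>i. i < l \<Longrightarrow> \<epsilon> i = 1 \<or> \<epsilon> i = - 1"
          and A: "\<And>i j. i < l \<Longrightarrow> j < l \<Longrightarrow> \<omega> (P (e' j)) (f' i) = (if i = j then \<epsilon> i else 0)"
        proof -
          have "\<forall>x\<in>?U2. \<omega> (P x) x = 0" using Q x2(1) by blast
          moreover have "l < m" using Suc k by simp
          ultimately show ?thesis using less.IH[OF _ I2 F2] that by blast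
        qed
        have Fr1: "frame ?U1 k (case_nat w e') (case_nat g f')"
          unfolding k by (rule frame_cons[OF frameD(1)[OF F1] wU gU wg F'])
        have Fr: "frame U m (case_nat e0 (case_nat w e')) (case_nat f0 (case_nat g f'))"
          unfolding Suc by (rule frame_cons[OF U e0(1) f0(1) ef Fr1])
        have pf: "\<omega> e0 (f' i) = 0" "\<omega> f0 (f' i) = 0" "\<omega> w (f' i) = 0" "\<omega> g (f' i) = 0" if "i < l" for i
          using x2[OF frameD(3)[OF F' that]] by auto
        have gf: "\<omega> g f0 = 0" using fg sym[of g f0] by simp
        show ?thesis
        proof (intro exI conjI)
          show "frame U m (case_nat e0 (case_nat w e')) (case_nat f0 (case_nat g f'))" by (rule Fr)
          show "\<forall>i<m. case_nat 1 (case_nat 1 \<epsilon>) i = 1 \<or> case_nat 1 (case_nat 1 \<epsilon>) i = - 1"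
            using \<epsilon> Suc k by (auto split: nat.split)
          show "\<forall>i<m. \<forall>j<m. \<omega> (P (case_nat e0 (case_nat w e') j)) (case_nat f0 (case_nat g f') i)
              = (if i = j then case_nat 1 (case_nat 1 \<epsilon>) i else 0)"
            using A Pe0 Pw ef gf eg wf wg fg pf PU2[OF frameD(2)[OF F']] Suc k
            by (auto simp: bilinear split: nat.split)
        qed (use two in simp)
      qed
    qed
  qed
qed

text \<open>With b proportional to P x - x one has P x = x + c b, so the diagonal entry is 1 and
  everything below it vanishes. The induction continues with the compression, which has the same
  products with vectors orthogonal to the plane. Where \<omega>(P x, x) vanishes identically, the
  involution case even gives a diagonal block.\<close>

lemma triangular_frame:
  assumes "isometry U P" "frame U m e f"
  shows "\<exists>e f \<epsilon>. frame U m e f \<and> (\<forall>i<m. (\<epsilon> i = 1 \<or> \<epsilon> i = - 1) \<and> \<omega> (P (e i)) (f i) = \<epsilon> i \<and>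
    (\<forall>j<i. \<omega> (P (e j)) (f i) = 0))"
  using assms
proof (induction m arbitrary: U P e f)
  case 0
  then show ?case by auto
next
  case (Suc m)
  note P = Suc.prems(1) and F = Suc.prems(2)
  note U = frameD(1)[OF F]
  show ?case
  proof (cases "\<forall>x \<in> U. \<omega> (P x) x = 0")
    case True
    then obtain e f \<epsilon> where "frame U (Suc m) e f" "\<forall>i<Suc m. \<epsilon> i = 1 \<or> \<epsilon> i = - 1"
      "\<forall>i<Suc m. \<forall>j<Suc m. \<omega> (P (e j)) (f i) = (if i = j then \<epsilon> i else 0)"
      using involution_frame[OF P F] by blast
    then show ?thesis by (intro exI[of _ e] exI[of _ f] exI[of _ \<epsilon>]) auto
  next
    case False
    then obtain x where x: "x \<in> U" "\<omega> (P x) x \<noteq> 0" by blast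
    define c where "c = \<omega> x (P x)"
    define b where "b = inverse c *s (P x - x)"
    have c: "c \<noteq> 0" using x(2) skew[of x "P x"] by (simp add: c_def)
    have b: "b \<in> U" unfolding b_def using x isometryD(3)[OF P] U by (intro subspace_scale subspace_diff) auto
    have xb: "\<omega> x b = 1" using c by (simp add: b_def bilinear c_def)
    have Px: "P x = 1 *s x + c *s b" using c by (simp add: b_def)
    obtain e0 f0 where F0: "frame (perp U x b) m e0 f0" using perp_frame[OF F x(1) b xb] by blast
    obtain e' f' \<epsilon> where F': "frame (perp U x b) m e' f'"
      and \<epsilon>: "\<And>i. i < m \<Longrightarrow> (\<epsilon> i = 1 \<or> \<epsilon> i = - 1) \<and> \<omega> (proj x b (P (e' i))) (f' i) = \<epsilon> i \<and>
        (\<forall>j<i. \<omega> (proj x b (P (e' j))) (f' i) = 0)"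
      using Suc.IH[OF isometry_compress[OF P U x(1) b xb Px c] F0] by blast
    have p: "\<omega> x (f' i) = 0" "\<omega> b (f' i) = 0" if "i < m" for i
      using perpD[OF frameD(3)[OF F' that]] by auto
    show ?thesis
    proof (intro exI conjI allI impI)
      show "frame U (Suc m) (case_nat x e') (case_nat b f')" by (rule frame_cons[OF U x(1) b xb F'])
      fix i assume i: "i < Suc m"
      show "case_nat 1 \<epsilon> i = 1 \<or> case_nat 1 \<epsilon> i = - 1" using \<epsilon> i by (auto split: nat.split)
      show "\<omega> (P (case_nat x e' i)) (case_nat b f' i) = case_nat 1 \<epsilon> i"
        using i \<epsilon> p xb Px by (auto simp: bilinear proj_right split: nat.split)
      fix j assume "j < i"
      then show "\<omega> (P (case_nat x e' j)) (case_nat b f' i) = 0"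
        using i \<epsilon> p xb Px by (auto simp: bilinear proj_right split: nat.split)
    qed
  qed
qed

lemma swap_bij: "k < m \<Longrightarrow> bij_betw (\<lambda>i. if i = l then k else if i = k then l else i) {..<m} {..<m}" if "l < m" for k l m :: nat
  by (rule bij_betw_byWitness[where f' = "\<lambda>i. if i = l then k else if i = k then l else i"]) (use that in auto)

lemma isometry_image_orthogonal:
  assumes P: "isometry U P" and a: "a \<in> U" and Pa: "P a = c *s b" "c \<noteq> 0" and x: "x \<in> perp U a b"
  shows "\<omega> (P x) b = 0"
proof -
  have "\<omega> (P x) (P a) = 0" using isometryD(4)[OF P perpD(1)[OF x] a] perpD[OF x] by simp
  then show ?thesis unfolding Pa(1) using Pa(2) by (simp add: bilinear)
qed

lemma image_pair:
  assumes P: "isometry U P" and U: "subspace U" and x: "x \<in> U" "\<omega> (P x) x \<noteq> 0"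
  obtains c b where "c \<noteq> 0" "b \<in> U" "\<omega> x b = 1" "P x = c *s b"
proof
  show "\<omega> x (P x) \<noteq> 0" using x(2) skew[of x "P x"] by simp
  then show "\<omega> x (inverse (\<omega> x (P x)) *s P x) = 1" "P x = \<omega> x (P x) *s (inverse (\<omega> x (P x)) *s P x)"
    by (simp_all add: bilinear)
  show "inverse (\<omega> x (P x)) *s P x \<in> U" using x isometryD(3)[OF P] U by (intro subspace_scale) auto
qed

text \<open>Taking f_0 proportional to P e_0, and f_1 to the compressed image of e_1, makes the
  first two columns of the block zero. The block is singular, but its corner is then entirely at the
  disposal of a shear, whose coefficients get multiplied by the nonzero values \<omega>(P e_0, e_0)
  and \<omega>(P e_1, e_1).\<close>

lemma two_anisotropic_frame:
  assumes P: "isometry U P" and F: "frame U (Suc (Suc m)) e f" and x: "x \<in> U" "\<omega> (P x) x \<noteq> 0"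
    and y: "y \<in> U" "\<omega> y x = 0" "\<omega> y (P x) = 0" "\<omega> (P y) y \<noteq> 0"
  shows "\<exists>e f. frame U (Suc (Suc m)) e f \<and> \<omega> (P (e 0)) (e 0) \<noteq> 0 \<and> \<omega> (P (e 1)) (e 1) \<noteq> 0 \<and> \<omega> (P (e 0)) (e 1) = 0 \<and>
    (\<forall>i < Suc (Suc m). \<omega> (P (e 0)) (f i) = 0 \<and> \<omega> (P (e 1)) (f i) = 0) \<and>
    (\<forall>i. 2 \<le> i \<longrightarrow> i < Suc (Suc m) \<longrightarrow> (\<omega> (P (e i)) (f i) = 1 \<or> \<omega> (P (e i)) (f i) = - 1) \<and> (\<forall>j<i. \<omega> (P (e j)) (f i) = 0))"
proof -
  note U = frameD(1)[OF F]
  obtain c b where c: "c \<noteq> 0" and b: "b \<in> U" "\<omega> x b = 1" and Px: "P x = c *s b" by (rule image_pair[OF P U x])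
  have yW: "y \<in> perp U x b" using y c Px by (auto simp: perp_def bilinear)
  let ?W = "perp U x b" and ?P1 = "\<lambda>z. proj x b (P z)"
  have P1: "isometry ?W ?P1" using isometry_compress[OF P U x(1) b, of 0 c] Px c by simp
  have W: "subspace ?W" by (rule subspace_perp[OF U])
  obtain e0 f0 where F1: "frame ?W (Suc m) e0 f0" using perp_frame[OF F x(1) b] by blast
  have proj1: "\<omega> (?P1 z) w = \<omega> (P z) w" if "w \<in> ?W" for z w using perpD[OF that] by (simp add: proj_right)
  have "\<omega> (?P1 y) y \<noteq> 0" using y(4) proj1[OF yW] by simp
  then obtain d g where d: "d \<noteq> 0" and g: "g \<in> ?W" "\<omega> y g = 1" and Py: "?P1 y = d *s g" by (rule image_pair[OF P1 W yW])
  let ?W2 = "perp ?W y g" and ?P2 = "\<lambda>z. proj y g (?P1 z)"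
  have P2: "isometry ?W2 ?P2" using isometry_compress[OF P1 W yW g, of 0 d] Py d by simp
  obtain e1 f1 where F2: "frame ?W2 m e1 f1" using perp_frame[OF F1 yW g] by blast
  have proj2: "\<omega> (?P2 z) w = \<omega> (P z) w" if "w \<in> ?W2" for z w
    using perpD[OF that] proj1[OF perpD(1)[OF that]] by (simp add: proj_right)
  obtain e' f' \<epsilon> where F': "frame ?W2 m e' f'" and \<epsilon>: "\<And>i. i < m \<Longrightarrow> (\<epsilon> i = 1 \<or> \<epsilon> i = - 1) \<and> \<omega> (?P2 (e' i)) (f' i) = \<epsilon> i \<and>
    (\<forall>j<i. \<omega> (?P2 (e' j)) (f' i) = 0)" using triangular_frame[OF P2 F2] by blast
  have fW2: "f' i \<in> ?W2" if "i < m" for i by (rule frameD(3)[OF F' that])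
  have A: "(\<omega> (P (e' i)) (f' i) = 1 \<or> \<omega> (P (e' i)) (f' i) = - 1) \<and> (\<forall>j<i. \<omega> (P (e' j)) (f' i) = 0)" if "i < m" for i
    using \<epsilon>[OF that] proj2[OF fW2[OF that]] by auto
  have Fr: "frame U (Suc (Suc m)) (case_nat x (case_nat y e')) (case_nat b (case_nat g f'))"
    by (rule frame_cons[OF U x(1) b frame_cons[OF W yW g F']])
  have bw: "\<omega> b w = 0" if "w \<in> ?W" for w using perpD[OF that] by simp
  have Pxw: "\<omega> (P x) w = 0" if "w \<in> ?W" for w using bw[OF that] by (simp add: Px bilinear)
  have Pyb: "\<omega> (P y) b = 0" by (rule isometry_image_orthogonal[OF P x(1) Px c yW])
  have Pyg: "\<omega> (P y) g = 0" using proj1[OF g(1), of y] Py by (simp add: bilinear)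
  have Pyf: "\<omega> (P y) (f' i) = 0" if "i < m" for i
    using proj1[OF perpD(1)[OF fW2[OF that]], of y] perpD[OF fW2[OF that]] Py by (simp add: bilinear)
  have Pxf: "\<omega> (P x) (f' i) = 0" if "i < m" for i using Pxw[OF perpD(1)[OF fW2[OF that]]] .
  show ?thesis
  proof (intro exI conjI allI impI)
    show "frame U (Suc (Suc m)) (case_nat x (case_nat y e')) (case_nat b (case_nat g f'))" by (rule Fr)
    show "\<omega> (P (case_nat x (case_nat y e') 0)) (case_nat x (case_nat y e') 0) \<noteq> 0" using x by simp
    show "\<omega> (P (case_nat x (case_nat y e') 1)) (case_nat x (case_nat y e') 1) \<noteq> 0" using y by simp
    show "\<omega> (P (case_nat x (case_nat y e') 0)) (case_nat x (case_nat y e') 1) = 0" using Pxw[OF yW] by simp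
    fix i assume i: "i < Suc (Suc m)"
    show "\<omega> (P (case_nat x (case_nat y e') 0)) (case_nat b (case_nat g f') i) = 0"
      using i Pxw[OF g(1)] Pxf by (auto simp: Px bilinear split: nat.split)
    show "\<omega> (P (case_nat x (case_nat y e') 1)) (case_nat b (case_nat g f') i) = 0"
      using i Pyb Pyg Pyf by (auto split: nat.split)
    assume "2 \<le> i"
    then obtain k where k: "i = Suc (Suc k)" "k < m" using i by (metis Suc_le_D Suc_less_eq add_2_eq_Suc le_Suc_ex)
    show "\<omega> (P (case_nat x (case_nat y e') i)) (case_nat b (case_nat g f') i) = 1 \<or> \<omega> (P (case_nat x (case_nat y e') i)) (case_nat b (case_nat g f') i) = - 1"
      using A k by simp
    fix j assume "j < i"
    then show "\<omega> (P (case_nat x (case_nat y e') j)) (case_nat b (case_nat g f') i) = 0"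
      using A k Pxf Pyf by (auto split: nat.split)
  qed
qed

text \<open>Here the compression to the complement of x and P x falls under the involution case, so
  the block is diagonal with first entry 0. The last alternative concerns the products \<omega>(P
  e_i, e_0), through which a shear acts on the corner: all of them vanish for i \<ge> 1, or a
  permutation moves a nonzero one to i = 1.\<close>

lemma one_anisotropic_frame:
  assumes P: "isometry U P" and F: "frame U (Suc m) e f" and x: "x \<in> U" "\<omega> (P x) x \<noteq> 0"
    and Q: "\<And>y. y \<in> U \<Longrightarrow> \<omega> y x = 0 \<Longrightarrow> \<omega> y (P x) = 0 \<Longrightarrow> \<omega> (P y) y = 0"
  shows "\<exists>e f \<epsilon>. frame U (Suc m) e f \<and> \<omega> (P (e 0)) (e 0) \<noteq> 0 \<and>
    (\<forall>i < Suc m. \<omega> (P (e 0)) (f i) = 0 \<and> \<omega> (P (e i)) (f 0) = 0 \<and> (\<epsilon> i = 1 \<or> \<epsilon> i = - 1)) \<and>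
    (\<forall>i. 1 \<le> i \<longrightarrow> i < Suc m \<longrightarrow> \<omega> (P (e 0)) (e i) = 0 \<and> \<omega> (P (e i)) (e i) = 0 \<and>
      (\<forall>j. 1 \<le> j \<longrightarrow> j < Suc m \<longrightarrow> \<omega> (P (e j)) (f i) = (if i = j then \<epsilon> i else 0))) \<and>
    ((\<forall>i. 1 \<le> i \<longrightarrow> i < Suc m \<longrightarrow> \<omega> (P (e i)) (e 0) = 0) \<or> \<omega> (P (e 1)) (e 0) \<noteq> 0)"
proof -
  note U = frameD(1)[OF F]
  obtain c b where c: "c \<noteq> 0" and b: "b \<in> U" "\<omega> x b = 1" and Px: "P x = c *s b" by (rule image_pair[OF P U x])
  let ?W = "perp U x b" and ?P1 = "\<lambda>z. proj x b (P z)"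
  have P1: "isometry ?W ?P1" using isometry_compress[OF P U x(1) b, of 0 c] Px c by simp
  obtain e0 f0 where F1: "frame ?W m e0 f0" using perp_frame[OF F x(1) b] by blast
  have proj1: "\<omega> (?P1 z) w = \<omega> (P z) w" if "w \<in> ?W" for z w using perpD[OF that] by (simp add: proj_right)
  have QW: "\<omega> (P z) z = 0" if "z \<in> ?W" for z
    by (rule Q) (use perpD[OF that] in \<open>auto simp: Px bilinear\<close>)
  have "\<forall>z\<in>?W. \<omega> (?P1 z) z = 0" using QW proj1 by simp
  then obtain e1 f1 \<epsilon>1 where F2: "frame ?W m e1 f1" and \<epsilon>1: "\<forall>i<m. \<epsilon>1 i = 1 \<or> \<epsilon>1 i = - 1"
    and A1: "\<forall>i<m. \<forall>j<m. \<omega> (?P1 (e1 j)) (f1 i) = (if i = j then \<epsilon>1 i else 0)"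
    using involution_frame[OF P1 F1] by blast
  obtain e' f' \<epsilon> where F': "frame ?W m e' f'" and \<epsilon>: "\<And>i. i < m \<Longrightarrow> \<epsilon> i = 1 \<or> \<epsilon> i = - 1"
    and A: "\<And>i j. i < m \<Longrightarrow> j < m \<Longrightarrow> \<omega> (?P1 (e' j)) (f' i) = (if i = j then \<epsilon> i else 0)"
    and \<gamma>: "(\<forall>i<m. \<omega> (P (e' i)) x = 0) \<or> \<omega> (P (e' 0)) x \<noteq> 0"
  proof (cases "\<forall>i<m. \<omega> (P (e1 i)) x = 0")
    case True
    then show ?thesis using that[of e1 f1 \<epsilon>1] F2 \<epsilon>1 A1 by blast
  next
    case False
    then obtain k where k: "k < m" "\<omega> (P (e1 k)) x \<noteq> 0" by blast
    define \<pi> where "\<pi> i = (if i = 0 then k else if i = k then 0 else i)" for i :: nat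
    have bij: "bij_betw \<pi> {..<m} {..<m}" unfolding \<pi>_def using swap_bij[of 0 m k] k by simp
    have into: "\<pi> i < m" if "i < m" for i using that k by (auto simp: \<pi>_def)
    have inj: "\<pi> i = \<pi> j \<longleftrightarrow> i = j" for i j by (auto simp: \<pi>_def)
    show ?thesis
    proof (rule that[of "\<lambda>i. e1 (\<pi> i)" "\<lambda>i. f1 (\<pi> i)" "\<lambda>i. \<epsilon>1 (\<pi> i)"])
      show "frame ?W m (\<lambda>i. e1 (\<pi> i)) (\<lambda>i. f1 (\<pi> i))" by (rule frame_permute[OF F2 bij])
      show "(\<forall>i<m. \<omega> (P (e1 (\<pi> i))) x = 0) \<or> \<omega> (P (e1 (\<pi> 0))) x \<noteq> 0" using k by (simp add: \<pi>_def)
    qed (use \<epsilon>1 A1 into inj in auto)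
  qed
  have eW: "e' i \<in> ?W" "f' i \<in> ?W" if "i < m" for i using frameD(2,3)[OF F' that] by auto
  have bw: "\<omega> (P x) w = 0" if "w \<in> ?W" for w using perpD[OF that] by (simp add: Px bilinear)
  have Peb: "\<omega> (P (e' i)) b = 0" if "i < m" for i by (rule isometry_image_orthogonal[OF P x(1) Px c eW(1)[OF that]])
  have A': "\<omega> (P (e' j)) (f' i) = (if i = j then \<epsilon> i else 0)" if "i < m" "j < m" for i j
    using A[OF that] proj1[OF eW(2)[OF that(1)]] by simp
  have Pxb: "\<omega> (P x) b = 0" by (simp add: Px bilinear)
  show ?thesis
  proof (intro exI conjI allI impI)
    show "frame U (Suc m) (case_nat x e') (case_nat b f')" by (rule frame_cons[OF U x(1) b F'])
    show "\<omega> (P (case_nat x e' 0)) (case_nat x e' 0) \<noteq> 0" using x by simp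
    show "(\<forall>i. 1 \<le> i \<longrightarrow> i < Suc m \<longrightarrow> \<omega> (P (case_nat x e' i)) (case_nat x e' 0) = 0) \<or> \<omega> (P (case_nat x e' 1)) (case_nat x e' 0) \<noteq> 0"
      using \<gamma> by (auto split: nat.split)
    fix i assume i: "i < Suc m"
    show "\<omega> (P (case_nat x e' 0)) (case_nat b f' i) = 0" "\<omega> (P (case_nat x e' i)) (case_nat b f' 0) = 0"
      using i Pxb bw[OF eW(2)] Peb by (auto split: nat.split)
    show "case_nat 1 \<epsilon> i = 1 \<or> case_nat 1 \<epsilon> i = - 1" using i \<epsilon> by (auto split: nat.split)
  next
    fix i assume "1 \<le> i" "i < Suc m"
    then obtain k where k: "i = Suc k" "k < m" by (cases i) auto
    show "\<omega> (P (case_nat x e' 0)) (case_nat x e' i) = 0" using k bw[OF eW(1)] by simp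
    show "\<omega> (P (case_nat x e' i)) (case_nat x e' i) = 0" using k QW[OF eW(1)] by simp
    fix j assume "1 \<le> j" "j < Suc m"
    then obtain l where l: "j = Suc l" "l < m" by (cases j) auto
    show "\<omega> (P (case_nat x e' j)) (case_nat b f' i) = (if i = j then case_nat 1 \<epsilon> i else 0)"
      using k l A' by simp
  qed
qed

lemma move_two_bij:
  assumes "i < m" "j < m" "i \<noteq> j"
  obtains \<pi> where "bij_betw \<pi> {..<m} {..<m}" "\<pi> 0 = i" "\<pi> (1::nat) = (j::nat)"
proof -
  define s where "s l = (if l = 0 then i else if l = i then 0 else l)" for l
  define t where "t l = (if l = 1 then s j else if l = s j then 1 else l)" for l
  have m: "0 < m" "1 < m" using assms by auto
  have s: "bij_betw s {..<m} {..<m}" unfolding s_def using swap_bij[of 0 m i] assms m by simp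
  have sj: "s j < m" "s j \<noteq> 0" "s (s j) = j" using assms by (auto simp: s_def)
  have t: "bij_betw t {..<m} {..<m}" unfolding t_def using swap_bij[of 1 m "s j"] sj m by simp
  show ?thesis
  proof
    show "bij_betw (s \<circ> t) {..<m} {..<m}" by (rule bij_betw_trans[OF t s])
    show "(s \<circ> t) 0 = i" using sj by (simp add: t_def) (simp add: s_def)
    show "(s \<circ> t) 1 = j" using sj by (simp add: t_def)
  qed
qed

text \<open>Meant for signs with product -1. Mixing a plane with eigenvalue 1 and one with
  eigenvalue -1 gives e_0 and e_1 whose images are orthogonal to all the f's, while \<omega>(P e_1,
  e_0) = -2 and \<omega>(P e_0, e_1) = 2. Two columns of the block vanish, and a shear can then
  supply a corner of determinant 1 instead of -1.\<close>

lemma mixed_frame: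
  assumes F: "frame U m e f" and m: "2 \<le> m" and two: "(2 :: 'a) \<noteq> 0" and P: "isometry U P"
    and E: "\<And>i. i < m \<Longrightarrow> P (e i) = \<epsilon> i *s e i \<and> P (f i) = \<epsilon> i *s f i"
    and \<epsilon>: "\<epsilon> 0 = 1" "\<epsilon> 1 = - 1"
  shows "\<exists>e f. frame U m e f \<and> \<omega> (P (e 0)) (e 0) = 0 \<and> \<omega> (P (e 1)) (e 1) = 0 \<and>
    \<omega> (P (e 1)) (e 0) = - 2 \<and> \<omega> (P (e 0)) (e 1) = 2 \<and>
    (\<forall>i<m. \<omega> (P (e 0)) (f i) = 0 \<and> \<omega> (P (e 1)) (f i) = 0) \<and>
    (\<forall>i. 2 \<le> i \<longrightarrow> i < m \<longrightarrow> (\<forall>j<m. \<omega> (P (e j)) (f i) = (if i = j then \<epsilon> i else 0)))"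
proof -
  note D = frameD[OF F]
  have m': "0 < m" "1 < m" "Suc 0 < m" using m by auto
  let ?h = "inverse 2 :: 'a"
  define e' where "e' i = (if i = 0 then e 0 + e 1 else if i = 1 then f 0 - f 1 else e i)" for i
  define f' where "f' i = (if i = 0 then ?h *s (f 0 + f 1) else if i = 1 then ?h *s (e 1 - e 0) else f i)" for i
  have hh: "?h + ?h = 1" using two by (metis mult_2 right_inverse)
  have hh2: "- ?h - ?h = - 1" using hh by (metis add_uminus_conv_diff minus_add_distrib)
  have "frame U m e' f'"
  proof (rule frameI)
    show "subspace U" by (rule D(1))
    show "e' i \<in> U" "f' i \<in> U" if "i < m" for i
      using that m' D(1-3) unfolding e'_def f'_def by (auto intro!: subspace_add subspace_diff subspace_scale)
    show "\<omega> (e' i) (e' j) = 0" "\<omega> (f' i) (f' j) = 0" if "i < m" "j < m" for i j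
      using that m' D(4-7) unfolding e'_def f'_def by (auto simp: bilinear)
    show "\<omega> (e' i) (f' j) = (if i = j then 1 else 0)" if "i < m" "j < m" for i j
      using that m' D(4-7) hh hh2 unfolding e'_def f'_def by (auto simp: bilinear)
    fix x assume x: "x \<in> U" "\<And>i. i < m \<Longrightarrow> \<omega> x (e' i) = 0" "\<And>i. i < m \<Longrightarrow> \<omega> x (f' i) = 0"
    have a: "\<omega> x (e 0) + \<omega> x (e 1) = 0" "\<omega> x (f 0) = \<omega> x (f 1)" "\<omega> x (f 0) + \<omega> x (f 1) = 0" "\<omega> x (e 1) = \<omega> x (e 0)"
      using x(2,3)[of 0] x(2,3)[of 1] m' two by (simp_all add: e'_def f'_def bilinear)
    have dbl: "c = 0" if "c + c = 0" for c :: 'a using that two by (metis mult_2 mult_eq_0_iff)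
    have z: "\<omega> x (e 0) = 0" "\<omega> x (f 0) = 0" using a dbl[of "\<omega> x (e 0)"] dbl[of "\<omega> x (f 0)"] by auto
    show "x = 0"
    proof (rule frame_complete[OF F x(1)])
      fix i assume i: "i < m"
      consider "i = 0" | "i = 1" | "2 \<le> i" by linarith
      then have "\<omega> x (e i) = 0 \<and> \<omega> x (f i) = 0"
      proof cases
        case 3
        then show ?thesis using x(2,3)[OF i] by (simp add: e'_def f'_def)
      qed (use z a in auto)
      then show "\<omega> x (e i) = 0" "\<omega> x (f i) = 0" by auto
    qed
  qed
  moreover have P0: "P (e' 0) = e 0 - e 1" and P1: "P (e' 1) = f 0 + f 1"
    using E m' \<epsilon> by (simp_all add: e'_def isometryD[OF P])
  moreover have Pi: "P (e' i) = \<epsilon> i *s e i" if "2 \<le> i" "i < m" for i using E that by (simp add: e'_def)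
  moreover have "\<omega> (P (e' 0)) (e' 0) = 0" "\<omega> (P (e' 1)) (e' 1) = 0" "\<omega> (P (e' 1)) (e' 0) = - 2" "\<omega> (P (e' 0)) (e' 1) = 2"
    unfolding P0 P1 using D(4-7) m' by (simp_all add: e'_def bilinear)
  moreover have "\<omega> (P (e' 0)) (f' i) = 0" "\<omega> (P (e' 1)) (f' i) = 0" if "i < m" for i
    unfolding P0 P1 using D(4-7) m' that by (auto simp: f'_def bilinear)
  moreover have "\<omega> (P (e' j)) (f' i) = (if i = j then \<epsilon> i else 0)" if "2 \<le> i" "i < m" "j < m" for i j
  proof -
    consider "j = 0" | "j = 1" | "2 \<le> j" by linarith
    then show ?thesis
    proof cases
      case 1
      then show ?thesis using that D(4-7) m' by (simp add: P0 f'_def bilinear)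
    next
      case 2
      then show ?thesis using that D(4-7) m' by (simp add: P1[unfolded One_nat_def] f'_def bilinear)
    next
      case 3
      then show ?thesis using that D(4-7) m' Pi by (simp add: f'_def bilinear)
    qed
  qed
  ultimately show ?thesis by (intro exI[of _ e'] exI[of _ f']) blast
qed

end

section \<open>Coordinates\<close>

definition vec_scale :: "'a :: field \<Rightarrow> (nat \<Rightarrow> 'a) \<Rightarrow> nat \<Rightarrow> 'a" where
  "vec_scale c x = (\<lambda>i. c * x i)"

definition vec_form :: "nat \<Rightarrow> (nat \<Rightarrow> 'a :: field) \<Rightarrow> (nat \<Rightarrow> 'a) \<Rightarrow> 'a" where
  "vec_form n x y = (\<Sum>i<n. x i * y (n + i) - x (n + i) * y i)"

text \<open>Vectors are functions on all natural numbers, so that one type serves every n; the space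
  of dimension 2n is cut out by the support. The form, too, only looks at indices below 2n.\<close>

definition vec_space :: "nat \<Rightarrow> (nat \<Rightarrow> 'a :: field) set" where
  "vec_space n = {x. \<forall>i\<ge>2 * n. x i = 0}"

definition unit_fun :: "nat \<Rightarrow> nat \<Rightarrow> 'a :: field" where
  "unit_fun k = (\<lambda>i. if i = k then 1 else 0)"

definition mat_fun :: "'a :: field mat \<Rightarrow> (nat \<Rightarrow> 'a) \<Rightarrow> nat \<Rightarrow> 'a" where
  "mat_fun P x = (\<lambda>i. if i < dim_row P then \<Sum>j<dim_col P. P $$ (i, j) * x j else 0)"

interpretation coord: symplectic_space vec_scale "vec_form n" for n
proof unfold_locales
  fix x y z :: "nat \<Rightarrow> 'a :: field" and c d
  show "vec_scale c (x + y) = vec_scale c x + vec_scale c y" "vec_scale (c + d) x = vec_scale c x + vec_scale d x"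
    "vec_scale c (vec_scale d x) = vec_scale (c * d) x" "vec_scale 1 x = x"
    by (simp_all add: vec_scale_def fun_eq_iff algebra_simps)
  show "vec_form n (x + y) z = vec_form n x z + vec_form n y z" "vec_form n (vec_scale c x) z = c * vec_form n x z"
    by (simp_all add: vec_form_def vec_scale_def algebra_simps sum.distrib sum_distrib_left sum_subtractf)
  show "vec_form n x x = 0" by (simp add: vec_form_def mult.commute)
  show "vec_form n x y = - vec_form n y x"
    unfolding vec_form_def by (simp add: sum_negf[symmetric] mult.commute del: sum_negf)
qed

lemma vec_form_cong:
  assumes "\<And>a. a < 2 * n \<Longrightarrow> x a = x' a" "\<And>a. a < 2 * n \<Longrightarrow> y a = y' a"
  shows "vec_form n x y = vec_form n x' y'"
  unfolding vec_form_def using assms by (intro sum.cong) auto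

lemma vec_form_unit:
  assumes "i < n"
  shows "vec_form n x (unit_fun i) = - x (n + i)" "vec_form n x (unit_fun (n + i)) = x i"
proof -
  have "vec_form n x (unit_fun i) = (\<Sum>j<n. if j = i then - x (n + i) else 0)"
    unfolding vec_form_def using assms by (intro sum.cong) (auto simp: unit_fun_def)
  then show "vec_form n x (unit_fun i) = - x (n + i)" using assms by simp
  have "vec_form n x (unit_fun (n + i)) = (\<Sum>j<n. if j = i then x i else 0)"
    unfolding vec_form_def using assms by (intro sum.cong) (auto simp: unit_fun_def)
  then show "vec_form n x (unit_fun (n + i)) = x i" using assms by simp
qed

lemma standard_frame: "coord.frame n (vec_space n) n unit_fun (\<lambda>i. unit_fun (n + i))"
proof (rule coord.frameI)
  show "coord.subspace (vec_space n)"
    by (simp add: coord.subspace_def vec_space_def vec_scale_def)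
  fix x assume x: "x \<in> vec_space n" "\<And>i. i < n \<Longrightarrow> vec_form n x (unit_fun i) = 0"
    "\<And>i. i < n \<Longrightarrow> vec_form n x (unit_fun (n + i)) = 0"
  show "x = 0"
  proof
    fix i
    consider "i < n" | j where "i = n + j" "j < n" | "2 * n \<le> i"
      by (metis le_add_diff_inverse mult_2 nat_add_left_cancel_less not_le)
    then show "x i = 0 i" using x vec_form_unit[of _ n x] by cases (auto simp: vec_space_def)
  qed
qed (auto simp: vec_form_unit, auto simp: unit_fun_def vec_space_def)

lemma symplectic_form_index:
  assumes "i < 2 * n" "j < 2 * n"
  shows "symplectic_form n $$ (i, j) = (if i < n then (if j = n + i then 1 else 0) else if i = n + j then - 1 else 0)"
  using assms unfolding symplectic_form_def by auto

lemma symplectic_form_mult: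
  assumes M: "M \<in> carrier_mat (2 * n) k" and i: "i < 2 * n" and j: "j < k"
  shows "(symplectic_form n * M) $$ (i, j) = (if i < n then M $$ (n + i, j) else - M $$ (i - n, j))"
proof -
  have "(symplectic_form n * M) $$ (i, j) = (\<Sum>l<2*n. symplectic_form n $$ (i, l) * M $$ (l, j))"
    by (rule mult_mat_index) (use M i j in auto)
  also have "\<dots> = (\<Sum>l<2*n. if l = (if i < n then n + i else i - n) then (if i < n then M $$ (n + i, j) else - M $$ (i - n, j)) else 0)"
    using i by (intro sum.cong) (auto simp: symplectic_form_index)
  also have "\<dots> = (if i < n then M $$ (n + i, j) else - M $$ (i - n, j))" using i by auto
  finally show ?thesis .
qed

lemma gram_index:
  assumes M: "M \<in> carrier_mat (2 * n) k" and N: "N \<in> carrier_mat (2 * n) l" and i: "i < k" and j: "j < l"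
  shows "(transpose_mat M * (symplectic_form n * N)) $$ (i, j) = vec_form n (\<lambda>a. M $$ (a, i)) (\<lambda>a. N $$ (a, j))"
proof -
  have c: "symplectic_form n * N \<in> carrier_mat (2 * n) l" using N by (metis mult_carrier_mat symplectic_form_carrier)
  have "(transpose_mat M * (symplectic_form n * N)) $$ (i, j)
      = (\<Sum>a<2*n. transpose_mat M $$ (i, a) * (symplectic_form n * N) $$ (a, j))"
    by (rule mult_mat_index[OF _ c]) (use M i j in auto)
  also have "\<dots> = (\<Sum>a<n+n. M $$ (a, i) * (if a < n then N $$ (n + a, j) else - N $$ (a - n, j)))"
    unfolding mult_2[symmetric] using M i j by (intro sum.cong) (auto simp: symplectic_form_mult[OF N])
  also have "\<dots> = (\<Sum>a<n. M $$ (a, i) * N $$ (n + a, j)) + (\<Sum>a<n. M $$ (n + a, i) * - N $$ (a, j))"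
  proof -
    have "(\<Sum>a<n+n. h a) = (\<Sum>a<n. h a) + (\<Sum>a<n. h (n + a))" for h :: "nat \<Rightarrow> 'a"
    proof -
      have "(\<Sum>a\<in>{0..<n+n}. h a) = (\<Sum>a\<in>{0..<n}. h a) + (\<Sum>a\<in>{n..<n+n}. h a)" by (simp add: sum.atLeastLessThan_concat)
      also have "(\<Sum>a\<in>{n..<n+n}. h a) = (\<Sum>a\<in>{0..<n}. h (n + a))"
        using sum.shift_bounds_nat_ivl[of h 0 n n] by (simp add: add.commute)
      finally show ?thesis by (simp add: atLeast0LessThan)
    qed
    then show ?thesis by simp
  qed
  finally show ?thesis by (simp add: vec_form_def sum_subtractf sum_negf)
qed

text \<open>Membership is defined by P G P^T = G, whereas frames speak about the columns of P, that
  is about P^T G P = G. \<open>key\<close> passes from one to the other because a one-sided inverse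
  is two-sided; for the converse it is applied to the transpose.\<close>

lemma Sp_iff_gram:
  fixes P :: "'a :: field mat"
  assumes P: "P \<in> carrier_mat (2 * n) (2 * n)"
  shows "P \<in> carrier (Sp n) \<longleftrightarrow> transpose_mat P * (symplectic_form n * P) = symplectic_form n"
proof -
  let ?G = "symplectic_form n :: 'a mat"
  have G: "?G \<in> carrier_mat (2 * n) (2 * n)" by simp
  have GG: "?G * (- ?G) = 1\<^sub>m (2 * n)" by (rule symplectic_form_sq)
  have G': "- ?G \<in> carrier_mat (2 * n) (2 * n)" using G by simp
  have GG': "(- ?G) * ?G = 1\<^sub>m (2 * n)" by (rule mat_mult_left_right_inverse[OF G G' GG])
  note as = assoc_mult_mat[of _ "2*n" "2*n" _ "2*n" _ "2*n"] mult_carrier_mat[of _ "2*n" "2*n" _ "2*n"]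
  have key: "transpose_mat M * (?G * M) = ?G" if M: "M \<in> carrier_mat (2 * n) (2 * n)" and e: "M * ?G * transpose_mat M = ?G" for M
  proof -
    have t: "transpose_mat M \<in> carrier_mat (2 * n) (2 * n)" using M by simp
    have "M * (?G * transpose_mat M * (- ?G)) = 1\<^sub>m (2 * n)"
    proof -
      have "M * (?G * transpose_mat M * (- ?G)) = (M * ?G * transpose_mat M) * (- ?G)" using M G G' t by (simp add: as)
      then show ?thesis unfolding e GG .
    qed
    then have "(?G * transpose_mat M * (- ?G)) * M = 1\<^sub>m (2 * n)"
      by (rule mat_mult_left_right_inverse[rotated 2]) (use M G G' t in \<open>auto intro!: mult_carrier_mat[of _ "2*n" "2*n"]\<close>)
    then have "(- ?G) * ((?G * transpose_mat M * (- ?G)) * M) = - ?G" by (simp only: right_mult_one_mat[OF G'])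
    moreover have "(- ?G) * ((?G * transpose_mat M * (- ?G)) * M) = ((- ?G) * ?G) * (transpose_mat M * ((- ?G) * M))"
      using M G G' t by (simp add: as)
    moreover have "transpose_mat M * ((- ?G) * M) = - (transpose_mat M * (?G * M))"
      using M t G uminus_mult_left_mat[of ?G M] uminus_mult_right_mat[of "transpose_mat M" "?G * M"] by (simp add: carrier_matD[OF G])
    ultimately have "1\<^sub>m (2 * n) * - (transpose_mat M * (?G * M)) = - ?G" unfolding GG' by simp
    moreover have c: "transpose_mat M * (?G * M) \<in> carrier_mat (2 * n) (2 * n)" using M t G by (simp add: as)
    ultimately have "- (transpose_mat M * (?G * M)) = - ?G" using left_mult_one_mat[OF uminus_carrier_mat[OF c]] by simp
    then show ?thesis using c G by (metis uminus_uminus_mat)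
  qed
  show ?thesis
  proof
    assume "P \<in> carrier (Sp n)"
    then show "transpose_mat P * (?G * P) = ?G" using key[OF P] by (simp add: Sp_iff)
  next
    assume e: "transpose_mat P * (?G * P) = ?G"
    have t: "transpose_mat P \<in> carrier_mat (2 * n) (2 * n)" using P by simp
    have "transpose_mat P * ?G * transpose_mat (transpose_mat P) = ?G" using e t P G by (simp add: as)
    from key[OF t this] have "P * (?G * transpose_mat P) = ?G" by simp
    then show "P \<in> carrier (Sp n)" unfolding Sp_iff using P t G by (simp add: as)
  qed
qed

lemma mat_fun_isometry:
  assumes P: "P \<in> carrier (Sp n)"
  shows "coord.isometry n (vec_space n) (mat_fun P)"
  unfolding coord.isometry_def
proof (intro conjI allI ballI)
  note c = Sp_carrier_mat[OF P]
  show "mat_fun P (x + y) = mat_fun P x + mat_fun P y" for x y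
    using c by (auto simp: mat_fun_def fun_eq_iff algebra_simps sum.distrib)
  show "mat_fun P (vec_scale k x) = vec_scale k (mat_fun P x)" for k x
    using c by (auto simp: mat_fun_def vec_scale_def fun_eq_iff sum_distrib_left algebra_simps)
  show "mat_fun P x \<in> vec_space n" for x using c by (auto simp: mat_fun_def vec_space_def)
  fix x y :: "nat \<Rightarrow> 'a"
  let ?m = "\<lambda>x. mat (2 * n) 1 (\<lambda>(i, _). x i)"
  have m: "?m x \<in> carrier_mat (2 * n) 1" for x :: "nat \<Rightarrow> 'a" by simp
  have Pm: "P * ?m x \<in> carrier_mat (2 * n) 1" for x using c by simp
  have G: "symplectic_form n \<in> carrier_mat (2 * n) (2 * n)" by simp
  have f: "vec_form n (\<lambda>a. ?m x $$ (a, 0)) (\<lambda>a. ?m y $$ (a, 0)) = vec_form n x y" for x y :: "nat \<Rightarrow> 'a"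
    by (rule vec_form_cong) auto
  have pm: "(P * ?m x) $$ (a, 0) = mat_fun P x a" if "a < 2 * n" for a x
    using that c by (subst mult_mat_index[OF c m]) (auto simp: mat_fun_def)
  have f': "vec_form n (\<lambda>a. (P * ?m x) $$ (a, 0)) (\<lambda>a. (P * ?m y) $$ (a, 0)) = vec_form n (mat_fun P x) (mat_fun P y)"
    by (rule vec_form_cong) (rule pm, assumption)+
  have "vec_form n (mat_fun P x) (mat_fun P y) = (transpose_mat (P * ?m x) * (symplectic_form n * (P * ?m y))) $$ (0, 0)"
    unfolding f'[symmetric] by (rule gram_index[OF Pm Pm, symmetric]) auto
  also have "transpose_mat (P * ?m x) * (symplectic_form n * (P * ?m y))
    = transpose_mat (?m x) * ((transpose_mat P * (symplectic_form n * P)) * ?m y)"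
  proof -
    have t: "transpose_mat P \<in> carrier_mat (2*n) (2*n)" "transpose_mat (?m x) \<in> carrier_mat 1 (2 * n)" using c by auto
    have GP: "symplectic_form n * P \<in> carrier_mat (2*n) (2*n)" by (rule mult_carrier_mat[OF G c])
    have "symplectic_form n * (P * ?m y) = (symplectic_form n * P) * ?m y" by (rule assoc_mult_mat[symmetric, OF G c m])
    moreover have "transpose_mat (P * ?m x) = transpose_mat (?m x) * transpose_mat P" by (rule transpose_mult[OF c m])
    moreover have "transpose_mat (?m x) * transpose_mat P * (symplectic_form n * P * ?m y) = transpose_mat (?m x) * (transpose_mat P * (symplectic_form n * P * ?m y))"
      by (rule assoc_mult_mat[OF t(2) t(1) mult_carrier_mat[OF GP m]])
    moreover have "transpose_mat P * (symplectic_form n * P * ?m y) = transpose_mat P * (symplectic_form n * P) * ?m y"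
      by (rule assoc_mult_mat[symmetric, OF t(1) GP m])
    ultimately show ?thesis by simp
  qed
  also have "transpose_mat P * (symplectic_form n * P) = symplectic_form n" using P Sp_iff_gram[OF c] by simp
  also have "(transpose_mat (?m x) * (symplectic_form n * ?m y)) $$ (0, 0)
      = vec_form n (\<lambda>a. ?m x $$ (a, 0)) (\<lambda>a. ?m y $$ (a, 0))"
    by (rule gram_index[OF m m]) auto
  also have "\<dots> = vec_form n x y" by (rule f)
  finally show "vec_form n (mat_fun P x) (mat_fun P y) = vec_form n x y" .
qed

text \<open>The frame vectors are the columns of a symplectic matrix g, and N = g^-1 P g satisfies G
  N = g^T G P g. So the entries of N are values of the form up to sign, and skew symmetry absorbs
  the sign.\<close>

lemma frame_block:
  fixes P :: "'a :: field mat"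
  assumes P: "P \<in> carrier (Sp n)" and F: "coord.frame n (vec_space n) n e f"
  shows "\<exists>A B C D. A \<in> carrier_mat n n \<and> B \<in> carrier_mat n n \<and> C \<in> carrier_mat n n \<and> D \<in> carrier_mat n n \<and>
    sp_conj n P (four_block_mat A B C D) \<and> A = mat n n (\<lambda>(i, j). vec_form n (mat_fun P (e j)) (f i))"
proof -
  let ?G = "symplectic_form n :: 'a mat"
  note c = Sp_carrier_mat[OF P]
  have G: "?G \<in> carrier_mat (2 * n) (2 * n)" by simp
  have G': "- ?G \<in> carrier_mat (2 * n) (2 * n)" using G by simp
  define h where "h j = (if j < n then e j else f (j - n))" for j
  define g where "g = mat (2 * n) (2 * n) (\<lambda>(i, j). h j i)"
  have g: "g \<in> carrier_mat (2 * n) (2 * n)" by (simp add: g_def)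
  have col: "vec_form n (\<lambda>a. g $$ (a, i)) y = vec_form n (h i) y" "vec_form n y (\<lambda>a. g $$ (a, i)) = vec_form n y (h i)" if "i < 2 * n" for i y
    using that unfolding vec_form_def by (auto intro!: sum.cong simp: g_def)
  note D = coord.frameD[OF F]
  have gS: "g \<in> carrier (Sp n)"
    unfolding Sp_iff_gram[OF g]
  proof (rule eq_matI)
    fix i j assume "i < dim_row ?G" "j < dim_col ?G"
    then have ij: "i < 2 * n" "j < 2 * n" using G by auto
    have "(transpose_mat g * (?G * g)) $$ (i, j) = vec_form n (h i) (h j)"
      using gram_index[OF g g ij] col ij by simp
    also have "\<dots> = ?G $$ (i, j)"
      unfolding symplectic_form_index[OF ij] h_def using D(4-7) ij by auto
    finally show "(transpose_mat g * (?G * g)) $$ (i, j) = ?G $$ (i, j)" .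
  qed (use g carrier_matD[OF G] in auto)
  obtain g' where g': "g' \<in> carrier (Sp n)" "g * g' = 1\<^sub>m (2 * n)" "g' * g = 1\<^sub>m (2 * n)" by (rule Sp_inverse[OF gS])
  note gc' = Sp_carrier_mat[OF g'(1)]
  note as = assoc_mult_mat[of _ "2*n" "2*n" _ "2*n" _ "2*n"] mult_carrier_mat[of _ "2*n" "2*n" _ "2*n"]
  define N where "N = g' * (P * g)"
  have N: "N \<in> carrier_mat (2 * n) (2 * n)" unfolding N_def using gc' c g by (simp add: as)
  have gN: "P * g = g * N"
  proof -
    have "g * N = (g * g') * (P * g)" unfolding N_def using g gc' c by (simp add: as)
    then show ?thesis unfolding g'(2) using c g by (simp add: as)
  qed
  have tg: "transpose_mat g \<in> carrier_mat (2 * n) (2 * n)" using g by simp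
  have e1: "?G * N = transpose_mat g * (?G * (P * g))"
  proof -
    have "transpose_mat g * (?G * (P * g)) = (transpose_mat g * (?G * g)) * N"
      unfolding gN using g G tg N by (simp add: as)
    also have "transpose_mat g * (?G * g) = ?G" using gS Sp_iff_gram[OF g] by simp
    finally show ?thesis by simp
  qed
  have Nij: "N $$ (i, j) = vec_form n (mat_fun P (e j)) (f i)" if ij: "i < n" "j < n" for i j
  proof -
    have Pg: "P * g \<in> carrier_mat (2 * n) (2 * n)" using c g by simp
    have "- N $$ (i, j) = (?G * N) $$ (n + i, j)" using ij by (subst symplectic_form_mult[OF N]) auto
    also have "\<dots> = vec_form n (\<lambda>a. g $$ (a, n + i)) (\<lambda>a. (P * g) $$ (a, j))"
      unfolding e1 by (rule gram_index[OF g Pg]) (use ij in auto)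
    also have "\<dots> = vec_form n (h (n + i)) (\<lambda>a. (P * g) $$ (a, j))" using col ij by simp
    also have "\<dots> = vec_form n (f i) (mat_fun P (e j))"
    proof -
      have "(P * g) $$ (a, j) = mat_fun P (e j) a" if "a < 2 * n" for a
      proof -
        have "(P * g) $$ (a, j) = (\<Sum>l<2*n. P $$ (a, l) * g $$ (l, j))" by (rule mult_mat_index[OF c g]) (use that ij in auto)
        then show ?thesis using that ij c by (simp add: mat_fun_def g_def h_def)
      qed
      then show ?thesis by (intro vec_form_cong) (auto simp: h_def simp del: index_mult_mat)
    qed
    finally show ?thesis using coord.skew[of n "f i" "mat_fun P (e j)"] by simp
  qed
  obtain A B C D where b: "split_block N n n = (A, B, C, D)" by (metis prod_cases4)
  have bl: "A \<in> carrier_mat n n" "B \<in> carrier_mat n n" "C \<in> carrier_mat n n" "D \<in> carrier_mat n n" "N = four_block_mat A B C D"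
    using split_block[OF b, of n n] N by (auto simp: mult_2)
  have "A = mat n n (\<lambda>(i, j). vec_form n (mat_fun P (e j)) (f i))"
  proof (rule eq_matI)
    fix i j assume "i < dim_row (mat n n (\<lambda>(i, j). vec_form n (mat_fun P (e j)) (f i)))"
      "j < dim_col (mat n n (\<lambda>(i, j). vec_form n (mat_fun P (e j)) (f i)))"
    then have ij: "i < n" "j < n" by auto
    then have "A $$ (i, j) = N $$ (i, j)" using bl by simp
    then show "A $$ (i, j) = mat n n (\<lambda>(i, j). vec_form n (mat_fun P (e j)) (f i)) $$ (i, j)" using Nij[OF ij] ij by simp
  qed (use bl in auto)
  moreover have "sp_conj n P N" unfolding sp_conj_def using gS gN by blast
  ultimately show ?thesis using bl by blast
qed

section \<open>Admissible polynomials\<close>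

text \<open>Take Y = C and conjugate C by the diagonal matrix of the partial products d_i of the
  \<alpha>. The subdiagonal ones match automatically; a nonzero entry - q_k of the first row, in
  column n-1-k, matches exactly if d_(n-1-k) = 1. Each nonzero coefficient of q thus costs one
  condition.\<close>

lemma good_diagonal:
  fixes q :: "'a :: field poly"
  assumes q: "monic q" and n: "degree q = n" and nz: "\<And>i. i < n \<Longrightarrow> \<alpha> i \<noteq> 0"
    and c: "\<And>k. k < n \<Longrightarrow> coeff q k \<noteq> 0 \<Longrightarrow> (\<Prod>i<n - k. \<alpha> i) = 1"
  shows "good q (mat n n (\<lambda>(i, j). if i = j then \<alpha> i else 0))"
proof -
  define diag where "diag f = mat n n (\<lambda>(i, j). if i = j then f i else 0 :: 'a)" for f
  define d where "d i = (\<Prod>l<Suc i. \<alpha> l)" for i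
  let ?C = "companion q"
  have C: "?C \<in> carrier_mat n n" using companion_carrier[of q] n by simp
  have D: "diag f \<in> carrier_mat n n" for f by (simp add: diag_def)
  have dl: "(diag f * M) $$ (i, j) = f i * M $$ (i, j)" if "M \<in> carrier_mat n n" "i < n" "j < n" for f M i j
  proof -
    have "(diag f * M) $$ (i, j) = (\<Sum>l<n. diag f $$ (i, l) * M $$ (l, j))" by (rule mult_mat_index[OF D that])
    also have "\<dots> = (\<Sum>l<n. if l = i then f i * M $$ (i, j) else 0)" using that by (intro sum.cong) (auto simp: diag_def)
    finally show ?thesis using that by simp
  qed
  have dr: "(M * diag f) $$ (i, j) = M $$ (i, j) * f j" if "M \<in> carrier_mat n n" "i < n" "j < n" for f M i j
  proof -
    have "(M * diag f) $$ (i, j) = (\<Sum>l<n. M $$ (i, l) * diag f $$ (l, j))" by (rule mult_mat_index[OF that(1) D that(2,3)])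
    also have "\<dots> = (\<Sum>l<n. if l = j then M $$ (i, j) * f j else 0)" using that by (intro sum.cong) (auto simp: diag_def)
    finally show ?thesis using that by simp
  qed
  have dnz: "d i \<noteq> 0" if "i < n" for i unfolding d_def using nz that by auto
  have dd: "diag d * diag (\<lambda>i. inverse (d i)) = 1\<^sub>m n"
  proof (rule eq_matI)
    fix i j assume "i < dim_row (1\<^sub>m n :: 'a mat)" "j < dim_col (1\<^sub>m n :: 'a mat)"
    then have ij: "i < n" "j < n" by auto
    then show "(diag d * diag (\<lambda>i. inverse (d i))) $$ (i, j) = 1\<^sub>m n $$ (i, j)"
      unfolding dl[OF D ij] using dnz by (simp add: diag_def)
  qed (use D in \<open>auto simp: diag_def\<close>)
  have "diag \<alpha> * ?C = diag d * ?C * diag (\<lambda>i. inverse (d i))"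
  proof (rule eq_matI)
    fix i j assume "i < dim_row (diag d * ?C * diag (\<lambda>i. inverse (d i)))" "j < dim_col (diag d * ?C * diag (\<lambda>i. inverse (d i)))"
    then have ij: "i < n" "j < n" by (simp_all add: diag_def)
    have "\<alpha> i * ?C $$ (i, j) = d i * ?C $$ (i, j) * inverse (d j)"
    proof -
      have "i = Suc j \<or> (i = 0 \<and> coeff q (n - 1 - j) \<noteq> 0) \<or> ?C $$ (i, j) = 0" using ij n by (auto simp: companion_def)
      then consider "i = Suc j" | "i = 0" "coeff q (n - 1 - j) \<noteq> 0" | "?C $$ (i, j) = 0" by blast
      then show ?thesis
      proof cases
        case 1
        moreover have "d (Suc j) = d j * \<alpha> (Suc j)" by (simp add: d_def)
        ultimately show ?thesis using dnz[OF ij(2)] by simp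
      next
        case 2
        then have "(\<Prod>i<n - (n - 1 - j). \<alpha> i) = 1" using ij by (intro c) auto
        moreover have "n - (n - 1 - j) = Suc j" using ij by simp
        ultimately have "d j = 1" by (simp add: d_def)
        then show ?thesis using 2 by (simp add: d_def)
      qed simp
    qed
    then show "(diag \<alpha> * ?C) $$ (i, j) = (diag d * ?C * diag (\<lambda>i. inverse (d i))) $$ (i, j)"
      using dl[OF C ij] dr[OF mult_carrier_mat[OF D C] ij] by (simp del: index_mult_mat)
  qed (use C in \<open>auto simp: diag_def\<close>)
  then have "similar_mat (diag \<alpha> * ?C) ?C"
    by (rule similar_mat_intro[OF mult_carrier_mat[OF D C] C D D dd])
  moreover have "similar_mat ?C ?C" by (rule similar_mat_refl[OF C])
  ultimately show ?thesis unfolding good_def diag_def by blast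
qed

lemma good_diagonal_permute:
  fixes q :: "'a :: field poly"
  assumes n: "degree q = n" and \<pi>: "bij_betw \<pi> {..<n} {..<n}"
    and g: "good q (mat n n (\<lambda>(i, j). if i = j then \<alpha> (\<pi> i) else 0))"
  shows "good q (mat n n (\<lambda>(i, j). if i = j then \<alpha> i else 0))"
proof -
  let ?A = "mat n n (\<lambda>(i, j). if i = j then \<alpha> i else 0)"
  have into: "\<pi> i < n" if "i < n" for i using bij_betwE[OF \<pi>] that by auto
  have inj: "inj_on \<pi> {..<n}" by (rule bij_betw_imp_inj_on[OF \<pi>])
  have "similar_mat (mat n n (\<lambda>(i, j). ?A $$ (\<pi> i, \<pi> j))) ?A"
    by (rule similar_mat_reindex[OF _ inj into]) auto
  moreover have "mat n n (\<lambda>(i, j). ?A $$ (\<pi> i, \<pi> j)) = mat n n (\<lambda>(i, j). if i = j then \<alpha> (\<pi> i) else 0)"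
    using into inj by (intro eq_matI) (auto simp: inj_on_def)
  ultimately have "similar_mat ?A (mat n n (\<lambda>(i, j). if i = j then \<alpha> (\<pi> i) else 0))"
    by (simp only: similar_mat_sym)
  then show ?thesis by (rule good_similar[OF g]) (simp add: n)
qed

section \<open>Binomials and trinomials coprime to their reciprocals\<close>

lemma binomial_poly:
  fixes \<delta> :: "'a :: field"
  assumes n: "1 \<le> n" and \<delta>: "\<delta> \<noteq> 0" "\<delta> * \<delta> \<noteq> 1"
  defines "q \<equiv> monom 1 n + [:\<delta>:]"
  shows "monic q" "degree q = n" "poly q 0 \<noteq> 0" "coprime q (reciprocal_poly q)" "\<And>k. coeff q k \<noteq> 0 \<Longrightarrow> k < n \<Longrightarrow> k = 0"
proof -
  show deg: "degree q = n" unfolding q_def using n by (subst degree_add_eq_left) (auto simp: degree_monom_eq)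
  have co: "coeff q k = (if k = n then 1 else if k = 0 then \<delta> else 0)" for k
    using n by (cases k) (auto simp: q_def coeff_pCons split: nat.split)
  show "monic q" using deg co by simp
  show q0: "poly q 0 \<noteq> 0" using \<delta> n co[of 0] by (simp add: poly_0_coeff_0)
  show "k = 0" if "coeff q k \<noteq> 0" "k < n" for k using that co[of k] by (auto split: if_splits)
  have "reciprocal_poly q = monom 1 n + [:inverse \<delta>:]"
  proof (rule poly_eqI)
    fix k
    have c0: "poly q 0 = \<delta>" using n by (simp add: poly_0_coeff_0 co)
    have "coeff (monom 1 n + [:inverse \<delta>:]) k = (if k = n then 1 else if k = 0 then inverse \<delta> else 0)"
      using n by (cases k) auto
    moreover have "coeff (reciprocal_poly q) k = inverse \<delta> * (if n < k then 0 else coeff q (n - k))"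
      unfolding reciprocal_poly_def c0 by (simp add: coeff_reflect_poly deg)
    moreover have "inverse \<delta> * (if n < k then 0 else coeff q (n - k)) = (if k = n then 1 else if k = 0 then inverse \<delta> else 0)"
      unfolding co using n \<delta> by auto
    ultimately show "coeff (reciprocal_poly q) k = coeff (monom 1 n + [:inverse \<delta>:]) k" by simp
  qed
  \<comment> \<open>The two binomials differ by a constant, which is nonzero because the square of
    \<delta> is not 1.\<close>
  then have diff: "q - reciprocal_poly q = [:\<delta> - inverse \<delta>:]" by (simp add: q_def)
  have ne: "\<delta> - inverse \<delta> \<noteq> 0" 
  proof
    assume "\<delta> - inverse \<delta> = 0"
    then have "\<delta> * \<delta> = \<delta> * inverse \<delta>" by simp
    then show False using \<delta> by simp
  qed
  show "coprime q (reciprocal_poly q)"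
  proof (rule coprimeI)
    fix d assume "d dvd q" "d dvd reciprocal_poly q"
    then have "d dvd [:\<delta> - inverse \<delta>:]" unfolding diff[symmetric] by (rule dvd_diff)
    moreover have "[:\<delta> - inverse \<delta>:] dvd 1" using ne by (simp add: is_unit_pCons_iff)
    ultimately show "is_unit d" by (rule dvd_trans)
  qed
qed

text \<open>The reciprocal is x^n + x^(n-k) - 1 and differs from q by x^k (x^(n-2k) + 1). As x is a
  unit modulo q, a common divisor divides x^(n-2k) + 1, and subtracting q from x^(2k) times that
  leaves x^(2k) + x^k + 1. Coprimality is then decided by these two polynomials, according to the
  characteristic.\<close>

lemma trinomial_poly:
  fixes n k :: nat
  assumes k: "1 \<le> k" "2 * k \<le> n"
  defines "q \<equiv> monom 1 n - monom 1 k - (1 :: 'a :: field poly)"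
  shows "monic q" "degree q = n" "poly q 0 \<noteq> 0" "\<And>j. coeff q j \<noteq> 0 \<Longrightarrow> j < n \<Longrightarrow> j = 0 \<or> j = k"
    "d dvd q \<Longrightarrow> d dvd reciprocal_poly q \<Longrightarrow> d dvd [:0, 1:] ^ (n - 2 * k) + 1 \<and> d dvd [:0, 1:] ^ (2 * k) + [:0, 1:] ^ k + 1"
proof -
  have kn: "k < n" using k by simp
  have co: "coeff q j = (if j = n then 1 else if j = k then - 1 else if j = 0 then - 1 else 0)" for j
    using k kn by (cases j) (auto simp: q_def one_pCons coeff_pCons split: nat.split)
  have "degree q \<le> n" by (rule degree_le) (use kn co in auto)
  moreover have "n \<le> degree q" by (rule le_degree) (simp add: co)
  ultimately show deg: "degree q = n" by simp
  show "monic q" using deg co by simp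
  show q0: "poly q 0 \<noteq> 0" using co[of 0] k kn by (simp add: poly_0_coeff_0)
  show "j = 0 \<or> j = k" if "coeff q j \<noteq> 0" "j < n" for j using that co[of j] by (auto split: if_splits)
  let ?x = "[:0, 1 :: 'a:]"
  have m: "monom 1 j = ?x ^ j" for j by (simp add: monom_altdef)
  have "reciprocal_poly q = monom 1 n + monom 1 (n - k) - 1"
  proof (rule poly_eqI)
    fix j
    have c0: "poly q 0 = - 1" using k kn by (simp add: poly_0_coeff_0 co)
    have "coeff (monom 1 n + monom 1 (n - k) - 1 :: 'a poly) j = (if j = n then 1 else if j = n - k then 1 else if j = 0 then - 1 else 0)"
      using k kn by (cases j) (auto simp: one_pCons)
    moreover have "coeff (reciprocal_poly q) j = - (if n < j then 0 else coeff q (n - j))"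
      unfolding reciprocal_poly_def c0 by (simp add: coeff_reflect_poly deg)
    moreover have "- (if n < j then 0 else coeff q (n - j)) = (if j = n then 1 else if j = n - k then 1 else if j = 0 then - 1 else 0)"
      unfolding co using k kn by auto
    ultimately show "coeff (reciprocal_poly q) j = coeff (monom 1 n + monom 1 (n - k) - 1) j" by simp
  qed
  then have r: "reciprocal_poly q = ?x ^ n + ?x ^ (n - k) - 1" by (simp add: m)
  have qx: "q = ?x ^ n - ?x ^ k - 1" by (simp add: q_def m)
  let ?e = "?x ^ (n - 2 * k) + 1"
  have p1: "?x ^ n = ?x ^ (2 * k) * ?x ^ (n - 2 * k)" "?x ^ (n - k) = ?x ^ k * ?x ^ (n - 2 * k)" "?x ^ n = ?x ^ k * ?x ^ (n - k)"
    using k kn by (simp_all add: power_add[symmetric])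
  assume d: "d dvd q" "d dvd reciprocal_poly q"
  have "reciprocal_poly q - q = ?x ^ k * ?e" unfolding r unfolding qx p1(2) by (simp add: distrib_left)
  then have a: "d dvd ?x ^ k * ?e" using dvd_diff[OF d(2,1)] by (simp only:)
  have ids: "e = (g * (X * e)) - e * (X * g - 1)" for e g X :: "'a poly" by (simp add: algebra_simps)
  have qe: "q = ?x ^ k * (?x ^ (n - k) - 1) - 1" unfolding qx p1(3) by (simp add: algebra_simps)
  have "d dvd (?x ^ (n - k) - 1) * (?x ^ k * ?e) - ?e * q" by (rule dvd_diff[OF dvd_mult[OF a] dvd_mult[OF d(1)]])
  also have "(?x ^ (n - k) - 1) * (?x ^ k * ?e) - ?e * q = ?e" unfolding qe by (rule ids[symmetric])
  finally have e: "d dvd ?e" .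
  have ids2: "Y * e - (Y * (e - 1) - X - 1) = Y + X + 1" for e X Y :: "'a poly" by (simp add: algebra_simps)
  have qe2: "q = ?x ^ (2 * k) * (?e - 1) - ?x ^ k - 1" unfolding qx p1(1) by simp
  have "d dvd ?x ^ (2 * k) * ?e - q" by (rule dvd_diff[OF dvd_mult[OF e] d(1)])
  also have "?x ^ (2 * k) * ?e - q = ?x ^ (2 * k) + ?x ^ k + 1" unfolding qe2 by (rule ids2)
  finally have "d dvd ?x ^ (2 * k) + ?x ^ k + 1" .
  then show "d dvd ?e \<and> d dvd ?x ^ (2 * k) + ?x ^ k + 1" using e by blast
qed

text \<open>Modulo d the element w is nilpotent, so c + w z with c nonzero is a unit; but it is also
  0 there.\<close>

lemma unit_if_dvd_square:
  fixes d w z :: "'a :: field poly"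
  assumes "d dvd w * w" "d dvd [:c:] + w * z" "c \<noteq> 0"
  shows "d dvd 1"
proof -
  have "d dvd ([:c:] + w * z) * ([:c:] - w * z) + w * w * (z * z)" by (rule dvd_add[OF dvd_mult2[OF assms(2)] dvd_mult2[OF assms(1)]])
  also have "([:c:] + w * z) * ([:c:] - w * z) + w * w * (z * z) = [:c * c:]" by (simp add: algebra_simps)
  also have "[:c * c:] dvd 1" using assms(3) by (simp add: is_unit_pCons_iff)
  finally show ?thesis .
qed

lemma minus_one_dvd_power_minus_one: "y - 1 dvd y ^ N - (1 :: 'a :: comm_ring_1)"
proof (induction N)
  case (Suc N)
  have "y ^ Suc N - 1 = y * (y ^ N - 1) + (y - 1)" by (simp add: algebra_simps)
  moreover have "y - 1 dvd y * (y ^ N - 1) + (y - 1)" using Suc by simp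
  ultimately show ?case by (simp only:)
qed simp

text \<open>In characteristic 3, with y = x^k, the polynomial y^2 + y + 1 is the square of y - 1,
  and y^N + 1 is 2 modulo y - 1. That k divides n makes x^(n-2k) a power of y.\<close>

lemma trinomial_coprime_3:
  assumes k: "1 \<le> k" "2 * k \<le> n" "k dvd n" and three: "(3 :: 'a :: field) = 0"
  defines "q \<equiv> monom 1 n - monom 1 k - (1 :: 'a poly)"
  shows "coprime q (reciprocal_poly q)"
proof (rule coprimeI)
  fix d assume "d dvd q" "d dvd reciprocal_poly q"
  then have e: "d dvd [:0, 1:] ^ (n - 2 * k) + 1" "d dvd [:0, 1:] ^ (2 * k) + [:0, 1:] ^ k + 1"
    using trinomial_poly(5)[OF k(1,2)] unfolding q_def by blast+
  define y where "y = [:0, 1 :: 'a:] ^ k"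
  have "k dvd n - 2 * k" using k by (intro dvd_diff_nat) auto
  then obtain N where N: "n - 2 * k = k * N" by blast
  obtain s where s: "y ^ N - 1 = (y - 1) * s" using minus_one_dvd_power_minus_one[of y N] by (rule dvdE)
  have three': "(3 :: 'a poly) = 0" using three by (simp add: numeral_poly)
  have "y * y + y + 1 = (y - 1) * (y - 1) + 3 * y" by (simp add: algebra_simps)
  then have "d dvd (y - 1) * (y - 1)" using e(2) three' unfolding y_def by (simp add: power_add mult_2)
  moreover have "d dvd [:2:] + (y - 1) * s"
  proof -
    have c2: "[:2 :: 'a:] = 1 + 1" by (simp add: one_pCons)
    have "[:0, 1:] ^ (n - 2 * k) + 1 = [:2:] + (y ^ N - 1)" unfolding N y_def power_mult c2 by simp
    then show ?thesis using e(1) s by simp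
  qed
  moreover have "(2 :: 'a) \<noteq> 0"
  proof
    assume "(2 :: 'a) = 0"
    moreover have "(3 :: 'a) = 2 + 1" by simp
    ultimately show False using three by simp
  qed
  ultimately show "is_unit d" by (rule unit_if_dvd_square)
qed

text \<open>In characteristic 2, with T = x^2 + x + 1, the polynomial x^(2k) + x^k + 1 is T for k =
  1 and T^2 for k = 2. Modulo T the cube of x is 1, so x^(n-2k) + 1 depends only on the exponent
  modulo 3 and is a unit unless that is 0.\<close>

lemma trinomial_coprime_2:
  assumes k: "k = 1 \<or> k = 2" "2 * k \<le> n" "(n - 2 * k) mod 3 \<noteq> 0" and two: "(2 :: 'a :: field) = 0"
  defines "q \<equiv> monom 1 n - monom 1 k - (1 :: 'a poly)"
  shows "coprime q (reciprocal_poly q)"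
proof (rule coprimeI)
  have k1: "1 \<le> k" using k by auto
  fix d assume "d dvd q" "d dvd reciprocal_poly q"
  then have e: "d dvd [:0, 1:] ^ (n - 2 * k) + 1" "d dvd [:0, 1:] ^ (2 * k) + [:0, 1:] ^ k + 1"
    using trinomial_poly(5)[OF k1 k(2)] unfolding q_def by blast+
  define x where "x = [:0, 1 :: 'a:]"
  define M where "M = n - 2 * k"
  let ?T = "x * x + x + 1"
  have two': "(2 :: 'a poly) = 0" using two by (simp add: numeral_poly)
  have dbl: "p + p = 0" for p :: "'a poly" using two' by (metis mult_2 mult_zero_left)
  have neg: "- p = p" for p :: "'a poly" by (rule minus_unique[OF dbl])
  have TT: "d dvd ?T * ?T"
    using k(1)
  proof
    assume "k = 1"
    then have "d dvd ?T" using e(2) by (simp add: x_def power2_eq_square numeral_2_eq_2)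
    then show ?thesis by simp
  next
    assume "k = 2"
    then have "d dvd x * x * x * x + x * x + 1" using e(2) by (simp add: x_def numeral_eq_Suc mult.assoc)
    moreover have "?T * ?T = x * x * x * x + x * x + 1 + (x * x * x + x * x * x) + (x * x + x * x) + (x + x)" by (simp add: algebra_simps)
    ultimately show ?thesis by (simp only: dbl add_0_right)
  qed
  define t r where "t = M div 3" and "r = M mod 3"
  have M: "M = 3 * t + r" by (simp add: t_def r_def)
  have "x ^ 3 - 1 dvd (x ^ 3) ^ t - 1" by (rule minus_one_dvd_power_minus_one)
  moreover have "x ^ 3 - 1 = ?T * (x - 1)" by (simp add: algebra_simps power3_eq_cube)
  ultimately have "?T * (x - 1) dvd (x ^ 3) ^ t - 1" by (simp only:)
  then have "?T dvd (x ^ 3) ^ t - 1" by (rule dvd_mult_left)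
  then have "?T dvd x ^ r * ((x ^ 3) ^ t - 1)" by (rule dvd_mult)
  then obtain s where s: "x ^ r * ((x ^ 3) ^ t - 1) = ?T * s" by blast
  have xM: "x ^ M + 1 = x ^ r + 1 + ?T * s"
  proof -
    have "x ^ M = x ^ r * (x ^ 3) ^ t" unfolding M power_add power_mult by (rule mult.commute)
    then show ?thesis unfolding s[symmetric] by (simp add: right_diff_distrib)
  qed
  have e1: "d dvd x ^ M + 1" using e(1) by (simp add: x_def M_def)
  have c1: "[:1 :: 'a:] = 1" by (simp add: one_pCons)
  have "r = 1 \<or> r = 2" using k(3) by (auto simp: r_def M_def)
  \<comment> \<open>The inverse b of x^r + 1 modulo T is x for r = 1 and x + 1 for r = 2.\<close>
  then obtain b z where bz: "(x ^ r + 1 + ?T * s) * b = [:1:] + ?T * z"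
  proof
    assume r: "r = 1"
    have "(x + 1 + ?T * s) * x = 1 + ?T * (1 + s * x) - (1 + 1)" by (simp add: algebra_simps)
    also have "\<dots> = 1 + ?T * (1 + s * x)" by (simp only: dbl diff_0_right)
    finally have "(x ^ r + 1 + ?T * s) * x = [:1:] + ?T * (1 + s * x)" by (simp only: c1 r power_one_right)
    then show ?thesis by (rule that)
  next
    assume r: "r = 2"
    have "(x ^ 2 + 1 + ?T * s) * (x + 1) = 1 + ?T * (x + s * (x + 1))" 
      by (simp add: algebra_simps power2_eq_square)
    then have "(x ^ r + 1 + ?T * s) * (x + 1) = [:1:] + ?T * (x + s * (x + 1))" by (simp only: c1 r)
    then show ?thesis by (rule that)
  qed
  have "d dvd [:1:] + ?T * z" unfolding bz[symmetric] using e1 xM by (simp add: dvd_mult2)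
  from unit_if_dvd_square[OF TT this] show "is_unit d" by simp
qed

text \<open>The element t serves the trace 0 for n = 2. Outside characteristics 2 and 3 one can take
  t = 1 and \<delta> = -2, as \<delta>^2 - 1 = 3. In characteristic 3 the square of t has to avoid
  0, 1 and -1, which one of m and m + 1 achieves.\<close>

lemma binomial_parameter:
  fixes m :: "'a :: field"
  assumes m: "m \<noteq> 0" "m \<noteq> 1" "m \<noteq> - 1"
  obtains \<delta> t :: 'a where "\<delta> \<noteq> 0" "\<delta> * \<delta> \<noteq> 1" "(2 :: 'a) \<noteq> 0 \<Longrightarrow> t \<noteq> 0 \<and> \<delta> = - (1 + t * t)"
proof -
  have m2: "m * m \<noteq> 1" using m by (simp add: square_eq_1_iff)
  consider "(2 :: 'a) = 0" | "(2 :: 'a) \<noteq> 0" "(3 :: 'a) \<noteq> 0" | "(2 :: 'a) \<noteq> 0" "(3 :: 'a) = 0" by blast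
  then show ?thesis
  proof cases
    case 1
    then show ?thesis using that[of m 1] m m2 by blast
  next
    case 2
    have four: "(- 2) * (- 2) \<noteq> (1 :: 'a)"
    proof
      assume "(- 2) * (- 2) = (1 :: 'a)"
      then have "(3 :: 'a) + 1 = 0 + 1" by simp
      then show False using 2(2) unfolding add_right_cancel by simp
    qed
    show ?thesis
    proof (rule that[OF _ four])
      show "(- 2 :: 'a) \<noteq> 0" using 2(1) by simp
      show "(1 :: 'a) \<noteq> 0 \<and> (- 2 :: 'a) = - (1 + 1 * 1)" by simp
    qed
  next
    case 3
    have third: "(1 :: 'a) + 1 = - 1" using 3(2) by (simp add: eq_neg_iff_add_eq_0)
    have ex: "\<exists>t :: 'a. t \<noteq> 0 \<and> t * t \<noteq> 1 \<and> t * t \<noteq> - 1"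
    proof (cases "m * m = - 1")
      case True
      have mm: "(m + 1) * (m + 1) = (m * m + 1) + (1 + 1) * m" by (simp add: algebra_simps)
      then have e: "(m + 1) * (m + 1) = - m" unfolding True third by simp
      have "m + 1 \<noteq> 0" using m by (metis add_eq_0_iff2)
      moreover have "- m \<noteq> 1" "- m \<noteq> - 1" using m by (metis minus_minus)+
      ultimately show ?thesis unfolding e[symmetric] by blast
    qed (use m m2 in blast)
    then obtain t :: 'a where t: "t \<noteq> 0" "t * t \<noteq> 1" "t * t \<noteq> - 1" by blast
    show ?thesis
    proof (rule that[of "- (1 + t * t)" t])
      have "1 + t * t \<noteq> 0" using t(3) add_eq_0_iff[of 1 "t * t"] by blast
      then show "- (1 + t * t) \<noteq> 0" by (simp only: neg_equal_0_iff_equal not_False_eq_True)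
      show "- (1 + t * t) * - (1 + t * t) \<noteq> 1"
      proof
        assume "- (1 + t * t) * - (1 + t * t) = 1"
        then have "1 + t * t = 1 \<or> 1 + t * t = - 1" by (simp only: minus_mult_minus square_eq_1_iff)
        moreover have "1 + t * t \<noteq> 1" using t(1) by simp
        ultimately have "1 + t * t = - 1" by blast
        then have "(1 + t * t) - 1 = - 1 - 1" by (simp only:)
        also have "- 1 - 1 = - (1 + 1 :: 'a)" by simp
        also have "\<dots> = 1" unfolding third by simp
        finally show False using t(2) by simp
      qed
    qed (use t in auto)
  qed
qed

section \<open>Reduction to the upper left block\<close>

lemma minus_one_eq_one: "(2 :: 'a :: ring_1) = 0 \<Longrightarrow> (- 1 :: 'a) = 1"
  by (rule minus_unique) simp

text \<open>Parameters of a shear giving the corner determinant \<sigma> while its characteristic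
  polynomial does not vanish at the last diagonal entry \<rho>; as \<rho>^2 = 1, this excludes just
  the trace \<rho> (1 + \<sigma>). For r = 1 or -1 the determinant fixes p u = k. If every choice
  failed, a quadratic would vanish at all nonzero p, which leaves only fields with the elements 0, 1
  and -1.\<close>

lemma shear_params:
  fixes c1 c2 \<sigma> \<rho> s :: "'a :: field"
  assumes c: "c1 \<noteq> 0" "c2 \<noteq> 0" and \<sigma>: "\<sigma> = 1 \<or> \<sigma> = - 1" and \<rho>: "\<rho> = 1 \<or> \<rho> = - 1"
  shows "\<exists>p r u. r \<noteq> 0 \<and> (p * u - r * r) * (c1 * c2) = \<sigma> \<and> p * c1 + r * s + u * c2 \<noteq> \<rho> * (1 + \<sigma>)"
proof -
  define k where "k = 1 + \<sigma> / (c1 * c2)"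
  define \<tau> where "\<tau> = \<rho> * (1 + \<sigma>)"
  have k: "(k - 1) * (c1 * c2) = \<sigma>" using c by (simp add: k_def)
  show ?thesis
  proof (cases "k = 0")
    case True
    have "\<exists>u. s + u * c2 \<noteq> \<tau>"
    proof (cases "s = \<tau>")
      case True
      then show ?thesis using c by (intro exI[of _ 1]) simp
    next
      case False
      then show ?thesis by (intro exI[of _ 0]) simp
    qed
    then obtain u where "s + u * c2 \<noteq> \<tau>" by blast
    then show ?thesis using k True unfolding \<tau>_def by (intro exI[of _ 0] exI[of _ 1] exI[of _ u]) simp
  next
    case False
    show ?thesis
    proof (rule ccontr)
      assume no: "\<not> ?thesis"
      \<comment> \<open>The supposed failure, specialised to u = k / p with r^2 = 1.\<close>
      have N: "p * c1 + r * s + k / p * c2 = \<tau>" if "p \<noteq> 0" "r * r = 1" for p r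
      proof -
        have r: "r \<noteq> 0" and pk: "p * (k / p) = k" using that by auto
        show ?thesis
        proof (rule ccontr)
          assume "p * c1 + r * s + k / p * c2 \<noteq> \<tau>"
          moreover have "(p * (k / p) - r * r) * (c1 * c2) = \<sigma>" unfolding pk that(2) by (rule k)
          ultimately have "\<exists>p r u. r \<noteq> 0 \<and> (p * u - r * r) * (c1 * c2) = \<sigma> \<and> p * c1 + r * s + u * c2 \<noteq> \<rho> * (1 + \<sigma>)"
            using r unfolding \<tau>_def by (intro exI[of _ p] exI[of _ r] exI[of _ "k / p"] conjI)
          then show False using no by (rule notE[rotated])
        qed
      qed
      define t where "t = c1 + k * c2"
      have e1: "t + s = \<tau>" using N[of 1 1] by (simp add: t_def algebra_simps)
      have e2: "t - s = \<tau>" using N[of 1 "- 1"] by (simp add: t_def algebra_simps)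
      have e3: "s - t = \<tau>" using N[of "- 1" 1] by (simp add: t_def algebra_simps)
      have N': "m * m * c1 + m * (s - \<tau>) + k * c2 = 0" if "m \<noteq> 0" for m
      proof -
        have "m * (m * c1 + s + k / m * c2) = m * \<tau>" using N[OF that, of 1] by simp
        moreover have "m * (m * c1 + s + k / m * c2) = m * m * c1 + m * s + k * c2" 
        proof -
          have "m * (k / m * c2) = k * c2" using that by simp
          then show ?thesis by (simp add: distrib_left mult.assoc)
        qed
        ultimately show ?thesis by (simp add: algebra_simps)
      qed
      show False
      proof (cases "\<exists>m :: 'a. m \<noteq> 0 \<and> m \<noteq> 1 \<and> m \<noteq> - 1")
        case True
        then obtain m :: 'a where m: "m \<noteq> 0" "m \<noteq> 1" "m + 1 \<noteq> 0" by (metis add_eq_0_iff2)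
        define d where "d = s - \<tau>"
        \<comment> \<open>Three zeros 1, m and m + 1 of a polynomial of degree at most 2 with
          leading coefficient c1; divided differences give c1 = 0.\<close>
        have z: "c1 + d + k * c2 = 0" "m * m * c1 + m * d + k * c2 = 0" "(m + 1) * (m + 1) * c1 + (m + 1) * d + k * c2 = 0"
          using N'[of 1] N'[OF m(1)] N'[OF m(3)] by (simp_all add: d_def)
        have "(m - 1) * ((m + 1) * c1 + d) = (m * m * c1 + m * d + k * c2) - (c1 + d + k * c2)" by (simp add: algebra_simps)
        then have a: "(m + 1) * c1 + d = 0" using z m(2) by simp
        have "m * ((m + 2) * c1 + d) = ((m + 1) * (m + 1) * c1 + (m + 1) * d + k * c2) - (c1 + d + k * c2)" by (simp add: algebra_simps)
        then have b: "(m + 2) * c1 + d = 0" using z m(1) by simp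
        have "((m + 2) * c1 + d) - ((m + 1) * c1 + d) = c1" by (simp add: algebra_simps)
        then have "0 - 0 = c1" by (simp only: a b)
        then show False using c by simp
      next
        case False
        then have U: "x = 0 \<or> x = 1 \<or> x = - 1" for x :: 'a by blast
        have c11: "c1 * c1 = 1" "c2 * c2 = 1" using U[of c1] U[of c2] c by auto
        \<comment> \<open>In GF(2) all of c1, c2 and \<sigma> are 1, so k = 0. In GF(3) the choices
          of p and r among 1 and -1 give s = t = 0 and \<sigma> = -1, and then c1 t = c1 c2 is
          impossible.\<close>
        show False
        proof (cases "(2 :: 'a) = 0")
          case True
          have "(- 1 :: 'a) = 1" using True by (rule minus_one_eq_one)
          then have "c1 = 1" "c2 = 1" "\<sigma> = 1" using U[of c1] U[of c2] c \<sigma> by auto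
          then show False using \<open>k \<noteq> 0\<close> True by (simp add: k_def)
        next
          case two: False
          have dbl: "x = 0" if "x + x = 0" for x :: 'a using that two by (metis mult_2 mult_eq_0_iff)
          have "s + s = (t + s) - (t - s)" by (simp add: algebra_simps)
          also have "\<dots> = 0" unfolding e1 e2 by simp
          finally have s: "s = 0" by (rule dbl)
          have "t + t = (t + s) - (s - t)" by (simp add: algebra_simps)
          also have "\<dots> = 0" unfolding e1 e3 by simp
          finally have t: "t = 0" by (rule dbl)
          have "1 + \<sigma> = 0" using e1 s t \<rho> unfolding \<tau>_def by auto
          then have sg: "\<sigma> = - 1" using \<sigma> two by auto
          have "c1 * c2 \<noteq> 0" using c by simp
          have "c1 * t = c1 * c1 + k * (c1 * c2)" by (simp add: t_def algebra_simps)
          also have "\<dots> = c1 * c1 + (k - 1) * (c1 * c2) + c1 * c2" by (simp add: algebra_simps)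
          also have "\<dots> = c1 * c2" unfolding k c11 sg by simp
          finally show False using t c by simp
        qed
      qed
    qed
  qed
qed

definition covered :: "nat \<Rightarrow> 'a :: field poly \<Rightarrow> 'a mat \<Rightarrow> bool" where
  "covered n q P \<longleftrightarrow> (\<exists>A B C D. A \<in> carrier_mat n n \<and> B \<in> carrier_mat n n \<and> C \<in> carrier_mat n n \<and> D \<in> carrier_mat n n \<and>
    sp_conj n P (four_block_mat A B C D) \<and> good q A)"

lemma covered_frame:
  assumes "P \<in> carrier (Sp n)" "coord.frame n (vec_space n) n e f"
    and "good q (mat n n (\<lambda>(i, j). vec_form n (mat_fun P (e j)) (f i)))"
  shows "covered n q P"
  using frame_block[OF assms(1,2)] assms(3) unfolding covered_def by blast

lemma covered_shear:
  fixes P :: "'a :: field mat"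
  assumes P: "P \<in> carrier (Sp n)" and F: "coord.frame n (vec_space n) n e f" and n: "2 \<le> n"
  defines "a \<equiv> \<lambda>i j. vec_form n (mat_fun P (e j)) (f i)" and "c \<equiv> \<lambda>i j. vec_form n (mat_fun P (e j)) (e i)"
  assumes g: "good q (mat n n (\<lambda>(i, j). a i j + (if i = 0 then p * c 0 j + r * c 1 j else if i = 1 then r * c 0 j + u * c 1 j else 0)))"
  shows "covered n q P"
proof -
  let ?f = "\<lambda>i. f i + (if i = 0 then vec_scale p (e 0) + vec_scale r (e 1) else if i = 1 then vec_scale r (e 0) + vec_scale u (e 1) else 0)"
  have eq: "mat n n (\<lambda>(i, j). vec_form n (mat_fun P (e j)) (?f i))
    = mat n n (\<lambda>(i, j). a i j + (if i = 0 then p * c 0 j + r * c 1 j else if i = 1 then r * c 0 j + u * c 1 j else 0))"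
    by (intro eq_matI) (auto simp: a_def c_def coord.bilinear)
  show ?thesis
    by (rule covered_frame[OF P coord.frame_shear[OF F n, where p = p and r = r and u = u]], unfold eq, rule g)
qed

lemma prod_pm_one: "finite I \<Longrightarrow> (\<And>i. i \<in> I \<Longrightarrow> \<epsilon> i = 1 \<or> \<epsilon> i = - 1) \<Longrightarrow> prod \<epsilon> I = 1 \<or> prod \<epsilon> I = (- 1 :: 'a :: field)"
proof (induction I rule: finite_induct)
  case (insert x F)
  have "prod \<epsilon> F = 1 \<or> prod \<epsilon> F = - 1" using insert by blast
  moreover have "\<epsilon> x = 1 \<or> \<epsilon> x = - 1" using insert by blast
  ultimately show ?case using insert.hyps by auto
qed simp

lemma prod_split_two: "2 \<le> n \<Longrightarrow> (\<Prod>i<n. \<epsilon> i) = \<epsilon> 0 * \<epsilon> (1::nat) * (\<Prod>i=2..<n. \<epsilon> i :: 'b :: comm_monoid_mult)"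
proof -
  assume "2 \<le> n"
  then have "{..<n} = insert 0 (insert 1 {2..<n})" by auto
  then show ?thesis by (simp add: mult.assoc)
qed

text \<open>As two columns of the block vanish, the shear alone determines the corner, with
  determinant (p u - r^2) c00 c11 and trace p c00 + r s + u c11. The determinant is set to the
  product \<sigma> of the other diagonal entries, so that the total is \<sigma>^2 = 1; a nonzero r
  makes the corner nonscalar.\<close>

lemma covered_two_anisotropic:
  fixes P :: "'a :: field mat"
  assumes q: "monic q" and deg: "degree q = n" and n: "3 \<le> n"
    and P: "P \<in> carrier (Sp n)" and F: "coord.frame n (vec_space n) n e f"
  defines "a \<equiv> \<lambda>i j. vec_form n (mat_fun P (e j)) (f i)" and "c \<equiv> \<lambda>i j. vec_form n (mat_fun P (e j)) (e i)"
  assumes c: "c 0 0 \<noteq> 0" "c 1 1 \<noteq> 0" "c 1 0 = 0" and a: "\<And>i. i < n \<Longrightarrow> a i 0 = 0 \<and> a i 1 = 0"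
    and tri: "\<And>i. 2 \<le> i \<Longrightarrow> i < n \<Longrightarrow> (a i i = 1 \<or> a i i = - 1) \<and> (\<forall>j<i. a i j = 0)"
  shows "covered n q P"
proof -
  define \<sigma> \<rho> s where "\<sigma> = (\<Prod>i=2..<n. a i i)" and "\<rho> = a (n - 1) (n - 1)" and "s = c 0 1"
  have \<sigma>: "\<sigma> = 1 \<or> \<sigma> = - 1" unfolding \<sigma>_def by (rule prod_pm_one) (use tri in auto)
  have \<rho>: "\<rho> = 1 \<or> \<rho> = - 1" unfolding \<rho>_def using tri[of "n - 1"] n by auto
  obtain p r u where r: "r \<noteq> 0" and det: "(p * u - r * r) * (c 0 0 * c 1 1) = \<sigma>"
    and tr: "p * c 0 0 + r * s + u * c 1 1 \<noteq> \<rho> * (1 + \<sigma>)" using shear_params[OF c(1,2) \<sigma> \<rho>, of s] by (elim exE conjE) (rule that)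
  let ?M = "mat n n (\<lambda>(i, j). a i j + (if i = 0 then p * c 0 j + r * c 1 j else if i = 1 then r * c 0 j + u * c 1 j else 0))"
  have n': "0 < n" "1 < n" "Suc 0 < n" "2 \<le> n" using n by auto
  have M: "?M $$ (0, 0) = p * c 0 0" "?M $$ (0, 1) = p * s + r * c 1 1" "?M $$ (1, 0) = r * c 0 0" "?M $$ (1, 1) = r * s + u * c 1 1"
    using n' a[of 0] a[of 1] c(3) by (simp_all add: s_def)
  have det': "?M $$ (0, 0) * ?M $$ (1, 1) - ?M $$ (0, 1) * ?M $$ (1, 0) = \<sigma>"
    unfolding M det[symmetric] by (simp add: algebra_simps)
  have pr: "(\<Prod>i=2..<n. ?M $$ (i, i)) = \<sigma>" unfolding \<sigma>_def by (intro prod.cong) auto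
  have "good q ?M"
  proof (rule good_nonscalar_block[OF q deg n _ _ _ _ refl])
    show "?M $$ (i, j) = 0" if "2 \<le> i" "i < n" "j < i" for i j using tri[OF that(1,2)] that by simp
    show "(?M $$ (0, 0) * ?M $$ (1, 1) - ?M $$ (0, 1) * ?M $$ (1, 0)) * (\<Prod>i=2..<n. ?M $$ (i, i)) = 1"
      unfolding det' pr using \<sigma> by auto
    show "?M $$ (0, 1) \<noteq> 0 \<or> ?M $$ (1, 0) \<noteq> 0 \<or> ?M $$ (0, 0) \<noteq> ?M $$ (1, 1)" unfolding M using r c by simp
    have l: "?M $$ (n - 1, n - 1) = \<rho>" using n by (simp add: \<rho>_def)
    have trM: "?M $$ (0, 0) + ?M $$ (1, 1) = p * c 0 0 + r * s + u * c 1 1" unfolding M by (simp add: add.assoc)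
    have ne: "\<rho> * (\<rho> * (1 + \<sigma>) - (p * c 0 0 + r * s + u * c 1 1)) \<noteq> 0" using tr \<rho> by auto
    have eqn: "\<rho> * (\<rho> * (1 + \<sigma>) - (p * c 0 0 + r * s + u * c 1 1)) = \<rho>\<^sup>2 - (p * c 0 0 + r * s + u * c 1 1) * \<rho> + \<sigma>"
    proof -
      have "\<rho> * (\<rho> * (1 + \<sigma>) - T) = \<rho>\<^sup>2 - T * \<rho> + \<sigma>" for T
        using \<rho> by (auto simp: algebra_simps power2_eq_square)
      then show ?thesis .
    qed
    show "(?M $$ (n - 1, n - 1))\<^sup>2 - (?M $$ (0, 0) + ?M $$ (1, 1)) * ?M $$ (n - 1, n - 1)
      + (?M $$ (0, 0) * ?M $$ (1, 1) - ?M $$ (0, 1) * ?M $$ (1, 0)) \<noteq> 0"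
      unfolding det' l trM using ne unfolding eqn .
  qed simp
  then show ?thesis unfolding a_def c_def by (rule covered_shear[OF P F n'(4)])
qed

text \<open>A shear can replace the zero in the first diagonal place by any s c00; \<mu> is the
  value that makes the product of the diagonal 1. If the products c 0 i with i \<ge> 1 vanish, the
  block becomes diagonal and \<open>H\<close> applies. Otherwise a nonzero r makes the corner
  nonscalar and shifts its trace, while the determinant stays \<mu> \<epsilon>_1.\<close>

lemma covered_one_anisotropic:
  fixes P :: "'a :: field mat"
  assumes q: "monic q" and deg: "degree q = n" and n: "3 \<le> n"
    and H: "\<And>\<alpha>. (\<And>i. i < n \<Longrightarrow> \<alpha> i = 1 \<or> \<alpha> i = - 1) \<Longrightarrow> (\<Prod>i<n. \<alpha> i) = 1 \<Longrightarrow> good q (mat n n (\<lambda>(i, j). if i = j then \<alpha> i else 0))"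
    and P: "P \<in> carrier (Sp n)" and F: "coord.frame n (vec_space n) n e f"
  defines "a \<equiv> \<lambda>i j. vec_form n (mat_fun P (e j)) (f i)" and "c \<equiv> \<lambda>i j. vec_form n (mat_fun P (e j)) (e i)"
  assumes c: "c 0 0 \<noteq> 0" and a0: "\<And>i. i < n \<Longrightarrow> a i 0 = 0 \<and> a 0 i = 0 \<and> (\<epsilon> i = 1 \<or> \<epsilon> i = - 1)"
    and ci: "\<And>i. 1 \<le> i \<Longrightarrow> i < n \<Longrightarrow> c i 0 = 0 \<and> c i i = 0"
    and a: "\<And>i j. 1 \<le> i \<Longrightarrow> i < n \<Longrightarrow> 1 \<le> j \<Longrightarrow> j < n \<Longrightarrow> a i j = (if i = j then \<epsilon> i else 0)"
    and \<gamma>: "(\<forall>i. 1 \<le> i \<longrightarrow> i < n \<longrightarrow> c 0 i = 0) \<or> c 0 1 \<noteq> 0"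
  shows "covered n q P"
proof -
  have n': "0 < n" "1 < n" "Suc 0 < n" "2 \<le> n" using n by auto
  define \<mu> s where "\<mu> = (\<Prod>i=1..<n. \<epsilon> i)" and "s = \<mu> / c 0 0"
  have \<mu>: "\<mu> = 1 \<or> \<mu> = - 1" unfolding \<mu>_def by (rule prod_pm_one) (use a0 in auto)
  have sc: "s * c 0 0 = \<mu>" using c by (simp add: s_def)
  show ?thesis
  proof (cases "\<forall>i. 1 \<le> i \<longrightarrow> i < n \<longrightarrow> c 0 i = 0")
    case True
    define \<alpha> where "\<alpha> i = (if i = 0 then \<mu> else \<epsilon> i)" for i
    have "{..<n} = insert 0 {1..<n}" using n by auto
    then have "(\<Prod>i<n. \<alpha> i) = \<mu> * (\<Prod>i=1..<n. \<alpha> i)" by (simp add: \<alpha>_def)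
    also have "(\<Prod>i=1..<n. \<alpha> i) = \<mu>" unfolding \<mu>_def by (intro prod.cong) (auto simp: \<alpha>_def)
    finally have "(\<Prod>i<n. \<alpha> i) = 1" using \<mu> by auto
    then have g: "good q (mat n n (\<lambda>(i, j). if i = j then \<alpha> i else 0))"
      by (intro H) (use \<mu> a0 in \<open>auto simp: \<alpha>_def\<close>)
    have eq: "mat n n (\<lambda>(i, j). if i = j then \<alpha> i else 0)
      = mat n n (\<lambda>(i, j). a i j + (if i = 0 then s * c 0 j + 0 * c 1 j else if i = 1 then 0 * c 0 j + 0 * c 1 j else 0))"
      (is "_ = ?M")
    proof (rule eq_matI)
      fix i j assume "i < dim_row ?M" "j < dim_col ?M"
      then have ij: "i < n" "j < n" by auto
      consider "i = 0" "j = 0" | "i = 0" "1 \<le> j" | "1 \<le> i" "j = 0" | "1 \<le> i" "1 \<le> j" by linarith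
      then show "mat n n (\<lambda>(i, j). if i = j then \<alpha> i else 0) $$ (i, j) = ?M $$ (i, j)"
        using ij a0 a True sc by cases (auto simp: \<alpha>_def)
    qed auto
    show ?thesis using g unfolding eq a_def c_def by (rule covered_shear[OF P F n'(4), where p = s and r = 0 and u = 0])
  next
    case False
    have \<gamma>1: "c 0 1 \<noteq> 0"
    proof (rule disjE[OF \<gamma>])
      assume "\<forall>i. 1 \<le> i \<longrightarrow> i < n \<longrightarrow> c 0 i = 0"
      with False show ?thesis by (rule notE)
    qed
    define \<gamma>' \<rho> where "\<gamma>' = c 0 1" and "\<rho> = \<epsilon> (n - 1)"
    have \<rho>: "\<rho> = 1 \<or> \<rho> = - 1" and \<epsilon>1: "\<epsilon> 1 = 1 \<or> \<epsilon> 1 = - 1" 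
    proof -
      have eps: "\<epsilon> i = 1 \<or> \<epsilon> i = - 1" if "i < n" for i using a0[OF that] by (elim conjE)
      show "\<rho> = 1 \<or> \<rho> = - 1" unfolding \<rho>_def by (rule eps) (use n' in simp)
      show "\<epsilon> 1 = 1 \<or> \<epsilon> 1 = - 1" by (rule eps) (use n' in simp)
    qed
    let ?D = "(\<rho> - \<mu>) * (\<rho> - \<epsilon> 1)"
    \<comment> \<open>One of r = 1 and r = -1 works. Both could fail only if 2 = 0, but then all
      signs are 1 and \<open>?D\<close> is 0, while the right-hand side is not.\<close>
    have "\<exists>r. r \<noteq> 0 \<and> ?D \<noteq> \<rho> * (r * \<gamma>')"
    proof (cases "?D = \<rho> * \<gamma>'")
      case False
      then show ?thesis by (intro exI[of _ 1]) simp
    next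
      case True
      have "?D \<noteq> - (\<rho> * \<gamma>')"
      proof
        assume "?D = - (\<rho> * \<gamma>')"
        then have "\<rho> * \<gamma>' = - (\<rho> * \<gamma>')" unfolding True .
        then have "2 * (\<rho> * \<gamma>') = 0" by (simp only: eq_neg_iff_add_eq_0 mult_2)
        moreover have nz: "\<rho> * \<gamma>' \<noteq> 0" using \<rho> \<gamma>1 by (auto simp: \<gamma>'_def)
        ultimately have two: "(2 :: 'a) = 0" by (simp only: mult_eq_0_iff simp_thms)
        have "(- 1 :: 'a) = 1" using two by (rule minus_one_eq_one)
        then have "\<rho> = 1" "\<mu> = 1" using \<rho> \<mu> by (simp_all only: disj_absorb)
        then show False using True nz by simp
      qed
      then show ?thesis by (intro exI[of _ "- 1"]) simp
    qed
    then obtain r where r: "r \<noteq> 0" "?D \<noteq> \<rho> * (r * \<gamma>')" by blast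
    let ?M = "mat n n (\<lambda>(i, j). a i j + (if i = 0 then s * c 0 j + r * c 1 j else if i = 1 then r * c 0 j + 0 * c 1 j else 0))"
    have M: "?M $$ (0, 0) = \<mu>" "?M $$ (0, 1) = s * \<gamma>'" "?M $$ (1, 0) = r * c 0 0" "?M $$ (1, 1) = \<epsilon> 1 + r * \<gamma>'"
      using n' a0[of 0] a0[of 1] ci[of 1] a[of 1 1] sc by (simp_all add: \<gamma>'_def)
    have det': "?M $$ (0, 0) * ?M $$ (1, 1) - ?M $$ (0, 1) * ?M $$ (1, 0) = \<mu> * \<epsilon> 1"
    proof -
      have "\<mu> * (\<epsilon> 1 + r * \<gamma>') - s * \<gamma>' * (r * c 0 0) = \<mu> * (\<epsilon> 1 + r * \<gamma>') - (s * c 0 0) * (r * \<gamma>')" by simp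
      also have "\<dots> = \<mu> * \<epsilon> 1" unfolding sc by (simp add: algebra_simps)
      finally show ?thesis unfolding M .
    qed
    have pr: "(\<Prod>i=2..<n. ?M $$ (i, i)) = (\<Prod>i=2..<n. \<epsilon> i)" using a by (intro prod.cong) auto
    have "{1..<n} = insert 1 {2..<n}" using n by auto
    then have \<mu>': "\<mu> = \<epsilon> 1 * (\<Prod>i=2..<n. \<epsilon> i)" unfolding \<mu>_def by simp
    have "good q ?M"
    proof (rule good_nonscalar_block[OF q deg n _ _ _ _ refl])
      show "?M $$ (i, j) = 0" if "2 \<le> i" "i < n" "j < i" for i j
        using that a[of i j] a0[of i] by (cases "j = 0") auto
      show "(?M $$ (0, 0) * ?M $$ (1, 1) - ?M $$ (0, 1) * ?M $$ (1, 0)) * (\<Prod>i=2..<n. ?M $$ (i, i)) = 1"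
      proof -
        have "\<mu> * \<epsilon> 1 * (\<Prod>i=2..<n. \<epsilon> i) = \<mu> * \<mu>" unfolding mult.assoc \<mu>'[symmetric] ..
        also have "\<dots> = 1" using \<mu> by auto
        finally show ?thesis unfolding det' pr .
      qed
      show "?M $$ (0, 1) \<noteq> 0 \<or> ?M $$ (1, 0) \<noteq> 0 \<or> ?M $$ (0, 0) \<noteq> ?M $$ (1, 1)" unfolding M using r c by simp
      have l: "?M $$ (n - 1, n - 1) = \<rho>" using n a[of "n - 1" "n - 1"] by (simp add: \<rho>_def)
      have "\<rho>\<^sup>2 - (\<mu> + (\<epsilon> 1 + r * \<gamma>')) * \<rho> + \<mu> * \<epsilon> 1 = ?D - \<rho> * (r * \<gamma>')"
        by (simp add: algebra_simps power2_eq_square)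
      then have "\<rho>\<^sup>2 - (\<mu> + (\<epsilon> 1 + r * \<gamma>')) * \<rho> + \<mu> * \<epsilon> 1 \<noteq> 0" using r(2) by simp
      then show "(?M $$ (n - 1, n - 1))\<^sup>2 - (?M $$ (0, 0) + ?M $$ (1, 1)) * ?M $$ (n - 1, n - 1)
        + (?M $$ (0, 0) * ?M $$ (1, 1) - ?M $$ (0, 1) * ?M $$ (1, 0)) \<noteq> 0"
        unfolding det' l unfolding M .
    qed simp
    then show ?thesis unfolding a_def c_def by (rule covered_shear[OF P F n'(4), where p = s and r = r and u = 0])
  qed
qed

lemma mat_fun_unit:
  assumes "P \<in> carrier_mat (2 * n) (2 * n)" "i < 2 * n" "j < 2 * n"
  shows "mat_fun P (unit_fun j) i = P $$ (i, j)"
proof -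
  have "mat_fun P (unit_fun j) i = (\<Sum>l<2*n. P $$ (i, l) * unit_fun j l)" using assms by (simp add: mat_fun_def)
  also have "\<dots> = (\<Sum>l<2*n. if l = j then P $$ (i, j) else 0)" by (intro sum.cong) (auto simp: unit_fun_def)
  finally show ?thesis using assms by simp
qed

lemma minus_one_of_frame:
  fixes P :: "'a :: field mat"
  assumes P: "P \<in> carrier (Sp n)" and F: "coord.frame n (vec_space n) n e f"
    and E: "\<And>i. i < n \<Longrightarrow> mat_fun P (e i) = vec_scale (- 1) (e i) \<and> mat_fun P (f i) = vec_scale (- 1) (f i)"
  shows "P = - 1\<^sub>m (2 * n)"
proof -
  note c = Sp_carrier_mat[OF P] and I = coord.isometryD[OF mat_fun_isometry[OF P]] and D = coord.frameD[OF F]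
  have m: "mat_fun P x = - x" if x: "x \<in> vec_space n" for x
  proof -
    have "mat_fun P x + x = 0"
    proof (rule coord.frame_complete[OF F])
      show "mat_fun P x + x \<in> vec_space n" by (intro coord.subspace_add[OF D(1)] I(3) x)
      fix i assume i: "i < n"
      have s: "vec_form n (mat_fun P x) y = - vec_form n x y" if "y \<in> vec_space n" "mat_fun P y = vec_scale (- 1) y" for y
      proof -
        have "- vec_form n (mat_fun P x) y = vec_form n x y" using I(4)[OF x that(1)] that(2) by (simp add: coord.bilinear)
        then show ?thesis by (metis minus_minus)
      qed
      show "vec_form n (mat_fun P x + x) (e i) = 0" "vec_form n (mat_fun P x + x) (f i) = 0"
        using s[OF D(2)[OF i]] s[OF D(3)[OF i]] E[OF i] by (simp_all add: coord.bilinear)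
    qed
    then show ?thesis by (simp add: eq_neg_iff_add_eq_0)
  qed
  show ?thesis
  proof (rule eq_matI)
    fix i j assume "i < dim_row (- 1\<^sub>m (2 * n) :: 'a mat)" "j < dim_col (- 1\<^sub>m (2 * n) :: 'a mat)"
    then have ij: "i < 2 * n" "j < 2 * n" by auto
    have "unit_fun j \<in> (vec_space n :: (nat \<Rightarrow> 'a) set)" using ij by (auto simp: unit_fun_def vec_space_def)
    then have "mat_fun P (unit_fun j) = - unit_fun j" by (rule m)
    then have "P $$ (i, j) = (- unit_fun j) i" unfolding mat_fun_unit[OF c ij, symmetric] by (rule arg_cong)
    then show "P $$ (i, j) = (- 1\<^sub>m (2 * n)) $$ (i, j)" using ij by (auto simp: unit_fun_def)
  qed (use c in auto)
qed

text \<open>The case distinction shared by n = 2 and n \<ge> 3; what they treat differently is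
  abstracted into \<open>H\<close>, \<open>two_aniso\<close>, \<open>one_aniso\<close> and
  \<open>mixed\<close>. The quadratic form \<omega>(P x, x) decides: it has a nonzero value, with or
  without another one on the complement of x and P x, or it vanishes and P is an involution.\<close>

lemma covered_cases:
  fixes P :: "'a :: field mat"
  assumes n: "2 \<le> n" and P: "P \<in> carrier (Sp n)" "P \<noteq> - 1\<^sub>m (2 * n)"
    and H: "\<And>\<alpha>. (\<And>i. i < n \<Longrightarrow> \<alpha> i = 1 \<or> \<alpha> i = - 1) \<Longrightarrow> \<exists>i<n. \<alpha> i = 1 \<Longrightarrow> (\<Prod>i<n. \<alpha> i) = 1 \<Longrightarrow> good q (mat n n (\<lambda>(i, j). if i = j then \<alpha> i else 0))"
    and two_aniso: "\<And>e f. coord.frame n (vec_space n) n e f \<Longrightarrow> vec_form n (mat_fun P (e 0)) (e 0) \<noteq> 0 \<Longrightarrow>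
      vec_form n (mat_fun P (e 1)) (e 1) \<noteq> 0 \<Longrightarrow> vec_form n (mat_fun P (e 0)) (e 1) = 0 \<Longrightarrow>
      \<forall>i<n. vec_form n (mat_fun P (e 0)) (f i) = 0 \<and> vec_form n (mat_fun P (e 1)) (f i) = 0 \<Longrightarrow>
      \<forall>i. 2 \<le> i \<longrightarrow> i < n \<longrightarrow> (vec_form n (mat_fun P (e i)) (f i) = 1 \<or> vec_form n (mat_fun P (e i)) (f i) = - 1) \<and>
        (\<forall>j<i. vec_form n (mat_fun P (e j)) (f i) = 0) \<Longrightarrow> covered n q P"
    and one_aniso: "\<And>e f \<epsilon>. coord.frame n (vec_space n) n e f \<Longrightarrow> vec_form n (mat_fun P (e 0)) (e 0) \<noteq> 0 \<Longrightarrow>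
      \<forall>i<n. vec_form n (mat_fun P (e 0)) (f i) = 0 \<and> vec_form n (mat_fun P (e i)) (f 0) = 0 \<and> (\<epsilon> i = 1 \<or> \<epsilon> i = - 1) \<Longrightarrow>
      \<forall>i. 1 \<le> i \<longrightarrow> i < n \<longrightarrow> vec_form n (mat_fun P (e 0)) (e i) = 0 \<and> vec_form n (mat_fun P (e i)) (e i) = 0 \<and>
        (\<forall>j. 1 \<le> j \<longrightarrow> j < n \<longrightarrow> vec_form n (mat_fun P (e j)) (f i) = (if i = j then \<epsilon> i else 0)) \<Longrightarrow>
      (\<forall>i. 1 \<le> i \<longrightarrow> i < n \<longrightarrow> vec_form n (mat_fun P (e i)) (e 0) = 0) \<or> vec_form n (mat_fun P (e 1)) (e 0) \<noteq> 0 \<Longrightarrow>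
      covered n q P"
    and mixed: "\<And>M :: 'a mat. M \<in> carrier_mat n n \<Longrightarrow> (2 :: 'a) \<noteq> 0 \<Longrightarrow> M $$ (0, 0) = 0 \<Longrightarrow> M $$ (0, 1) = - 1 \<Longrightarrow>
      M $$ (1, 0) = 1 \<Longrightarrow> M $$ (1, 1) = 0 \<Longrightarrow> (\<And>i j. 2 \<le> i \<Longrightarrow> i < n \<Longrightarrow> j < i \<Longrightarrow> M $$ (i, j) = 0) \<Longrightarrow>
      (\<And>i. 2 \<le> i \<Longrightarrow> i < n \<Longrightarrow> M $$ (i, i) = 1 \<or> M $$ (i, i) = - 1) \<Longrightarrow> (\<Prod>i=2..<n. M $$ (i, i)) = 1 \<Longrightarrow> good q M"
  shows "covered n q P"
proof -
  let ?Q = "\<lambda>x. vec_form n (mat_fun P x) x"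
  note I = mat_fun_isometry[OF P(1)] and S = standard_frame[where n = n and ?'a = 'a]
  have n': "0 < n" "1 < n" "2 \<le> n" using n by auto
  show ?thesis
  proof (cases "\<exists>x\<in>vec_space n. ?Q x \<noteq> 0")
    case True
    then obtain x where x: "x \<in> vec_space n" "?Q x \<noteq> 0" by blast
    show ?thesis
    proof (cases "\<exists>y\<in>vec_space n. vec_form n y x = 0 \<and> vec_form n y (mat_fun P x) = 0 \<and> ?Q y \<noteq> 0")
      case True
      then obtain y where y: "y \<in> vec_space n" "vec_form n y x = 0" "vec_form n y (mat_fun P x) = 0" "?Q y \<noteq> 0" by blast
      have n2: "Suc (Suc (n - 2)) = n" using n by simp
      have S2: "coord.frame n (vec_space n) (Suc (Suc (n - 2))) unit_fun (\<lambda>i. unit_fun (n + i) :: nat \<Rightarrow> 'a)" unfolding n2 by (rule S)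
      show ?thesis
        using coord.two_anisotropic_frame[OF I S2 x y, unfolded n2] by (elim exE conjE) (rule two_aniso)
    next
      case False
      then have Q: "?Q y = 0" if "y \<in> vec_space n" "vec_form n y x = 0" "vec_form n y (mat_fun P x) = 0" for y using that by blast
      have n1: "Suc (n - 1) = n" using n by simp
      have S': "coord.frame n (vec_space n) (Suc (n - 1)) unit_fun (\<lambda>i. unit_fun (n + i) :: nat \<Rightarrow> 'a)" unfolding n1 by (rule S)
      show ?thesis
        by (rule exE[OF coord.one_anisotropic_frame[OF I S' x, unfolded n1]], rule Q, assumption, assumption, assumption,
            elim exE conjE, rule one_aniso)
    qed
  next
    case False
    have Q: "\<forall>x\<in>vec_space n. ?Q x = 0"
    proof (rule ballI, rule ccontr)
      fix x :: "nat \<Rightarrow> 'a" assume xV: "x \<in> vec_space n" and xQ: "?Q x \<noteq> 0"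
      have "\<exists>x\<in>vec_space n. ?Q x \<noteq> 0" by (rule bexI, rule xQ, rule xV)
      with False show False by (rule notE)
    qed
    obtain e f \<epsilon> where F: "coord.frame n (vec_space n) n e f" and \<epsilon>: "\<forall>i<n. \<epsilon> i = 1 \<or> \<epsilon> i = - 1"
      and A: "\<forall>i<n. \<forall>j<n. vec_form n (mat_fun P (e j)) (f i) = (if i = j then \<epsilon> i else 0)"
      and E: "(2 :: 'a) \<noteq> 0 \<longrightarrow> (\<forall>i<n. mat_fun P (e i) = vec_scale (\<epsilon> i) (e i) \<and> mat_fun P (f i) = vec_scale (\<epsilon> i) (f i))"
      using coord.involution_frame[OF I S Q] by (elim exE conjE) (rule that)
    \<comment> \<open>This is where -I is set apart. If all signs differed from 1, the
      characteristic could not be 2, and every frame vector would be an eigenvector for -1.\<close>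
    have ex1: "\<exists>i<n. \<epsilon> i = 1"
    proof (rule ccontr)
      assume no: "\<not> ?thesis"
      have m: "\<epsilon> i \<noteq> 1" "\<epsilon> i = - 1" if "i < n" for i
      proof -
        show ne: "\<epsilon> i \<noteq> 1"
        proof
          assume "\<epsilon> i = 1"
          with that have "\<exists>i<n. \<epsilon> i = 1" by (intro exI conjI)
          with no show False by (rule notE)
        qed
        then show "\<epsilon> i = - 1" using \<epsilon>[rule_format, OF that] by simp
      qed
      have two: "(2 :: 'a) \<noteq> 0"
      proof
        assume "(2 :: 'a) = 0"
        then have "(- 1 :: 'a) = 1" by (rule minus_one_eq_one)
        then have "\<epsilon> 0 = 1" using m(2)[of 0] n by simp
        then show False using m(1)[of 0] n by simp
      qed
      have "P = - 1\<^sub>m (2 * n)" 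
      proof (rule minus_one_of_frame[OF P(1) F])
        fix i assume i: "i < n"
        show "mat_fun P (e i) = vec_scale (- 1) (e i) \<and> mat_fun P (f i) = vec_scale (- 1) (f i)"
          using mp[OF E two, rule_format, OF i] unfolding m(2)[OF i] .
      qed
      then show False using P(2) by simp
    qed
    show ?thesis
    proof (cases "(\<Prod>i<n. \<epsilon> i) = 1")
      case True
      have eqm: "mat n n (\<lambda>(i, j). vec_form n (mat_fun P (e j)) (f i)) = mat n n (\<lambda>(i, j). if i = j then \<epsilon> i else 0)"
        using A by (intro eq_matI) auto
      show ?thesis by (rule covered_frame[OF P(1) F], unfold eqm, rule H[OF \<epsilon>[rule_format] ex1 True])
    next
      case False
      have "(\<Prod>i<n. \<epsilon> i) = 1 \<or> (\<Prod>i<n. \<epsilon> i) = - 1"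
      proof (rule prod_pm_one)
        show "\<epsilon> i = 1 \<or> \<epsilon> i = - 1" if "i \<in> {..<n}" for i by (rule \<epsilon>[rule_format]) (use that in simp)
      qed simp
      then have pr: "(\<Prod>i<n. \<epsilon> i) = - 1" by (elim disjE) (use False in simp_all)
      have two: "(2 :: 'a) \<noteq> 0"
      proof
        assume "(2 :: 'a) = 0"
        then have "(- 1 :: 'a) = 1" by (rule minus_one_eq_one)
        then show False using pr False by simp
      qed
      have E: "mat_fun P (e i) = vec_scale (\<epsilon> i) (e i) \<and> mat_fun P (f i) = vec_scale (\<epsilon> i) (f i)" if "i < n" for i
        by (rule mp[OF E two, rule_format, OF that])
      obtain i where i: "i < n" "\<epsilon> i = 1" using ex1 by (elim exE conjE) (rule that)
      have "\<exists>j<n. \<epsilon> j = - 1"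
      proof (rule ccontr)
        assume no: "\<not> ?thesis"
        have "\<epsilon> i = 1" if "i < n" for i
        proof -
          have "\<epsilon> i \<noteq> - 1"
          proof
            assume "\<epsilon> i = - 1"
            with that have "\<exists>j<n. \<epsilon> j = - 1" by (intro exI conjI)
            with no show False by (rule notE)
          qed
          then show ?thesis using \<epsilon>[rule_format, OF that] by simp
        qed
        then have "(\<Prod>i<n. \<epsilon> i) = 1" by simp
        then show False using False by simp
      qed
      then obtain j where j: "j < n" "\<epsilon> j = - 1" by (elim exE conjE) (rule that)
      have m11: "(1 :: 'a) \<noteq> - 1"
      proof
        assume "(1 :: 'a) = - 1"
        then have "(1 :: 'a) + 1 = 0" by (simp only: eq_neg_iff_add_eq_0)
        then show False using two by simp
      qed
      then have ij: "i \<noteq> j" using i j by auto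
      obtain \<pi> where \<pi>: "bij_betw \<pi> {..<n} {..<n}" "\<pi> 0 = i" "\<pi> 1 = j" by (rule coord.move_two_bij[OF i(1) j(1) ij])
      define \<epsilon>' where "\<epsilon>' i = \<epsilon> (\<pi> i)" for i
      have into: "\<pi> i < n" if "i < n" for i using bij_betwE[OF \<pi>(1)] that by auto
      have F': "coord.frame n (vec_space n) n (\<lambda>i. e (\<pi> i)) (\<lambda>i. f (\<pi> i))" by (rule coord.frame_permute[OF F \<pi>(1)])
      have pr': "(\<Prod>i<n. \<epsilon>' i) = - 1" unfolding \<epsilon>'_def using prod.reindex_bij_betw[OF \<pi>(1), of \<epsilon>] pr by simp
      have \<epsilon>01: "\<epsilon>' 0 = 1" "\<epsilon>' 1 = - 1" using i j \<pi> by (simp_all add: \<epsilon>'_def)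
      have E': "mat_fun P (e (\<pi> i)) = vec_scale (\<epsilon>' i) (e (\<pi> i)) \<and> mat_fun P (f (\<pi> i)) = vec_scale (\<epsilon>' i) (f (\<pi> i))"
        if "i < n" for i using E[OF into[OF that]] by (simp add: \<epsilon>'_def)
      obtain e1 f1 where F1: "coord.frame n (vec_space n) n e1 f1" and Q1: "?Q (e1 0) = 0" "?Q (e1 1) = 0"
        "vec_form n (mat_fun P (e1 1)) (e1 0) = - 2" "vec_form n (mat_fun P (e1 0)) (e1 1) = 2"
        and A0: "\<forall>i<n. vec_form n (mat_fun P (e1 0)) (f1 i) = 0 \<and> vec_form n (mat_fun P (e1 1)) (f1 i) = 0"
        and A2: "\<forall>i. 2 \<le> i \<longrightarrow> i < n \<longrightarrow> (\<forall>j<n. vec_form n (mat_fun P (e1 j)) (f1 i) = (if i = j then \<epsilon>' i else 0))"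
        by (rule exE[OF coord.mixed_frame[OF F' n'(3) two I E' \<epsilon>01]], assumption, elim exE conjE, rule that)
      note A0 = A0[rule_format] and A2 = A2[rule_format]
      \<comment> \<open>A shear by 1/2 along both e_0 and e_1 turns the values -2 and 2 into the
        corner with rows (0, -1) and (1, 0). It replaces the two signs 1 and -1, so the other signs
        multiply to 1, like its determinant.\<close>
      define h :: 'a where "h = inverse 2"
      have hh: "h * 2 = 1" using two by (simp add: h_def)
      let ?M = "mat n n (\<lambda>(i, j). vec_form n (mat_fun P (e1 j)) (f1 i)
        + (if i = 0 then h * vec_form n (mat_fun P (e1 j)) (e1 0) + 0 * vec_form n (mat_fun P (e1 j)) (e1 1)
          else if i = 1 then 0 * vec_form n (mat_fun P (e1 j)) (e1 0) + h * vec_form n (mat_fun P (e1 j)) (e1 1) else 0))"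
      have M: "?M $$ (0, 0) = 0" "?M $$ (0, 1) = - 1" "?M $$ (1, 0) = 1" "?M $$ (1, 1) = 0"
        using n' A0[of 0] A0[of 1] Q1 hh by simp_all
      have Md: "?M $$ (i, i) = \<epsilon>' i" if "2 \<le> i" "i < n" for i using A2[OF that that(2)] that by simp
      have pr2: "(\<Prod>i=2..<n. ?M $$ (i, i)) = 1"
      proof -
        have "(\<Prod>i=2..<n. ?M $$ (i, i)) = (\<Prod>i=2..<n. \<epsilon>' i)" by (intro prod.cong refl Md) auto
        also have "\<dots> = 1" using prod_split_two[OF n'(3), of \<epsilon>'] unfolding pr' \<epsilon>01 by simp
        finally show ?thesis .
      qed
      have "good q ?M"
      proof (rule mixed[OF _ two M _ _ pr2])
        show "?M $$ (i, j) = 0" if "2 \<le> i" "i < n" "j < i" for i j using A2[OF that(1,2) less_trans[OF that(3,2)]] that by simp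
        show "?M $$ (i, i) = 1 \<or> ?M $$ (i, i) = - 1" if "2 \<le> i" "i < n" for i
          unfolding Md[OF that] \<epsilon>'_def by (rule \<epsilon>[rule_format, OF into[OF that(2)]])
      qed simp
      then show ?thesis by (rule covered_shear[OF P(1) F1 n'(3)])
    qed
  qed
qed

theorem covered_ge_3:
  fixes P :: "'a :: field mat"
  assumes q: "monic q" and deg: "degree q = n" and n: "3 \<le> n"
    and H: "\<And>\<alpha>. (\<And>i. i < n \<Longrightarrow> \<alpha> i = 1 \<or> \<alpha> i = - 1) \<Longrightarrow> (\<Prod>i<n. \<alpha> i) = 1 \<Longrightarrow> good q (mat n n (\<lambda>(i, j). if i = j then \<alpha> i else 0))"
    and P: "P \<in> carrier (Sp n)" "P \<noteq> - 1\<^sub>m (2 * n)"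
  shows "covered n q P"
proof (rule covered_cases[OF _ P])
  show "2 \<le> n" using n by simp
next
  show "good q (mat n n (\<lambda>(i, j). if i = j then \<alpha> i else 0))"
    if "\<And>i. i < n \<Longrightarrow> \<alpha> i = 1 \<or> \<alpha> i = - 1" "(\<Prod>i<n. \<alpha> i) = 1" for \<alpha> using H that by blast
next
  fix e f
  assume F: "coord.frame n (vec_space n) n e f"
    and h: "vec_form n (mat_fun P (e 0)) (e 0) \<noteq> 0" "vec_form n (mat_fun P (e 1)) (e 1) \<noteq> 0" "vec_form n (mat_fun P (e 0)) (e 1) = 0"
      "\<forall>i<n. vec_form n (mat_fun P (e 0)) (f i) = 0 \<and> vec_form n (mat_fun P (e 1)) (f i) = 0"
      "\<forall>i. 2 \<le> i \<longrightarrow> i < n \<longrightarrow> (vec_form n (mat_fun P (e i)) (f i) = 1 \<or> vec_form n (mat_fun P (e i)) (f i) = - 1) \<and>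
        (\<forall>j<i. vec_form n (mat_fun P (e j)) (f i) = 0)"
  show "covered n q P"
    by (rule covered_two_anisotropic[OF q deg n P(1) F h(1-3) h(4)[rule_format] h(5)[rule_format]])
next
  fix e f \<epsilon>
  assume F: "coord.frame n (vec_space n) n e f"
    and h: "vec_form n (mat_fun P (e 0)) (e 0) \<noteq> 0"
      "\<forall>i<n. vec_form n (mat_fun P (e 0)) (f i) = 0 \<and> vec_form n (mat_fun P (e i)) (f 0) = 0 \<and> (\<epsilon> i = 1 \<or> \<epsilon> i = - 1)"
      "\<forall>i. 1 \<le> i \<longrightarrow> i < n \<longrightarrow> vec_form n (mat_fun P (e 0)) (e i) = 0 \<and> vec_form n (mat_fun P (e i)) (e i) = 0 \<and>
        (\<forall>j. 1 \<le> j \<longrightarrow> j < n \<longrightarrow> vec_form n (mat_fun P (e j)) (f i) = (if i = j then \<epsilon> i else 0))"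
      "(\<forall>i. 1 \<le> i \<longrightarrow> i < n \<longrightarrow> vec_form n (mat_fun P (e i)) (e 0) = 0) \<or> vec_form n (mat_fun P (e 1)) (e 0) \<noteq> 0"
  show "covered n q P"
  proof (rule covered_one_anisotropic[where \<epsilon> = \<epsilon>, OF q deg n H P(1) F h(1) h(2)[rule_format] _ _ h(4)])
    show "vec_form n (mat_fun P (e 0)) (e i) = 0 \<and> vec_form n (mat_fun P (e i)) (e i) = 0" if "1 \<le> i" "i < n" for i
      using h(3)[rule_format, OF that] by (elim conjE, intro conjI)
    show "vec_form n (mat_fun P (e j)) (f i) = (if i = j then \<epsilon> i else 0)" if "1 \<le> i" "i < n" "1 \<le> j" "j < n" for i j
      by (rule h(3)[rule_format, OF that(1,2), THEN conjunct2, THEN conjunct2, rule_format, OF that(3,4)])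
  qed
next
  fix M :: "'a mat"
  assume M: "M \<in> carrier_mat n n" and two: "(2 :: 'a) \<noteq> 0" and h: "M $$ (0, 0) = 0" "M $$ (0, 1) = - 1" "M $$ (1, 0) = 1" "M $$ (1, 1) = 0"
    "\<And>i j. 2 \<le> i \<Longrightarrow> i < n \<Longrightarrow> j < i \<Longrightarrow> M $$ (i, j) = 0" "\<And>i. 2 \<le> i \<Longrightarrow> i < n \<Longrightarrow> M $$ (i, i) = 1 \<or> M $$ (i, i) = - 1"
    "(\<Prod>i=2..<n. M $$ (i, i)) = 1"
  have last: "2 \<le> n - 1" "n - 1 < n" using n by auto
  have sq: "(M $$ (n - 1, n - 1))\<^sup>2 = 1" using h(6)[OF last] by (elim disjE) simp_all
  show "good q M"
  proof (rule good_nonscalar_block[OF q deg n M h(5) _ _ refl])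
    show "(M $$ (0, 0) * M $$ (1, 1) - M $$ (0, 1) * M $$ (1, 0)) * (\<Prod>i=2..<n. M $$ (i, i)) = 1"
      unfolding h(7) h(1-4) by simp
    show "M $$ (0, 1) \<noteq> 0 \<or> M $$ (1, 0) \<noteq> 0 \<or> M $$ (0, 0) \<noteq> M $$ (1, 1)" unfolding h(1-4) by simp
    \<comment> \<open>The corner has characteristic polynomial x^2 + 1, whose value at both 1 and -1
      is 2.\<close>
    show "(M $$ (n - 1, n - 1))\<^sup>2 - (M $$ (0, 0) + M $$ (1, 1)) * M $$ (n - 1, n - 1)
      + (M $$ (0, 0) * M $$ (1, 1) - M $$ (0, 1) * M $$ (1, 0)) \<noteq> 0"
      unfolding sq h(1-4) using two by simp
  qed
qed

section \<open>The group of 4 by 4 matrices\<close>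

definition mat2 :: "'a :: field \<Rightarrow> 'a \<Rightarrow> 'a \<Rightarrow> 'a \<Rightarrow> 'a mat" where
  "mat2 a b c d = mat 2 2 (\<lambda>(i, j). if i = 0 then (if j = 0 then a else b) else (if j = 0 then c else d))"

lemma mat2_carrier [simp]: "mat2 a b c d \<in> carrier_mat 2 2"
  by (simp add: mat2_def)

lemma mat2_index [simp]: "mat2 a b c d $$ (0, 0) = a" "mat2 a b c d $$ (0, Suc 0) = b"
  "mat2 a b c d $$ (Suc 0, 0) = c" "mat2 a b c d $$ (Suc 0, Suc 0) = d"
  by (simp_all add: mat2_def)

lemma mat2_eq:
  assumes "A \<in> carrier_mat 2 2"
  shows "A = mat2 (A $$ (0, 0)) (A $$ (0, 1)) (A $$ (1, 0)) (A $$ (1, 1))"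
  by (rule eq_matI) (use assms in \<open>auto simp: mat2_def less_2_cases_iff\<close>)

lemma mat2_mult: "mat2 a b c d * mat2 a' b' c' d' = mat2 (a * a' + b * c') (a * b' + b * d') (c * a' + d * c') (c * b' + d * d')"
proof (rule eq_matI)
  fix i j assume "i < dim_row (mat2 (a * a' + b * c') (a * b' + b * d') (c * a' + d * c') (c * b' + d * d'))"
    "j < dim_col (mat2 (a * a' + b * c') (a * b' + b * d') (c * a' + d * c') (c * b' + d * d'))"
  then have ij: "i < 2" "j < 2" by (simp_all add: mat2_def)
  then have "(mat2 a b c d * mat2 a' b' c' d') $$ (i, j) = (\<Sum>l<2. mat2 a b c d $$ (i, l) * mat2 a' b' c' d' $$ (l, j))"
    by (intro mult_mat_index) auto
  then show "(mat2 a b c d * mat2 a' b' c' d') $$ (i, j)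
    = mat2 (a * a' + b * c') (a * b' + b * d') (c * a' + d * c') (c * b' + d * d') $$ (i, j)"
    using ij by (auto simp: numeral_2_eq_2 less_Suc_eq simp del: index_mult_mat)
qed (simp_all add: mat2_def)

text \<open>A nonscalar 2 by 2 matrix is cyclic, so trace and determinant determine it up to
  similarity. The basis used needs a nonzero lower left entry; transposition or, for a diagonal
  matrix, conjugation by a unipotent one provides it.\<close>

lemma mat2_similar_companion:
  fixes a b c d :: "'a :: field"
  assumes ns: "b \<noteq> 0 \<or> c \<noteq> 0 \<or> a \<noteq> d"
  shows "similar_mat (mat2 a b c d) (companion [:a * d - b * c, - (a + d), 1:])"
proof -
  let ?q = "[:a * d - b * c, - (a + d), 1:]"
  have deg: "degree ?q = 2" and q: "monic ?q" by simp_all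
  have c_case: "similar_mat (mat2 a b c d) (companion [:a * d - b * c, - (a + d), 1:])" if c: "c \<noteq> 0" for a b c d :: 'a
  proof -
    let ?q = "[:a * d - b * c, - (a + d), 1:]"
    \<comment> \<open>With \<zeta>_1 = 1, row 1 of the relation says x = c \<zeta>_0 + d and so
      gives \<zeta>_0.\<close>
    define \<zeta> where "\<zeta> i = (if i = 0 then [:- d / c, 1 / c:] else [:1:])" for i :: nat
    have s2: "(\<Sum>i<2. F i) = F 0 + F (Suc 0)" for F :: "nat \<Rightarrow> 'a poly" by (simp add: numeral_2_eq_2)
    show ?thesis
    proof (rule similar_companionI[where n = 2 and \<zeta> = \<zeta>])
      show "degree (\<zeta> i) = 2 - 1 - i" "\<zeta> i \<noteq> 0" if "i < 2" for i
        using that c by (auto simp: \<zeta>_def less_2_cases_iff)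
      fix j :: nat assume "j < 2"
      then have "j = 0 \<or> j = Suc 0" by auto
      then show "\<exists>r. pCons 0 (\<zeta> j) - (\<Sum>i<2. Polynomial.smult (mat2 a b c d $$ (j, i)) (\<zeta> i)) = Polynomial.smult r ?q"
      proof
        assume "j = 0"
        then show ?thesis using c unfolding s2
          by (intro exI[of _ "1 / c"]) (simp add: \<zeta>_def field_simps)
      next
        assume "j = Suc 0"
        then show ?thesis using c unfolding s2
          by (intro exI[of _ 0]) (simp add: \<zeta>_def)
      qed
    qed auto
  qed
  show ?thesis
  proof (cases "c = 0")
    case False
    then show ?thesis by (rule c_case)
  next
    case c: True
    show ?thesis
    proof (cases "b = 0")
      case False
      have "similar_mat (mat2 a c b d) (companion ?q)" using c_case[OF False, of a c d] by (simp add: mult.commute)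
      then have "similar_mat (transpose_mat (mat2 a c b d)) (companion ?q)"
        by (rule similar_companion_transposeI[OF q _ mat2_carrier])
      moreover have "transpose_mat (mat2 a c b d) = mat2 a b c d"
        by (rule eq_matI) (auto simp: mat2_def)
      ultimately show ?thesis by simp
    next
      case b: True
      have ad: "a - d \<noteq> 0" using ns b c by simp
      have one: "1\<^sub>m 2 = mat2 1 0 0 (1 :: 'a)" by (rule eq_matI) (auto simp: mat2_def less_2_cases_iff)
      have "similar_mat (mat2 a 0 0 d) (mat2 a 0 (a - d) d)"
        by (rule similar_mat_intro[of _ 2 _ "mat2 1 0 (- 1) 1" "mat2 1 0 1 1"]) (simp_all add: mat2_mult one)
      moreover have "similar_mat (mat2 a 0 (a - d) d) (companion ?q)" using c_case[OF ad, of a 0 d] b c by simp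
      ultimately show ?thesis using b c similar_mat_trans by metis
    qed
  qed
qed

text \<open>The witness Y has characteristic polynomial q; as it and its product with the given
  matrix are nonscalar, comparing their traces and determinants is enough.\<close>

lemma good_mat2I:
  fixes a b c d :: "'a :: field"
  assumes q: "q = [:a' * d' - b' * c', - (a' + d'), 1:]" and Y: "b' \<noteq> 0 \<or> c' \<noteq> 0 \<or> a' \<noteq> d'"
    and P: "mat2 a b c d * mat2 a' b' c' d' = mat2 r s t u" "s \<noteq> 0 \<or> t \<noteq> 0 \<or> r \<noteq> u"
    and "r * u - s * t = a' * d' - b' * c'" "r + u = a' + d'"
  shows "good q (mat2 a b c d)"
  unfolding good_def
proof (intro exI conjI)
  show "similar_mat (mat2 a' b' c' d') (companion q)" unfolding q by (rule mat2_similar_companion[OF Y])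
  show "similar_mat (mat2 a b c d * mat2 a' b' c' d') (companion q)"
    unfolding P(1) q assms(5,6)[symmetric] by (rule mat2_similar_companion[OF P(2)])
qed

lemma good_mat2_transfer:
  fixes a b c d :: "'a :: field"
  assumes g: "good q (mat2 a' b' c' d')" and deg: "degree q = 2"
    and ns: "b \<noteq> 0 \<or> c \<noteq> 0 \<or> a \<noteq> d" "b' \<noteq> 0 \<or> c' \<noteq> 0 \<or> a' \<noteq> d'"
    and e: "a * d - b * c = a' * d' - b' * c'" "a + d = a' + d'"
  shows "good q (mat2 a b c d)"
proof -
  have "similar_mat (mat2 a b c d) (mat2 a' b' c' d')"
    using mat2_similar_companion[OF ns(1)] similar_mat_sym[OF mat2_similar_companion[OF ns(2)]] unfolding e by (rule similar_mat_trans)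
  then show ?thesis by (rule good_similar[OF g]) (simp add: deg)
qed

text \<open>A nonscalar block of determinant 1 matters only through its trace. \<open>T\<close>
  holds for traces known to be good for q; the other hypotheses say which traces the adapted frames
  must be able to reach, and deal with the scalar blocks.\<close>

lemma covered_2:
  fixes P :: "'a :: field mat"
  assumes P: "P \<in> carrier (Sp 2)" "P \<noteq> - 1\<^sub>m (2 * 2)"
    and T: "\<And>a b c d. a * d - b * c = 1 \<Longrightarrow> b \<noteq> 0 \<or> c \<noteq> 0 \<or> a \<noteq> d \<Longrightarrow> T (a + d) \<Longrightarrow> good q (mat2 a b c d)"
    and one: "good q (mat2 1 0 0 1)"
    and minus_one: "good q (mat2 (- 1) 0 0 (- 1)) \<or> T (- 2)"
    and zero: "(2 :: 'a) \<noteq> 0 \<Longrightarrow> T 0"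
    and two_aniso: "\<And>c1 c2 s. c1 \<noteq> 0 \<Longrightarrow> c2 \<noteq> 0 \<Longrightarrow> \<exists>p r u. (p * u - r * r) * (c1 * c2) = 1 \<and>
      (r \<noteq> 0 \<or> p * c1 \<noteq> u * c2) \<and> T (p * c1 + r * s + u * c2)"
    and one_aniso: "\<And>\<epsilon>. \<epsilon> = 1 \<or> \<epsilon> = - 1 \<Longrightarrow> \<exists>x. x \<noteq> 0 \<and> T (2 * \<epsilon> + x)"
  shows "covered 2 q P"
proof -
  let ?c = "\<lambda>e i j. vec_form 2 (mat_fun P (e j)) (e i)" and ?a = "\<lambda>e f i j. vec_form 2 (mat_fun P (e j)) (f i)"
  have shear: "covered 2 q P" if F: "coord.frame 2 (vec_space 2) 2 e f"
    and g: "good q (mat2 (?a e f 0 0 + (p * ?c e 0 0 + r * ?c e 1 0)) (?a e f 0 1 + (p * ?c e 0 1 + r * ?c e 1 1))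
      (?a e f 1 0 + (r * ?c e 0 0 + u * ?c e 1 0)) (?a e f 1 1 + (r * ?c e 0 1 + u * ?c e 1 1)))" for e f p r u
  proof (rule covered_shear[OF P(1) F, where p = p and r = r and u = u])
    have m: "mat 2 2 (\<lambda>(i, j). ?a e f i j + (if i = 0 then p * ?c e 0 j + r * ?c e 1 j else if i = 1 then r * ?c e 0 j + u * ?c e 1 j else 0))
      = mat2 (?a e f 0 0 + (p * ?c e 0 0 + r * ?c e 1 0)) (?a e f 0 1 + (p * ?c e 0 1 + r * ?c e 1 1))
      (?a e f 1 0 + (r * ?c e 0 0 + u * ?c e 1 0)) (?a e f 1 1 + (r * ?c e 0 1 + u * ?c e 1 1))"
      by (rule eq_matI) (auto simp: mat2_def less_2_cases_iff)
    show "good q (mat 2 2 (\<lambda>(i, j). ?a e f i j + (if i = 0 then p * ?c e 0 j + r * ?c e 1 j else if i = 1 then r * ?c e 0 j + u * ?c e 1 j else 0)))"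
      unfolding m by (rule g)
  qed simp
  show ?thesis
  proof (rule covered_cases[OF _ P])
  show "(2 :: nat) \<le> 2" by simp
  show "good q (mat 2 2 (\<lambda>(i, j). if i = j then \<alpha> i else 0))"
    if \<alpha>: "\<And>i. i < 2 \<Longrightarrow> \<alpha> i = 1 \<or> \<alpha> i = - 1" and ex: "\<exists>i<2. \<alpha> i = 1" and pr: "(\<Prod>i<2. \<alpha> i) = 1" for \<alpha>
  proof -
    have "mat 2 2 (\<lambda>(i, j). if i = j then \<alpha> i else 0) = mat2 (\<alpha> 0) 0 0 (\<alpha> 1)"
      by (rule eq_matI) (auto simp: mat2_def less_2_cases_iff)
    moreover have "\<alpha> 0 * \<alpha> 1 = 1" using pr by (simp add: numeral_2_eq_2)
    then have "\<alpha> 0 = 1 \<and> \<alpha> 1 = 1" using ex by (auto simp: less_2_cases_iff)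
    ultimately show ?thesis using one by simp
  qed
  show "good q M" if "M \<in> carrier_mat 2 2" "(2 :: 'a) \<noteq> 0" "M $$ (0, 0) = 0" "M $$ (0, 1) = - 1" "M $$ (1, 0) = 1" "M $$ (1, 1) = 0" for M :: "'a mat"
  proof -
    have "M = mat2 0 (- 1) 1 0" using mat2_eq[OF that(1)] that(3-6) by simp
    then show ?thesis using T[of 0 0 "- 1" 1] zero that(2) by simp
  qed
next
  fix e f
  assume F: "coord.frame 2 (vec_space 2) 2 e f"
    and h: "?c e 0 0 \<noteq> 0" "?c e 1 1 \<noteq> 0" "?c e 1 0 = 0" "\<forall>i<2. ?a e f i 0 = 0 \<and> ?a e f i 1 = 0"
  have a: "?a e f 0 0 = 0" "?a e f 0 1 = 0" "?a e f 1 0 = 0" "?a e f 1 1 = 0" using h(4) by auto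
  obtain p r u where pru: "(p * u - r * r) * (?c e 0 0 * ?c e 1 1) = 1" "r \<noteq> 0 \<or> p * ?c e 0 0 \<noteq> u * ?c e 1 1"
    "T (p * ?c e 0 0 + r * ?c e 0 1 + u * ?c e 1 1)" using two_aniso[OF h(1,2), of "?c e 0 1"] by (elim exE conjE) (rule that)
  show "covered 2 q P"
  proof (rule shear[OF F, of p r u], unfold a h(3), rule T)
    show "(0 + (p * ?c e 0 0 + r * 0)) * (0 + (r * ?c e 0 1 + u * ?c e 1 1)) - (0 + (p * ?c e 0 1 + r * ?c e 1 1)) * (0 + (r * ?c e 0 0 + u * 0)) = 1"
      unfolding pru(1)[symmetric] by (simp add: algebra_simps)
    show "0 + (p * ?c e 0 1 + r * ?c e 1 1) \<noteq> 0 \<or> 0 + (r * ?c e 0 0 + u * 0) \<noteq> 0 \<or> 0 + (p * ?c e 0 0 + r * 0) \<noteq> 0 + (r * ?c e 0 1 + u * ?c e 1 1)"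
      using pru(2) h(1) by (cases "r = 0") auto
    show "T (0 + (p * ?c e 0 0 + r * 0) + (0 + (r * ?c e 0 1 + u * ?c e 1 1)))" using pru(3) by (simp add: add.assoc)
  qed
next
  fix e f \<epsilon>
  assume F: "coord.frame 2 (vec_space 2) 2 e f" and c: "?c e 0 0 \<noteq> 0"
    and h: "\<forall>i<2. ?a e f i 0 = 0 \<and> ?a e f 0 i = 0 \<and> (\<epsilon> i = 1 \<or> \<epsilon> i = - 1)"
      "\<forall>i. 1 \<le> i \<longrightarrow> i < 2 \<longrightarrow> ?c e i 0 = 0 \<and> ?c e i i = 0 \<and> (\<forall>j. 1 \<le> j \<longrightarrow> j < 2 \<longrightarrow> ?a e f i j = (if i = j then \<epsilon> i else 0))"
  define x where "x = \<epsilon> 1"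
  have a: "?a e f 0 0 = 0" "?a e f 0 1 = 0" "?a e f 1 0 = 0" "?a e f 1 1 = x" "?c e 1 0 = 0" "?c e 1 1 = 0"
  proof -
    have one2: "(1 :: nat) < 2" by simp
    note h2 = mp[OF mp[OF spec[where x = 1, OF h(2)] order_refl] one2]
    note h3 = mp[OF mp[OF spec[where x = 1, OF conjunct2[OF conjunct2[OF h2]]] order_refl] one2]
    show "?a e f 0 0 = 0" "?a e f 0 1 = 0" "?a e f 1 0 = 0" using h(1)[rule_format, of 0] h(1)[rule_format, of 1] by simp_all
    show "?a e f 1 1 = x" using h3 by (simp add: x_def)
    show "?c e 1 0 = 0" by (rule conjunct1[OF h2])
    show "?c e 1 1 = 0" by (rule conjunct1[OF conjunct2[OF h2]])
  qed
  have x: "x = 1 \<or> x = - 1" using h(1)[rule_format, of 1] by (simp add: x_def)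
  then have xx: "x * x = 1" by auto
  define s \<gamma> where "s = x / ?c e 0 0" and "\<gamma> = ?c e 0 1"
  have sc: "s * ?c e 0 0 = x" using c by (simp add: s_def)
  have sh: "covered 2 q P" if "good q (mat2 x (s * \<gamma>) (r * ?c e 0 0) (x + r * \<gamma>))" for r
    by (rule shear[OF F, of s r 0], unfold a sc \<gamma>_def[symmetric]) (use that in simp)
  have det: "x * (x + r * \<gamma>) - s * \<gamma> * (r * ?c e 0 0) = 1" for r
  proof -
    have "x * (x + r * \<gamma>) - s * \<gamma> * (r * ?c e 0 0) = x * x + x * (r * \<gamma>) - (s * ?c e 0 0) * (r * \<gamma>)" by (simp add: algebra_simps)
    then show ?thesis unfolding sc xx by simp
  qed
  show "covered 2 q P"
  proof (cases "\<gamma> = 0")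
    case True
    show ?thesis
    proof (rule disjE[OF x])
      assume "x = 1"
      then show ?thesis using sh[of 0] True one by simp
    next
      assume xm: "x = - 1"
      from minus_one show ?thesis
      proof
        assume "good q (mat2 (- 1) 0 0 (- 1))"
        then show ?thesis using sh[of 0] True xm by simp
      next
        \<comment> \<open>With \<gamma> = 0 and r = 0 the block would be the scalar -1; r = 1 keeps
          the trace -2 but makes it nonscalar.\<close>
        assume "T (- 2)"
        then have "T (x + (x + 1 * \<gamma>))" using xm True by simp
        then have "good q (mat2 x (s * \<gamma>) (1 * ?c e 0 0) (x + 1 * \<gamma>))" by (intro T[OF det]) (use c in simp_all)
        then show ?thesis by (rule sh)
      qed
    qed
  next
    case False
    obtain y where y: "y \<noteq> 0" "T (2 * x + y)" using one_aniso[OF x] by (elim exE conjE) (rule that)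
    \<comment> \<open>Taking r = y / \<gamma> gives the trace 2 x + y, and y \<noteq> 0 makes the
      block nonscalar.\<close>
    have "y / \<gamma> * \<gamma> = y" using False by simp
    then have e: "x + (x + y / \<gamma> * \<gamma>) = 2 * x + y" by (simp only: mult_2 add.assoc)
    have "T (x + (x + y / \<gamma> * \<gamma>))" unfolding e by (rule y(2))
    then have "good q (mat2 x (s * \<gamma>) (y / \<gamma> * ?c e 0 0) (x + y / \<gamma> * \<gamma>))"
      by (intro T[OF det]) (use c y False in simp_all)
    then show ?thesis by (rule sh)
  qed
  qed
qed

section \<open>The choice of q according to the field\<close>

lemma field_dichotomy:
  obtains m :: "'a :: field" where "m \<noteq> 0" "m \<noteq> 1" "m \<noteq> - 1"
  | "(UNIV :: 'a set) = {0, 1}" "(2 :: 'a) = 0" "card (UNIV :: 'a set) = 2"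
  | "(UNIV :: 'a set) = {0, 1, - 1}" "(3 :: 'a) = 0" "(2 :: 'a) \<noteq> 0"
proof (cases "\<exists>m :: 'a. m \<noteq> 0 \<and> m \<noteq> 1 \<and> m \<noteq> - 1")
  case True
  then show ?thesis using that(1) by blast
next
  case False
  then have U: "(UNIV :: 'a set) = {0, 1, - 1}" by auto
  show ?thesis
  proof (cases "(2 :: 'a) = 0")
    case True
    then have m11: "(- 1 :: 'a) = 1" by (rule minus_one_eq_one)
    have U2: "(UNIV :: 'a set) = {0, 1}" unfolding U m11 by simp
    show ?thesis by (rule that(2)[OF U2 True]) (simp add: U2)
  next
    case two: False
    have "(2 :: 'a) \<in> {0, 1, - 1}" unfolding U[symmetric] by simp
    moreover have "(2 :: 'a) \<noteq> 1"
    proof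
      assume "(2 :: 'a) = 1"
      then have "(1 :: 'a) + 1 = 1 + 0" by simp
      then show False unfolding add_left_cancel by simp
    qed
    ultimately have "(2 :: 'a) = - 1" using two by simp
    then have "(2 :: 'a) + 1 = 0" by (simp only: add.left_inverse)
    then have "(3 :: 'a) = 0" by simp
    then show ?thesis by (rule that(3)[OF U _ two])
  qed
qed

lemma trinomial_good_diagonal:
  fixes \<alpha> :: "nat \<Rightarrow> 'a :: field"
  assumes k: "1 \<le> k" "2 * k \<le> n" and \<alpha>: "\<And>i. i < n \<Longrightarrow> \<alpha> i = 1 \<or> \<alpha> i = - 1"
    and pr: "(\<Prod>i<n. \<alpha> i) = 1" "(\<Prod>i<n - k. \<alpha> i) = 1"
  shows "good (monom 1 n - monom 1 k - 1) (mat n n (\<lambda>(i, j). if i = j then \<alpha> i else 0))"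
proof (rule good_diagonal[OF trinomial_poly(1,2)[OF k]])
  show "\<alpha> i \<noteq> 0" if "i < n" for i using \<alpha>[OF that] by auto
  show "(\<Prod>i<n - j. \<alpha> i) = 1" if "j < n" "coeff (monom 1 n - monom 1 k - (1 :: 'a poly)) j \<noteq> 0" for j
    using trinomial_poly(4)[OF k that(2,1)] pr by auto
qed

lemma move_to_last:
  assumes "i < n"
  obtains \<pi> where "bij_betw \<pi> {..<n} {..<n}" "\<pi> (n - 1) = (i :: nat)"
  using coord.swap_bij[of "n - 1" n i] assms by (intro that[of "\<lambda>l. if l = n - 1 then i else if l = i then n - 1 else l"]) auto

lemma move_to_last_two:
  assumes "i < n" "j < n" "i \<noteq> j"
  obtains \<pi> where "bij_betw \<pi> {..<n} {..<n}" "\<pi> (n - 1) = (i :: nat)" "\<pi> (n - 2) = j"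
proof -
  obtain s where s: "bij_betw s {..<n} {..<n}" "s (n - 1) = i" by (rule move_to_last[OF assms(1)])
  have "j \<in> s ` {..<n}" using bij_betw_imp_surj_on[OF s(1)] assms by simp
  then obtain l where l: "l < n" "s l = j" by auto
  have ln: "l \<noteq> n - 1" using l s assms by auto
  define t where "t k = (if k = n - 2 then l else if k = l then n - 2 else k)" for k
  have t: "bij_betw t {..<n} {..<n}" unfolding t_def using coord.swap_bij[of "n - 2" n l] l ln by auto
  show ?thesis
  proof
    show "bij_betw (s \<circ> t) {..<n} {..<n}" by (rule bij_betw_trans[OF t s(1)])
    have "n - 1 \<noteq> n - 2" using assms by auto
    then have "t (n - 1) = n - 1" using ln by (simp add: t_def)
    then show "(s \<circ> t) (n - 1) = i" using s by simp
    show "(s \<circ> t) (n - 2) = j" using l by (simp add: t_def)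
  qed
qed

text \<open>The coefficient of x^k demands that, after a permutation, the last k signs have product
  1. For k = 1 and n odd some sign is 1, since otherwise the total product is -1; for k = 2 two of
  any three signs agree; in characteristic 2 all signs are 1.\<close>

lemma trinomial_good_sign_diagonal:
  fixes \<alpha> :: "nat \<Rightarrow> 'a :: field"
  assumes k: "k = 1 \<and> odd n \<or> k = 2 \<and> 4 \<le> n \<or> (2 :: 'a) = 0 \<and> 1 \<le> k" and kn: "2 * k \<le> n"
    and \<alpha>: "\<And>i. i < n \<Longrightarrow> \<alpha> i = 1 \<or> \<alpha> i = - 1" and pr: "(\<Prod>i<n. \<alpha> i) = 1"
  shows "good (monom 1 n - monom 1 k - 1) (mat n n (\<lambda>(i, j). if i = j then \<alpha> i else 0))"
proof (cases "(2 :: 'a) = 0")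
  case True
  then have "(- 1 :: 'a) = 1" by (rule minus_one_eq_one)
  then have "\<alpha> i = 1" if "i < n" for i using \<alpha>[OF that] by auto
  then have "(\<Prod>i<n - k. \<alpha> i) = 1" by (intro prod.neutral) auto
  moreover have "1 \<le> k" using k by auto
  ultimately show ?thesis using trinomial_good_diagonal[OF _ kn \<alpha> pr] by simp
next
  case two: False
  have k1: "1 \<le> k" using k by auto
  have perm: "good (monom 1 n - monom 1 k - 1) (mat n n (\<lambda>(i, j). if i = j then \<alpha> i else 0))"
    if \<pi>: "bij_betw \<pi> {..<n} {..<n}" and p: "(\<Prod>i<n - k. \<alpha> (\<pi> i)) = 1" for \<pi>
  proof (rule good_diagonal_permute[OF trinomial_poly(2)[OF k1 kn] \<pi>])
    have into: "\<pi> i < n" if "i < n" for i using bij_betwE[OF \<pi>] that by auto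
    show "good (monom 1 n - monom 1 k - 1) (mat n n (\<lambda>(i, j). if i = j then \<alpha> (\<pi> i) else 0))"
    proof (rule trinomial_good_diagonal[OF k1 kn])
      show "\<alpha> (\<pi> i) = 1 \<or> \<alpha> (\<pi> i) = - 1" if "i < n" for i by (rule \<alpha>[OF into[OF that]])
      show "(\<Prod>i<n. \<alpha> (\<pi> i)) = 1" using prod.reindex_bij_betw[OF \<pi>, of \<alpha>] pr by simp
      show "(\<Prod>i<n - k. \<alpha> (\<pi> i)) = 1" by (rule p)
    qed
  qed
  have all: "(\<Prod>i<n. \<alpha> (\<pi> i)) = 1" if "bij_betw \<pi> {..<n} {..<n}" for \<pi>
    using prod.reindex_bij_betw[OF that, of \<alpha>] pr by simp
  consider "k = 1" "odd n" | "k = 2" "4 \<le> n" using k two by auto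
  then show ?thesis
  proof cases
    case 1
    have "\<exists>i<n. \<alpha> i = 1"
    proof (rule ccontr)
      assume "\<not> ?thesis"
      then have "\<alpha> i = - 1" if "i < n" for i using \<alpha> that by blast
      then have "(\<Prod>i<n. \<alpha> i) = (- 1) ^ n" by simp
      then have "(1 :: 'a) = - 1" using pr 1 by simp
      then show False using two by (metis add.right_inverse one_add_one)
    qed
    then obtain i where i: "i < n" "\<alpha> i = 1" by blast
    obtain \<pi> where \<pi>: "bij_betw \<pi> {..<n} {..<n}" "\<pi> (n - 1) = i" by (rule move_to_last[OF i(1)])
    have n: "n = Suc (n - 1)" using i by simp
    have "(\<Prod>i<Suc (n - 1). \<alpha> (\<pi> i)) = 1" using all[OF \<pi>(1)] n by simp
    then have "(\<Prod>i<n - 1. \<alpha> (\<pi> i)) = 1" unfolding prod.lessThan_Suc using \<pi> i by simp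
    then show ?thesis using perm[OF \<pi>(1)] 1 by simp
  next
    case 2
    have "\<alpha> 0 = \<alpha> 1 \<or> \<alpha> 0 = \<alpha> 2 \<or> \<alpha> 1 = \<alpha> 2" using \<alpha>[of 0] \<alpha>[of 1] \<alpha>[of 2] 2 by auto
    then obtain i j where ij: "i < n" "j < n" "i \<noteq> j" "\<alpha> i = \<alpha> j"
    proof (elim disjE)
      assume "\<alpha> 0 = \<alpha> 1"
      then show ?thesis using 2 by (intro that[of 0 1]) auto
    next
      assume "\<alpha> 0 = \<alpha> 2"
      then show ?thesis using 2 by (intro that[of 0 2]) auto
    next
      assume "\<alpha> 1 = \<alpha> 2"
      then show ?thesis using 2 by (intro that[of 1 2]) auto
    qed
    obtain \<pi> where \<pi>: "bij_betw \<pi> {..<n} {..<n}" "\<pi> (n - 1) = i" "\<pi> (n - 2) = j" by (rule move_to_last_two[OF ij(1-3)])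
    have aa: "\<alpha> j * \<alpha> j = 1" using \<alpha>[OF ij(2)] by auto
    have n: "n = Suc (Suc (n - 2))" "Suc (n - 2) = n - 1" using 2 by auto
    have "(\<Prod>i<Suc (Suc (n - 2)). \<alpha> (\<pi> i)) = 1" using all[OF \<pi>(1)] n(1) by simp
    then have "(\<Prod>i<n - 2. \<alpha> (\<pi> i)) = 1" unfolding prod.lessThan_Suc unfolding n(2) using \<pi> ij aa by (simp add: mult.assoc)
    then show ?thesis using perm[OF \<pi>(1)] 2 by simp
  qed
qed

text \<open>Two traces are enough. A nonscalar block of trace m + 1/m is similar to the diagonal
  matrix of m and 1/m, which is good because x^2 + \<delta> has no middle coefficient. The trace 0
  comes from the mixed frame outside characteristic 2, and there the shape of \<delta> is
  used.\<close>

lemma covered_2_large_field: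
  fixes P :: "'a :: field mat" and m :: 'a
  assumes m: "m \<noteq> 0" "m \<noteq> 1" "m \<noteq> - 1"
    and \<delta>: "\<delta> \<noteq> 0" "\<delta> * \<delta> \<noteq> 1" "(2 :: 'a) \<noteq> 0 \<Longrightarrow> t \<noteq> 0 \<and> \<delta> = - (1 + t * t)"
    and P: "P \<in> carrier (Sp 2)" "P \<noteq> - 1\<^sub>m (2 * 2)"
  shows "covered 2 (monom 1 2 + [:\<delta>:]) P"
proof -
  let ?q = "monom 1 2 + [:\<delta>:]"
  have q: "?q = [:\<delta>, 0, 1:]" by (simp add: numeral_2_eq_2 monom_Suc monom_0)
  have deg: "degree ?q = 2" using binomial_poly(2)[of 2 \<delta>] \<delta> by simp
  define \<tau> where "\<tau> = m + 1 / m"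
  define T where "T x \<longleftrightarrow> x = \<tau> \<or> (2 :: 'a) \<noteq> 0 \<and> x = 0" for x
  have m2: "m * m \<noteq> 1" using m by (simp add: square_eq_1_iff)
  have mm: "m \<noteq> 1 / m" using m m2 by (simp add: field_simps)
  have diag: "good ?q (mat2 a 0 0 b)" if ab: "a * b = 1" for a b
  proof -
    have "mat2 a 0 0 b = mat 2 2 (\<lambda>(i, j). if i = j then (if i = 0 then a else b) else 0)"
      by (rule eq_matI) (auto simp: mat2_def less_2_cases_iff)
    moreover have "good ?q (mat 2 2 (\<lambda>(i, j). if i = j then (if i = 0 then a else b) else 0))"
    proof (rule good_diagonal)
      show "monic ?q" "degree ?q = 2" using binomial_poly(1,2)[of 2 \<delta>] \<delta> by simp_all
      show "(if i = 0 then a else b) \<noteq> 0" for i :: nat using ab by auto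
      show "(\<Prod>i<2 - k. if i = 0 then a else b) = 1" if "k < 2" "coeff ?q k \<noteq> 0" for k :: nat
        using binomial_poly(5)[of 2 \<delta> k] \<delta> that ab by (simp add: numeral_2_eq_2)
    qed
    ultimately show ?thesis by simp
  qed
  show ?thesis
  proof (rule covered_2[OF P, where T = T])
    fix a b c d :: 'a
    assume d: "a * d - b * c = 1" and ns: "b \<noteq> 0 \<or> c \<noteq> 0 \<or> a \<noteq> d" and "T (a + d)"
    then consider "a + d = \<tau>" | "(2 :: 'a) \<noteq> 0" "a + d = 0" unfolding T_def by blast
    then show "good ?q (mat2 a b c d)"
    proof cases
      case 1
      show ?thesis
        by (rule good_mat2_transfer[OF diag[of m "1 / m"] deg ns]) (use m mm d 1 in \<open>auto simp: \<tau>_def\<close>)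
    next
      case 2
      have t: "t \<noteq> 0" "\<delta> = - (1 + t * t)" using \<delta>(3) 2(1) by auto
      \<comment> \<open>The matrix with rows (t, \<delta>) and (1, -t) has trace 0 and determinant -
        t^2 - \<delta> = 1. Both the witness and the product have trace 0 and determinant \<delta>,
        as x^2 + \<delta> requires.\<close>
      have g: "good ?q (mat2 t \<delta> 1 (- t))"
      proof (rule good_mat2I[where a' = "- \<delta>" and b' = "t * \<delta>" and c' = t and d' = \<delta> and r = 0 and s = "- \<delta>" and t = 1 and u = 0])
        have td: "t * t + \<delta> = - 1" using t by simp
        have "- \<delta> * \<delta> - t * \<delta> * t = - \<delta> * (t * t + \<delta>)" by (simp add: algebra_simps)
        then have dd: "- \<delta> * \<delta> - t * \<delta> * t = \<delta>" unfolding td by simp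
        show "?q = [:- \<delta> * \<delta> - t * \<delta> * t, - (- \<delta> + \<delta>), 1:]" unfolding dd q by simp
        show "t * \<delta> \<noteq> 0 \<or> t \<noteq> 0 \<or> - \<delta> \<noteq> \<delta>" using t by simp
        have "t * (t * \<delta>) + \<delta> * \<delta> = \<delta> * (t * t + \<delta>)" "1 * - \<delta> + - t * t = - (t * t + \<delta>)" by (simp_all add: algebra_simps)
        then have e: "t * (t * \<delta>) + \<delta> * \<delta> = - \<delta>" "1 * - \<delta> + - t * t = 1" unfolding td by simp_all
        have "t * - \<delta> + \<delta> * t = 0" "1 * (t * \<delta>) + - t * \<delta> = 0" by (simp_all add: algebra_simps)
        then show "mat2 t \<delta> 1 (- t) * mat2 (- \<delta>) (t * \<delta>) t \<delta> = mat2 0 (- \<delta>) 1 0" unfolding mat2_mult e by simp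
        show "0 * 0 - - \<delta> * 1 = - \<delta> * \<delta> - t * \<delta> * t" unfolding dd by simp
      qed simp_all
      show ?thesis
        by (rule good_mat2_transfer[OF g deg ns]) (use d 2 t in auto)
    qed
  next
    show "good ?q (mat2 1 0 0 1)" by (rule diag) simp
    show "good ?q (mat2 (- 1) 0 0 (- 1)) \<or> T (- 2)" by (rule disjI1, rule diag) simp
    show "T 0" if "(2 :: 'a) \<noteq> 0" using that by (simp add: T_def)
  next
    fix c1 c2 s :: 'a
    assume c: "c1 \<noteq> 0" "c2 \<noteq> 0"
    show "\<exists>p r u. (p * u - r * r) * (c1 * c2) = 1 \<and> (r \<noteq> 0 \<or> p * c1 \<noteq> u * c2) \<and> T (p * c1 + r * s + u * c2)"
    proof (intro exI conjI)
      \<comment> \<open>The diagonal of the corner becomes m and 1/m; they differ, so r = 0 still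
        leaves it nonscalar.\<close>
      show "(m / c1 * (1 / (m * c2)) - 0 * 0) * (c1 * c2) = 1" using c m by simp
      show "0 \<noteq> (0 :: 'a) \<or> m / c1 * c1 \<noteq> 1 / (m * c2) * c2" using c mm by simp
      show "T (m / c1 * c1 + 0 * s + 1 / (m * c2) * c2)" using c by (simp add: T_def \<tau>_def)
    qed
  next
    fix \<epsilon> :: 'a assume \<epsilon>: "\<epsilon> = 1 \<or> \<epsilon> = - 1"
    \<comment> \<open>Reaching the trace m + 1/m needs the summand \<tau> - 2 \<epsilon>; m times it
      is the square of m - \<epsilon>, hence nonzero.\<close>
    have sq: "m * (\<tau> - 2 * \<epsilon>) = (m - \<epsilon>) * (m - \<epsilon>)"
      using \<epsilon> m(1) by (auto simp: \<tau>_def algebra_simps)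
    have "m \<noteq> \<epsilon>" using m(2,3) \<epsilon> by auto
    have "\<tau> - 2 * \<epsilon> \<noteq> 0"
    proof
      assume z: "\<tau> - 2 * \<epsilon> = 0"
      have "(m - \<epsilon>) * (m - \<epsilon>) = 0" unfolding sq[symmetric] z by simp
      then show False using \<open>m \<noteq> \<epsilon>\<close> by simp
    qed
    then show "\<exists>x. x \<noteq> 0 \<and> T (2 * \<epsilon> + x)" by (intro exI[of _ "\<tau> - 2 * \<epsilon>"]) (simp add: T_def)
  qed
qed

text \<open>Over GF(3) the polynomial is x^2 - x - 1, and the matrix with rows (0, 1) and (1, 1)
  serves as witness throughout. It makes the traces 0 and 1 good, and the trace -2 is 1.\<close>

lemma covered_2_three_elements:
  fixes P :: "'a :: field mat"
  assumes U: "(UNIV :: 'a set) = {0, 1, - 1}" and three: "(3 :: 'a) = 0" and two: "(2 :: 'a) \<noteq> 0"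
    and P: "P \<in> carrier (Sp 2)" "P \<noteq> - 1\<^sub>m (2 * 2)"
  shows "covered 2 (monom 1 2 - monom 1 1 - 1) P"
proof -
  let ?q = "monom 1 2 - monom 1 1 - (1 :: 'a poly)"
  have q: "?q = [:- 1, - 1, 1:]" by (simp add: numeral_2_eq_2 monom_Suc monom_0 one_pCons)
  have deg: "degree ?q = 2" unfolding q by simp
  have sq: "x * x = 1" if "x \<noteq> 0" for x :: 'a
  proof -
    have "x \<in> {0, 1, - 1}" unfolding U[symmetric] by simp
    then show ?thesis using that by auto
  qed
  have m2: "(2 :: 'a) = - 1"
  proof -
    have "(2 :: 'a) + 1 = 0" using three by simp
    then show ?thesis by (simp only: eq_neg_iff_add_eq_0)
  qed
  have m11: "(1 :: 'a) \<noteq> - 1"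
  proof
    assume "(1 :: 'a) = - 1"
    then have "(1 :: 'a) + 1 = 0" by (simp only: eq_neg_iff_add_eq_0)
    then show False using two by simp
  qed
  have m11': "(- 1 :: 'a) + - 1 = 1"
  proof -
    have "(- 1 :: 'a) + - 1 = - 2" by simp
    also have "\<dots> = 1" unfolding m2 by simp
    finally show ?thesis .
  qed
  define T :: "'a \<Rightarrow> bool" where "T x \<longleftrightarrow> x = 0 \<or> x = 1" for x
  show ?thesis
  proof (rule covered_2[OF P, where T = T])
    fix a b c d :: 'a
    assume d: "a * d - b * c = 1" and ns: "b \<noteq> 0 \<or> c \<noteq> 0 \<or> a \<noteq> d" and "T (a + d)"
    then consider "a + d = 0" | "a + d = 1" unfolding T_def by blast
    then show "good ?q (mat2 a b c d)"
    proof cases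
      case 1
      have g: "good ?q (mat2 1 1 1 (- 1))"
        unfolding q by (rule good_mat2I[where a' = 0 and b' = 1 and c' = 1 and d' = 1 and r = 1 and s = 2 and t = "- 1" and u = 0])
          (simp_all add: mat2_mult m2)
      show ?thesis by (rule good_mat2_transfer[OF g deg ns]) (use d 1 m2 in simp_all)
    next
      case 2
      have g: "good ?q (mat2 0 1 (- 1) 1)"
        unfolding q by (rule good_mat2I[where a' = 0 and b' = 1 and c' = 1 and d' = 1 and r = 1 and s = 1 and t = 1 and u = 0])
          (simp_all add: mat2_mult)
      show ?thesis by (rule good_mat2_transfer[OF g deg ns]) (use d 2 in simp_all)
    qed
  next
    show "good ?q (mat2 1 0 0 1)"
      unfolding q by (rule good_mat2I[where a' = 0 and b' = 1 and c' = 1 and d' = 1 and r = 0 and s = 1 and t = 1 and u = 1])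
        (simp_all add: mat2_mult)
    have "- 2 = (1 :: 'a)" using m2 by simp
    then show "good ?q (mat2 (- 1) 0 0 (- 1)) \<or> T (- 2)" by (simp add: T_def)
    show "T 0" by (simp add: T_def)
  next
    fix c1 c2 s :: 'a
    assume c: "c1 \<noteq> 0" "c2 \<noteq> 0"
    have cc: "c1 * c1 = 1" "c2 * c2 = 1" using sq c by auto
    have ccne: "c1 * c2 * (c1 * c2) = 1" using sq[of "c1 * c2"] c by simp
    have "c1 * c2 = 1 \<or> c1 * c2 = - 1" using ccne by (simp only: square_eq_1_iff)
    then show "\<exists>p r u. (p * u - r * r) * (c1 * c2) = 1 \<and> (r \<noteq> 0 \<or> p * c1 \<noteq> u * c2) \<and> T (p * c1 + r * s + u * c2)"
    proof
      assume e: "c1 * c2 = - 1"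
      have "s * c2 * c2 = s" using cc by (simp add: mult.assoc)
      \<comment> \<open>With p = 0 and r = 1 the determinant is right; u = - s c2 cancels the trace
        because c2^2 = 1.\<close>
      then have Tz: "T (0 * c1 + 1 * s + - s * c2 * c2)" by (simp add: T_def)
      show ?thesis by (intro exI[of _ 0] exI[of _ 1] exI[of _ "- s * c2"] conjI disjI1 Tz) (use e in simp_all)
    next
      assume e: "c1 * c2 = 1"
      have "c2 = c1 * c1 * c2" using cc by simp
      also have "\<dots> = c1" using e by (simp add: mult.assoc)
      finally have c12: "c2 = c1" .
      \<comment> \<open>For p = 1, u = -1 and c1 = c2 the trace is r s, which is 0 if s = 0 and s^2
        = 1 otherwise. The determinant is -2 = 1.\<close>
      define r where "r = (if s = 0 then 1 else s)"
      have r: "r \<noteq> 0" "r * r = 1" using sq[of r] by (auto simp: r_def)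
      have "T (1 * c1 + r * s + - 1 * c2)" unfolding c12 T_def using sq[of s] by (auto simp: r_def)
      moreover have "(1 * - 1 - r * r) * (c1 * c2) = 1" unfolding e r(2) using m11' by simp
      ultimately show ?thesis using r(1) by (intro exI[of _ 1] exI[of _ r] exI[of _ "- 1"] conjI disjI1)
    qed
  next
    fix \<epsilon> :: 'a assume \<epsilon>: "\<epsilon> = 1 \<or> \<epsilon> = - 1"
    then show "\<exists>x. x \<noteq> 0 \<and> T (2 * \<epsilon> + x)"
    proof
      assume "\<epsilon> = 1"
      then show ?thesis by (intro exI[of _ 1]) (simp add: T_def three)
    next
      assume "\<epsilon> = - 1"
      then show ?thesis by (intro exI[of _ "- 1"]) (simp add: T_def three)
    qed
  qed
qed

theorem corollary1p3:
  fixes n :: nat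
  assumes "2 * n \<ge> 4"
    and "card (UNIV :: 'a :: field set) = 2 \<longrightarrow> 2 * n \<ge> 6"
  shows "\<exists>\<Omega> \<in> conjugacy_classes (Sp n :: 'a mat monoid).
    cyclic_class \<Omega> \<and> strictly_hyperbolic_class \<Omega> \<and>
    carrier (Sp n) = (\<Omega> <#>\<^bsub>Sp n\<^esub> \<Omega>) \<union> {- 1\<^sub>m (2 * n)}"
proof -
  have n: "2 \<le> n" using assms(1) by simp
  have main: ?thesis if "monic q" "poly q 0 \<noteq> 0" "degree q = n" "coprime q (reciprocal_poly q)"
    "\<And>P. P \<in> carrier (Sp n) \<Longrightarrow> P \<noteq> - 1\<^sub>m (2 * n) \<Longrightarrow> covered n q P" for q :: "'a poly"
  proof (rule class_square_covers[OF that(1-4)])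
    fix P :: "'a mat" assume "P \<in> carrier (Sp n)" "P \<noteq> - 1\<^sub>m (2 * n)"
    from that(5)[OF this] show "\<exists>A B C D. A \<in> carrier_mat n n \<and> B \<in> carrier_mat n n \<and> C \<in> carrier_mat n n \<and> D \<in> carrier_mat n n \<and>
      sp_conj n P (four_block_mat A B C D) \<and> good q A" unfolding covered_def .
  qed
  show ?thesis
  proof (cases rule: field_dichotomy[where ?'a = 'a])
    case (1 m)
    obtain \<delta> t :: 'a where \<delta>: "\<delta> \<noteq> 0" "\<delta> * \<delta> \<noteq> 1" "(2 :: 'a) \<noteq> 0 \<Longrightarrow> t \<noteq> 0 \<and> \<delta> = - (1 + t * t)"
      by (rule binomial_parameter[OF 1]) (rule that)
    have n1: "1 \<le> n" using n by simp
    note q = binomial_poly[OF n1 \<delta>(1,2)]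
    show ?thesis
    proof (rule main[OF q(1,3,2,4)])
      fix P :: "'a mat" assume P: "P \<in> carrier (Sp n)" "P \<noteq> - 1\<^sub>m (2 * n)"
      show "covered n (monom 1 n + [:\<delta>:]) P"
      proof (cases "n = 2")
        case True
        show ?thesis unfolding True by (rule covered_2_large_field[OF 1 \<delta> P[unfolded True]])
      next
        case False
        show ?thesis
        proof (rule covered_ge_3[OF q(1,2) _ _ P])
          fix \<alpha> assume \<alpha>: "\<And>i. i < n \<Longrightarrow> \<alpha> i = 1 \<or> \<alpha> i = (- 1 :: 'a)" and pr: "(\<Prod>i<n. \<alpha> i) = 1"
          show "good (monom 1 n + [:\<delta>:]) (mat n n (\<lambda>(i, j). if i = j then \<alpha> i else 0))"
          proof (rule good_diagonal[OF q(1,2)])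
            show "\<alpha> i \<noteq> 0" if "i < n" for i using \<alpha>[OF that] by auto
            show "(\<Prod>i<n - k. \<alpha> i) = 1" if "k < n" "coeff (monom 1 n + [:\<delta>:]) k \<noteq> 0" for k
              using q(5)[OF that(2,1)] pr by simp
          qed
        qed (use n False in simp)
      qed
    qed
  next
    case 2
    have n3: "3 \<le> n" using assms(2) 2(3) by simp
    \<comment> \<open>Keeps n - 2 k off the multiples of 3: if n is 2 modulo 3, then n - 4 is 1;
      otherwise n - 2 is 1 or 2.\<close>
    define k where "k = (if n mod 3 = 2 then 2 else 1 :: nat)"
    have k: "k = 1 \<or> k = 2" "1 \<le> k" by (auto simp: k_def)
    have kn: "2 * k \<le> n"
    proof (cases "n mod 3 = 2")
      case True
      then have k2: "k = 2" by (simp add: k_def)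
      have "n \<noteq> 3" using True by auto
      then show ?thesis using n3 unfolding k2 by linarith
    next
      case False
      then have k1: "k = 1" by (simp add: k_def)
      show ?thesis using n3 unfolding k1 by linarith
    qed
    have km: "(n - 2 * k) mod 3 \<noteq> 0"
    proof
      assume z: "(n - 2 * k) mod 3 = 0"
      define s where "s = (n - 2 * k) div 3"
      have "n - 2 * k = s * 3" using div_mult_mod_eq[of "n - 2 * k" 3] unfolding z s_def by linarith
      then have ns: "n = 2 * k + s * 3" using kn by linarith
      have nk: "n mod 3 = (2 * k) mod 3" unfolding ns by simp
      show False
      proof (cases "n mod 3 = 2")
        case True
        then have k2: "k = 2" by (simp add: k_def)
        show False using nk True unfolding k2 by simp
      next
        case False
        then have k1: "k = 1" by (simp add: k_def)
        show False using nk False unfolding k1 by simp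
      qed
    qed
    note q = trinomial_poly[OF k(2) kn]
    show ?thesis
    proof (rule main[OF q(1,3,2) trinomial_coprime_2[OF k(1) kn km 2(2)]])
      fix P :: "'a mat" assume P: "P \<in> carrier (Sp n)" "P \<noteq> - 1\<^sub>m (2 * n)"
      show "covered n (monom 1 n - monom 1 k - 1) P"
        by (rule covered_ge_3[OF q(1,2) n3 trinomial_good_sign_diagonal[OF _ kn] P]) (use 2 k in auto)
    qed
  next
    case 3
    \<comment> \<open>Here k has to divide n and to suit sign diagonals: 1 for odd n, 2 for even n
      \<ge> 4. For n = 2 only k = 1 satisfies 2 k \<le> n, and that case is treated
      separately.\<close>
    define k where "k = (if odd n \<or> n = 2 then 1 else 2 :: nat)"
    have k: "1 \<le> k" by (simp add: k_def)
    have n4: "4 \<le> n" if "k = 2"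
    proof -
      have "even n" "n \<noteq> 2" using that by (auto simp: k_def split: if_splits)
      then obtain t where t: "n = 2 * t" by (elim evenE)
      have "t \<noteq> 1" "1 \<le> t" using t \<open>n \<noteq> 2\<close> n by auto
      then show ?thesis using t by linarith
    qed
    have kn: "2 * k \<le> n" using n n4 by (auto simp: k_def split: if_splits)
    have kd: "k dvd n" by (auto simp: k_def)
    note q = trinomial_poly[OF k kn]
    show ?thesis
    proof (rule main[OF q(1,3,2) trinomial_coprime_3[OF k kn kd 3(2)]])
      fix P :: "'a mat" assume P: "P \<in> carrier (Sp n)" "P \<noteq> - 1\<^sub>m (2 * n)"
      show "covered n (monom 1 n - monom 1 k - 1) P"
      proof (cases "n = 2")
        case True
        then have "k = 1" by (simp add: k_def)
        show ?thesis unfolding True \<open>k = 1\<close> by (rule covered_2_three_elements[OF 3 P[unfolded True]])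
      next
        case False
        have n3: "3 \<le> n" using n False by simp
        have kk: "k = 1 \<and> odd n \<or> k = 2 \<and> 4 \<le> n \<or> (2 :: 'a) = 0 \<and> 1 \<le> k"
          using n4 False by (auto simp: k_def split: if_splits)
        show ?thesis
          by (rule covered_ge_3[OF q(1,2) n3 trinomial_good_sign_diagonal[OF kk kn] P]) auto
      qed
    qed
  qed
qed

end
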